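(* There is a constant $c>0$, independent of the time horizon $T$, such that for every $T>0$ the operator $\widetilde{\mathcal{A}}=\mathcal{A}-\mathcal{B}\mathcal{K}:E(0,T;A)\to\mathcal{P}$, where $\mathcal{K}x=-(x+\dot x)$, i.e. $$\widetilde{\mathcal{A}}x=\begin{pmatrix}\ddot x+Ax+x+\dot x\\ x(0)\\ \dot x(0)\end{pmatrix},$$ fulfills $$\|\mathcal{C}\widetilde{\mathcal{A}}^{-1}\|_{\mathcal{P}\to L^2(0,T;H_0^1(\Omega)\times L^2(\Omega))}\le c.$$
   Context: Let $\Omega\subset\mathbb{R}^n$ be a bounded open domain. $A=-\Delta$ is the (homogeneous) Dirichlet Laplacian on $L^2(\Omega)$, with domain $H^2(\Omega)\cap H_0^1(\Omega)$, self-adjoint and uniformly positive, with square root $A^{1/2}$ defined on $H_0^1(\Omega)$; $H_0^1(\Omega)$ carries the energy inner product $\langle x,y\rangle_{H_0^1(\Omega)}=\langle A^{1/2}x,A^{1/2}y\rangle_{L^2(\Omega)}$. $H^{-1}(\Omega)$ is the dual of $H_0^1(\Omega)$ with respect to the pivot space $L^2(\Omega)$, and $A$ also denotes its unique bounded extension $A:H_0^1(\Omega)\to H^{-1}(\Omega)$, which is the Riesz isomorphism of $H_0^1(\Omega)$. For $T>0$, with $\ddot x$ the second distributional time derivative (as an $H^{-1}(\Omega)$-valued distribution on $(0,T)$), let $$E(0,T;A):=\{x\in C([0,T];H_0^1(\Omega))\cap C^1([0,T];L^2(\Omega)):\ \ddot x+Ax\in L^2(0,T;L^2(\Omega))\},$$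 $$\|x\|_{E(0,T;A)}:=\|x\|_{C([0,T];H_0^1(\Omega))}+\|\dot x\|_{C([0,T];L^2(\Omega))}+\|\ddot x+Ax\|_{L^2(0,T;L^2(\Omega))}.$$ Let $\mathcal{P}:=L^2(0,T;L^2(\Omega))\times H_0^1(\Omega)\times L^2(\Omega)$ with the product Hilbert norm. Define $$\mathcal{A}:E(0,T;A)\to\mathcal{P},\ \mathcal{A}x=\begin{pmatrix}\ddot x+Ax\\ x(0)\\ \dot x(0)\end{pmatrix},\qquad \mathcal{B}:L^2(0,T;L^2(\Omega))\to\mathcal{P},\ \mathcal{B}u=\begin{pmatrix}u\\ 0\\ 0\end{pmatrix},$$ $$\mathcal{C}:E(0,T;A)\to L^2(0,T;H_0^1(\Omega)\times L^2(\Omega)),\ \mathcal{C}x=(x,\dot x),\qquad \mathcal{K}:E(0,T;A)\to L^2(0,T;L^2(\Omega)),\ \mathcal{K}x=-(x+\dot x).$$ *)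

theory Defs
  imports "HOL-Analysis.Analysis"
begin

section \<open>Hilbert-space valued square-integrable functions modulo null sets\<close>

text \<open>Bochner (strong) measurability, so that no separability of the target space is needed.\<close>

definition strongly_measurable :: "('a::euclidean_space \<Rightarrow> 'b::real_inner) \<Rightarrow> bool" where
  "strongly_measurable f \<longleftrightarrow>
     (\<exists>s. (\<forall>i::nat. simple_function lebesgue (s i)) \<and>
          (AE x in lebesgue. (\<lambda>i. s i x) \<longlonglongrightarrow> f x))"

definition square_integrable :: "('a::euclidean_space \<Rightarrow> 'b::real_inner) \<Rightarrow> bool" where
  "square_integrable f \<longleftrightarrow> strongly_measurable f \<and> integrable lebesgue (\<lambda>x. (norm (f x))\<^sup>2)"

lemma strongly_measurable_combine:
  assumes "strongly_measurable f" "strongly_measurable g"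
    and h: "\<And>X Y x y. X \<longlonglongrightarrow> x \<Longrightarrow> Y \<longlonglongrightarrow> y \<Longrightarrow> (\<lambda>i::nat. h (X i) (Y i)) \<longlonglongrightarrow> h x y"
  shows "strongly_measurable (\<lambda>x. h (f x) (g x))"
proof -
  obtain s t where s: "\<And>i::nat. simple_function lebesgue (s i)"
      "AE x in lebesgue. (\<lambda>i. s i x) \<longlonglongrightarrow> f x"
    and t: "\<And>i::nat. simple_function lebesgue (t i)"
      "AE x in lebesgue. (\<lambda>i. t i x) \<longlonglongrightarrow> g x"
    using assms(1,2) unfolding strongly_measurable_def by blast
  have "AE x in lebesgue. (\<lambda>i. h (s i x) (t i x)) \<longlonglongrightarrow> h (f x) (g x)"
    using s(2) t(2) by eventually_elim (rule h)
  moreover have "simple_function lebesgue (\<lambda>x. h (s i x) (t i x))" for i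
    using s(1) t(1) by (rule simple_function_compose2)
  ultimately show ?thesis
    unfolding strongly_measurable_def by (intro exI[of _ "\<lambda>i x. h (s i x) (t i x)"]) simp
qed

lemma strongly_measurable_imp_borel:
  fixes f :: "'a::euclidean_space \<Rightarrow> real"
  assumes "strongly_measurable f"
  shows "f \<in> borel_measurable lebesgue"
proof -
  obtain s where s: "\<And>i::nat. simple_function lebesgue (s i)"
      "AE x in lebesgue. (\<lambda>i. s i x) \<longlonglongrightarrow> f x"
    using assms unfolding strongly_measurable_def by blast
  have [measurable]: "s i \<in> borel_measurable lebesgue" for i
    using s(1) by (rule borel_measurable_simple_function)
  have "(\<lambda>x. lim (\<lambda>i. s i x)) \<in> borel_measurable lebesgue"
    by measurable
  moreover have "AE x in lebesgue. lim (\<lambda>i. s i x) = f x"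
    using s(2) by eventually_elim (rule limI)
  ultimately show ?thesis by (rule borel_measurable_AE)
qed

lemma square_integrable_inner:
  assumes "square_integrable f" "square_integrable g"
  shows "integrable lebesgue (\<lambda>x. inner (f x) (g x))"
proof (rule Bochner_Integration.integrable_bound)
  show "integrable lebesgue (\<lambda>x. (norm (f x))\<^sup>2 + (norm (g x))\<^sup>2)"
    using assms unfolding square_integrable_def by (intro Bochner_Integration.integrable_add) auto
  show "(\<lambda>x. inner (f x) (g x)) \<in> borel_measurable lebesgue"
    using assms unfolding square_integrable_def
    by (intro strongly_measurable_imp_borel strongly_measurable_combine[where h = inner] tendsto_inner)
      simp_all
  have "norm (inner u v) \<le> norm ((norm u)\<^sup>2 + (norm v)\<^sup>2)" for u v :: 'b
  proof -
    have "\<bar>inner u v\<bar> \<le> norm u * norm v" by (rule Cauchy_Schwarz_ineq2)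
    also have "\<dots> \<le> (norm u)\<^sup>2 + (norm v)\<^sup>2"
      using sum_squares_bound[of "norm u" "norm v"] mult_nonneg_nonneg[of "norm u" "norm v"]
        norm_ge_zero[of u] norm_ge_zero[of v] by linarith
    finally show ?thesis by simp
  qed
  then show "AE x in lebesgue. norm (inner (f x) (g x)) \<le> norm ((norm (f x))\<^sup>2 + (norm (g x))\<^sup>2)"
    by simp
qed

lemma square_integrable_add:
  assumes "square_integrable f" "square_integrable g"
  shows "square_integrable (\<lambda>x. f x + g x)"
proof -
  have "strongly_measurable (\<lambda>x. f x + g x)"
    using assms unfolding square_integrable_def
    by (intro strongly_measurable_combine[where h = "(+)"] tendsto_add) simp_all
  moreover have "(norm (f x + g x))\<^sup>2 = inner (f x) (f x) + inner (g x) (g x) + 2 * inner (f x) (g x)" for x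
    by (simp add: power2_norm_eq_inner inner_add_left inner_add_right inner_commute)
  ultimately show ?thesis
    unfolding square_integrable_def
    using square_integrable_inner[OF assms(1,1)] square_integrable_inner[OF assms(2,2)]
      square_integrable_inner[OF assms] by simp
qed

lemma square_integrable_scaleR:
  assumes "square_integrable f"
  shows "square_integrable (\<lambda>x. c *\<^sub>R f x)"
proof -
  have "strongly_measurable (\<lambda>x. c *\<^sub>R f x)"
    using assms unfolding square_integrable_def
    by (intro strongly_measurable_combine[where h = "\<lambda>u _. c *\<^sub>R u" and g = f] tendsto_scaleR tendsto_const)
      simp_all
  then show ?thesis
    using assms unfolding square_integrable_def by (simp add: power_mult_distrib)
qed

lemma square_integrable_zero: "square_integrable (\<lambda>x. 0)"
  unfolding square_integrable_def strongly_measurable_def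
  by (auto intro!: exI[of _ "\<lambda>i x. 0"])

lemma square_integrable_uminus:
  "square_integrable f \<Longrightarrow> square_integrable (\<lambda>x. - f x)"
  using square_integrable_scaleR[of f "-1"] by simp

lemma square_integrable_diff:
  "square_integrable f \<Longrightarrow> square_integrable g \<Longrightarrow> square_integrable (\<lambda>x. f x - g x)"
  using square_integrable_add[of f "\<lambda>x. - g x"] square_integrable_uminus[of g] by simp

definition lsq_rel :: "('a::euclidean_space \<Rightarrow> 'b::real_inner) \<Rightarrow> ('a \<Rightarrow> 'b) \<Rightarrow> bool" where
  "lsq_rel f g \<longleftrightarrow> square_integrable f \<and> square_integrable g \<and> (AE x in lebesgue. f x = g x)"

text \<open>The type \<open>('a, 'b) lsq\<close> is $L^2(\mathbb{R}^n; X)$ for \<open>'a\<close> = $\mathbb{R}^n$ and \<open>'b\<close> = $X$.\<close>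

quotient_type (overloaded) ('a, 'b) lsq =
  "'a::euclidean_space \<Rightarrow> 'b::real_inner" / partial: lsq_rel
proof (rule part_equivpI)
  show "\<exists>f::'a \<Rightarrow> 'b. lsq_rel f f"
    using square_integrable_zero unfolding lsq_rel_def by auto
  show "symp (lsq_rel :: ('a \<Rightarrow> 'b) \<Rightarrow> _)"
    unfolding symp_def lsq_rel_def by (auto elim: eventually_mono)
  show "transp (lsq_rel :: ('a \<Rightarrow> 'b) \<Rightarrow> _)"
    unfolding transp_def lsq_rel_def by (auto elim: eventually_elim2)
qed

instantiation lsq :: (euclidean_space, real_inner) real_vector
begin

lift_definition zero_lsq :: "('a, 'b) lsq" is "\<lambda>x. 0"
  by (simp add: lsq_rel_def square_integrable_zero)

lift_definition plus_lsq :: "('a, 'b) lsq \<Rightarrow> ('a, 'b) lsq \<Rightarrow> ('a, 'b) lsq" is "\<lambda>f g x. f x + g x"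
  unfolding lsq_rel_def by (auto intro: square_integrable_add elim: eventually_elim2)

lift_definition uminus_lsq :: "('a, 'b) lsq \<Rightarrow> ('a, 'b) lsq" is "\<lambda>f x. - f x"
  unfolding lsq_rel_def by (auto intro: square_integrable_uminus)

lift_definition minus_lsq :: "('a, 'b) lsq \<Rightarrow> ('a, 'b) lsq \<Rightarrow> ('a, 'b) lsq" is "\<lambda>f g x. f x - g x"
  unfolding lsq_rel_def by (auto intro: square_integrable_diff elim: eventually_elim2)

lift_definition scaleR_lsq :: "real \<Rightarrow> ('a, 'b) lsq \<Rightarrow> ('a, 'b) lsq" is "\<lambda>c f x. c *\<^sub>R f x"
  unfolding lsq_rel_def by (auto intro: square_integrable_scaleR elim: eventually_mono)

instance
proof
  fix f g h :: "('a, 'b) lsq" and a b :: real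
  show "f + g + h = f + (g + h)" 
    by transfer (auto simp: lsq_rel_def add.assoc intro!: square_integrable_add)
  show "f + g = g + f"
    by transfer (auto simp: lsq_rel_def add.commute intro!: square_integrable_add)
  show "0 + f = f"
    by transfer (auto simp: lsq_rel_def)
  show "- f + f = 0"
    by transfer (auto simp: lsq_rel_def square_integrable_zero)
  show "f - g = f + - g"
    by transfer (auto simp: lsq_rel_def intro!: square_integrable_diff)
  show "a *\<^sub>R (f + g) = a *\<^sub>R f + a *\<^sub>R g"
    by transfer (auto simp: lsq_rel_def scaleR_add_right
        intro!: square_integrable_add square_integrable_scaleR)
  show "(a + b) *\<^sub>R f = a *\<^sub>R f + b *\<^sub>R f"
    by transfer (auto simp: lsq_rel_def scaleR_add_left
        intro!: square_integrable_add square_integrable_scaleR)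
  show "a *\<^sub>R b *\<^sub>R f = (a * b) *\<^sub>R f"
    by transfer (auto simp: lsq_rel_def intro!: square_integrable_scaleR)
  show "1 *\<^sub>R f = f"
    by transfer (auto simp: lsq_rel_def)
qed

end

instantiation lsq :: (euclidean_space, real_inner) real_inner
begin

lift_definition inner_lsq :: "('a, 'b) lsq \<Rightarrow> ('a, 'b) lsq \<Rightarrow> real"
  is "\<lambda>f g. \<integral>x. inner (f x) (g x) \<partial>lebesgue"
proof -
  fix f f' g g' :: "'a \<Rightarrow> 'b"
  assume *: "lsq_rel f f'" "lsq_rel g g'"
  then have "AE x in lebesgue. inner (f x) (g x) = inner (f' x) (g' x)"
    unfolding lsq_rel_def by (auto elim: eventually_elim2)
  with * show "(\<integral>x. inner (f x) (g x) \<partial>lebesgue) = (\<integral>x. inner (f' x) (g' x) \<partial>lebesgue)"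
    unfolding lsq_rel_def
    by (intro integral_cong_AE) (auto intro!: borel_measurable_integrable square_integrable_inner)
qed

definition norm_lsq :: "('a, 'b) lsq \<Rightarrow> real" where "norm_lsq f = sqrt (inner f f)"
definition dist_lsq :: "('a, 'b) lsq \<Rightarrow> ('a, 'b) lsq \<Rightarrow> real" where "dist_lsq f g = norm (f - g)"
definition sgn_lsq :: "('a, 'b) lsq \<Rightarrow> ('a, 'b) lsq" where "sgn_lsq f = inverse (norm f) *\<^sub>R f"
definition uniformity_lsq :: "(('a, 'b) lsq \<times> ('a, 'b) lsq) filter" where
  "uniformity_lsq = (INF e\<in>{0<..}. principal {(f, g). dist f g < e})"
definition open_lsq :: "('a, 'b) lsq set \<Rightarrow> bool" where
  "open_lsq U \<longleftrightarrow> (\<forall>f\<in>U. \<forall>\<^sub>F (f', g) in uniformity. f' = f \<longrightarrow> g \<in> U)"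

instance
proof
  fix f g h :: "('a, 'b) lsq" and a :: real
  show "inner f g = inner g f"
    by transfer (simp add: inner_commute)
  show "inner (f + g) h = inner f h + inner g h"
    by transfer (auto simp: lsq_rel_def inner_add_left square_integrable_inner)
  show "inner (a *\<^sub>R f) g = a * inner f g"
    by transfer simp
  show "0 \<le> inner f f"
    by transfer simp
  show "inner f f = 0 \<longleftrightarrow> f = 0"
  proof transfer
    fix f :: "'a \<Rightarrow> 'b"
    assume f: "lsq_rel f f"
    then have "integrable lebesgue (\<lambda>x. inner (f x) (f x))"
      by (auto simp: lsq_rel_def square_integrable_inner)
    then have "(\<integral>x. inner (f x) (f x) \<partial>lebesgue) = 0 \<longleftrightarrow> (AE x in lebesgue. inner (f x) (f x) = 0)"
      by (intro integral_nonneg_eq_0_iff_AE) auto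
    then show "(\<integral>x. inner (f x) (f x) \<partial>lebesgue) = 0 \<longleftrightarrow> lsq_rel f (\<lambda>x. 0)"
      using f by (auto simp: lsq_rel_def square_integrable_zero)
  qed
  show "norm f = sqrt (inner f f)" by (rule norm_lsq_def)
  show "dist f g = norm (f - g)" by (rule dist_lsq_def)
  show "sgn f = f /\<^sub>R norm f" by (rule sgn_lsq_def)
  show "uniformity = (INF e\<in>{0<..}. principal {(f, g::('a, 'b) lsq). dist f g < e})"
    by (rule uniformity_lsq_def)
  show "open U \<longleftrightarrow> (\<forall>f\<in>U. \<forall>\<^sub>F (f', g) in uniformity. f' = f \<longrightarrow> g \<in> U)" for U :: "('a, 'b) lsq set"
    by (rule open_lsq_def)
qed

end

text \<open>$L^2(S; X)$, identified by zero extension with the functions in $L^2(\mathbb{R}^n; X)$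
  that vanish almost everywhere outside \<open>S\<close>.\<close>

definition lsq_on :: "'a::euclidean_space set \<Rightarrow> ('a, 'b::real_inner) lsq set" where
  "lsq_on S = {f. AE x in lebesgue. x \<notin> S \<longrightarrow> rep_lsq f x = 0}"

definition lsq_class :: "'a::euclidean_space set \<Rightarrow> ('a \<Rightarrow> 'b::real_inner) \<Rightarrow> ('a, 'b) lsq" where
  "lsq_class S f = abs_lsq (\<lambda>x. if x \<in> S then f x else 0)"


section \<open>Test functions and Sobolev spaces\<close>

definition partial_deriv :: "'a::euclidean_space \<Rightarrow> ('a \<Rightarrow> real) \<Rightarrow> 'a \<Rightarrow> real" where
  "partial_deriv b f x = frechet_derivative f (at x) b"

primrec C_k :: "nat \<Rightarrow> ('a::euclidean_space \<Rightarrow> real) \<Rightarrow> bool" where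
  "C_k 0 f \<longleftrightarrow> continuous_on UNIV f"
| "C_k (Suc k) f \<longleftrightarrow> (\<forall>x. f differentiable (at x)) \<and> (\<forall>b\<in>Basis. C_k k (partial_deriv b f))"

definition test_functions :: "'a::euclidean_space set \<Rightarrow> ('a \<Rightarrow> real) set" where
  "test_functions S =
     {\<phi>. (\<forall>k. C_k k \<phi>) \<and> compact (closure {x. \<phi> x \<noteq> 0}) \<and> closure {x. \<phi> x \<noteq> 0} \<subseteq> S}"

definition laplacian :: "('a::euclidean_space \<Rightarrow> real) \<Rightarrow> 'a \<Rightarrow> real" where
  "laplacian \<phi> x = (\<Sum>b\<in>Basis. partial_deriv b (partial_deriv b \<phi>) x)"

text \<open>\<open>g\<close> is the weak derivative of \<open>u\<close> in direction \<open>b\<close> on \<open>\<Omega>\<close>.\<close>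

definition weak_partial ::
  "'a::euclidean_space set \<Rightarrow> 'a \<Rightarrow> ('a, real) lsq \<Rightarrow> ('a, real) lsq \<Rightarrow> bool" where
  "weak_partial \<Omega> b u g \<longleftrightarrow> g \<in> lsq_on \<Omega> \<and>
     (\<forall>\<phi>\<in>test_functions \<Omega>.
        inner u (lsq_class \<Omega> (partial_deriv b \<phi>)) = - inner g (lsq_class \<Omega> \<phi>))"

definition H1 :: "'a::euclidean_space set \<Rightarrow> ('a, real) lsq set" where
  "H1 \<Omega> = {u \<in> lsq_on \<Omega>. \<forall>b\<in>Basis. \<exists>g. weak_partial \<Omega> b u g}"

definition H2 :: "'a::euclidean_space set \<Rightarrow> ('a, real) lsq set" where
  "H2 \<Omega> = {u \<in> H1 \<Omega>. \<forall>b\<in>Basis. \<exists>g\<in>H1 \<Omega>. weak_partial \<Omega> b u g}"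

text \<open>$H_0^1(\Omega)$ is the closure of the test functions in $H^1(\Omega)$.\<close>

definition H10 :: "'a::euclidean_space set \<Rightarrow> ('a, real) lsq set" where
  "H10 \<Omega> = {u \<in> H1 \<Omega>. \<exists>\<phi>. (\<forall>k::nat. \<phi> k \<in> test_functions \<Omega>) \<and>
      (\<lambda>k. lsq_class \<Omega> (\<phi> k)) \<longlonglongrightarrow> u \<and>
      (\<forall>b\<in>Basis. \<exists>g. weak_partial \<Omega> b u g \<and>
         (\<lambda>k. lsq_class \<Omega> (partial_deriv b (\<phi> k))) \<longlonglongrightarrow> g)}"


section \<open>The Dirichlet Laplacian and its square root\<close>

text \<open>Unbounded operators on a closed subspace \<open>H\<close> are represented by their graphs.\<close>

definition op_adjoint :: "'v::real_inner set \<Rightarrow> ('v \<times> 'v) set \<Rightarrow> ('v \<times> 'v) set" where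
  "op_adjoint H G = {(v, w). v \<in> H \<and> w \<in> H \<and> (\<forall>(u, f)\<in>G. inner f v = inner u w)}"

definition self_adjoint :: "'v::real_inner set \<Rightarrow> ('v \<times> 'v) set \<Rightarrow> bool" where
  "self_adjoint H G \<longleftrightarrow> G \<subseteq> H \<times> H \<and> H \<subseteq> closure (Domain G) \<and> op_adjoint H G = G"

definition nonnegative_op :: "('v::real_inner \<times> 'v) set \<Rightarrow> bool" where
  "nonnegative_op G \<longleftrightarrow> (\<forall>(u, f)\<in>G. 0 \<le> inner f u)"

text \<open>The nonnegative self-adjoint square root of a nonnegative self-adjoint operator exists and is
  unique; the composition of graphs includes the usual condition on domains.\<close>

definition op_sqrt :: "'v::real_inner set \<Rightarrow> ('v \<times> 'v) set \<Rightarrow> ('v \<times> 'v) set" where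
  "op_sqrt H G = (SOME S. self_adjoint H S \<and> nonnegative_op S \<and> S O S = G)"

text \<open>The operator $-\Delta$ with homogeneous Dirichlet conditions, with domain all
  $u \in H_0^1(\Omega)$ for which the distribution $-\Delta u$ belongs to $L^2(\Omega)$. On every
  bounded open set this is self-adjoint. Its restriction to $H^2(\Omega) \cap H_0^1(\Omega)$
  is the same operator whenever that restriction is self-adjoint (for instance if the boundary is
  smooth or $\Omega$ is convex), see \<open>dirichlet_laplacian_eq_H2\<close> below.\<close>

definition dirichlet_laplacian ::
  "'a::euclidean_space set \<Rightarrow> (('a, real) lsq \<times> ('a, real) lsq) set" where
  "dirichlet_laplacian \<Omega> = {(u, f). u \<in> H10 \<Omega> \<and> f \<in> lsq_on \<Omega> \<and>
     (\<forall>\<phi>\<in>test_functions \<Omega>. - inner u (lsq_class \<Omega> (laplacian \<phi>)) = inner f (lsq_class \<Omega> \<phi>))}"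

definition A_half :: "'a::euclidean_space set \<Rightarrow> ('a, real) lsq \<Rightarrow> ('a, real) lsq" where
  "A_half \<Omega> u = (THE f. (u, f) \<in> op_sqrt (lsq_on \<Omega>) (dirichlet_laplacian \<Omega>))"

definition H10_inner :: "'a::euclidean_space set \<Rightarrow> ('a, real) lsq \<Rightarrow> ('a, real) lsq \<Rightarrow> real" where
  "H10_inner \<Omega> u v = inner (A_half \<Omega> u) (A_half \<Omega> v)"

definition H10_norm :: "'a::euclidean_space set \<Rightarrow> ('a, real) lsq \<Rightarrow> real" where
  "H10_norm \<Omega> u = sqrt (H10_inner \<Omega> u u)"


section \<open>Functionals on \<open>H10\<close> and distributions in time\<close>

text \<open>Elements of $H^{-1}(\Omega)$, the dual of $H_0^1(\Omega)$, are functionals whose values matter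
  only on \<open>H10 \<Omega>\<close>. The pivot space embeds by the inner product of $L^2(\Omega)$, and the
  extension of the Laplacian to $H_0^1(\Omega)$ is the Riesz isomorphism.\<close>

type_synonym 'a functional = "('a, real) lsq \<Rightarrow> real"

definition pivot :: "('a::euclidean_space, real) lsq \<Rightarrow> 'a functional" where
  "pivot y = (\<lambda>v. inner y v)"

definition A_ext :: "'a::euclidean_space set \<Rightarrow> ('a, real) lsq \<Rightarrow> 'a functional" where
  "A_ext \<Omega> u = (\<lambda>v. H10_inner \<Omega> u v)"

text \<open>The regular distribution on $(0,T)$ given by \<open>g\<close> maps \<open>\<phi>\<close> to the element
  $\int_0^T \varphi(t) g(t)\,dt$ of $H^{-1}(\Omega)$, here evaluated at \<open>v\<close>.\<close>

definition regular_distr ::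
  "real \<Rightarrow> (real \<Rightarrow> 'a::euclidean_space functional) \<Rightarrow> (real \<Rightarrow> real) \<Rightarrow> 'a functional" where
  "regular_distr T g \<phi> = (\<lambda>v. LINT t:{0..T}|lebesgue. \<phi> t * g t v)"

definition distr_deriv ::
  "((real \<Rightarrow> real) \<Rightarrow> 'a::euclidean_space functional) \<Rightarrow> (real \<Rightarrow> real) \<Rightarrow> 'a functional" where
  "distr_deriv D \<phi> = (\<lambda>v. - D (deriv \<phi>) v)"


section \<open>The spaces and operators of the wave equation\<close>

definition L2_time :: "'a::euclidean_space set \<Rightarrow> real \<Rightarrow> (real, ('a, real) lsq) lsq set" where
  "L2_time \<Omega> T = {f \<in> lsq_on {0..T}. AE t in lebesgue. rep_lsq f t \<in> lsq_on \<Omega>}"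

definition time_deriv :: "real \<Rightarrow> (real \<Rightarrow> 'v::real_normed_vector) \<Rightarrow> real \<Rightarrow> 'v" where
  "time_deriv T x t = vector_derivative x (at t within {0..T})"

text \<open>The identity $\ddot x + A x = f$ of distributions on $(0,T)$, with \<open>f\<close> in
  $L^2(0,T;L^2(\Omega))$.\<close>

definition is_wave_image :: "'a::euclidean_space set \<Rightarrow> real \<Rightarrow> (real \<Rightarrow> ('a, real) lsq) \<Rightarrow>
    (real, ('a, real) lsq) lsq \<Rightarrow> bool" where
  "is_wave_image \<Omega> T x f \<longleftrightarrow> f \<in> L2_time \<Omega> T \<and>
     (\<forall>\<phi>\<in>test_functions {0<..<T}. \<forall>v\<in>H10 \<Omega>.
        distr_deriv (distr_deriv (regular_distr T (\<lambda>t. pivot (x t)))) \<phi> v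
          + regular_distr T (\<lambda>t. A_ext \<Omega> (x t)) \<phi> v
        = regular_distr T (\<lambda>t. pivot (rep_lsq f t)) \<phi> v)"

definition wave_op ::
  "'a::euclidean_space set \<Rightarrow> real \<Rightarrow> (real \<Rightarrow> ('a, real) lsq) \<Rightarrow> (real, ('a, real) lsq) lsq" where
  "wave_op \<Omega> T x = (THE f. is_wave_image \<Omega> T x f)"

text \<open>Functions on $[0,T]$ are extended by zero to the whole line, so that equality in \<open>E_space\<close> is
  equality on $[0,T]$.\<close>

definition E_space :: "'a::euclidean_space set \<Rightarrow> real \<Rightarrow> (real \<Rightarrow> ('a, real) lsq) set" where
  "E_space \<Omega> T = {x.
     (\<forall>t. t \<notin> {0..T} \<longrightarrow> x t = 0) \<and>
     (\<forall>t\<in>{0..T}. x t \<in> H10 \<Omega>) \<and>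
     (\<forall>t\<in>{0..T}. ((\<lambda>s. H10_norm \<Omega> (x s - x t)) \<longlongrightarrow> 0) (at t within {0..T})) \<and>
     (\<forall>t\<in>{0..T}. x differentiable (at t within {0..T})) \<and>
     continuous_on {0..T} (time_deriv T x) \<and>
     (\<exists>f. is_wave_image \<Omega> T x f)}"

type_synonym 'a data = "(real, ('a, real) lsq) lsq \<times> ('a, real) lsq \<times> ('a, real) lsq"

definition P_space :: "'a::euclidean_space set \<Rightarrow> real \<Rightarrow> 'a data set" where
  "P_space \<Omega> T = L2_time \<Omega> T \<times> H10 \<Omega> \<times> lsq_on \<Omega>"

definition P_norm :: "'a::euclidean_space set \<Rightarrow> 'a data \<Rightarrow> real" where
  "P_norm \<Omega> = (\<lambda>(u, y, z). sqrt ((norm u)\<^sup>2 + (H10_norm \<Omega> y)\<^sup>2 + (norm z)\<^sup>2))"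

definition op_A :: "'a::euclidean_space set \<Rightarrow> real \<Rightarrow> (real \<Rightarrow> ('a, real) lsq) \<Rightarrow> 'a data" where
  "op_A \<Omega> T x = (wave_op \<Omega> T x, x 0, time_deriv T x 0)"

definition op_B :: "(real, ('a::euclidean_space, real) lsq) lsq \<Rightarrow> 'a data" where
  "op_B u = (u, 0, 0)"

definition op_C :: "real \<Rightarrow> (real \<Rightarrow> ('a::euclidean_space, real) lsq) \<Rightarrow>
    (real, ('a, real) lsq \<times> ('a, real) lsq) lsq" where
  "op_C T x = lsq_class {0..T} (\<lambda>t. (x t, time_deriv T x t))"

definition op_K :: "real \<Rightarrow> (real \<Rightarrow> ('a::euclidean_space, real) lsq) \<Rightarrow> (real, ('a, real) lsq) lsq" where
  "op_K T x = - lsq_class {0..T} (\<lambda>t. x t + time_deriv T x t)"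

definition op_A_tilde ::
  "'a::euclidean_space set \<Rightarrow> real \<Rightarrow> (real \<Rightarrow> ('a, real) lsq) \<Rightarrow> 'a data" where
  "op_A_tilde \<Omega> T x = op_A \<Omega> T x - op_B (op_K T x)"

text \<open>The norm of $L^2(0,T;H_0^1(\Omega) \times L^2(\Omega))$.\<close>

definition energy_norm :: "'a::euclidean_space set \<Rightarrow> real \<Rightarrow>
    (real, ('a, real) lsq \<times> ('a, real) lsq) lsq \<Rightarrow> real" where
  "energy_norm \<Omega> T z = sqrt (LINT t:{0..T}|lebesgue.
     (H10_norm \<Omega> (fst (rep_lsq z t)))\<^sup>2 + (norm (snd (rep_lsq z t)))\<^sup>2)"

text \<open>The operator norm; it is infinite for unbounded operators, and the quotient at a vector of
  norm zero is zero.\<close>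

definition operator_norm :: "'p set \<Rightarrow> ('p \<Rightarrow> real) \<Rightarrow> ('y \<Rightarrow> real) \<Rightarrow> ('p \<Rightarrow> 'y) \<Rightarrow> ereal" where
  "operator_norm P normP normY F = (SUP p\<in>P. ereal (normY (F p) / normP p))"


section \<open>Consistency of the definitions\<close>

lemma op_A_tilde_eq:
  "op_A_tilde \<Omega> T x =
     (wave_op \<Omega> T x + lsq_class {0..T} (\<lambda>t. x t + time_deriv T x t), x 0, time_deriv T x 0)"
  by (simp add: op_A_tilde_def op_A_def op_B_def op_K_def)

lemma test_function_partial_deriv:
  assumes "\<phi> \<in> test_functions S" "b \<in> Basis"
  shows "partial_deriv b \<phi> \<in> test_functions S"
proof -
  let ?K = "closure {x. \<phi> x \<noteq> 0}"
  have "partial_deriv b \<phi> x = 0" if "x \<notin> ?K" for x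
  proof -
    have "((\<lambda>y. 0::real) has_derivative (\<lambda>h. 0)) (at x)" by simp
    then have "(\<phi> has_derivative (\<lambda>h. 0)) (at x)"
    proof (rule has_derivative_transform_within_open)
      show "open (- ?K)" by (intro open_Compl closed_closure)
      show "x \<in> - ?K" using that by simp
      show "0 = \<phi> y" if "y \<in> - ?K" for y
        using that closure_subset[of "{x. \<phi> x \<noteq> 0}"] by auto
    qed
    then have "frechet_derivative \<phi> (at x) = (\<lambda>h. 0)"
      using frechet_derivative_at by force
    then show ?thesis by (simp add: partial_deriv_def)
  qed
  then have "{x. partial_deriv b \<phi> x \<noteq> 0} \<subseteq> ?K" by blast
  then have sub: "closure {x. partial_deriv b \<phi> x \<noteq> 0} \<subseteq> ?K"
    by (simp add: closure_minimal)
  moreover have "compact ?K" "?K \<subseteq> S" "\<And>k. C_k (Suc k) \<phi>"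
    using assms(1) by (auto simp: test_functions_def simp del: C_k.simps)
  ultimately show ?thesis
    using assms(2) compact_Int_closed[of ?K "closure {x. partial_deriv b \<phi> x \<noteq> 0}"]
    by (auto simp: test_functions_def Int_absorb1)
qed

lemma test_function_square_integrable:
  fixes \<phi> :: "'a::euclidean_space \<Rightarrow> real"
  assumes "\<phi> \<in> test_functions S"
  shows "square_integrable \<phi>" "(\<lambda>x. if x \<in> S then \<phi> x else 0) = \<phi>"
proof -
  let ?K = "closure {x. \<phi> x \<noteq> 0}"
  have cont: "continuous_on UNIV \<phi>" and K: "compact ?K" "?K \<subseteq> S"
    using assms by (auto simp: test_functions_def dest: spec[of _ 0])
  have borel: "\<phi> \<in> borel_measurable borel"
    using cont by (rule borel_measurable_continuous_onI)
  obtain s where s: "\<And>i::nat. simple_function borel (s i)" "\<And>x. (\<lambda>i. s i x) \<longlonglongrightarrow> \<phi> x"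
    using borel_measurable_implies_sequence_metric[OF borel, of 0] by auto
  have "simple_function lebesgue (s i)" for i
    using s(1)[of i] by (auto simp: simple_function_def intro: sets_completionI_sets)
  then have "strongly_measurable \<phi>"
    unfolding strongly_measurable_def using s(2) by blast
  moreover have "integrable lebesgue (\<lambda>x. (norm (\<phi> x))\<^sup>2)"
  proof -
    have "(\<lambda>x. indicator ?K x *\<^sub>R (\<phi> x)\<^sup>2) = (\<lambda>x. (norm (\<phi> x))\<^sup>2)"
      using closure_subset[of "{x. \<phi> x \<noteq> 0}"] by (fastforce simp: indicator_def)
    moreover have "integrable lborel (\<lambda>x. indicator ?K x *\<^sub>R (\<phi> x)\<^sup>2)"
      using K(1) by (intro borel_integrable_compact continuous_intros)
        (auto intro: continuous_on_subset[OF cont])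
    ultimately show ?thesis
      by (simp add: integrable_completion borel_measurable_integrable)
  qed
  ultimately show "square_integrable \<phi>" by (simp add: square_integrable_def)
  show "(\<lambda>x. if x \<in> S then \<phi> x else 0) = \<phi>"
    using K(2) closure_subset[of "{x. \<phi> x \<noteq> 0}"] by fastforce
qed

lemma abs_lsq_add:
  assumes "square_integrable f" "square_integrable g"
  shows "abs_lsq (\<lambda>x. f x + g x) = abs_lsq f + abs_lsq g"
  by (rule sym, rule plus_lsq.abs_eq) (use assms in \<open>auto simp: lsq_rel_def\<close>)

lemma abs_lsq_sum:
  assumes "finite I" "\<And>i. i \<in> I \<Longrightarrow> square_integrable (f i)"
  shows "abs_lsq (\<lambda>x. \<Sum>i\<in>I. f i x) = (\<Sum>i\<in>I. abs_lsq (f i)) \<and> square_integrable (\<lambda>x. \<Sum>i\<in>I. f i x)"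
  using assms
  by (induction I rule: finite_induct)
    (auto simp: abs_lsq_add square_integrable_add square_integrable_zero zero_lsq_def)

lemma lsq_class_laplacian:
  assumes "\<phi> \<in> test_functions \<Omega>"
  shows "lsq_class \<Omega> (laplacian \<phi>) = (\<Sum>b\<in>Basis. lsq_class \<Omega> (partial_deriv b (partial_deriv b \<phi>)))"
proof -
  have *: "partial_deriv b (partial_deriv b \<phi>) \<in> test_functions \<Omega>" if "b \<in> Basis" for b
    using assms that by (intro test_function_partial_deriv)
  have "(if x \<in> \<Omega> then laplacian \<phi> x else 0) =
      (\<Sum>b\<in>Basis. partial_deriv b (partial_deriv b \<phi>) x)" for x
    using fun_cong[OF test_function_square_integrable(2)[OF *], of _ x]
    by (auto simp: laplacian_def)
  then have "lsq_class \<Omega> (laplacian \<phi>) =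
      abs_lsq (\<lambda>x. \<Sum>b\<in>Basis. partial_deriv b (partial_deriv b \<phi>) x)"
    by (simp add: lsq_class_def)
  also have "\<dots> = (\<Sum>b\<in>Basis. abs_lsq (partial_deriv b (partial_deriv b \<phi>)))"
    by (intro conjunct1[OF abs_lsq_sum]) (use * test_function_square_integrable(1) in auto)
  also have "\<dots> = (\<Sum>b\<in>Basis. lsq_class \<Omega> (partial_deriv b (partial_deriv b \<phi>)))"
    using test_function_square_integrable(2)[OF *] by (simp add: lsq_class_def)
  finally show ?thesis .
qed

lemma H10_approx:
  assumes "u \<in> H10 \<Omega>"
  obtains \<phi> g where "\<And>k::nat. \<phi> k \<in> test_functions \<Omega>" "(\<lambda>k. lsq_class \<Omega> (\<phi> k)) \<longlonglongrightarrow> u"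
    "\<And>b. b \<in> Basis \<Longrightarrow> weak_partial \<Omega> b u (g b)"
    "\<And>b. b \<in> Basis \<Longrightarrow> (\<lambda>k. lsq_class \<Omega> (partial_deriv b (\<phi> k))) \<longlonglongrightarrow> g b"
proof -
  obtain \<phi> where \<phi>: "\<And>k::nat. \<phi> k \<in> test_functions \<Omega>" "(\<lambda>k. lsq_class \<Omega> (\<phi> k)) \<longlonglongrightarrow> u"
      "\<forall>b\<in>Basis. \<exists>g. weak_partial \<Omega> b u g \<and> (\<lambda>k. lsq_class \<Omega> (partial_deriv b (\<phi> k))) \<longlonglongrightarrow> g"
    using assms unfolding H10_def by auto
  obtain g where "\<forall>b\<in>Basis. weak_partial \<Omega> b u (g b) \<and>
      (\<lambda>k. lsq_class \<Omega> (partial_deriv b (\<phi> k))) \<longlonglongrightarrow> g b"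
    using bchoice[OF \<phi>(3)] by blast
  with \<phi> that show thesis by blast
qed

lemma dirichlet_laplacian_green:
  assumes uf: "(u, f) \<in> dirichlet_laplacian \<Omega>"
    and gu: "\<And>b. b \<in> Basis \<Longrightarrow> weak_partial \<Omega> b u (gu b)"
    and \<phi>: "\<And>k::nat. \<phi> k \<in> test_functions \<Omega>" "(\<lambda>k. lsq_class \<Omega> (\<phi> k)) \<longlonglongrightarrow> v"
    and gv: "\<And>b. b \<in> Basis \<Longrightarrow> (\<lambda>k. lsq_class \<Omega> (partial_deriv b (\<phi> k))) \<longlonglongrightarrow> gv b"
  shows "inner f v = (\<Sum>b\<in>Basis. inner (gu b) (gv b))"
proof -
  have "inner f (lsq_class \<Omega> (\<phi> k)) =
      (\<Sum>b\<in>Basis. inner (gu b) (lsq_class \<Omega> (partial_deriv b (\<phi> k))))" for k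
  proof -
    have "inner f (lsq_class \<Omega> (\<phi> k)) = - inner u (lsq_class \<Omega> (laplacian (\<phi> k)))"
      using uf \<phi>(1) by (auto simp: dirichlet_laplacian_def)
    also have "\<dots> = (\<Sum>b\<in>Basis. - inner u (lsq_class \<Omega> (partial_deriv b (partial_deriv b (\<phi> k)))))"
      using \<phi>(1) by (simp add: lsq_class_laplacian inner_sum_right sum_negf)
    also have "\<dots> = (\<Sum>b\<in>Basis. inner (gu b) (lsq_class \<Omega> (partial_deriv b (\<phi> k))))"
      using gu test_function_partial_deriv[OF \<phi>(1)]
      by (intro sum.cong) (auto simp: weak_partial_def)
    finally show ?thesis .
  qed
  moreover have "(\<lambda>k. inner f (lsq_class \<Omega> (\<phi> k))) \<longlonglongrightarrow> inner f v"
    using \<phi>(2) by (intro tendsto_inner tendsto_const)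
  moreover have "(\<lambda>k. \<Sum>b\<in>Basis. inner (gu b) (lsq_class \<Omega> (partial_deriv b (\<phi> k))))
      \<longlonglongrightarrow> (\<Sum>b\<in>Basis. inner (gu b) (gv b))"
    using gv by (intro tendsto_sum tendsto_inner tendsto_const)
  ultimately show ?thesis
    using LIMSEQ_unique by simp
qed

lemma dirichlet_laplacian_symmetric:
  assumes uf: "(u, f) \<in> dirichlet_laplacian \<Omega>" and vg: "(v, g) \<in> dirichlet_laplacian \<Omega>"
  shows "inner f v = inner u g"
proof -
  have uv: "u \<in> H10 \<Omega>" "v \<in> H10 \<Omega>"
    using assms by (auto simp: dirichlet_laplacian_def)
  obtain \<phi> gu where u: "\<And>k::nat. \<phi> k \<in> test_functions \<Omega>" "(\<lambda>k. lsq_class \<Omega> (\<phi> k)) \<longlonglongrightarrow> u"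
    "\<And>b. b \<in> Basis \<Longrightarrow> weak_partial \<Omega> b u (gu b)"
    "\<And>b. b \<in> Basis \<Longrightarrow> (\<lambda>k. lsq_class \<Omega> (partial_deriv b (\<phi> k))) \<longlonglongrightarrow> gu b"
    using H10_approx[OF uv(1)] by blast
  obtain \<psi> gv where v: "\<And>k::nat. \<psi> k \<in> test_functions \<Omega>" "(\<lambda>k. lsq_class \<Omega> (\<psi> k)) \<longlonglongrightarrow> v"
    "\<And>b. b \<in> Basis \<Longrightarrow> weak_partial \<Omega> b v (gv b)"
    "\<And>b. b \<in> Basis \<Longrightarrow> (\<lambda>k. lsq_class \<Omega> (partial_deriv b (\<psi> k))) \<longlonglongrightarrow> gv b"
    using H10_approx[OF uv(2)] by blast
  have "inner f v = (\<Sum>b\<in>Basis. inner (gu b) (gv b))"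
    using uf u(3) v(1,2,4) by (rule dirichlet_laplacian_green)
  moreover have "inner g u = (\<Sum>b\<in>Basis. inner (gv b) (gu b))"
    using vg v(3) u(1,2,4) by (rule dirichlet_laplacian_green)
  ultimately show ?thesis by (simp add: inner_commute)
qed

lemma dirichlet_laplacian_eq_H2:
  assumes "self_adjoint (lsq_on \<Omega>) {(u, f) \<in> dirichlet_laplacian \<Omega>. u \<in> H2 \<Omega>}"
  shows "dirichlet_laplacian \<Omega> = {(u, f) \<in> dirichlet_laplacian \<Omega>. u \<in> H2 \<Omega>}" (is "_ = ?G")
proof
  have "dirichlet_laplacian \<Omega> \<subseteq> op_adjoint (lsq_on \<Omega>) ?G"
  proof
    fix p assume "p \<in> dirichlet_laplacian \<Omega>"
    then obtain v g where p: "p = (v, g)" "(v, g) \<in> dirichlet_laplacian \<Omega>"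
      by (cases p) auto
    then have "v \<in> lsq_on \<Omega>" "g \<in> lsq_on \<Omega>"
      by (auto simp: dirichlet_laplacian_def H10_def H1_def)
    with p show "p \<in> op_adjoint (lsq_on \<Omega>) ?G"
      using dirichlet_laplacian_symmetric[OF _ p(2)] by (auto simp: op_adjoint_def)
  qed
  then show "dirichlet_laplacian \<Omega> \<subseteq> ?G"
    using assms by (simp add: self_adjoint_def)
qed auto

end

theory Submission
  imports Defs
begin

text \<open>Write \<open>L\<close> for $L^2(\Omega)$, \<open>D\<close> for the Dirichlet form $\int \nabla u \cdot \nabla v$ and \<open>R\<close> for
the inverse of $A$, so that \<open>D (R f) v = inner f v\<close> for all \<open>v\<close> in $H_0^1(\Omega)$. The Poincare
inequality bounds the square of the norm of \<open>L\<close> by \<open>C\<close> times \<open>D\<close>, whence \<open>R\<close> is bounded, symmetric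
and nonnegative. All the analysis is done with \<open>D\<close> and \<open>R\<close>; the norm of $H_0^1(\Omega)$ is given
by a square root of $A$, and \<open>S_energy\<close> shows that every self-adjoint root of $A$ has energy
\<open>D\<close> (\<open>H10_inner_eq\<close>). A root exists because the bounded operator \<open>R\<close> has one.

Take first $x = R y$ with \<open>y\<close> twice continuously differentiable in time. Then
$f = \ddot x + \dot x + x + A x$ is $R \ddot y + R \dot y + R y + y$, called \<open>source\<close> below, and no
unbounded operator is left. The functional
$|\dot x|^2 + D(x) + \frac32 |x|^2 + \langle \dot x, x\rangle$ is nonnegative and its derivative is at most
$3 |f|^2 - D(x) - \frac12 |\dot x|^2$. The damping enters here, and integration over $[0,T]$ bounds
$\int D(x) + \frac12 |\dot x|^2$ by the data with constants that do not involve \<open>T\<close>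
(\<open>energy_estimate\<close>).

The operator is injective: the difference \<open>d\<close> of two solutions with equal data satisfies a weak
equation, which after applying \<open>R\<close>, one integration in time and the lemma of du Bois-Reymond becomes
$R \ddot p + R \dot p + R p + p = 0$ for the primitive \<open>p\<close> of \<open>d\<close>. For this equation
$\langle R \dot p, \dot p\rangle + \langle R p, p\rangle + |p|^2$ does not increase
(\<open>homogeneous_ode_zero\<close>), so \<open>p\<close> vanishes.

The operator is surjective: the functions \<open>source\<close> with zero initial data are dense
(\<open>sources_dense\<close>), since the iterated time integrals of a function orthogonal to them solve the same
homogeneous equation with time reversed. Adding $h_0 + t h_1$ to \<open>y\<close> adjusts the initial data, so
arbitrary data are limits of data of such \<open>x\<close> (\<open>data_approximation\<close>). The energy estimate for
differences makes the approximations converge uniformly in time, the limit solves the equation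
weakly, and the estimate survives the limit. Collecting factors gives $c = \sqrt{12 + 8 C}$.\<close>

section \<open>Symmetric forms that are complete on a subspace\<close>

text \<open>Completeness refers to \<open>D\<close> itself, because the energy space is not closed in the norm of the
ambient space. With \<open>V = UNIV\<close> and \<open>D = inner\<close> this is an ordinary Hilbert space.\<close>

locale hilbert_form =
  fixes V :: "'v::real_vector set" and D :: "'v \<Rightarrow> 'v \<Rightarrow> real"
  assumes sub: "subspace V"
    and D_add_left: "\<And>u v w. u \<in> V \<Longrightarrow> v \<in> V \<Longrightarrow> w \<in> V \<Longrightarrow> D (u + v) w = D u w + D v w"
    and D_scale_left: "\<And>c u v. u \<in> V \<Longrightarrow> v \<in> V \<Longrightarrow> D (c *\<^sub>R u) v = c * D u v"
    and D_sym: "\<And>u v. u \<in> V \<Longrightarrow> v \<in> V \<Longrightarrow> D u v = D v u"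
    and D_nonneg: "\<And>u. u \<in> V \<Longrightarrow> 0 \<le> D u u"
    and D_definite: "\<And>u. u \<in> V \<Longrightarrow> D u u = 0 \<Longrightarrow> u = 0"
    and D_complete: "\<And>X. (\<And>n. X n \<in> V) \<Longrightarrow>
      (\<And>e. e > 0 \<Longrightarrow> \<exists>N. \<forall>m\<ge>N. \<forall>n\<ge>N. D (X m - X n) (X m - X n) < e) \<Longrightarrow>
      \<exists>u\<in>V. (\<lambda>n. D (X n - u) (X n - u)) \<longlonglongrightarrow> 0"
begin

lemmas V_ops = subspace_0[OF sub] subspace_add[OF sub] subspace_diff[OF sub] subspace_scale[OF sub]

lemma D_add_right: "u \<in> V \<Longrightarrow> v \<in> V \<Longrightarrow> w \<in> V \<Longrightarrow> D w (u + v) = D w u + D w v"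
  by (metis D_add_left D_sym V_ops(2))

lemma D_scale_right: "u \<in> V \<Longrightarrow> v \<in> V \<Longrightarrow> D v (c *\<^sub>R u) = c * D v u"
  by (metis D_scale_left D_sym V_ops(4))

lemma D_diff_left: "u \<in> V \<Longrightarrow> v \<in> V \<Longrightarrow> w \<in> V \<Longrightarrow> D (u - v) w = D u w - D v w"
  using D_add_left[of u "(-1) *\<^sub>R v" w] D_scale_left[of v w "-1"] V_ops(4)[of v "-1"] by simp

lemma D_diff_right: "u \<in> V \<Longrightarrow> v \<in> V \<Longrightarrow> w \<in> V \<Longrightarrow> D w (u - v) = D w u - D w v"
  by (metis D_diff_left D_sym V_ops(3))

lemmas D_expand = D_add_left D_add_right D_diff_left D_diff_right D_scale_left D_scale_right

lemma D_square_combination: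
  assumes "u \<in> V" "v \<in> V"
  shows "D (u + t *\<^sub>R v) (u + t *\<^sub>R v) = D u u + 2 * t * D u v + t\<^sup>2 * D v v"
  using assms by (simp add: D_expand V_ops D_sym[of v u] power2_eq_square algebra_simps)

lemma D_Cauchy_Schwarz:
  assumes "u \<in> V" "v \<in> V"
  shows "(D u v)\<^sup>2 \<le> D u u * D v v"
proof (cases "D v v = 0")
  case True
  then have "v = 0" using assms D_definite by blast
  then have "D u v = 0" using D_scale_right[of v u 0] assms by simp
  then show ?thesis using True by simp
next
  case False
  then have pos: "D v v > 0" using D_nonneg[OF assms(2)] by simp
  have "0 \<le> D (u + (- D u v / D v v) *\<^sub>R v) (u + (- D u v / D v v) *\<^sub>R v)"
    using assms by (intro D_nonneg V_ops)
  also have "\<dots> = D u u - (D u v)\<^sup>2 / D v v"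
    using pos assms by (simp only: D_square_combination) (simp add: power2_eq_square field_simps)
  finally show ?thesis using pos by (simp add: field_simps)
qed

lemma D_continuous:
  assumes X: "\<And>n. X n \<in> V" "u \<in> V" "(\<lambda>n. D (X n - u) (X n - u)) \<longlonglongrightarrow> 0" and v: "v \<in> V"
  shows "(\<lambda>n. D (X n) v) \<longlonglongrightarrow> D u v"
proof -
  have "(\<lambda>n. sqrt (D (X n - u) (X n - u) * D v v)) \<longlonglongrightarrow> sqrt (0 * D v v)"
    by (intro tendsto_intros X)
  then have "(\<lambda>n. sqrt (D (X n - u) (X n - u) * D v v)) \<longlonglongrightarrow> 0" by simp
  then have "(\<lambda>n. D (X n - u) v) \<longlonglongrightarrow> 0"
  proof (rule Lim_null_comparison[rotated], intro always_eventually allI)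
    fix n
    show "norm (D (X n - u) v) \<le> sqrt (D (X n - u) (X n - u) * D v v)"
      using D_Cauchy_Schwarz[OF V_ops(3)[OF X(1)[of n] X(2)] v]
      by (simp add: real_le_rsqrt)
  qed
  then have "(\<lambda>n. D (X n - u) v + D u v) \<longlonglongrightarrow> 0 + D u v" by (intro tendsto_intros)
  then show ?thesis using X v by (simp add: D_diff_left)
qed

lemma D_triangle_square:
  assumes "u \<in> V" "v \<in> V"
  shows "D (u + v) (u + v) \<le> 2 * D u u + 2 * D v v"
  using D_nonneg[OF V_ops(3)[OF assms]] assms by (simp add: D_expand V_ops D_sym[of v u])

lemma D_diff_triangle:
  assumes "p \<in> V" "q \<in> V" "r \<in> V"
  shows "D (p - q) (p - q) \<le> 2 * D (p - r) (p - r) + 2 * D (q - r) (q - r)"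
proof -
  have U: "p - r \<in> V" "q - r \<in> V" using assms by (auto intro: V_ops)
  have "p - q = (p - r) - (q - r)" by simp
  then have "D (p - q) (p - q) = D ((p - r) - (q - r)) ((p - r) - (q - r))" by (simp only:)
  also have "\<dots> = D (p - r) (p - r) - 2 * D (p - r) (q - r) + D (q - r) (q - r)"
    using U V_ops(3)[OF U] D_sym[OF U(2) U(1)] by (simp only: D_diff_left D_diff_right)
  moreover have "0 \<le> D (p - r) (p - r) + 2 * 1 * D (p - r) (q - r) + 1\<^sup>2 * D (q - r) (q - r)"
    using D_nonneg[OF V_ops(2)[OF U]] D_square_combination[OF U, of 1] by simp
  ultimately show ?thesis by simp
qed

lemma D_diff_commute: "p \<in> V \<Longrightarrow> q \<in> V \<Longrightarrow> D (p - q) (p - q) = D (q - p) (q - p)"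
  using D_scale_left[of "p - q" "p - q" "-1"] D_scale_right[of "p - q" "q - p" "-1"] by (simp add: V_ops)

lemma parallelogram:
  assumes "u \<in> V" "v \<in> V"
  shows "D (v - u) (v - u) = 2 * D u u + 2 * D v v - 4 * D ((1/2) *\<^sub>R (u + v)) ((1/2) *\<^sub>R (u + v))"
  using assms by (simp add: D_expand V_ops D_sym[of v u]) (simp add: field_simps)

text \<open>A sequence minimising the distance to \<open>M\<close> is a Cauchy sequence by the parallelogram law. Since \<open>M\<close>
is not assumed closed, the projection \<open>p\<close> is only a limit of elements of \<open>M\<close>.\<close>

lemma projection:
  assumes M: "subspace M" "M \<subseteq> V" and u: "u \<in> V"
  obtains X p where "\<And>n. X n \<in> M" "p \<in> V" "(\<lambda>n::nat. D (X n - p) (X n - p)) \<longlonglongrightarrow> 0"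
    "\<And>m. m \<in> M \<Longrightarrow> D (u - p) m = 0"
proof -
  define q where "q m = D (u - m) (u - m)" for m
  define d where "d = (INF m\<in>M. q m)"
  have MV: "m \<in> V" if "m \<in> M" for m using that M by blast
  have bdd: "bdd_below (q ` M)"
    using MV u by (intro bdd_belowI2[of _ 0]) (auto simp: q_def intro!: D_nonneg V_ops)
  have dle: "d \<le> q m" if "m \<in> M" for m
    unfolding d_def using bdd that by (rule cINF_lower)
  have ne: "M \<noteq> {}" using subspace_0[OF M(1)] by blast
  have "\<exists>m\<in>M. q m < d + 1 / real (Suc n)" for n
    using cINF_less_iff[OF ne bdd, of "d + 1 / real (Suc n)"] by (simp add: d_def)
  then obtain X where X: "\<And>n. X n \<in> M" "\<And>n. q (X n) < d + 1 / real (Suc n)"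
    by metis
  have XV: "X n \<in> V" for n using X(1) MV by blast
  have par: "D (X m - X n) (X m - X n) \<le> 2 / real (Suc m) + 2 / real (Suc n)" for m n
  proof -
    have mid: "(1/2) *\<^sub>R (X m + X n) \<in> M"
      by (intro subspace_scale subspace_add M X)
    have "D (X m - X n) (X m - X n) = 2 * q (X m) + 2 * q (X n) - 4 * q ((1/2) *\<^sub>R (X m + X n))"
    proof -
      have "(1/2) *\<^sub>R u + (1/2) *\<^sub>R u = u"
        by (simp flip: scaleR_add_left)
      then have "(1/2) *\<^sub>R ((u - X m) + (u - X n)) = u - (1/2) *\<^sub>R (X m + X n)"
        by (simp add: scaleR_add_right scaleR_diff_right algebra_simps)
      moreover have "(u - X n) - (u - X m) = X m - X n" by simp
      ultimately show ?thesis
        using parallelogram[OF V_ops(3)[OF u XV[of m]] V_ops(3)[OF u XV[of n]]]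
        by (simp only: q_def)
    qed
    then show ?thesis using X(2)[of m] X(2)[of n] dle[OF mid] by simp
  qed
  have "\<exists>p\<in>V. (\<lambda>n. D (X n - p) (X n - p)) \<longlonglongrightarrow> 0"
  proof (rule D_complete[OF XV])
    fix e :: real assume e: "e > 0"
    obtain N where N: "1 / real (Suc N) < e / 4"
      using reals_Archimedean[of "e/4"] e by (auto simp: inverse_eq_divide)
    show "\<exists>N. \<forall>m\<ge>N. \<forall>n\<ge>N. D (X m - X n) (X m - X n) < e"
    proof (intro exI allI impI)
      fix m n assume "N \<le> m" "N \<le> n"
      then have "1 / real (Suc m) \<le> 1 / real (Suc N)" "1 / real (Suc n) \<le> 1 / real (Suc N)"
        by (simp_all add: frac_le)
      then show "D (X m - X n) (X m - X n) < e"
        using par[of m n] N by simp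
    qed
  qed
  then obtain p where p: "p \<in> V" "(\<lambda>n. D (X n - p) (X n - p)) \<longlonglongrightarrow> 0" by blast
  have "D (u - p) m = 0" if m: "m \<in> M" for m
  proof -
    have mV: "m \<in> V" using MV[OF m] .
    have bound: "2 * t * D (u - p) m \<le> t\<^sup>2 * D m m" for t
    proof -
      have "2 * t * D (u - X n) m \<le> 1 / real (Suc n) + t\<^sup>2 * D m m" for n
      proof -
        have "d \<le> q (X n + t *\<^sub>R m)"
          by (intro dle subspace_add subspace_scale M X m)
        also have "\<dots> = D ((u - X n) + (- t) *\<^sub>R m) ((u - X n) + (- t) *\<^sub>R m)"
          by (simp add: q_def algebra_simps)
        also have "\<dots> = q (X n) - 2 * t * D (u - X n) m + t\<^sup>2 * D m m"
          using D_square_combination[OF V_ops(3)[OF u XV[of n]] mV, of "- t"] by (simp add: q_def)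
        finally show ?thesis using X(2)[of n] by simp
      qed
      moreover have "(\<lambda>n. 2 * t * D (u - X n) m) \<longlonglongrightarrow> 2 * t * D (u - p) m"
        using D_continuous[OF XV p mV] D_diff_left[OF u XV mV] D_diff_left[OF u p(1) mV]
        by (simp only:) (intro tendsto_intros)
      moreover have "(\<lambda>n. 1 / real (Suc n) + t\<^sup>2 * D m m) \<longlonglongrightarrow> 0 + t\<^sup>2 * D m m"
        by (intro tendsto_intros) (use LIMSEQ_inverse_real_of_nat in \<open>simp add: inverse_eq_divide\<close>)
      ultimately have "2 * t * D (u - p) m \<le> 0 + t\<^sup>2 * D m m"
        by (intro LIMSEQ_le) auto
      then show ?thesis by simp
    qed
    show ?thesis
    proof (cases "D m m = 0")
      case True
      then show ?thesis using bound[of 1] bound[of "-1"] by simp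
    next
      case False
      then have pos: "D m m > 0" using D_nonneg[OF mV] by simp
      have "2 * (D (u - p) m)\<^sup>2 \<le> (D (u - p) m)\<^sup>2"
        using bound[of "D (u - p) m / D m m"] pos by (simp add: power2_eq_square field_simps)
      then show ?thesis by simp
    qed
  qed
  then show thesis using that[OF X(1) p] by blast
qed

lemma dense_if_orthogonal_trivial:
  assumes M: "subspace M" "M \<subseteq> V" and u: "u \<in> V"
    and triv: "\<And>v. v \<in> V \<Longrightarrow> (\<And>m. m \<in> M \<Longrightarrow> D v m = 0) \<Longrightarrow> v = 0"
  obtains X where "\<And>n. X n \<in> M" "(\<lambda>n::nat. D (X n - u) (X n - u)) \<longlonglongrightarrow> 0"
proof -
  obtain X p where Xp: "\<And>n. X n \<in> M" "p \<in> V" "(\<lambda>n::nat. D (X n - p) (X n - p)) \<longlonglongrightarrow> 0"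
    "\<And>m. m \<in> M \<Longrightarrow> D (u - p) m = 0"
    using projection[OF M u] by blast
  then have "u - p = 0" using u by (intro triv V_ops) auto
  then show thesis using that[OF Xp(1)] Xp(3) by simp
qed

text \<open>The representing vector is a multiple of the component of \<open>u\<close> orthogonal to the kernel of \<open>l\<close>, for
any \<open>u\<close> outside the kernel.\<close>

lemma riesz:
  fixes l :: "'v \<Rightarrow> real"
  assumes l_add: "\<And>u v. u \<in> V \<Longrightarrow> v \<in> V \<Longrightarrow> l (u + v) = l u + l v"
    and l_scale: "\<And>c v. v \<in> V \<Longrightarrow> l (c *\<^sub>R v) = c * l v"
    and bounded: "\<And>v. v \<in> V \<Longrightarrow> (l v)\<^sup>2 \<le> K * D v v"
  obtains z where "z \<in> V" "\<And>v. v \<in> V \<Longrightarrow> D z v = l v"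
proof (cases "\<forall>v\<in>V. l v = 0")
  case True
  have "D 0 v = 0" if "v \<in> V" for v
    using D_scale_left[of 0 v 0] V_ops(1) that by simp
  then show thesis using True V_ops(1) by (intro that[of 0]) auto
next
  case False
  then obtain u where u: "u \<in> V" "l u \<noteq> 0" by blast
  define M where "M = {v \<in> V. l v = 0}"
  have l0: "l 0 = 0" using l_scale[of 0 0] V_ops(1) by simp
  have l_diff: "l (a - b) = l a - l b" if "a \<in> V" "b \<in> V" for a b
    using l_add[of a "(-1) *\<^sub>R b"] l_scale[of b "-1"] that V_ops(4)[of b "-1"] by simp
  have M: "subspace M" "M \<subseteq> V"
    by (auto simp: M_def subspace_def V_ops l_add l_scale l0)
  obtain X p where Xp: "\<And>n. X n \<in> M" "p \<in> V" "(\<lambda>n::nat. D (X n - p) (X n - p)) \<longlonglongrightarrow> 0"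
    "\<And>m. m \<in> M \<Longrightarrow> D (u - p) m = 0"
    using projection[OF M u(1)] by blast
  have XV: "X n \<in> V" "l (X n) = 0" for n using Xp(1) by (auto simp: M_def)
  have "l p = 0"
  proof -
    have "(l p)\<^sup>2 \<le> K * D (X n - p) (X n - p)" for n
      using bounded[OF V_ops(3)[OF XV(1)[of n] Xp(2)]] XV Xp(2) by (simp add: l_diff)
    moreover have "(\<lambda>n. K * D (X n - p) (X n - p)) \<longlonglongrightarrow> K * 0" by (intro tendsto_intros Xp)
    ultimately have "(l p)\<^sup>2 \<le> K * 0" by (intro LIMSEQ_le_const) auto
    then show ?thesis by simp
  qed
  define z where "z = u - p"
  have z: "z \<in> V" "l z \<noteq> 0" using u Xp(2) \<open>l p = 0\<close> by (auto simp: z_def V_ops l_diff)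
  then have "D z z \<noteq> 0" using D_definite l0 by metis
  have "D ((l z / D z z) *\<^sub>R z) v = l v" if v: "v \<in> V" for v
  proof -
    have "v - (l v / l z) *\<^sub>R z \<in> M"
      using v z by (auto simp: M_def V_ops l_diff l_scale)
    then have "D z (v - (l v / l z) *\<^sub>R z) = 0" using Xp(4) by (simp add: z_def)
    then have "D z v = (l v / l z) * D z z" using v z by (simp add: D_expand V_ops)
    then show ?thesis using v z \<open>D z z \<noteq> 0\<close> by (simp add: D_scale_left)
  qed
  then show thesis by (rule that[OF V_ops(4)[OF z(1)]])
qed

end

lemma hilbert_form_inner:
  "hilbert_form (UNIV :: 'v::{real_inner,complete_space} set) inner"
proof
  fix X :: "nat \<Rightarrow> 'v"
  assume C: "\<And>e. e > 0 \<Longrightarrow> \<exists>N. \<forall>m\<ge>N. \<forall>n\<ge>N. inner (X m - X n) (X m - X n) < e"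
  have "Cauchy X"
  proof (rule CauchyI)
    fix e :: real assume e: "e > 0"
    obtain N where N: "\<forall>m\<ge>N. \<forall>n\<ge>N. (norm (X m - X n))\<^sup>2 < e\<^sup>2"
      using C[of "e\<^sup>2"] e by (auto simp: power2_norm_eq_inner)
    then show "\<exists>N. \<forall>m\<ge>N. \<forall>n\<ge>N. norm (X m - X n) < e"
      using e power2_less_imp_less[of _ e] by (intro exI[of _ N]) auto
  qed
  then obtain u where "X \<longlonglongrightarrow> u" using Cauchy_convergent convergent_def by blast
  then have "(\<lambda>n. inner (X n - u) (X n - u)) \<longlonglongrightarrow> inner (u - u) (u - u)"
    by (intro tendsto_intros)
  then show "\<exists>u\<in>UNIV. (\<lambda>n. inner (X n - u) (X n - u)) \<longlonglongrightarrow> 0" by auto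
qed (auto simp: inner_add_left intro: inner_commute)

lemma riesz_inner:
  fixes l :: "'v::{real_inner,complete_space} \<Rightarrow> real"
  assumes "bounded_linear l"
  obtains z where "\<And>v. inner z v = l v"
proof -
  interpret hilbert_form "UNIV :: 'v set" inner by (rule hilbert_form_inner)
  interpret l: bounded_linear l by fact
  obtain K where K: "\<And>v. norm (l v) \<le> norm v * K" using l.bounded by blast
  have "(l v)\<^sup>2 \<le> K\<^sup>2 * inner v v" for v
    using power_mono[OF K[of v], of 2] by (simp add: power_mult_distrib power2_norm_eq_inner mult.commute)
  then obtain z where "\<And>v. inner z v = l v"
    using riesz[of l "K\<^sup>2"] l.add l.scale by auto
  then show thesis by (rule that)
qed

lemma dense_if_orthogonal_trivial_inner:
  fixes M :: "'v::{real_inner,complete_space} set"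
  assumes V: "closed V" "subspace V" and M: "subspace M" "M \<subseteq> V"
    and triv: "\<And>v. v \<in> V \<Longrightarrow> (\<And>m. m \<in> M \<Longrightarrow> inner v m = 0) \<Longrightarrow> v = 0"
  shows "V \<subseteq> closure M"
proof
  fix u assume u: "u \<in> V"
  interpret hilbert_form "UNIV :: 'v set" inner by (rule hilbert_form_inner)
  obtain X p where Xp: "\<And>n. X n \<in> M" "p \<in> UNIV" "(\<lambda>n::nat. inner (X n - p) (X n - p)) \<longlonglongrightarrow> 0"
    "\<And>m. m \<in> M \<Longrightarrow> inner (u - p) m = 0"
    by (rule projection[OF M(1) subset_UNIV UNIV_I[of u]], rule that)
  from Xp(3) have "(\<lambda>n. sqrt (inner (X n - p) (X n - p))) \<longlonglongrightarrow> sqrt 0" by (rule tendsto_real_sqrt)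
  then have lim: "X \<longlonglongrightarrow> p"
    by (simp add: norm_eq_sqrt_inner[symmetric] tendsto_norm_zero_iff LIM_zero_iff)
  then have "p \<in> V" using closed_sequentially[OF V(1)] Xp(1) M(2) by blast
  then have "u - p = 0" using Xp(4) u V(2) by (intro triv subspace_diff) auto
  then show "u \<in> closure M" using lim Xp(1) closure_sequential by fastforce
qed

lemma closed_subspace_projection:
  fixes H :: "'v::{real_inner,banach} set"
  assumes H: "closed H" "subspace H"
  obtains p where "p \<in> H" "\<And>m. m \<in> H \<Longrightarrow> inner (x - p) m = 0"
proof -
  interpret hilbert_form "UNIV :: 'v set" inner by (rule hilbert_form_inner)
  obtain X p where Xp: "\<And>n. X n \<in> H" "p \<in> UNIV" "(\<lambda>n::nat. inner (X n - p) (X n - p)) \<longlonglongrightarrow> 0"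
    "\<And>m. m \<in> H \<Longrightarrow> inner (x - p) m = 0"
    by (rule projection[OF H(2) subset_UNIV UNIV_I[of x]], rule that)
  from Xp(3) have "(\<lambda>n. sqrt (inner (X n - p) (X n - p))) \<longlonglongrightarrow> sqrt 0" by (rule tendsto_real_sqrt)
  then have "X \<longlonglongrightarrow> p"
    by (simp add: norm_eq_sqrt_inner[symmetric] tendsto_norm_zero_iff LIM_zero_iff)
  from closed_sequentially[OF H(1) Xp(1) this] have "p \<in> H" .
  from that[OF this Xp(4)] show thesis .
qed

section \<open>Square-integrable functions: representatives, simple functions, completeness\<close>

lemma lsq_rel_rep: "lsq_rel (rep_lsq f) (rep_lsq f)"
  by (rule Quotient3_rep_reflp[OF Quotient3_lsq])

lemma square_integrable_rep: "square_integrable (rep_lsq f)"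
  using lsq_rel_rep[of f] by (simp add: lsq_rel_def)

lemma abs_rep_lsq: "abs_lsq (rep_lsq f) = f"
  by (rule Quotient3_abs_rep[OF Quotient3_lsq])

lemma abs_lsq_eq_iff:
  assumes "square_integrable f" "square_integrable g"
  shows "abs_lsq f = abs_lsq g \<longleftrightarrow> (AE x in lebesgue. f x = g x)"
  using Quotient3_rel[OF Quotient3_lsq, of f g] assms by (auto simp: lsq_rel_def)

lemma rep_abs_lsq:
  assumes "square_integrable f"
  shows "AE x in lebesgue. rep_lsq (abs_lsq f) x = f x"
  using abs_lsq_eq_iff[OF square_integrable_rep assms, of "abs_lsq f"] by (simp add: abs_rep_lsq)

lemma lsq_cases:
  obtains f where "square_integrable f" "F = abs_lsq f"
  using square_integrable_rep[of F] abs_rep_lsq[of F] by metis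

lemma abs_lsq_diff:
  assumes "square_integrable f" "square_integrable g"
  shows "abs_lsq (\<lambda>x. f x - g x) = abs_lsq f - abs_lsq g"
  by (rule sym, rule minus_lsq.abs_eq) (use assms in \<open>auto simp: lsq_rel_def\<close>)

lemma abs_lsq_scaleR:
  assumes "square_integrable f"
  shows "abs_lsq (\<lambda>x. c *\<^sub>R f x) = c *\<^sub>R abs_lsq f"
  by (rule sym, rule scaleR_lsq.abs_eq) (use assms in \<open>auto simp: lsq_rel_def\<close>)

lemma inner_abs_lsq:
  assumes "square_integrable f" "square_integrable g"
  shows "inner (abs_lsq f) (abs_lsq g) = (\<integral>x. inner (f x) (g x) \<partial>lebesgue)"
  by (rule inner_lsq.abs_eq) (use assms in \<open>auto simp: lsq_rel_def\<close>)

lemma inner_rep_lsq: "inner f g = (\<integral>x. inner (rep_lsq f x) (rep_lsq g x) \<partial>lebesgue)"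
  using inner_abs_lsq[OF square_integrable_rep square_integrable_rep, of f g] by (simp add: abs_rep_lsq)

lemma inner_rep_abs_lsq:
  assumes "square_integrable g"
  shows "inner f (abs_lsq g) = (\<integral>x. inner (rep_lsq f x) (g x) \<partial>lebesgue)"
  using inner_abs_lsq[OF square_integrable_rep[of f] assms] by (simp add: abs_rep_lsq)

lemma norm_abs_lsq:
  assumes "square_integrable f"
  shows "(norm (abs_lsq f))\<^sup>2 = (\<integral>x. (norm (f x))\<^sup>2 \<partial>lebesgue)"
  by (simp only: power2_norm_eq_inner inner_abs_lsq[OF assms assms])

lemma norm_abs_lsq_nn:
  assumes "square_integrable f"
  shows "ennreal ((norm (abs_lsq f))\<^sup>2) = (\<integral>\<^sup>+x. ennreal ((norm (f x))\<^sup>2) \<partial>lebesgue)"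
  unfolding norm_abs_lsq[OF assms]
  by (rule nn_integral_eq_integral[symmetric]) (use assms in \<open>auto simp: square_integrable_def\<close>)

lemma square_integrable_measurable [measurable_dest]:
  "square_integrable f \<Longrightarrow> (\<lambda>x. norm (f x)) \<in> borel_measurable lebesgue"
  by (rule strongly_measurable_imp_borel, rule strongly_measurable_combine[where h = "\<lambda>u _. norm u"])
    (auto simp: square_integrable_def intro: tendsto_norm)

lemma strongly_measurable_norm:
  "strongly_measurable f \<Longrightarrow> (\<lambda>x. norm (f x)) \<in> borel_measurable lebesgue"
  by (rule strongly_measurable_imp_borel, rule strongly_measurable_combine[where h = "\<lambda>u _. norm u"])
    (auto intro: tendsto_norm)

lemma square_integrable_nn:
  assumes "strongly_measurable f" "(\<integral>\<^sup>+x. ennreal ((norm (f x))\<^sup>2) \<partial>lebesgue) < \<infinity>"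
  shows "square_integrable f"
  unfolding square_integrable_def
proof (intro conjI assms(1) integrableI_nonneg)
  note strongly_measurable_norm[OF assms(1), measurable]
  show "(\<lambda>x. (norm (f x))\<^sup>2) \<in> borel_measurable lebesgue" by measurable
qed (use assms(2) in auto)

lemma strongly_measurable_simple: "simple_function lebesgue s \<Longrightarrow> strongly_measurable s"
  unfolding strongly_measurable_def by (intro exI[of _ "\<lambda>_. s"]) auto

lemma square_integrable_bound:
  assumes f: "square_integrable f" and g: "strongly_measurable g"
    and le: "AE x in lebesgue. norm (g x) \<le> c * norm (f x)"
  shows "square_integrable g"
  unfolding square_integrable_def
proof (intro conjI g)
  note strongly_measurable_norm[OF g, measurable]
  show "integrable lebesgue (\<lambda>x. (norm (g x))\<^sup>2)"
  proof (rule Bochner_Integration.integrable_bound)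
    show "integrable lebesgue (\<lambda>x. c\<^sup>2 * (norm (f x))\<^sup>2)"
      using f by (auto simp: square_integrable_def)
    show "AE x in lebesgue. norm ((norm (g x))\<^sup>2) \<le> norm (c\<^sup>2 * (norm (f x))\<^sup>2)"
      using le by eventually_elim (auto simp: power_mult_distrib[symmetric] intro!: power_mono)
  qed measurable
qed

text \<open>Truncating the approximating simple functions where they exceed twice the limit makes the
  convergence dominated.\<close>

lemma simple_functions_dense:
  fixes f :: "'a::euclidean_space \<Rightarrow> 'b::real_inner"
  assumes f: "square_integrable f"
  obtains s where "\<And>i::nat. simple_function lebesgue (s i)" "\<And>i. square_integrable (s i)"
    "(\<lambda>i. abs_lsq (s i)) \<longlonglongrightarrow> abs_lsq f"
proof -
  obtain s0 where s0: "\<And>i::nat. simple_function lebesgue (s0 i)"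
      "AE x in lebesgue. (\<lambda>i. s0 i x) \<longlonglongrightarrow> f x"
    using f unfolding square_integrable_def strongly_measurable_def by blast
  define B where "B i = {x. norm (s0 i x) \<le> 2 * norm (f x)}" for i
  define s where "s i x = indicator (B i) x *\<^sub>R s0 i x" for i x
  note square_integrable_measurable[OF f, measurable]
  have [measurable]: "(\<lambda>x. norm (s0 i x)) \<in> borel_measurable lebesgue" for i
    by (intro strongly_measurable_norm strongly_measurable_simple s0)
  have B: "B i \<in> sets lebesgue" for i
  proof -
    have "{x \<in> space lebesgue. norm (s0 i x) \<le> 2 * norm (f x)} \<in> sets lebesgue" by measurable
    then show ?thesis by (simp add: B_def)
  qed
  have s: "simple_function lebesgue (s i)" for i
    unfolding s_def
    by (rule simple_function_compose2[where h = "\<lambda>a b. a *\<^sub>R b"]) (auto intro: s0 B)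
  have bound: "norm (s i x) \<le> 2 * norm (f x)" for i x
    by (auto simp: s_def B_def indicator_def)
  have sq: "square_integrable (s i)" for i
    by (rule square_integrable_bound[OF f strongly_measurable_simple[OF s]]) (use bound in auto)
  have lim: "AE x in lebesgue. (\<lambda>i. s i x) \<longlonglongrightarrow> f x"
    using s0(2)
  proof eventually_elim
    case (elim x)
    show ?case
    proof (cases "f x = 0")
      case True
      then have "s i x = 0" for i using bound[of i x] by simp
      then show ?thesis using True by simp
    next
      case False
      have "(\<lambda>i. norm (s0 i x)) \<longlonglongrightarrow> norm (f x)" using elim by (rule tendsto_norm)
      then have "\<forall>\<^sub>F i in sequentially. norm (s0 i x) < 2 * norm (f x)"
        by (rule order_tendstoD) (use False in auto)
      then have "\<forall>\<^sub>F i in sequentially. s0 i x = s i x"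
        by eventually_elim (auto simp: s_def B_def)
      with elim show ?thesis by (rule Lim_transform_eventually)
    qed
  qed
  have diff: "square_integrable (\<lambda>x. s i x - f x)" for i
    by (rule square_integrable_diff[OF sq f])
  have nsq: "(norm (s i x - f x))\<^sup>2 \<le> 9 * (norm (f x))\<^sup>2" for i x
  proof -
    have "norm (s i x - f x) \<le> 3 * norm (f x)"
      using norm_triangle_ineq4[of "s i x" "f x"] bound[of i x] by simp
    from power_mono[OF this, of 2] show ?thesis by (simp add: power_mult_distrib)
  qed
  have "(\<lambda>i. \<integral>x. (norm (s i x - f x))\<^sup>2 \<partial>lebesgue) \<longlonglongrightarrow> (\<integral>x. 0 \<partial>(lebesgue :: 'a measure))"
  proof (rule integral_dominated_convergence)
    show "integrable lebesgue (\<lambda>x. 9 * (norm (f x))\<^sup>2)"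
      using f by (auto simp: square_integrable_def)
    show "AE x in lebesgue. (\<lambda>i. (norm (s i x - f x))\<^sup>2) \<longlonglongrightarrow> 0"
      using lim
    proof eventually_elim
      case (elim x)
      then have "(\<lambda>i. (norm (s i x - f x))\<^sup>2) \<longlonglongrightarrow> (norm (f x - f x))\<^sup>2"
        by (intro tendsto_intros)
      then show ?case by simp
    qed
    show "(\<lambda>x. (norm (s i x - f x))\<^sup>2) \<in> borel_measurable lebesgue" for i
      using square_integrable_measurable[OF diff[of i]] by measurable
  qed (use nsq in auto)
  then have "(\<lambda>i. (norm (abs_lsq (s i) - abs_lsq f))\<^sup>2) \<longlonglongrightarrow> 0"
    by (simp add: norm_abs_lsq[OF diff] abs_lsq_diff[OF sq f, symmetric])
  then have "(\<lambda>i. sqrt ((norm (abs_lsq (s i) - abs_lsq f))\<^sup>2)) \<longlonglongrightarrow> sqrt 0"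
    by (rule tendsto_real_sqrt)
  then have "(\<lambda>i. abs_lsq (s i)) \<longlonglongrightarrow> abs_lsq f"
    by (simp add: tendsto_norm_zero_iff LIM_zero_iff)
  then show thesis by (rule that[OF s sq])
qed

lemma Cauchy_from_geometric:
  fixes Y :: "nat \<Rightarrow> 'v::real_normed_vector"
  assumes "\<And>k. norm (Y (Suc k) - Y k) \<le> C * r ^ k" "0 \<le> r" "r < 1" "C \<ge> 0"
  shows "\<And>j k. k \<le> j \<Longrightarrow> norm (Y j - Y k) \<le> C * r ^ k / (1 - r)" "Cauchy Y"
proof -
  show *: "norm (Y j - Y k) \<le> C * r ^ k / (1 - r)" if "k \<le> j" for j k
  proof -
    have "norm (Y (k + i) - Y k) \<le> C * r ^ k * (1 - r ^ i) / (1 - r)" for i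
    proof (induction i)
      case (Suc i)
      have "norm (Y (k + Suc i) - Y k) \<le> norm (Y (Suc (k + i)) - Y (k + i)) + norm (Y (k + i) - Y k)"
        using norm_triangle_ineq[of "Y (Suc (k + i)) - Y (k + i)" "Y (k + i) - Y k"] by simp
      also have "\<dots> \<le> C * r ^ (k + i) + C * r ^ k * (1 - r ^ i) / (1 - r)"
        by (intro add_mono Suc assms)
      also have "\<dots> = C * r ^ k * (1 - r ^ Suc i) / (1 - r)"
        using assms(3) by (simp add: field_simps power_add)
      finally show ?case .
    qed simp
    from this[of "j - k"] have "norm (Y j - Y k) \<le> C * r ^ k * (1 - r ^ (j - k)) / (1 - r)"
      using that by simp
    also have "\<dots> \<le> C * r ^ k * 1 / (1 - r)"
      using assms by (intro divide_right_mono mult_left_mono) auto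
    finally show ?thesis by simp
  qed
  show "Cauchy Y"
  proof (rule CauchyI')
    fix e :: real assume e: "e > 0"
    have "(\<lambda>k. C * r ^ k / (1 - r)) \<longlonglongrightarrow> C * 0 / (1 - r)"
      using assms by (intro tendsto_intros LIMSEQ_realpow_zero) auto
    then have "\<forall>\<^sub>F k in sequentially. C * r ^ k / (1 - r) < e"
      using e by (intro order_tendstoD) auto
    then obtain N where N: "\<And>k. k \<ge> N \<Longrightarrow> C * r ^ k / (1 - r) < e"
      by (auto simp: eventually_sequentially)
    show "\<exists>M. \<forall>m\<ge>M. \<forall>n>m. dist (Y m) (Y n) < e"
    proof (intro exI allI impI)
      fix m n assume "N \<le> m" "m < n"
      then show "dist (Y m) (Y n) < e"
        using *[of m n] N[of m] by (simp add: dist_norm norm_minus_commute)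
    qed
  qed
qed

text \<open>The Riesz-Fischer argument. Summability of $2^k |s_{k+1} - s_k|^2$ almost everywhere forces geometric
decay of the increments, hence pointwise convergence; a limit of simple functions is strongly
measurable by definition, and Fatou's lemma identifies it as the limit in $L^2$.\<close>

lemma simple_rapid_limit:
  fixes s :: "nat \<Rightarrow> 'a::euclidean_space \<Rightarrow> 'b::{real_inner,complete_space}"
  assumes s: "\<And>k. simple_function lebesgue (s k)" "\<And>k. square_integrable (s k)"
    and fast: "\<And>k. norm (abs_lsq (s (Suc k)) - abs_lsq (s k)) \<le> (1/2) ^ k"
  shows "convergent (\<lambda>k. abs_lsq (s k))"
proof -
  define u where "u k x = norm (s (Suc k) x - s k x)" for k x
  have du: "square_integrable (\<lambda>x. s (Suc k) x - s k x)" for k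
    by (rule square_integrable_diff[OF s(2) s(2)])
  have [measurable]: "u k \<in> borel_measurable lebesgue" for k
    unfolding u_def using square_integrable_measurable[OF du] .
  have "(\<integral>\<^sup>+x. ennreal ((u k x)\<^sup>2) \<partial>lebesgue) \<le> ennreal ((1/4) ^ k)" for k
  proof -
    have "(\<integral>\<^sup>+x. ennreal ((u k x)\<^sup>2) \<partial>lebesgue) = ennreal ((norm (abs_lsq (s (Suc k)) - abs_lsq (s k)))\<^sup>2)"
      using norm_abs_lsq_nn[OF du[of k]] by (simp add: u_def abs_lsq_diff[OF s(2) s(2)])
    also have "\<dots> \<le> ennreal (((1/2) ^ k)\<^sup>2)"
      by (intro ennreal_leI power_mono fast) auto
    also have "((1/2::real) ^ k)\<^sup>2 = (1/4) ^ k"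
      by (simp only: power_mult[symmetric] mult.commute[of k 2])
        (simp only: power_mult power_divide, simp)
    finally show ?thesis .
  qed
  then have k1: "(\<integral>\<^sup>+x. ennreal (2 ^ k * (u k x)\<^sup>2) \<partial>lebesgue) \<le> ennreal ((1/2) ^ k)" for k
  proof -
    have "(\<integral>\<^sup>+x. ennreal (2 ^ k * (u k x)\<^sup>2) \<partial>lebesgue) = ennreal (2 ^ k) * (\<integral>\<^sup>+x. ennreal ((u k x)\<^sup>2) \<partial>lebesgue)"
      by (subst nn_integral_cmult[symmetric]) (auto simp: ennreal_mult)
    also have "\<dots> \<le> ennreal (2 ^ k) * ennreal ((1/4) ^ k)"
      by (intro mult_left_mono) (use \<open>\<And>k. (\<integral>\<^sup>+x. ennreal ((u k x)\<^sup>2) \<partial>lebesgue) \<le> ennreal ((1/4) ^ k)\<close> in auto)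
    also have "\<dots> = ennreal ((1/2) ^ k)"
      by (subst ennreal_mult[symmetric]) (auto simp: power_mult_distrib[symmetric])
    finally show ?thesis .
  qed
  have "(\<integral>\<^sup>+x. (\<Sum>k. ennreal (2 ^ k * (u k x)\<^sup>2)) \<partial>lebesgue) = (\<Sum>k. \<integral>\<^sup>+x. ennreal (2 ^ k * (u k x)\<^sup>2) \<partial>lebesgue)"
    by (rule nn_integral_suminf) measurable
  also have "\<dots> \<le> (\<Sum>k. ennreal ((1/2) ^ k))"
    by (intro suminf_le k1) auto
  also have "\<dots> < \<infinity>"
    by (subst suminf_ennreal2) (auto simp: summable_geometric)
  finally have "(\<integral>\<^sup>+x. (\<Sum>k. ennreal (2 ^ k * (u k x)\<^sup>2)) \<partial>lebesgue) \<noteq> \<infinity>"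
    by (rule less_imp_neq)
  then have "AE x in lebesgue. (\<Sum>k. ennreal (2 ^ k * (u k x)\<^sup>2)) \<noteq> \<infinity>"
    by (rule nn_integral_noteq_infinite[rotated]) measurable
  then have conv: "AE x in lebesgue. convergent (\<lambda>k. s k x)"
  proof eventually_elim
    case (elim x)
    define C where "C = enn2real (\<Sum>k. ennreal (2 ^ k * (u k x)\<^sup>2))"
    have bound: "2 ^ k * (u k x)\<^sup>2 \<le> C" for k
    proof -
      have "ennreal (2 ^ k * (u k x)\<^sup>2) \<le> (\<Sum>k. ennreal (2 ^ k * (u k x)\<^sup>2))"
      proof -
        have "(\<Sum>i\<in>{k}. ennreal (2 ^ i * (u i x)\<^sup>2)) \<le> (\<Sum>k. ennreal (2 ^ k * (u k x)\<^sup>2))"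
          by (rule sum_le_suminf) auto
        then show ?thesis by simp
      qed
      also have "\<dots> = ennreal C"
        unfolding C_def by (rule ennreal_enn2real[symmetric]) (use elim in \<open>simp add: top.not_eq_extremum\<close>)
      finally show ?thesis
        by (subst (asm) ennreal_le_iff) (auto simp: C_def)
    qed
    have C: "C \<ge> 0" by (simp add: C_def)
    have "norm (s (Suc k) x - s k x) \<le> sqrt C * (sqrt (1/2)) ^ k" for k
    proof (rule power2_le_imp_le)
      show "(norm (s (Suc k) x - s k x))\<^sup>2 \<le> (sqrt C * (sqrt (1/2)) ^ k)\<^sup>2"
      proof -
        have "(sqrt C * (sqrt (1/2)) ^ k)\<^sup>2 = C * ((sqrt (1/2))\<^sup>2) ^ k"
          using C by (simp only: power_mult_distrib power_mult[symmetric] mult.commute[of k 2])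
            (simp only: power_mult real_sqrt_pow2)
        also have "\<dots> = C / 2 ^ k" by (simp add: power_divide)
        finally have eq: "(sqrt C * (sqrt (1/2)) ^ k)\<^sup>2 = C / 2 ^ k" .
        show ?thesis unfolding eq using bound[of k] by (simp add: u_def field_simps)
      qed
    qed (use C in auto)
    from Cauchy_from_geometric(2)[OF this] have "Cauchy (\<lambda>k. s k x)"
      using C by auto
    then show ?case by (simp add: Cauchy_convergent_iff)
  qed
  define f where "f x = lim (\<lambda>k. s k x)" for x
  have lim: "AE x in lebesgue. (\<lambda>k. s k x) \<longlonglongrightarrow> f x"
    using conv by eventually_elim (simp add: f_def convergent_LIMSEQ_iff)
  then have fm: "strongly_measurable f"
    unfolding strongly_measurable_def using s(1) by blast
  have dk: "strongly_measurable (\<lambda>x. s k x - f x)" for k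
    by (rule strongly_measurable_combine[where h = "(-)"])
      (auto intro: fm strongly_measurable_simple s(1) tendsto_diff)
  have geo: "norm (abs_lsq (s j) - abs_lsq (s k)) \<le> 2 * (1/2) ^ k" if "k \<le> j" for j k
    using Cauchy_from_geometric(1)[of "\<lambda>k. abs_lsq (s k)" 1 "1/2" k j] fast that by simp
  have djk: "square_integrable (\<lambda>x. s k x - s j x)" for k j
    by (rule square_integrable_diff[OF s(2) s(2)])
  have est: "(\<integral>\<^sup>+x. ennreal ((norm (s k x - f x))\<^sup>2) \<partial>lebesgue) \<le> ennreal ((2 * (1/2) ^ k)\<^sup>2)" for k
  proof -
    have "(\<integral>\<^sup>+x. ennreal ((norm (s k x - f x))\<^sup>2) \<partial>lebesgue)
        = (\<integral>\<^sup>+x. liminf (\<lambda>j. ennreal ((norm (s k x - s j x))\<^sup>2)) \<partial>lebesgue)"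
    proof (rule nn_integral_cong_AE)
      show "AE x in lebesgue. ennreal ((norm (s k x - f x))\<^sup>2) = liminf (\<lambda>j. ennreal ((norm (s k x - s j x))\<^sup>2))"
        using lim
      proof eventually_elim
        case (elim x)
        have "(\<lambda>j. ennreal ((norm (s k x - s j x))\<^sup>2)) \<longlonglongrightarrow> ennreal ((norm (s k x - f x))\<^sup>2)"
          by (intro tendsto_ennrealI tendsto_intros elim)
        then show ?case by (intro lim_imp_Liminf[symmetric]) auto
      qed
    qed
    also have "\<dots> \<le> liminf (\<lambda>j. \<integral>\<^sup>+x. ennreal ((norm (s k x - s j x))\<^sup>2) \<partial>lebesgue)"
    proof (rule nn_integral_liminf)
      fix j
      note square_integrable_measurable[OF djk[of k j], measurable]
      show "(\<lambda>x. ennreal ((norm (s k x - s j x))\<^sup>2)) \<in> borel_measurable lebesgue" by measurable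
    qed
    also have "\<dots> \<le> ennreal ((2 * (1/2) ^ k)\<^sup>2)"
    proof -
      have "\<forall>\<^sub>F j in sequentially. (\<integral>\<^sup>+x. ennreal ((norm (s k x - s j x))\<^sup>2) \<partial>lebesgue) \<le> ennreal ((2 * (1/2) ^ k)\<^sup>2)"
        using eventually_ge_at_top[of k]
      proof eventually_elim
        case (elim j)
        have "(\<integral>\<^sup>+x. ennreal ((norm (s k x - s j x))\<^sup>2) \<partial>lebesgue) = ennreal ((norm (abs_lsq (s k) - abs_lsq (s j)))\<^sup>2)"
          using norm_abs_lsq_nn[OF djk[of k j]] by (simp add: abs_lsq_diff[OF s(2) s(2)])
        also have "\<dots> \<le> ennreal ((2 * (1/2) ^ k)\<^sup>2)"
          using geo[OF elim] by (intro ennreal_leI power_mono) (auto simp: norm_minus_commute)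
        finally show ?case .
      qed
      then have "liminf (\<lambda>j. \<integral>\<^sup>+x. ennreal ((norm (s k x - s j x))\<^sup>2) \<partial>lebesgue)
          \<le> liminf (\<lambda>j::nat. ennreal ((2 * (1/2) ^ k)\<^sup>2))" by (rule Liminf_mono)
      then show ?thesis by (simp add: Liminf_const)
    qed
    finally show ?thesis .
  qed
  have sqd: "square_integrable (\<lambda>x. s k x - f x)" for k
    by (rule square_integrable_nn[OF dk]) (rule le_less_trans[OF est], simp)
  have "square_integrable (\<lambda>x. s 0 x - (s 0 x - f x))"
    by (rule square_integrable_diff[OF s(2) sqd])
  then have f: "square_integrable f" by simp
  have "norm (abs_lsq (s k) - abs_lsq f) \<le> 2 * (1/2) ^ k" for k
  proof -
    have "ennreal ((norm (abs_lsq (s k) - abs_lsq f))\<^sup>2) \<le> ennreal ((2 * (1/2) ^ k)\<^sup>2)"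
      using est[of k] norm_abs_lsq_nn[OF sqd[of k]] by (simp add: abs_lsq_diff[OF s(2) f])
    then have "(norm (abs_lsq (s k) - abs_lsq f))\<^sup>2 \<le> (2 * (1/2) ^ k)\<^sup>2"
      by (subst (asm) ennreal_le_iff) auto
    then show ?thesis by (rule power2_le_imp_le) simp
  qed
  moreover have "(\<lambda>k. 2 * (1/2::real) ^ k) \<longlonglongrightarrow> 2 * 0"
    by (intro tendsto_intros LIMSEQ_realpow_zero) auto
  ultimately have "(\<lambda>k. norm (abs_lsq (s k) - abs_lsq f)) \<longlonglongrightarrow> 0"
    by (intro Lim_null_comparison[of "\<lambda>k. norm (abs_lsq (s k) - abs_lsq f)" "\<lambda>k. 2 * (1/2::real) ^ k"]) auto
  then have "(\<lambda>k. abs_lsq (s k)) \<longlonglongrightarrow> abs_lsq f"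
    by (simp add: tendsto_norm_zero_iff LIM_zero_iff)
  then show ?thesis by (rule convergentI)
qed

text \<open>A rapidly converging subsequence stays close to simple functions, for which the limit has been
found.\<close>

instance lsq :: (euclidean_space, "{real_inner,complete_space}") complete_space
proof
  fix X :: "nat \<Rightarrow> ('a, 'b) lsq" assume X: "Cauchy X"
  have "\<exists>N. \<forall>m\<ge>N. \<forall>n\<ge>N. norm (X m - X n) < (1/8) * (1/2) ^ k" for k :: nat
    using CauchyD[OF X, of "(1/8) * (1/2) ^ k"] by simp
  then obtain N where N: "\<And>k m n. m \<ge> N k \<Longrightarrow> n \<ge> N k \<Longrightarrow> norm (X m - X n) < (1/8) * (1/2) ^ k"
    by metis
  define r where "r k = (\<Sum>i\<le>k. N i) + k" for k
  have rN: "N k \<le> r k" "r k \<le> r (Suc k)" for k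
    using member_le_sum[of k "{..k}" N] by (auto simp: r_def)
  have rsub: "strict_mono r" by (rule strict_monoI_Suc) (simp add: r_def)
  have "\<exists>s. simple_function lebesgue s \<and> square_integrable s \<and> norm (abs_lsq s - X (r k)) < (1/8) * (1/2) ^ k" for k
  proof -
    obtain f where f: "square_integrable f" "X (r k) = abs_lsq f" by (rule lsq_cases)
    obtain s where s: "\<And>i::nat. simple_function lebesgue (s i)" "\<And>i. square_integrable (s i)"
      "(\<lambda>i. abs_lsq (s i)) \<longlonglongrightarrow> abs_lsq f"
      using simple_functions_dense[OF f(1)] by blast
    have "\<exists>no. \<forall>n\<ge>no. norm (abs_lsq (s n) - abs_lsq f) < (1/8) * (1/2) ^ k"
      by (rule LIMSEQ_D[OF s(3)]) simp
    then show ?thesis using s f by auto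
  qed
  then obtain s where s: "\<And>k. simple_function lebesgue (s k)" "\<And>k. square_integrable (s k)"
    "\<And>k. norm (abs_lsq (s k) - X (r k)) < (1/8) * (1/2) ^ k" by metis
  have "norm (abs_lsq (s (Suc k)) - abs_lsq (s k)) \<le> (1/2) ^ k" for k
  proof -
    have "abs_lsq (s (Suc k)) - abs_lsq (s k) =
       (abs_lsq (s (Suc k)) - X (r (Suc k))) + (X (r (Suc k)) - X (r k)) - (abs_lsq (s k) - X (r k))"
      by simp
    also have "norm \<dots> \<le> norm (abs_lsq (s (Suc k)) - X (r (Suc k))) + norm (X (r (Suc k)) - X (r k)) + norm (abs_lsq (s k) - X (r k))"
      by (intro order_trans[OF norm_triangle_ineq4] add_mono norm_triangle_ineq order_refl)
    also have "\<dots> \<le> (1/8) * (1/2) ^ Suc k + (1/8) * (1/2) ^ k + (1/8) * (1/2) ^ k"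
      using s(3)[of k] s(3)[of "Suc k"] N[of k "r (Suc k)" "r k"] rN[of k] rN[of "Suc k"]
      by (intro add_mono) auto
    also have "\<dots> \<le> (1/2) ^ k" by simp
    finally show ?thesis .
  qed
  from simple_rapid_limit[OF s(1,2) this] obtain L where L: "(\<lambda>k. abs_lsq (s k)) \<longlonglongrightarrow> L"
    by (auto simp: convergent_def)
  have "(\<lambda>k. (1/8) * (1/2::real) ^ k) \<longlonglongrightarrow> (1/8) * 0"
    by (intro tendsto_intros LIMSEQ_realpow_zero) auto
  then have "(\<lambda>k. X (r k) - abs_lsq (s k)) \<longlonglongrightarrow> 0"
    using s(3) by (intro Lim_null_comparison[of "\<lambda>k. X (r k) - abs_lsq (s k)" "\<lambda>k. (1/8) * (1/2::real) ^ k"])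
      (auto simp: norm_minus_commute less_imp_le)
  from tendsto_add[OF this L] have "(X \<circ> r) \<longlonglongrightarrow> L" by (simp add: o_def)
  then have "X \<longlonglongrightarrow> L" by (rule Cauchy_converges_subseq[OF X rsub])
  then show "convergent X" by (rule convergentI)
qed

instance lsq :: (euclidean_space, "{real_inner,complete_space}") banach ..

section \<open>Functions determined by integrals over boxes and by test functions\<close>

text \<open>Open boxes are stable under intersection and generate the Borel sets, so that the integral vanishes
over every Borel set.\<close>

lemma set_integral_zero_on_boxes:
  fixes F :: "'a::euclidean_space \<Rightarrow> real"
  assumes F: "integrable lebesgue F"
    and box: "\<And>a b. (LINT x:box a b|lebesgue. F x) = 0"
  shows "AE x in lebesgue. F x = 0"
proof -
  obtain G where G [measurable]: "G \<in> borel_measurable lborel" and FG: "AE x in lborel. F x = G x"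
    using completion_ex_borel_measurable_real[of F lborel] F by (auto dest: borel_measurable_integrable)
  have FG': "AE x in lebesgue. F x = G x" using FG by (rule AE_completion)
  have [measurable]: "G \<in> borel_measurable lebesgue" "F \<in> borel_measurable lebesgue"
    using G F by (auto intro: measurable_completion borel_measurable_integrable)
  have "integrable lebesgue G"
    using F FG' by (subst integrable_cong_AE[of G _ F]) (auto elim: eventually_mono)
  then have Gi: "integrable lborel G" by (simp add: integrable_completion)
  have Gs: "set_integrable lborel A G" if "A \<in> sets lborel" for A
    unfolding set_integrable_def using that Gi by (rule integrable_mult_indicator)
  have Gbox: "(LINT x:box a b|lborel. G x) = 0" for a b
  proof -
    have "(LINT x:box a b|lborel. G x) = (LINT x:box a b|lebesgue. G x)"
      unfolding set_lebesgue_integral_def by (rule integral_completion[symmetric]) measurable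
    also have "\<dots> = (LINT x:box a b|lebesgue. F x)"
      unfolding set_lebesgue_integral_def
    proof (rule integral_cong_AE)
      show "AE x in lebesgue. indicat_real (box a b) x *\<^sub>R G x = indicat_real (box a b) x *\<^sub>R F x"
        using FG' by eventually_elim simp
      have "box a b \<in> sets lebesgue" by (rule fmeasurableD[OF lmeasurable_box])
      then have "indicat_real (box a b) \<in> borel_measurable lebesgue" by (rule borel_measurable_indicator)
      then show "(\<lambda>x. indicat_real (box a b) x *\<^sub>R G x) \<in> borel_measurable lebesgue"
        "(\<lambda>x. indicat_real (box a b) x *\<^sub>R F x) \<in> borel_measurable lebesgue"
        by (auto intro!: borel_measurable_times)
    qed
    finally show ?thesis using box by simp
  qed
  have GU: "(LINT x:UNIV|lborel. G x) = 0"
  proof -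
    have "(\<lambda>i. LINT x:box (- (real i *\<^sub>R One)) (real i *\<^sub>R One)|lborel. G x)
       \<longlonglongrightarrow> (LINT x:(\<Union>i::nat. box (- (real i *\<^sub>R One)) (real i *\<^sub>R One))|lborel. G x)"
      by (rule set_integral_cont_up) (auto intro!: incseq_SucI subset_box_imp simp: UN_box_eq_UNIV Gs)
    then show ?thesis unfolding Gbox UN_box_eq_UNIV by (simp add: LIMSEQ_const_iff)
  qed
  have "AE x in lborel. G x = 0"
  proof (rule sigma_finite_measure.density_zero[OF lborel.sigma_finite_measure_axioms Gi])
    fix A :: "'a set" assume "A \<in> sets lborel"
    then have A: "A \<in> sigma_sets UNIV (range (\<lambda>(a, b). box a b))"
      by (simp add: borel_eq_box)
    have sig: "sigma_sets UNIV (range (\<lambda>(a, b). box a b :: 'a set)) = sets lborel"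
      by (simp add: borel_eq_box)
    have "Int_stable (range (\<lambda>(a, b). box a b :: 'a set))"
      by (auto simp: Int_stable_def box_Int_box)
    moreover have "range (\<lambda>(a, b). box a b :: 'a set) \<subseteq> Pow UNIV" by simp
    ultimately show "(LINT x:A|lborel. G x) = 0"
      using A
    proof (induction rule: sigma_sets_induct_disjoint)
      case (basic A)
      then show ?case using Gbox by auto
    next
      case empty
      show ?case by (simp add: set_lebesgue_integral_def)
    next
      case (compl A)
      then have "A \<in> sets lborel" using sig by simp
      then have "(LINT x:A \<union> (UNIV - A)|lborel. G x) = (LINT x:A|lborel. G x) + (LINT x:UNIV - A|lborel. G x)"
        by (intro set_integral_Un Gs) auto
      then show ?case using compl GU by simp
    next
      case (union A)
      then have "A i \<in> sets lborel" for i using sig by auto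
      then have "(LINT x:(\<Union>i. A i)|lborel. G x) = (\<Sum>i. LINT x:A i|lborel. G x)"
        using union(1) by (intro lebesgue_integral_countable_add Gs) (auto simp: disjoint_family_on_def)
      then show ?case using union by simp
    qed
  qed
  then have "AE x in lebesgue. G x = 0" by (rule AE_completion)
  with FG' show ?thesis by eventually_elim simp
qed

text \<open>A simple function has finitely many values, so it meets only finitely many of the exceptional null
sets.\<close>

lemma lsq_zero_weak:
  fixes f :: "('a::euclidean_space, 'b::real_inner) lsq"
  assumes "\<And>h. AE x in lebesgue. inner (rep_lsq f x) h = 0"
  shows "f = 0"
proof -
  obtain f0 where f0: "square_integrable f0" "f = abs_lsq f0" by (rule lsq_cases)
  obtain s where s: "\<And>i::nat. simple_function lebesgue (s i)" "\<And>i. square_integrable (s i)"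
    "(\<lambda>i. abs_lsq (s i)) \<longlonglongrightarrow> abs_lsq f0"
    using simple_functions_dense[OF f0(1)] by blast
  have "inner f (abs_lsq (s i)) = 0" for i
  proof -
    have "finite (range (s i))" using simple_functionD(1)[OF s(1)[of i]] by simp
    then have "AE x in lebesgue. \<forall>h\<in>range (s i). inner (rep_lsq f x) h = 0"
      by (rule iffD2[OF AE_finite_all]) (intro ballI assms)
    then have "AE x in lebesgue. inner (rep_lsq f x) (s i x) = 0"
      by eventually_elim auto
    then have "(\<integral>x. inner (rep_lsq f x) (s i x) \<partial>lebesgue) = (\<integral>x. 0 \<partial>(lebesgue :: 'a measure))"
      using square_integrable_inner[OF square_integrable_rep s(2), of f i]
      by (intro integral_cong_AE) auto
    then show ?thesis using inner_rep_abs_lsq[OF s(2)] by simp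
  qed
  moreover have "(\<lambda>i. inner f (abs_lsq (s i))) \<longlonglongrightarrow> inner f (abs_lsq f0)"
    by (intro tendsto_intros s)
  ultimately have "inner f f = 0" using f0(2) by (simp add: LIMSEQ_const_iff)
  then show ?thesis by simp
qed

lemma square_integrable_indicator:
  fixes h :: "'b::real_inner" and S :: "'a::euclidean_space set"
  assumes "S \<in> lmeasurable"
  shows "square_integrable (\<lambda>x. indicator S x *\<^sub>R h)"
proof -
  have S: "S \<in> sets lebesgue" using assms by (rule fmeasurableD)
  have "simple_function lebesgue (\<lambda>x. indicator S x :: real)"
    using S by (rule simple_function_indicator)
  then have "simple_function lebesgue (\<lambda>x. (\<lambda>c::real. c *\<^sub>R h) (indicator S x))"
    by (rule simple_function_compose1)
  then have "strongly_measurable (\<lambda>x. indicator S x *\<^sub>R h)" by (intro strongly_measurable_simple) simp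
  moreover have "(\<lambda>x. (norm (indicator S x *\<^sub>R h))\<^sup>2) = (\<lambda>x. indicator S x * (norm h)\<^sup>2)"
    by (auto simp: indicator_def)
  moreover have "integrable lebesgue (\<lambda>x. indicator S x * (norm h)\<^sup>2)"
    using assms by (intro integrable_mult_left) (auto simp: fmeasurable_def less_top[symmetric])
  ultimately show ?thesis by (simp add: square_integrable_def)
qed

subsection \<open>Smooth bumps\<close>

text \<open>With \<open>p = 1\<close> this is the standard smooth function with value 0 on the negative axis. The polynomial
makes the family closed under differentiation, so that smoothness is an induction.\<close>

definition theta :: "real poly \<Rightarrow> real \<Rightarrow> real" where
  "theta p x = (if x > 0 then poly p (1 / x) * exp (- (1 / x)) else 0)"

lemma poly_times_exp_tendsto_0: "((\<lambda>u. poly p u * exp (- u)) \<longlongrightarrow> (0::real)) at_top"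
proof -
  have "((\<lambda>u. \<Sum>i\<le>degree p. coeff p i * (u ^ i / exp u)) \<longlongrightarrow> (\<Sum>i\<le>degree p. coeff p i * 0)) at_top"
    by (intro tendsto_intros tendsto_power_div_exp_0)
  moreover have "poly p u * exp (- u) = (\<Sum>i\<le>degree p. coeff p i * (u ^ i / exp u))" for u
    unfolding poly_altdef sum_distrib_right
    by (intro sum.cong refl) (simp add: exp_minus divide_inverse)
  ultimately show ?thesis by (simp only: mult_zero_right sum.neutral_const)
qed

lemma theta_nonpos: "x \<le> 0 \<Longrightarrow> theta p x = 0"
  by (simp add: theta_def)

lemma theta_deriv:
  "(theta p has_real_derivative theta ([:0, 0, 1:] * (p - pderiv p)) x) (at x)"
proof -
  consider "x > 0" | "x < 0" | "x = 0" by linarith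
  then show ?thesis
  proof cases
    case 1
    have d: "((\<lambda>x. 1 / x) has_real_derivative - ((1 / x) * (1 / x))) (at x)"
      using 1 by (auto intro!: derivative_eq_intros)
    have "((\<lambda>x. poly p (1 / x) * exp (- (1 / x))) has_real_derivative
        poly (pderiv p) (1 / x) * (- ((1 / x) * (1 / x))) * exp (- (1 / x))
        + exp (- (1 / x)) * (- (- ((1 / x) * (1 / x)))) * poly p (1 / x)) (at x)"
      by (rule DERIV_mult[OF DERIV_chain2[OF poly_DERIV d] DERIV_chain2[OF DERIV_exp DERIV_minus[OF d]]])
    also have "poly (pderiv p) (1 / x) * (- ((1 / x) * (1 / x))) * exp (- (1 / x))
        + exp (- (1 / x)) * (- (- ((1 / x) * (1 / x)))) * poly p (1 / x) = theta ([:0, 0, 1:] * (p - pderiv p)) x"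
      unfolding theta_def using 1 by (simp only: if_True poly_mult poly_diff poly_pCons poly_0) (simp add: algebra_simps)
    finally have "((\<lambda>x. poly p (1 / x) * exp (- (1 / x))) has_real_derivative
        theta ([:0, 0, 1:] * (p - pderiv p)) x) (at x)" .
    then show ?thesis
    proof (rule has_field_derivative_transform_within_open)
      show "open {0::real<..}" by (rule open_greaterThan)
      show "x \<in> {0<..}" using 1 by simp
      show "poly p (1 / y) * exp (- (1 / y)) = theta p y" if "y \<in> {0<..}" for y
        using that by (simp add: theta_def)
    qed
  next
    case 2
    have z: "theta q x = 0" for q using 2 by (intro theta_nonpos) simp
    have "((\<lambda>_. 0) has_real_derivative 0) (at x)" by (rule DERIV_const)
    then have "(theta p has_real_derivative 0) (at x)"
    proof (rule has_field_derivative_transform_within_open[where S = "{..<0}"])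
      show "x \<in> {..<0}" using 2 by simp
      show "0 = theta p y" if "y \<in> {..<0}" for y
        using that theta_nonpos[of y p] by simp
    qed simp
    then show ?thesis unfolding z .
  next
    case 3
    have "((\<lambda>h. theta p h / h) \<longlongrightarrow> 0) (at_right 0)"
    proof -
      have "((\<lambda>h. poly (pCons 0 p) (inverse h) * exp (- inverse h)) \<longlongrightarrow> 0) (at_right 0)"
        using filterlim_compose[OF poly_times_exp_tendsto_0 filterlim_inverse_at_top_right] .
      moreover have "\<forall>\<^sub>F h in at_right 0. poly (pCons 0 p) (inverse h) * exp (- inverse h) = theta p h / h"
        by (rule eventually_at_right_less[THEN eventually_mono]) (auto simp: theta_def inverse_eq_divide)
      ultimately show ?thesis by (rule Lim_transform_eventually)
    qed
    moreover have "((\<lambda>h. theta p h / h) \<longlongrightarrow> 0) (at_left 0)"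
    proof -
      have "\<forall>\<^sub>F h in at_left (0::real). h < 0"
        unfolding eventually_at by (intro exI[of _ 1]) simp
      then have "\<forall>\<^sub>F h in at_left 0. 0 = theta p h / h"
        by (rule eventually_mono) (simp add: theta_nonpos)
      then show ?thesis by (rule Lim_transform_eventually[OF tendsto_const])
    qed
    ultimately have "((\<lambda>h. theta p h / h) \<longlongrightarrow> 0) (at 0)" by (intro filterlim_split_at)
    then show ?thesis unfolding has_field_derivative_iff 3 theta_nonpos[OF order_refl] by simp
  qed
qed

lemma partial_derivI:
  "(f has_derivative f') (at x) \<Longrightarrow> partial_deriv b f x = f' b"
  by (simp add: partial_deriv_def frechet_derivative_at[symmetric])

lemma partial_deriv_has_derivative:
  "f differentiable (at x) \<Longrightarrow> (f has_derivative (\<lambda>h. partial_deriv h f x)) (at x)"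
  unfolding partial_deriv_def using frechet_derivative_works by force

lemma partial_deriv_real:
  "(f has_real_derivative f') (at x) \<Longrightarrow> partial_deriv b f x = f' * b"
  by (rule partial_derivI) (simp add: has_field_derivative_def)

lemma C_k_theta: "C_k k (theta p)"
proof (induction k arbitrary: p)
  case 0
  show ?case
    by (auto intro!: continuous_at_imp_continuous_on DERIV_isCont[OF theta_deriv])
next
  case (Suc k)
  have "partial_deriv 1 (theta p) = theta ([:0, 0, 1:] * (p - pderiv p))"
    by (rule ext) (simp add: partial_deriv_real[OF theta_deriv])
  then show ?case using Suc
    by (auto simp: real_differentiable_def intro: theta_deriv)
qed

lemma C_k_Suc: "C_k (Suc k) f \<Longrightarrow> C_k k f"
proof (induction k arbitrary: f)
  case 0
  then show ?case
    by (auto intro!: continuous_at_imp_continuous_on differentiable_imp_continuous_within)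
qed auto

lemma C_k_continuous: "C_k k f \<Longrightarrow> continuous_on UNIV f"
  by (induction k) (use C_k_Suc in auto)

lemma C_k_const: "C_k k (\<lambda>x. c)"
proof (induction k arbitrary: c)
  case (Suc k)
  have "partial_deriv b (\<lambda>x. c) = (\<lambda>x. 0)" for b :: 'a
    by (rule ext) (simp add: partial_derivI[OF has_derivative_const])
  then show ?case using Suc by simp
qed simp

lemma C_k_add: "C_k k f \<Longrightarrow> C_k k g \<Longrightarrow> C_k k (\<lambda>x. f x + g x)"
proof (induction k arbitrary: f g)
  case 0
  then show ?case by (auto intro: continuous_intros)
next
  case (Suc k)
  have "partial_deriv b (\<lambda>x. f x + g x) = (\<lambda>x. partial_deriv b f x + partial_deriv b g x)" for b
    by (rule ext, rule partial_derivI)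
      (use Suc.prems in \<open>auto intro!: has_derivative_add partial_deriv_has_derivative\<close>)
  then show ?case using Suc by auto
qed

lemma C_k_mult: "C_k k f \<Longrightarrow> C_k k g \<Longrightarrow> C_k k (\<lambda>x. f x * g x)"
proof (induction k arbitrary: f g)
  case 0
  then show ?case by (auto intro: continuous_intros)
next
  case (Suc k)
  have "partial_deriv b (\<lambda>x. f x * g x) = (\<lambda>x. f x * partial_deriv b g x + partial_deriv b f x * g x)" for b
    by (rule ext, rule partial_derivI)
      (use Suc.prems in \<open>auto intro!: has_derivative_mult partial_deriv_has_derivative\<close>)
  then show ?case using Suc C_k_Suc[OF Suc.prems(1)] C_k_Suc[OF Suc.prems(2)]
    by (auto intro!: C_k_add Suc.IH)
qed

lemma C_k_prod:
  assumes "finite I" "\<And>i. i \<in> I \<Longrightarrow> C_k k (f i)"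
  shows "C_k k (\<lambda>x. \<Prod>i\<in>I. f i x)"
  using assms by (induction I rule: finite_induct) (auto intro: C_k_const C_k_mult)

lemma C_k_affine:
  fixes f :: "real \<Rightarrow> real" and v :: "'a::euclidean_space"
  shows "C_k k f \<Longrightarrow> C_k k (\<lambda>x. f (c + inner x v))"
proof (induction k arbitrary: f)
  case 0
  then have c: "continuous_on UNIV f" by simp
  show ?case
    unfolding C_k.simps by (rule continuous_on_compose2[OF c]) (intro continuous_intros, simp)
next
  case (Suc k)
  have d: "((\<lambda>x. f (c + inner x v)) has_derivative (\<lambda>h. partial_deriv (inner h v) f (c + inner x v))) (at x)" for x
  proof -
    have "((\<lambda>x. c + inner x v) has_derivative (\<lambda>h. inner h v)) (at x)"
      by (auto intro!: derivative_eq_intros)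
    then show ?thesis
      by (rule has_derivative_compose[OF _ partial_deriv_has_derivative]) (use Suc.prems in auto)
  qed
  have lin: "partial_deriv t f y = t * partial_deriv 1 f y" for t y
  proof -
    have "bounded_linear (\<lambda>h. partial_deriv h f y)"
      using partial_deriv_has_derivative[of f y] Suc.prems by (auto intro: has_derivative_bounded_linear)
    then interpret bounded_linear "\<lambda>h. partial_deriv h f y" .
    show ?thesis using scale[of t 1] by simp
  qed
  have "partial_deriv b (\<lambda>x. f (c + inner x v)) = (\<lambda>x. inner b v * partial_deriv 1 f (c + inner x v))" for b
    by (rule ext) (subst lin[symmetric], rule partial_derivI[OF d])
  moreover have "(\<lambda>x. f (c + inner x v)) differentiable (at x)" for x
    using d differentiable_def by blast
  ultimately show ?case using Suc by (auto intro!: C_k_mult C_k_const)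
qed

text \<open>The factor \<open>Suc n\<close> steepens the bump, so that for large \<open>n\<close> it approaches the indicator of the box.\<close>

definition box_bump :: "'a::euclidean_space \<Rightarrow> 'a \<Rightarrow> nat \<Rightarrow> 'a \<Rightarrow> real" where
  "box_bump a b n x = (\<Prod>i\<in>Basis. theta 1 (real (Suc n) * (x \<bullet> i - a \<bullet> i)) * theta 1 (real (Suc n) * (b \<bullet> i - x \<bullet> i)))"

lemma theta_one: "theta 1 x = (if x > 0 then exp (- (1 / x)) else 0)"
  by (simp add: theta_def)

lemma theta_one_bounds: "0 \<le> theta 1 x" "theta 1 x \<le> 1"
  by (auto simp: theta_one)

lemma box_bump_bounds: "0 \<le> box_bump a b n x" "box_bump a b n x \<le> 1"
  unfolding box_bump_def
  by (auto intro!: prod_nonneg prod_le_1 mult_nonneg_nonneg mult_le_one theta_one_bounds)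

lemma box_bump_support: "box_bump a b n x \<noteq> 0 \<longleftrightarrow> x \<in> box a b"
proof -
  have "theta 1 (real (Suc n) * t) \<noteq> 0 \<longleftrightarrow> t > 0" for t
    by (simp add: theta_one zero_less_mult_iff del: of_nat_Suc)
  then show ?thesis by (auto simp: box_bump_def box_def)
qed

lemma C_k_box_bump: "C_k k (box_bump a b n)"
proof -
  have eq: "box_bump a b n = (\<lambda>x. \<Prod>i\<in>Basis. theta 1 ((- real (Suc n) * (a \<bullet> i)) + x \<bullet> (real (Suc n) *\<^sub>R i))
     * theta 1 (real (Suc n) * (b \<bullet> i) + x \<bullet> ((- real (Suc n)) *\<^sub>R i)))"
    unfolding box_bump_def by (simp add: algebra_simps)
  show ?thesis unfolding eq
    by (intro C_k_prod C_k_mult C_k_affine C_k_theta) auto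
qed

lemma box_bump_test:
  assumes "cbox a b \<subseteq> S"
  shows "box_bump a b n \<in> test_functions S"
proof -
  have sub: "closure {x. box_bump a b n x \<noteq> 0} \<subseteq> cbox a b"
    by (rule closure_minimal) (auto simp: box_bump_support box_subset_cbox[THEN subsetD])
  moreover have "compact (closure {x. box_bump a b n x \<noteq> 0})"
    using compact_Int_closed[OF compact_cbox[of a b] closed_closure[of "{x. box_bump a b n x \<noteq> 0}"]] sub
    by (simp add: Int_absorb1)
  ultimately show ?thesis using assms by (auto simp: test_functions_def C_k_box_bump)
qed

lemma box_bump_tendsto: "(\<lambda>n. box_bump a b n x) \<longlonglongrightarrow> indicator (box a b) x"
proof (cases "x \<in> box a b")
  case True
  have *: "(\<lambda>n. theta 1 (real (Suc n) * t)) \<longlonglongrightarrow> 1" if "t > 0" for t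
  proof -
    have "(\<lambda>n. exp (- ((1 / t) * inverse (real (Suc n))))) \<longlonglongrightarrow> exp (- ((1 / t) * 0))"
      by (intro tendsto_intros LIMSEQ_inverse_real_of_nat)
    moreover have "theta 1 (real (Suc n) * t) = exp (- ((1 / t) * inverse (real (Suc n))))" for n
      using that by (simp add: theta_one inverse_eq_divide zero_less_mult_iff del: of_nat_Suc)
    ultimately show ?thesis by simp
  qed
  have "(\<lambda>n. box_bump a b n x) \<longlonglongrightarrow> (\<Prod>i\<in>(Basis::'a set). 1 * 1)"
    unfolding box_bump_def using True by (intro tendsto_prod tendsto_mult *) (auto simp: box_def)
  then show ?thesis using True by simp
next
  case False
  then have "box_bump a b n x = 0" for n using box_bump_support by blast
  then show ?thesis using False by simp
qed

subsection \<open>Test functions\<close>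

lemma test_function_props:
  assumes "\<phi> \<in> test_functions S"
  shows "continuous_on UNIV \<phi>" "\<phi> differentiable (at x)" "C_k k \<phi>"
    "x \<notin> closure {x. \<phi> x \<noteq> 0} \<Longrightarrow> \<phi> x = 0" "compact (closure {x. \<phi> x \<noteq> 0})" "closure {x. \<phi> x \<noteq> 0} \<subseteq> S"
proof -
  have C: "C_k k \<phi>" for k using assms by (simp add: test_functions_def)
  then show "C_k k \<phi>" .
  show "continuous_on UNIV \<phi>" "\<phi> differentiable (at x)" using C[of 0] C[of "Suc 0"] by simp_all
  show "x \<notin> closure {x. \<phi> x \<noteq> 0} \<Longrightarrow> \<phi> x = 0"
    using closure_subset[of "{x. \<phi> x \<noteq> 0}"] by blast
  show "compact (closure {x. \<phi> x \<noteq> 0})" "closure {x. \<phi> x \<noteq> 0} \<subseteq> S"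
    using assms by (simp_all add: test_functions_def)
qed

lemma test_functionI:
  assumes "\<And>k. C_k k \<phi>" "compact K" "K \<subseteq> S" "\<And>x. x \<notin> K \<Longrightarrow> \<phi> x = 0"
  shows "\<phi> \<in> test_functions S"
proof -
  have sub: "closure {x. \<phi> x \<noteq> 0} \<subseteq> K"
    by (rule closure_minimal) (use assms in \<open>auto intro: compact_imp_closed\<close>)
  moreover have "compact (closure {x. \<phi> x \<noteq> 0})"
    using compact_Int_closed[OF assms(2) closed_closure[of "{x. \<phi> x \<noteq> 0}"]] sub
    by (simp add: Int_absorb1)
  ultimately show ?thesis using assms by (auto simp: test_functions_def)
qed

lemma test_function_combination:
  assumes "\<phi> \<in> test_functions S" "\<psi> \<in> test_functions S"
  shows "(\<lambda>x. \<phi> x + c * \<psi> x) \<in> test_functions S"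
proof (rule test_functionI[where K = "closure {x. \<phi> x \<noteq> 0} \<union> closure {x. \<psi> x \<noteq> 0}"])
  show "C_k k (\<lambda>x. \<phi> x + c * \<psi> x)" for k
    by (intro C_k_add C_k_mult C_k_const test_function_props(3)[OF assms(1)] test_function_props(3)[OF assms(2)])
  show "compact (closure {x. \<phi> x \<noteq> 0} \<union> closure {x. \<psi> x \<noteq> 0})"
    by (intro compact_Un test_function_props(5)[OF assms(1)] test_function_props(5)[OF assms(2)])
  show "closure {x. \<phi> x \<noteq> 0} \<union> closure {x. \<psi> x \<noteq> 0} \<subseteq> S"
    by (intro Un_least test_function_props(6)[OF assms(1)] test_function_props(6)[OF assms(2)])
  show "\<phi> x + c * \<psi> x = 0" if "x \<notin> closure {x. \<phi> x \<noteq> 0} \<union> closure {x. \<psi> x \<noteq> 0}" for x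
  proof -
    have "\<phi> x = 0" by (rule test_function_props(4)[OF assms(1)]) (use that in blast)
    moreover have "\<psi> x = 0" by (rule test_function_props(4)[OF assms(2)]) (use that in blast)
    ultimately show ?thesis by simp
  qed
qed

lemma lsq_class_test:
  "\<phi> \<in> test_functions S \<Longrightarrow> lsq_class S \<phi> = abs_lsq \<phi>"
  by (simp add: lsq_class_def test_function_square_integrable(2))

lemma inner_test:
  assumes "\<phi> \<in> test_functions S"
  shows "inner f (lsq_class S \<phi>) = (\<integral>x. rep_lsq f x * \<phi> x \<partial>lebesgue)"
  using inner_rep_abs_lsq[OF test_function_square_integrable(1)[OF assms], of f]
  by (simp add: lsq_class_test[OF assms])

text \<open>Bumps converge boundedly to indicators of boxes, so \<open>f\<close> has integral zero over every box whose closure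
lies in \<open>S\<close>. Hence \<open>f\<close> vanishes almost everywhere on such boxes, and countably many of them exhaust
\<open>S\<close> up to null sets.\<close>

theorem test_functions_orthogonal:
  fixes f :: "('a::euclidean_space, real) lsq"
  assumes S: "open S" and ortho: "\<And>\<phi>. \<phi> \<in> test_functions S \<Longrightarrow> inner f (lsq_class S \<phi>) = 0"
  shows "AE x in lebesgue. x \<in> S \<longrightarrow> rep_lsq f x = 0"
proof -
  let ?f = "rep_lsq f"
  have fi: "integrable lebesgue (\<lambda>x. ?f x * indicator (cbox a b) x)" for a b
    using square_integrable_inner[OF square_integrable_rep square_integrable_indicator[OF lmeasurable_cbox], of f a b 1]
    by simp
  have meas: "?f \<in> borel_measurable lebesgue"
    using square_integrable_rep[of f] by (auto simp: square_integrable_def intro: strongly_measurable_imp_borel)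
  have zero: "(LINT x:box a b|lebesgue. ?f x) = 0" if ab: "cbox a b \<subseteq> S" for a b
  proof -
    have "(\<lambda>n. \<integral>x. ?f x * box_bump a b n x \<partial>lebesgue) \<longlonglongrightarrow> (\<integral>x. ?f x * indicator (box a b) x \<partial>lebesgue)"
    proof (rule integral_dominated_convergence[where w = "\<lambda>x. norm (?f x * indicator (cbox a b) x)"])
      show "integrable lebesgue (\<lambda>x. norm (?f x * indicator (cbox a b) x))"
        using fi by (rule integrable_norm)
      show "AE x in lebesgue. (\<lambda>n. ?f x * box_bump a b n x) \<longlonglongrightarrow> ?f x * indicator (box a b) x"
        by (intro always_eventually allI tendsto_mult tendsto_const box_bump_tendsto)
      show "AE x in lebesgue. norm (?f x * box_bump a b n x) \<le> norm (?f x * indicator (cbox a b) x)" for n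
      proof (intro always_eventually allI)
        fix x
        show "norm (?f x * box_bump a b n x) \<le> norm (?f x * indicator (cbox a b) x)"
        proof (cases "x \<in> box a b")
          case True
          then have "x \<in> cbox a b" using box_subset_cbox by blast
          then show ?thesis using box_bump_bounds[of a b n x] by (auto simp: abs_mult mult_left_le)
        next
          case False
          then have "box_bump a b n x = 0" using box_bump_support by blast
          then show ?thesis by simp
        qed
      qed
      show "(\<lambda>x. ?f x * indicator (box a b) x) \<in> borel_measurable lebesgue"
        using meas by (intro borel_measurable_times borel_measurable_indicator) auto
      have "box_bump a b n \<in> borel_measurable lebesgue" for n
        using C_k_continuous[OF C_k_box_bump[of 0 a b n]]
        by (intro measurable_completion) (auto intro: borel_measurable_continuous_onI)
      then show "(\<lambda>x. ?f x * box_bump a b n x) \<in> borel_measurable lebesgue" for n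
        using meas by (intro borel_measurable_times)
    qed
    moreover have "(\<integral>x. ?f x * box_bump a b n x \<partial>lebesgue) = 0" for n
      using ortho[OF box_bump_test[OF ab]] inner_test[OF box_bump_test[OF ab]] by simp
    ultimately show ?thesis by (simp add: LIMSEQ_const_iff set_lebesgue_integral_def mult.commute)
  qed
  have local: "AE x in lebesgue. x \<in> box a b \<longrightarrow> ?f x = 0" if sub: "cbox a b \<subseteq> S" for a b
  proof -
    have "AE x in lebesgue. ?f x * indicator (box a b) x = 0"
    proof (rule set_integral_zero_on_boxes)
      have "integrable lebesgue (\<lambda>x. indicator (box a b) x *\<^sub>R (?f x * indicator (cbox a b) x))"
        by (rule integrable_mult_indicator[OF _ fi]) auto
      moreover have "(\<lambda>x. indicator (box a b) x *\<^sub>R (?f x * indicator (cbox a b) x)) = (\<lambda>x. ?f x * indicator (box a b) x)"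
        using box_subset_cbox[of a b] by (intro ext) (auto simp: indicator_def)
      ultimately show "integrable lebesgue (\<lambda>x. ?f x * indicator (box a b) x)" by simp
      fix c d
      have "\<exists>a' b'. box a b \<inter> box c d = box a' b' \<and> cbox a b \<inter> cbox c d = cbox a' b'"
        by (intro exI conjI, rule box_Int_box, rule Int_interval)
      then obtain a' b' where ab': "box a b \<inter> box c d = box a' b'" "cbox a b \<inter> cbox c d = cbox a' b'"
        by blast
      have "(LINT x:box c d|lebesgue. ?f x * indicator (box a b) x) = (LINT x:box a' b'|lebesgue. ?f x)"
        unfolding set_lebesgue_integral_def ab'(1)[symmetric]
        by (intro Bochner_Integration.integral_cong) (auto simp: indicator_def)
      also have "\<dots> = 0" using sub ab'(2) by (intro zero) blast
      finally show "(LINT x:box c d|lebesgue. ?f x * indicator (box a b) x) = 0" .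
    qed
    then show ?thesis by eventually_elim (auto simp: indicator_def)
  qed
  obtain \<D> where D: "countable \<D>" "\<D> \<subseteq> Pow S" "\<And>X. X \<in> \<D> \<Longrightarrow> \<exists>a b. X = cbox a b" "\<Union>\<D> = S"
    by (rule open_countable_Union_open_cbox[OF S], rule that)
  have "AE x in lebesgue. x \<in> X \<longrightarrow> ?f x = 0" if X: "X \<in> \<D>" for X
  proof -
    obtain a b where ab: "X = cbox a b" using D(3)[OF X] by blast
    have "negligible (cbox a b - box a b)" by (rule negligible_frontier_interval)
    then have "AE x in lebesgue. x \<notin> cbox a b - box a b"
      unfolding negligible_iff_null_sets by (rule AE_not_in)
    moreover have "cbox a b \<subseteq> S" using subsetD[OF D(2) X] ab by simp
    from local[OF this] have "AE x in lebesgue. x \<in> box a b \<longrightarrow> ?f x = 0" .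
    ultimately show ?thesis unfolding ab by eventually_elim blast
  qed
  then have "AE x in lebesgue. \<forall>X\<in>\<D>. x \<in> X \<longrightarrow> ?f x = 0"
    by (intro iffD2[OF AE_ball_countable[OF D(1)]] ballI)
  then show ?thesis by eventually_elim (use D(4) in blast)
qed

section \<open>The square root of a bounded positive operator\<close>

text \<open>A fixed point \<open>Y\<close> of this iteration satisfies $(1 - Y)^2 = 1 - Q$. It will be used with
$Q = 1 - R / C$.\<close>

primrec sqrt_iterate :: "('v::real_normed_vector \<Rightarrow>\<^sub>L 'v) \<Rightarrow> nat \<Rightarrow> 'v \<Rightarrow>\<^sub>L 'v" where
  "sqrt_iterate Q 0 = 0"
| "sqrt_iterate Q (Suc n) = (1/2) *\<^sub>R (Q + (sqrt_iterate Q n o\<^sub>L sqrt_iterate Q n))"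

primrec scalar_iterate :: "nat \<Rightarrow> real" where
  "scalar_iterate 0 = 0"
| "scalar_iterate (Suc n) = (1 + (scalar_iterate n)\<^sup>2) / 2"

lemma scalar_iterate_bounds: "0 \<le> scalar_iterate n" "scalar_iterate n \<le> 1"
proof -
  have "0 \<le> scalar_iterate n \<and> scalar_iterate n \<le> 1"
    by (induction n) (auto simp: power_le_one)
  then show "0 \<le> scalar_iterate n" "scalar_iterate n \<le> 1" by auto
qed

lemma scalar_iterate_mono: "scalar_iterate n \<le> scalar_iterate (Suc n)"
proof -
  have "0 \<le> (1 - scalar_iterate n)\<^sup>2" by simp
  then show ?thesis by (simp add: power2_eq_square algebra_simps)
qed

lemma compose_ops:
  fixes f g h :: "'v::real_normed_vector \<Rightarrow>\<^sub>L 'v"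
  shows "f o\<^sub>L (g + h) = (f o\<^sub>L g) + (f o\<^sub>L h)" "(f + g) o\<^sub>L h = (f o\<^sub>L h) + (g o\<^sub>L h)"
    "f o\<^sub>L (g - h) = (f o\<^sub>L g) - (f o\<^sub>L h)" "(f - g) o\<^sub>L h = (f o\<^sub>L h) - (g o\<^sub>L h)"
    "f o\<^sub>L (c *\<^sub>R g) = c *\<^sub>R (f o\<^sub>L g)" "(c *\<^sub>R f) o\<^sub>L g = c *\<^sub>R (f o\<^sub>L g)"
    "(f o\<^sub>L g) o\<^sub>L h = f o\<^sub>L (g o\<^sub>L h)" "f o\<^sub>L 0 = 0" "0 o\<^sub>L f = 0"
  by (auto intro!: blinfun_eqI simp: blinfun.add_left blinfun.add_right blinfun.diff_left
      blinfun.diff_right blinfun.scaleR_left blinfun.scaleR_right blinfun.zero_right)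

lemma sqrt_iterate_commute:
  assumes "C o\<^sub>L Q = Q o\<^sub>L C"
  shows "C o\<^sub>L sqrt_iterate Q n = sqrt_iterate Q n o\<^sub>L C"
proof (induction n)
  case 0
  show ?case by (simp add: compose_ops)
next
  case (Suc n)
  let ?Y = "sqrt_iterate Q n"
  have "C o\<^sub>L (?Y o\<^sub>L ?Y) = (C o\<^sub>L ?Y) o\<^sub>L ?Y" by (simp only: compose_ops(7))
  also have "\<dots> = ?Y o\<^sub>L (C o\<^sub>L ?Y)" by (subst Suc) (rule compose_ops(7))
  also have "\<dots> = (?Y o\<^sub>L ?Y) o\<^sub>L C" by (simp only: Suc compose_ops(7))
  finally show ?case using assms by (simp add: compose_ops(1-6))
qed

lemma sqrt_iterate_commute2: "sqrt_iterate Q m o\<^sub>L sqrt_iterate Q n = sqrt_iterate Q n o\<^sub>L sqrt_iterate Q m"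
  by (rule sqrt_iterate_commute[OF sqrt_iterate_commute[OF refl, symmetric]])

text \<open>The iterates are polynomials in \<open>Q\<close> with nonnegative coefficients, so \<open>norm Q \<le> 1\<close> makes the
  scalar iteration a majorant.\<close>

lemma sqrt_iterate_majorant:
  assumes Q: "norm Q \<le> 1"
  shows "norm (sqrt_iterate Q n) \<le> scalar_iterate n"
    and "norm (sqrt_iterate Q (Suc n) - sqrt_iterate Q n) \<le> scalar_iterate (Suc n) - scalar_iterate n"
proof -
  show bound: "norm (sqrt_iterate Q n) \<le> scalar_iterate n" for n
  proof (induction n)
    case (Suc n)
    have "norm (sqrt_iterate Q (Suc n)) = norm (Q + (sqrt_iterate Q n o\<^sub>L sqrt_iterate Q n)) / 2"
      by simp
    also have "\<dots> \<le> (norm Q + norm (sqrt_iterate Q n o\<^sub>L sqrt_iterate Q n)) / 2"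
      by (intro divide_right_mono norm_triangle_ineq) simp
    also have "\<dots> \<le> (1 + scalar_iterate n * scalar_iterate n) / 2"
      by (intro divide_right_mono add_mono Q order_trans[OF norm_blinfun_compose] mult_mono Suc)
        (auto simp: scalar_iterate_bounds)
    finally show ?case by (simp add: power2_eq_square)
  qed simp
  show "norm (sqrt_iterate Q (Suc n) - sqrt_iterate Q n) \<le> scalar_iterate (Suc n) - scalar_iterate n"
  proof (induction n)
    case 0
    show ?case using Q by (simp add: compose_ops)
  next
    case (Suc n)
    let ?Y = "sqrt_iterate Q" and ?y = "scalar_iterate"
    have "?Y (Suc (Suc n)) - ?Y (Suc n) = (1/2) *\<^sub>R ((?Y (Suc n) o\<^sub>L ?Y (Suc n)) - (?Y n o\<^sub>L ?Y n))"
      by (simp only: sqrt_iterate.simps(2)[of Q "Suc n"] sqrt_iterate.simps(2)[of Q n] scaleR_diff_right[symmetric] add_diff_cancel_left)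
    also have "(?Y (Suc n) o\<^sub>L ?Y (Suc n)) - (?Y n o\<^sub>L ?Y n) = (?Y (Suc n) + ?Y n) o\<^sub>L (?Y (Suc n) - ?Y n)"
      by (simp only: compose_ops(1-4) sqrt_iterate_commute2[of Q n "Suc n"]) (simp del: sqrt_iterate.simps)
    finally have "norm (?Y (Suc (Suc n)) - ?Y (Suc n)) = norm ((?Y (Suc n) + ?Y n) o\<^sub>L (?Y (Suc n) - ?Y n)) / 2"
      by (simp only: norm_scaleR)
    also have "\<dots> \<le> ((?y (Suc n) + ?y n) * (?y (Suc n) - ?y n)) / 2"
      by (intro divide_right_mono order_trans[OF norm_blinfun_compose] mult_mono Suc
          order_trans[OF norm_triangle_ineq] add_mono bound add_nonneg_nonneg scalar_iterate_bounds norm_ge_zero) simp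
    also have "\<dots> = ?y (Suc (Suc n)) - ?y (Suc n)"
      by (simp only: scalar_iterate.simps(2)[of "Suc n"] scalar_iterate.simps(2)[of n]) (simp add: power2_eq_square field_simps)
    finally show ?case .
  qed
qed

lemma sqrt_iterate_convergent:
  fixes Q :: "'v::banach \<Rightarrow>\<^sub>L 'v"
  assumes Q: "norm Q \<le> 1"
  shows "convergent (sqrt_iterate Q)"
proof -
  have inc: "incseq scalar_iterate" by (intro incseq_SucI scalar_iterate_mono)
  have "convergent scalar_iterate"
    by (rule Bseq_monoseq_convergent)
      (use inc scalar_iterate_bounds in \<open>auto simp: incseq_imp_monoseq intro!: BseqI'[of _ 1]\<close>)
  then have C: "Cauchy scalar_iterate" by (rule convergent_Cauchy)
  have diff: "norm (sqrt_iterate Q (k + i) - sqrt_iterate Q k) \<le> scalar_iterate (k + i) - scalar_iterate k" for k i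
  proof (induction i)
    case (Suc i)
    have "norm (sqrt_iterate Q (k + Suc i) - sqrt_iterate Q k) \<le>
      norm (sqrt_iterate Q (Suc (k + i)) - sqrt_iterate Q (k + i)) + norm (sqrt_iterate Q (k + i) - sqrt_iterate Q k)"
      using norm_triangle_ineq[of "sqrt_iterate Q (Suc (k + i)) - sqrt_iterate Q (k + i)" "sqrt_iterate Q (k + i) - sqrt_iterate Q k"]
      by (simp del: sqrt_iterate.simps)
    also have "\<dots> \<le> (scalar_iterate (Suc (k + i)) - scalar_iterate (k + i)) + (scalar_iterate (k + i) - scalar_iterate k)"
      by (intro add_mono Suc sqrt_iterate_majorant(2) Q)
    finally show ?case by (simp del: scalar_iterate.simps sqrt_iterate.simps)
  qed simp
  have "Cauchy (sqrt_iterate Q)"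
  proof (rule CauchyI')
    fix e :: real assume "e > 0"
    from CauchyD[OF C this] obtain M where
      M: "\<And>m n. m \<ge> M \<Longrightarrow> n \<ge> M \<Longrightarrow> norm (scalar_iterate m - scalar_iterate n) < e"
      by blast
    show "\<exists>M. \<forall>m\<ge>M. \<forall>n>m. dist (sqrt_iterate Q m) (sqrt_iterate Q n) < e"
    proof (intro exI allI impI)
      fix m n assume mn: "M \<le> m" "m < n"
      have "norm (sqrt_iterate Q n - sqrt_iterate Q m) \<le> scalar_iterate n - scalar_iterate m"
        using diff[of m "n - m"] mn by simp
      also have "\<dots> < e" using M[of n m] mn by simp
      finally show "dist (sqrt_iterate Q m) (sqrt_iterate Q n) < e"
        by (simp add: dist_norm norm_minus_commute)
    qed
  qed
  then show ?thesis by (simp add: Cauchy_convergent_iff)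
qed

text \<open>The bound on \<open>norm (R f)\<close> makes the norm of $1 - R / C$ at most 1, so the iteration converges in the
operator norm and $\sqrt{C}\,(1 - Y)$ is a root. It is nonnegative since \<open>norm Y \<le> 1\<close>.\<close>

theorem positive_sqrt_exists:
  fixes R :: "'v::{real_inner,banach} \<Rightarrow> 'v"
  assumes lin: "bounded_linear R" and sym: "\<And>f g. inner (R f) g = inner f (R g)"
    and pos: "\<And>f. (norm (R f))\<^sup>2 \<le> C * inner (R f) f" and C: "C > 0"
  obtains B where "bounded_linear B" "\<And>f g. inner (B f) g = inner f (B g)"
    "\<And>f. 0 \<le> inner (B f) f" "\<And>f. B (B f) = R f"
proof -
  interpret R: bounded_linear R by (rule lin)
  define Q where "Q = id_blinfun - (1 / C) *\<^sub>R Blinfun R"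
  have Qv: "Q f = f - (1 / C) *\<^sub>R R f" for f
    by (simp add: Q_def blinfun.diff_left blinfun.scaleR_left bounded_linear_Blinfun_apply lin)
  have nQ: "norm Q \<le> 1"
  proof (rule norm_blinfun_bound)
    fix f
    have eq: "(norm (Q f))\<^sup>2 = (norm f)\<^sup>2 - 2 / C * inner (R f) f + (norm (R f))\<^sup>2 / C\<^sup>2"
      unfolding Qv power2_norm_eq_inner
      by (simp add: inner_diff_left inner_diff_right inner_commute[of f "R f"] power2_eq_square diff_divide_distrib)
    have "(norm (R f))\<^sup>2 / C\<^sup>2 \<le> (C * inner (R f) f) / C\<^sup>2"
      by (intro divide_right_mono pos) simp
    moreover have "(C * inner (R f) f) / C\<^sup>2 = inner (R f) f / C"
      using C by (simp add: power2_eq_square)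
    moreover have "0 \<le> inner (R f) f / C"
    proof -
      have "0 \<le> C * inner (R f) f" using order_trans[OF zero_le_power2 pos] .
      then have "0 \<le> inner (R f) f" using C by (simp add: zero_le_mult_iff)
      then show ?thesis using C by simp
    qed
    ultimately have "(norm (Q f))\<^sup>2 \<le> (norm f)\<^sup>2" using eq by simp
    then have "norm (Q f) \<le> norm f" by (rule power2_le_imp_le) simp
    then show "norm (Q f) \<le> 1 * norm f" by simp
  qed simp
  obtain Y where Y: "sqrt_iterate Q \<longlonglongrightarrow> Y"
    using sqrt_iterate_convergent[OF nQ] unfolding convergent_def by blast
  have Yn: "norm Y \<le> 1"
    by (rule LIMSEQ_le_const2[OF tendsto_norm[OF Y]])
      (use order_trans[OF sqrt_iterate_majorant(1)[OF nQ] scalar_iterate_bounds(2)] in auto)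
  have "(\<lambda>n. (1/2) *\<^sub>R (Q + (sqrt_iterate Q n o\<^sub>L sqrt_iterate Q n))) \<longlonglongrightarrow> (1/2) *\<^sub>R (Q + (Y o\<^sub>L Y))"
    by (intro tendsto_intros bounded_bilinear.tendsto[OF bounded_bilinear_blinfun_compose] Y)
  moreover have "(\<lambda>n. sqrt_iterate Q (Suc n)) \<longlonglongrightarrow> Y" using Y by (rule LIMSEQ_Suc)
  ultimately have Y2: "Y = (1/2) *\<^sub>R (Q + (Y o\<^sub>L Y))"
    unfolding sqrt_iterate.simps(2) by (rule LIMSEQ_unique[rotated])
  have "2 *\<^sub>R Y = 2 *\<^sub>R ((1/2) *\<^sub>R (Q + (Y o\<^sub>L Y)))" by (rule arg_cong[OF Y2])
  then have "2 *\<^sub>R Y = Q + (Y o\<^sub>L Y)" by (simp only: scaleR_scaleR) simp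
  then have fix2: "2 *\<^sub>R Y f = Q f + Y (Y f)" for f
    by (metis blinfun.add_left blinfun.scaleR_left blinfun_apply_blinfun_compose)
  have Qsym: "inner (Q f) g = inner f (Q g)" for f g
    by (simp add: Qv inner_diff_left inner_diff_right sym)
  have Ynsym: "inner (sqrt_iterate Q n f) g = inner f (sqrt_iterate Q n g)" for n f g
    by (induction n arbitrary: f g)
      (auto simp: blinfun.add_left blinfun.scaleR_left inner_add_left inner_add_right Qsym)
  have Yap: "(\<lambda>n. sqrt_iterate Q n f) \<longlonglongrightarrow> Y f" for f
    by (intro blinfun.tendsto Y tendsto_const)
  have Ysym: "inner (Y f) g = inner f (Y g)" for f g
  proof (rule LIMSEQ_unique)
    show "(\<lambda>n. inner (sqrt_iterate Q n f) g) \<longlonglongrightarrow> inner (Y f) g" by (intro tendsto_intros Yap)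
    show "(\<lambda>n. inner (sqrt_iterate Q n f) g) \<longlonglongrightarrow> inner f (Y g)"
      unfolding Ynsym by (intro tendsto_intros Yap)
  qed
  define B where "B f = sqrt C *\<^sub>R (f - Y f)" for f
  have "bounded_linear B" unfolding B_def
    by (intro bounded_linear_intros)
  moreover have "inner (B f) g = inner f (B g)" for f g
    by (simp add: B_def inner_diff_left inner_diff_right Ysym)
  moreover have "0 \<le> inner (B f) f" for f
  proof -
    have "inner (Y f) f \<le> norm (Y f) * norm f" by (rule norm_cauchy_schwarz)
    also have "\<dots> \<le> (1 * norm f) * norm f"
      by (intro mult_right_mono order_trans[OF norm_blinfun] Yn) auto
    finally show ?thesis using C by (simp add: B_def inner_diff_left power2_norm_eq_inner[symmetric] power2_eq_square)
  qed
  moreover have "B (B f) = R f" for f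
  proof -
    have "B (B f) = C *\<^sub>R (f - 2 *\<^sub>R Y f + Y (Y f))"
      using C by (simp add: B_def blinfun.scaleR_right blinfun.diff_right scaleR_2 scaleR_diff_right[symmetric])
    also have "f - 2 *\<^sub>R Y f + Y (Y f) = f - Q f" unfolding fix2 by simp
    also have "C *\<^sub>R (f - Q f) = R f" using C by (simp add: Qv)
    finally show ?thesis .
  qed
  ultimately show thesis by (rule that)
qed

section \<open>The operator of a form and its square root\<close>

text \<open>\<open>V\<close> is the energy space and \<open>H\<close> the pivot space. The ambient space is larger than \<open>H\<close>, because
functions on a domain are represented by their extensions by zero to the whole space.\<close>

locale form_triple = hilbert_form V D
  for V :: "'v::{real_inner,banach} set" and D :: "'v \<Rightarrow> 'v \<Rightarrow> real" +
  fixes H :: "'v set" and C :: real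
  assumes H_closed: "closed H" and H_sub: "subspace H" and VH: "V \<subseteq> H"
    and C_pos: "C > 0" and poincare: "\<And>u. u \<in> V \<Longrightarrow> (norm u)\<^sup>2 \<le> C * D u u"
    and V_total: "\<And>f. f \<in> H \<Longrightarrow> (\<And>v. v \<in> V \<Longrightarrow> inner f v = 0) \<Longrightarrow> f = 0"
begin

text \<open>The weak solution of $A u = f$. On the orthogonal complement of \<open>H\<close> it is zero.\<close>

definition R :: "'v \<Rightarrow> 'v" where
  "R f = (SOME z. z \<in> V \<and> (\<forall>v\<in>V. D z v = inner f v))"

lemma R_props: "R f \<in> V \<and> (\<forall>v\<in>V. D (R f) v = inner f v)"
proof -
  have "(inner f v)\<^sup>2 \<le> ((norm f)\<^sup>2 * C) * D v v" if "v \<in> V" for v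
  proof -
    have "(inner f v)\<^sup>2 \<le> (norm f)\<^sup>2 * (norm v)\<^sup>2"
      using Cauchy_Schwarz_ineq[of f v] by (simp add: power2_norm_eq_inner)
    also have "\<dots> \<le> (norm f)\<^sup>2 * (C * D v v)" by (intro mult_left_mono poincare that) simp
    finally show ?thesis by (simp add: mult.assoc)
  qed
  then obtain z where "z \<in> V" "\<And>v. v \<in> V \<Longrightarrow> D z v = inner f v"
    by (rule riesz[of "inner f", rotated 2]) (auto simp: inner_add_right)
  then have "\<exists>z. z \<in> V \<and> (\<forall>v\<in>V. D z v = inner f v)" by blast
  then show ?thesis unfolding R_def by (rule someI_ex)
qed

lemma R_in: "R f \<in> V" using R_props by blast

lemma R_eq: "v \<in> V \<Longrightarrow> D (R f) v = inner f v" using R_props by blast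

lemma R_unique:
  assumes "z \<in> V" "\<And>v. v \<in> V \<Longrightarrow> D z v = inner f v"
  shows "z = R f"
proof -
  have d: "z - R f \<in> V" using assms(1) R_in by (intro V_ops)
  then have "D (z - R f) (z - R f) = 0"
    using assms R_in R_eq[OF d, of f] by (simp add: D_diff_left)
  from D_definite[OF d this] show ?thesis by simp
qed

lemma R_sym: "inner (R f) g = inner f (R g)"
  using R_eq[OF R_in, of g f] R_eq[OF R_in, of f g] D_sym[OF R_in R_in] by (simp add: inner_commute)

lemma R_form: "inner (R f) f = D (R f) (R f)"
  using R_eq[OF R_in, of f f] by (simp add: inner_commute)

lemma R_nonneg: "0 \<le> inner (R f) f"
  unfolding R_form by (rule D_nonneg[OF R_in])

lemma R_pos: "(norm (R f))\<^sup>2 \<le> C * inner (R f) f"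
  unfolding R_form by (rule poincare[OF R_in])

lemma R_linear: "bounded_linear R"
proof (rule bounded_linear_intro)
  show "R (f + g) = R f + R g" for f g
    by (rule R_unique[symmetric]) (auto simp: V_ops R_in D_add_left R_eq inner_add_left)
  show "R (c *\<^sub>R f) = c *\<^sub>R R f" for c f
    by (rule R_unique[symmetric]) (auto simp: V_ops R_in D_scale_left R_eq)
  show "norm (R f) \<le> norm f * C" for f
  proof (cases "R f = 0")
    case False
    have "norm (R f) * norm (R f) \<le> C * (norm (R f) * norm f)"
      using order_trans[OF R_pos mult_left_mono[OF norm_cauchy_schwarz less_imp_le[OF C_pos]]]
      by (simp add: power2_eq_square)
    then have "norm (R f) * norm (R f) \<le> norm (R f) * (norm f * C)" by (simp add: algebra_simps)
    then show ?thesis using False by simp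
  qed (use C_pos in simp)
qed

lemma R_eq_0: "R f = 0 \<longleftrightarrow> (\<forall>v\<in>V. inner f v = 0)"
proof
  assume "R f = 0"
  then have "\<forall>v\<in>V. inner f v = D 0 v" using R_eq[of _ f] by simp
  then show "\<forall>v\<in>V. inner f v = 0" using D_scale_left[of 0 _ 0] V_ops(1) by simp
next
  assume "\<forall>v\<in>V. inner f v = 0"
  then have "D (R f) (R f) = 0" using R_eq[OF R_in] R_in by simp
  then show "R f = 0" using D_definite[OF R_in] by blast
qed

lemma R_inj: "f \<in> H \<Longrightarrow> R f = 0 \<Longrightarrow> f = 0"
  using V_total R_eq_0 by blast

lemma R_image_subspace: "subspace (R ` H)"
proof -
  interpret R: bounded_linear R by (rule R_linear)
  show ?thesis by (rule linear_subspace_image[OF R.linear H_sub])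
qed

text \<open>If \<open>v\<close> is \<open>D\<close>-orthogonal to the range, then in particular \<open>inner v v = D v (R v) = 0\<close>.\<close>

lemma R_dense_form:
  assumes "u \<in> V"
  obtains X where "\<And>n. X n \<in> H" "(\<lambda>n::nat. D (R (X n) - u) (R (X n) - u)) \<longlonglongrightarrow> 0"
proof -
  have RV: "R ` H \<subseteq> V" using R_in by blast
  have triv: "v = 0" if "v \<in> V" "\<And>m. m \<in> R ` H \<Longrightarrow> D v m = 0" for v
  proof -
    have "v \<in> H" using that VH by blast
    then have "D v (R v) = 0" using that(2) by blast
    then have "inner v v = 0" using R_eq[OF that(1), of v] D_sym[OF that(1) R_in, of v] by simp
    then show ?thesis by simp
  qed
  obtain Y where Y: "\<And>n. Y n \<in> R ` H" "(\<lambda>n::nat. D (Y n - u) (Y n - u)) \<longlonglongrightarrow> 0"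
    using dense_if_orthogonal_trivial[OF R_image_subspace RV assms triv] by metis
  have "\<forall>n. \<exists>f. f \<in> H \<and> Y n = R f" using Y(1) by blast
  then obtain X where X: "\<And>n. X n \<in> H" "\<And>n. Y n = R (X n)" by metis
  from that[OF X(1)] show thesis using Y(2) by (simp add: X(2))
qed

lemma R_dense: "H \<subseteq> closure (R ` H)"
proof (rule dense_if_orthogonal_trivial_inner[OF H_closed H_sub R_image_subspace])
  show "R ` H \<subseteq> H" using R_in VH by blast
  fix v assume v: "v \<in> H" "\<And>m. m \<in> R ` H \<Longrightarrow> inner v m = 0"
  have "R v \<in> H" using R_in VH by blast
  then have "inner v (R (R v)) = 0" using v(2) by blast
  then have "R v = 0" using R_sym[of v "R v"] by simp
  then show "v = 0" by (rule R_inj[OF v(1)])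
qed

text \<open>The graph of the operator $A$ of the form, parametrised by the right-hand side.\<close>

definition op_graph :: "('v \<times> 'v) set" where "op_graph = {(R f, f) |f. f \<in> H}"

text \<open>If \<open>B\<close> is a root of \<open>R\<close>, the inverse relation of \<open>B\<close> is a root of $A$. Its domain is dense since it
contains the range of \<open>R\<close>.\<close>

lemma op_sqrt_exists: "\<exists>S. self_adjoint H S \<and> nonnegative_op S \<and> S O S = op_graph"
proof -
  obtain B where B: "bounded_linear B" "\<And>f g. inner (B f) g = inner f (B g)"
    "\<And>f. 0 \<le> inner (B f) f" "\<And>f. B (B f) = R f"
    using positive_sqrt_exists[OF R_linear R_sym R_pos C_pos] by metis
  \<comment> \<open>\<open>R\<close>, and therefore \<open>B\<close>, annihilates the orthogonal complement of \<open>H\<close>.\<close>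
  have BH: "B f \<in> H" for f
  proof -
    obtain p where p: "p \<in> H" "\<And>m. m \<in> H \<Longrightarrow> inner (B f - p) m = 0"
      using closed_subspace_projection[OF H_closed H_sub] by metis
    define h where "h = B f - p"
    have "R h = 0" unfolding R_eq_0 h_def using p(2) VH by blast
    then have "inner (B h) (B h) = 0" using B(2)[of "B h" h] B(4) by (simp add: inner_commute)
    then have "B h = 0" by simp
    then have "inner (B f) h = 0" using B(2)[of f h] by simp
    moreover have "inner p h = 0" using p by (simp add: h_def inner_commute)
    ultimately have "inner h h = 0" by (simp add: h_def inner_diff_left)
    then show ?thesis using p(1) by (simp add: h_def)
  qed
  define S where "S = {(B f, f) |f. f \<in> H}"
  have dom: "Domain S = B ` H" by (auto simp: S_def)
  have RB: "R ` H \<subseteq> B ` H" using B(4) BH by (metis image_subsetI imageI)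
  have "H \<subseteq> closure (Domain S)"
    unfolding dom by (rule subset_trans[OF R_dense closure_mono[OF RB]])
  moreover have "op_adjoint H S = S"
  proof -
    have "v = B w" if "v \<in> H" "w \<in> H" "\<forall>f\<in>H. inner f v = inner (B f) w" for v w
    proof -
      have d: "v - B w \<in> H" using that BH H_sub by (simp add: subspace_diff)
      then have "inner (v - B w) (v - B w) = 0"
        using that(3)[rule_format, OF d] by (simp add: inner_diff_right B(2))
      then show ?thesis by simp
    qed
    then show ?thesis by (auto simp: op_adjoint_def S_def BH B(2))
  qed
  moreover have "S \<subseteq> H \<times> H" by (auto simp: S_def BH)
  moreover have "nonnegative_op S" using B(3) by (auto simp: nonnegative_op_def S_def inner_commute)
  moreover have "S O S = op_graph" by (auto simp: S_def op_graph_def B(4)[symmetric] BH relcomp_unfold)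
  ultimately show ?thesis by (auto simp: self_adjoint_def)
qed

context
  fixes S assumes S: "self_adjoint H S" "S O S = op_graph"
begin

lemma S_sym:
  assumes "(u, f) \<in> S" "(v, g) \<in> S"
  shows "inner f v = inner u g"
proof -
  have "(v, g) \<in> op_adjoint H S" using S(1) assms(2) by (simp add: self_adjoint_def)
  then show ?thesis using assms(1) by (auto simp: op_adjoint_def)
qed

lemma S_adjoint:
  "v \<in> H \<Longrightarrow> g \<in> H \<Longrightarrow> (\<And>u f. (u, f) \<in> S \<Longrightarrow> inner f v = inner u g) \<Longrightarrow> (v, g) \<in> S"
  using S(1) unfolding self_adjoint_def by (auto simp: op_adjoint_def)

text \<open>Symmetry makes \<open>f - g\<close> orthogonal to the domain of \<open>S\<close>, which is dense.\<close>

lemma S_unique: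
  assumes "(u, f) \<in> S" "(u, g) \<in> S"
  shows "f = g"
proof -
  have fg: "f \<in> H" "g \<in> H" using assms S(1) by (auto simp: self_adjoint_def)
  have "Domain S \<subseteq> {v. inner v (f - g) = 0}"
    using S_sym[OF assms(1)] S_sym[OF assms(2)] by (auto simp: inner_diff_right inner_commute)
  moreover have "closed {v. inner v (f - g) = 0}"
    by (intro closed_Collect_eq continuous_intros)
  ultimately have "closure (Domain S) \<subseteq> {v. inner v (f - g) = 0}" by (rule closure_minimal)
  moreover have "f - g \<in> closure (Domain S)"
    using S(1) fg H_sub by (auto simp: self_adjoint_def subspace_diff)
  ultimately have "inner (f - g) (f - g) = 0" by blast
  then show ?thesis by simp
qed

lemma S_limit:
  assumes "\<And>n. (X n, Y n) \<in> S" "X \<longlonglongrightarrow> u" "Y \<longlonglongrightarrow> f"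
  shows "(u, f) \<in> S"
proof (rule S_adjoint)
  have H2: "X n \<in> H" "Y n \<in> H" for n using assms(1)[of n] S(1) by (auto simp: self_adjoint_def)
  show "u \<in> H" by (rule closed_sequentially[OF H_closed H2(1) assms(2)])
  show "f \<in> H" by (rule closed_sequentially[OF H_closed H2(2) assms(3)])
  fix v g assume vg: "(v, g) \<in> S"
  show "inner g u = inner v f"
  proof (rule LIMSEQ_unique)
    show "(\<lambda>n. inner g (X n)) \<longlonglongrightarrow> inner g u" by (intro tendsto_intros assms)
    show "(\<lambda>n. inner g (X n)) \<longlonglongrightarrow> inner v f"
      unfolding S_sym[OF vg assms(1)] by (intro tendsto_intros assms)
  qed
qed

text \<open>On the range of \<open>R\<close> the energy of the square root is \<open>inner f (R f) = D (R f) (R f)\<close>; the form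
  norm carries this to all of \<open>V\<close> since the graph of the square root is closed.\<close>

lemma S_approx:
  assumes u: "u \<in> V"
  obtains X Y c where "\<And>n. X n \<in> H" "\<And>n. (R (X n), Y n) \<in> S" "Y \<longlonglongrightarrow> c" "(u, c) \<in> S"
    "(\<lambda>n::nat. D (R (X n) - u) (R (X n) - u)) \<longlonglongrightarrow> 0"
    "\<And>v e. (v, e) \<in> S \<Longrightarrow> v \<in> V \<Longrightarrow> inner c e = D u v"
proof -
  obtain X where X: "\<And>n. X n \<in> H" "(\<lambda>n::nat. D (R (X n) - u) (R (X n) - u)) \<longlonglongrightarrow> 0"
    by (rule R_dense_form[OF u], rule that)
  interpret R: bounded_linear R by (rule R_linear)
  have ex: "\<exists>b. (R f, b) \<in> S \<and> (b, f) \<in> S" if "f \<in> H" for f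
  proof -
    have "(R f, f) \<in> S O S" using that S(2) by (auto simp: op_graph_def)
    then show ?thesis by blast
  qed
  then have "\<forall>n. \<exists>b. (R (X n), b) \<in> S \<and> (b, X n) \<in> S" using X(1) by simp
  then obtain Y where Y: "\<And>n. (R (X n), Y n) \<in> S" "\<And>n. (Y n, X n) \<in> S"
    by metis
  have form: "inner b e = D (R f) v" if "(b, f) \<in> S" "(v, e) \<in> S" "v \<in> V" for b f v e
    using S_sym[OF that(1) that(2)] R_eq[OF that(3)] by simp
  have nY: "(norm (Y m - Y n))\<^sup>2 = D (R (X m) - R (X n)) (R (X m) - R (X n))" for m n
  proof -
    have "inner (Y i) (Y j) = D (R (X i)) (R (X j))" for i j
      by (rule form[OF Y(2) Y(1) R_in])
    then show ?thesis
      by (simp add: power2_norm_eq_inner inner_diff_left inner_diff_right D_diff_left D_diff_right R_in V_ops(3))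
  qed
  have "Cauchy Y"
  proof (rule CauchyI)
    fix e :: real assume e: "e > 0"
    have "\<forall>\<^sub>F n in sequentially. D (R (X n) - u) (R (X n) - u) < e\<^sup>2 / 4"
      using X(2) e by (intro order_tendstoD) auto
    then obtain N where N: "\<And>n. n \<ge> N \<Longrightarrow> D (R (X n) - u) (R (X n) - u) < e\<^sup>2 / 4"
      by (auto simp: eventually_sequentially)
    show "\<exists>M. \<forall>m\<ge>M. \<forall>n\<ge>M. norm (Y m - Y n) < e"
    proof (intro exI allI impI)
      fix m n assume mn: "N \<le> m" "N \<le> n"
      have "(norm (Y m - Y n))\<^sup>2 < e\<^sup>2"
        using D_diff_triangle[OF R_in R_in u, of "X m" "X n"] N[OF mn(1)] N[OF mn(2)] by (simp add: nY)
      then show "norm (Y m - Y n) < e" using e by (simp add: power2_less_imp_less)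
    qed
  qed
  then obtain c where c: "Y \<longlonglongrightarrow> c" using Cauchy_convergent convergent_def by blast
  have "(\<lambda>n. R (X n) - u) \<longlonglongrightarrow> 0"
  proof -
    have "(\<lambda>n. sqrt (C * D (R (X n) - u) (R (X n) - u))) \<longlonglongrightarrow> sqrt (C * 0)"
      by (intro tendsto_intros X)
    then have "(\<lambda>n. sqrt (C * D (R (X n) - u) (R (X n) - u))) \<longlonglongrightarrow> 0" by simp
    then show ?thesis
    proof (rule Lim_null_comparison[rotated], intro always_eventually allI)
      show "norm (R (X n) - u) \<le> sqrt (C * D (R (X n) - u) (R (X n) - u))" for n
        using poincare[OF V_ops(3)[OF R_in u]] by (simp add: real_le_rsqrt)
    qed
  qed
  then have "(\<lambda>n. R (X n)) \<longlonglongrightarrow> u" by (simp add: LIM_zero_iff)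
  from S_limit[OF Y(1) this c] have uc: "(u, c) \<in> S" .
  have "inner c e = D u v" if "(v, e) \<in> S" "v \<in> V" for v e
  proof (rule LIMSEQ_unique)
    show "(\<lambda>n. inner (Y n) e) \<longlonglongrightarrow> inner c e" by (intro tendsto_intros c)
    show "(\<lambda>n. inner (Y n) e) \<longlonglongrightarrow> D u v"
      unfolding form[OF Y(2) that] by (rule D_continuous[OF R_in u X(2) that(2)])
  qed
  from that[OF X(1) Y(1) c uc X(2) this] show thesis .
qed

lemma S_energy:
  assumes "u \<in> V" "v \<in> V"
  shows "inner (THE f. (u, f) \<in> S) (THE f. (v, f) \<in> S) = D u v"
proof -
  obtain X Y c where c: "(u, c) \<in> S" "\<And>v e. (v, e) \<in> S \<Longrightarrow> v \<in> V \<Longrightarrow> inner c e = D u v"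
    by (rule S_approx[OF assms(1)], rule that)
  obtain X Y d where d: "(v, d) \<in> S"
    by (rule S_approx[OF assms(2)], rule that)
  have "(THE f. (u, f) \<in> S) = c" by (rule the_equality) (auto intro: c S_unique)
  moreover have "(THE f. (v, f) \<in> S) = d" by (rule the_equality) (auto intro: d S_unique)
  ultimately show ?thesis using c(2)[OF d assms(2)] by simp
qed

end

text \<open>\<open>op_sqrt\<close> is an unspecified root, so the identity is proved for all self-adjoint roots.\<close>

theorem op_sqrt_energy:
  assumes "u \<in> V" "v \<in> V"
  shows "inner (THE f. (u, f) \<in> op_sqrt H op_graph) (THE f. (v, f) \<in> op_sqrt H op_graph) = D u v"
proof (rule S_energy[OF _ _ assms])
  have "self_adjoint H (op_sqrt H op_graph) \<and> nonnegative_op (op_sqrt H op_graph) \<and>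
      op_sqrt H op_graph O op_sqrt H op_graph = op_graph"
    unfolding op_sqrt_def by (rule someI_ex[OF op_sqrt_exists])
  then show "self_adjoint H (op_sqrt H op_graph)" "op_sqrt H op_graph O op_sqrt H op_graph = op_graph" by auto
qed

end

section \<open>Integration by parts and the Poincare inequality\<close>

lemma integrable_compact_support:
  fixes f :: "'a::euclidean_space \<Rightarrow> real"
  assumes "continuous_on UNIV f" "compact K" "\<And>x. x \<notin> K \<Longrightarrow> f x = 0"
  shows "integrable lebesgue f" "integrable lborel f" "f \<in> borel_measurable borel"
proof -
  show borel: "f \<in> borel_measurable borel"
    using assms(1) by (rule borel_measurable_continuous_onI)
  have "(\<lambda>x. indicator K x *\<^sub>R f x) = f"
    using assms(3) by (fastforce simp: indicator_def)
  moreover have "integrable lborel (\<lambda>x. indicator K x *\<^sub>R f x)"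
    by (intro borel_integrable_compact assms(2) continuous_on_subset[OF assms(1)]) simp
  ultimately show "integrable lborel f" by simp
  then show "integrable lebesgue f" using borel by (simp add: integrable_completion)
qed

lemma integral_translation:
  fixes g :: "'a::euclidean_space \<Rightarrow> real"
  assumes "g \<in> borel_measurable borel"
  shows "(\<integral>x. g (c + x) \<partial>lborel) = (\<integral>x. g x \<partial>lborel)"
proof -
  have "(\<integral>x. g x \<partial>distr lborel borel ((+) c)) = (\<integral>x. g (c + x) \<partial>lborel)"
    by (rule integral_distr) (use assms in auto)
  then show ?thesis by (simp only: lborel_distr_plus)
qed

lemma partial_deriv_scale:
  assumes "g differentiable (at y)"
  shows "partial_deriv (t *\<^sub>R b) g y = t * partial_deriv b g y"
proof -
  have "bounded_linear (\<lambda>h. partial_deriv h g y)"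
    by (rule has_derivative_bounded_linear[OF partial_deriv_has_derivative[OF assms]])
  then interpret bounded_linear "\<lambda>h. partial_deriv h g y" .
  show ?thesis by (simp add: scale)
qed

lemma partial_deriv_line:
  fixes g :: "'a::euclidean_space \<Rightarrow> real"
  assumes "\<And>x. g differentiable (at x)"
  shows "((\<lambda>t. g (x + t *\<^sub>R b)) has_real_derivative partial_deriv b g (x + s *\<^sub>R b)) (at s)"
proof -
  have "((\<lambda>t. x + t *\<^sub>R b) has_derivative (\<lambda>h. h *\<^sub>R b)) (at s)"
    by (auto intro!: derivative_eq_intros)
  then have "((\<lambda>t. g (x + t *\<^sub>R b)) has_derivative (\<lambda>h. partial_deriv (h *\<^sub>R b) g (x + s *\<^sub>R b))) (at s)"
    by (rule has_derivative_compose[OF _ partial_deriv_has_derivative[OF assms]])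
  then show ?thesis
    unfolding has_field_derivative_def
    by (rule has_derivative_eq_rhs) (simp add: fun_eq_iff partial_deriv_scale[OF assms] mult.commute)
qed

text \<open>The difference quotients in direction \<open>b\<close> have integral zero by translation invariance and
  converge boundedly to the derivative.\<close>

lemma integral_partial_deriv_zero:
  fixes g :: "'a::euclidean_space \<Rightarrow> real"
  assumes diff: "\<And>x. g differentiable (at x)" and cont: "continuous_on UNIV (partial_deriv b g)"
    and K: "compact K" "\<And>x. x \<notin> K \<Longrightarrow> g x = 0"
  shows "(\<integral>x. partial_deriv b g x \<partial>lebesgue) = 0"
proof -
  have gc: "continuous_on UNIV g"
    by (intro continuous_at_imp_continuous_on ballI differentiable_imp_continuous_within diff)
  note gi = integrable_compact_support[OF gc K]
  have db: "partial_deriv b g \<in> borel_measurable borel"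
    using cont by (rule borel_measurable_continuous_onI)
  define r where "r n = inverse (real (Suc n))" for n
  have r: "0 < r n" "r n \<le> 1" for n by (simp_all add: r_def field_simps)
  define q where "q n x = (g (x + r n *\<^sub>R b) - g x) / r n" for n x
  obtain \<rho> where \<rho>: "\<And>x. x \<in> K \<Longrightarrow> norm x \<le> \<rho>"
    using compact_imp_bounded[OF K(1)] by (auto simp: bounded_iff)
  \<comment> \<open>The shifts are not longer than \<open>b\<close>, so all difference quotients vanish outside this radius.\<close>
  define \<rho>' where "\<rho>' = \<bar>\<rho>\<bar> + norm b"
  have "compact (partial_deriv b g ` cball 0 (\<rho>' + norm b))"
    by (intro compact_continuous_image continuous_on_subset[OF cont]) auto
  then have "bounded (partial_deriv b g ` cball 0 (\<rho>' + norm b))" by (rule compact_imp_bounded)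
  then obtain M where "\<And>y. y \<in> partial_deriv b g ` cball 0 (\<rho>' + norm b) \<Longrightarrow> norm y \<le> M"
    unfolding bounded_iff by blast
  then have M: "\<bar>partial_deriv b g x\<bar> \<le> M" if "norm x \<le> \<rho>' + norm b" for x
    using that by fastforce
  have bound: "\<bar>q n x\<bar> \<le> M * indicator (cball 0 \<rho>') x" for n and x :: 'a
  proof (cases "norm x \<le> \<rho>'")
    case True
    have "\<exists>z. 0 < z \<and> z < r n \<and> g (x + r n *\<^sub>R b) - g (x + 0 *\<^sub>R b) = (r n - 0) * partial_deriv b g (x + z *\<^sub>R b)"
      by (rule MVT2[OF r(1)]) (rule partial_deriv_line[OF diff])
    then obtain z where z: "0 < z" "z < r n" "g (x + r n *\<^sub>R b) - g x = r n * partial_deriv b g (x + z *\<^sub>R b)"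
      by auto
    have "norm (x + z *\<^sub>R b) \<le> norm x + norm (z *\<^sub>R b)" by (rule norm_triangle_ineq)
    also have "norm (z *\<^sub>R b) \<le> norm b" using z r[of n] by (simp add: mult_left_le_one_le)
    finally have "norm (x + z *\<^sub>R b) \<le> \<rho>' + norm b" using True by simp
    from M[OF this] show ?thesis using z(3) r(1)[of n] True by (simp add: q_def)
  next
    case False
    have big: "norm x > \<rho> + norm b" using False abs_ge_self[of \<rho>] unfolding \<rho>'_def by linarith
    have "x \<notin> K" using \<rho>[of x] big norm_ge_zero[of b] by force
    moreover have "x + r n *\<^sub>R b \<notin> K"
    proof
      assume "x + r n *\<^sub>R b \<in> K"
      then have "norm (x + r n *\<^sub>R b) \<le> \<rho>" by (rule \<rho>)
      moreover have "norm x \<le> norm (x + r n *\<^sub>R b) + norm (r n *\<^sub>R b)"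
        using norm_triangle_ineq4[of "x + r n *\<^sub>R b" "r n *\<^sub>R b"] by simp
      moreover have "norm (r n *\<^sub>R b) \<le> norm b" using r[of n] by (simp add: mult_left_le_one_le)
      ultimately show False using big by linarith
    qed
    ultimately show ?thesis using False by (simp add: q_def K(2))
  qed
  have zero: "(\<integral>x. q n x \<partial>lborel) = 0" for n
  proof -
    have gt: "integrable lborel (\<lambda>x. g (x + r n *\<^sub>R b))"
    proof (rule integrable_compact_support(2))
      show "continuous_on UNIV (\<lambda>x. g (x + r n *\<^sub>R b))"
        by (rule continuous_on_compose2[OF gc]) (auto intro!: continuous_intros)
      show "compact ((+) (- r n *\<^sub>R b) ` K)" using K(1) by (rule compact_translation)
      show "g (x + r n *\<^sub>R b) = 0" if "x \<notin> (+) (- r n *\<^sub>R b) ` K" for x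
      proof (rule K(2), rule notI)
        assume "x + r n *\<^sub>R b \<in> K"
        then have "- r n *\<^sub>R b + (x + r n *\<^sub>R b) \<in> (+) (- r n *\<^sub>R b) ` K" by (rule imageI)
        with that show False by simp
      qed
    qed
    have "(\<integral>x. q n x \<partial>lborel) = ((\<integral>x. g (x + r n *\<^sub>R b) \<partial>lborel) - (\<integral>x. g x \<partial>lborel)) / r n"
      unfolding q_def using gt gi(2) by simp
    also have "(\<integral>x. g (x + r n *\<^sub>R b) \<partial>lborel) = (\<integral>x. g x \<partial>lborel)"
      using integral_translation[OF gi(3), of "r n *\<^sub>R b"] by (simp add: add.commute)
    finally show ?thesis by simp
  qed
  have "(\<lambda>n. \<integral>x. q n x \<partial>lborel) \<longlonglongrightarrow> (\<integral>x. partial_deriv b g x \<partial>lborel)"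
  proof (rule integral_dominated_convergence[where w = "\<lambda>x. M * indicator (cball (0::'a) \<rho>') x"])
    show "integrable lborel (\<lambda>x. M * indicator (cball (0::'a) \<rho>') x)"
      using emeasure_bounded_finite[OF bounded_cball[of "0::'a" \<rho>']]
      by (intro integrable_mult_right integrable_real_indicator) auto
    show "partial_deriv b g \<in> borel_measurable lborel" using db by simp
    show "q n \<in> borel_measurable lborel" for n
      unfolding q_def using gi(3) by measurable
    show "AE x in lborel. norm (q n x) \<le> M * indicator (cball 0 \<rho>') x" for n
      using bound by auto
    show "AE x in lborel. (\<lambda>n. q n x) \<longlonglongrightarrow> partial_deriv b g x"
    proof (intro always_eventually allI)
      fix x
      have "((\<lambda>t. g (x + t *\<^sub>R b)) has_real_derivative partial_deriv b g (x + 0 *\<^sub>R b)) (at 0)"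
        by (rule partial_deriv_line[OF diff])
      then have "((\<lambda>h. (g (x + h *\<^sub>R b) - g x) / h) \<longlongrightarrow> partial_deriv b g x) (at 0)"
        by (simp add: has_field_derivative_iff)
      moreover have "filterlim r (at 0) sequentially"
      proof (rule filterlim_atI)
        show "r \<longlonglongrightarrow> 0" unfolding r_def by (rule LIMSEQ_inverse_real_of_nat)
        show "\<forall>\<^sub>F n in sequentially. r n \<noteq> 0" using r(1) by (simp add: less_imp_neq[symmetric] order_less_imp_not_eq2)
      qed
      ultimately show "(\<lambda>n. q n x) \<longlonglongrightarrow> partial_deriv b g x"
        unfolding q_def by (rule filterlim_compose)
    qed
  qed
  then have "(\<integral>x. partial_deriv b g x \<partial>lborel) = 0"
    unfolding zero by (simp add: LIMSEQ_const_iff)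
  then show ?thesis using db by (simp add: integral_completion)
qed

lemma partial_deriv_mult:
  assumes "f differentiable (at x)" "g differentiable (at x)"
  shows "partial_deriv b (\<lambda>x. f x * g x) x = f x * partial_deriv b g x + partial_deriv b f x * g x"
  by (rule partial_derivI)
    (use assms in \<open>auto intro!: has_derivative_mult partial_deriv_has_derivative\<close>)

lemma test_partial_continuous:
  assumes "\<phi> \<in> test_functions S" "b \<in> Basis"
  shows "continuous_on UNIV (partial_deriv b \<phi>)"
  by (rule test_function_props(1)[OF test_function_partial_deriv[OF assms]])

lemma test_function_support:
  assumes "\<phi> \<in> test_functions S"
  obtains K where "compact K" "K \<subseteq> S" "\<And>x. x \<notin> K \<Longrightarrow> \<phi> x = 0"
  by (rule that[OF test_function_props(5,6,4)[OF assms]])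

lemma test_integration_by_parts:
  assumes \<phi>: "\<phi> \<in> test_functions S" and \<psi>: "\<psi> \<in> test_functions S'" and b: "b \<in> Basis"
  shows "(\<integral>x. \<phi> x * partial_deriv b \<psi> x \<partial>lebesgue) = - (\<integral>x. partial_deriv b \<phi> x * \<psi> x \<partial>lebesgue)"
proof -
  have eq: "partial_deriv b (\<lambda>x. \<phi> x * \<psi> x) = (\<lambda>x. \<phi> x * partial_deriv b \<psi> x + partial_deriv b \<phi> x * \<psi> x)"
    by (rule ext, rule partial_deriv_mult[OF test_function_props(2)[OF \<phi>] test_function_props(2)[OF \<psi>]])
  obtain K where K: "compact K" "\<And>x. x \<notin> K \<Longrightarrow> \<phi> x = 0"
    by (rule test_function_support[OF \<phi>], rule that)
  obtain K' where K': "compact K'" "\<And>x. x \<notin> K' \<Longrightarrow> \<psi> x = 0"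
    by (rule test_function_support[OF \<psi>], rule that)
  have i1: "integrable lebesgue (\<lambda>x. \<phi> x * partial_deriv b \<psi> x)"
    by (rule integrable_compact_support(1)[OF _ K(1)])
      (intro continuous_on_mult test_function_props(1)[OF \<phi>] test_partial_continuous[OF \<psi> b], simp add: K(2))
  have i2: "integrable lebesgue (\<lambda>x. partial_deriv b \<phi> x * \<psi> x)"
    by (rule integrable_compact_support(1)[OF _ K'(1)])
      (intro continuous_on_mult test_function_props(1)[OF \<psi>] test_partial_continuous[OF \<phi> b], simp add: K'(2))
  have "(\<integral>x. partial_deriv b (\<lambda>x. \<phi> x * \<psi> x) x \<partial>lebesgue) = 0"
  proof (rule integral_partial_deriv_zero[OF _ _ K(1)])
    show "(\<lambda>x. \<phi> x * \<psi> x) differentiable (at x)" for x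
      by (intro differentiable_mult test_function_props(2)[OF \<phi>] test_function_props(2)[OF \<psi>])
    show "continuous_on UNIV (partial_deriv b (\<lambda>x. \<phi> x * \<psi> x))"
      unfolding eq by (intro continuous_on_add continuous_on_mult test_function_props(1)[OF \<phi>]
          test_function_props(1)[OF \<psi>] test_partial_continuous[OF \<phi> b] test_partial_continuous[OF \<psi> b])
    show "\<phi> x * \<psi> x = 0" if "x \<notin> K" for x
      using K(2)[OF that] by simp
  qed
  then show ?thesis unfolding eq using i1 i2 by simp
qed

text \<open>The derivative of $x_b \varphi^2$ in direction \<open>b\<close> has integral zero, so
$\int \varphi^2 = -2 \int x_b\, \varphi\, \partial_b \varphi$; completing the square in
$\varphi + 2 x_b\, \partial_b \varphi$ and $|x_b| \le B$ give the constant.\<close>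

lemma test_poincare:
  assumes \<phi>: "\<phi> \<in> test_functions S" and b: "b \<in> Basis" and B: "\<And>x. x \<in> S \<Longrightarrow> norm x \<le> B"
  shows "(norm (lsq_class S \<phi>))\<^sup>2 \<le> 4 * B\<^sup>2 * (norm (lsq_class S (partial_deriv b \<phi>)))\<^sup>2"
proof -
  let ?d = "partial_deriv b \<phi>"
  note d = test_function_partial_deriv[OF \<phi> b]
  note c = test_function_props(1)[OF \<phi>] test_function_props(1)[OF d]
  obtain K where K: "compact K" "\<And>x. x \<notin> K \<Longrightarrow> \<phi> x = 0"
    by (rule test_function_support[OF \<phi>], rule that)
  obtain K' where K': "compact K'" "K' \<subseteq> S" "\<And>x. x \<notin> K' \<Longrightarrow> ?d x = 0"
    by (rule test_function_support[OF d], rule that)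
  have dS: "?d x = 0" if "x \<notin> S" for x
    using K'(2,3) that by blast
  have i1: "integrable lebesgue (\<lambda>x. \<phi> x * \<phi> x)"
    by (rule integrable_compact_support(1)[OF _ K(1)]) (intro continuous_on_mult c, simp add: K(2))
  have i2: "integrable lebesgue (\<lambda>x. (x \<bullet> b) * (\<phi> x * ?d x))"
    by (rule integrable_compact_support(1)[OF _ K(1)])
      (intro continuous_on_mult continuous_on_inner continuous_on_id continuous_on_const c, simp add: K(2))
  have i3: "integrable lebesgue (\<lambda>x. ?d x * ?d x)"
    by (rule integrable_compact_support(1)[OF _ K'(1)]) (intro continuous_on_mult c, simp add: K'(3))
  have eq: "partial_deriv b (\<lambda>x. (\<phi> x * \<phi> x) * (x \<bullet> b)) x = \<phi> x * \<phi> x + 2 * ((x \<bullet> b) * (\<phi> x * ?d x))" for x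
  proof -
    have l: "((\<lambda>x. x \<bullet> b) has_derivative (\<lambda>h. h \<bullet> b)) (at x)" by (auto intro!: derivative_eq_intros)
    have "((\<lambda>x. \<phi> x * \<phi> x) has_derivative (\<lambda>h. \<phi> x * partial_deriv h \<phi> x + partial_deriv h \<phi> x * \<phi> x)) (at x)"
      by (intro has_derivative_mult partial_deriv_has_derivative test_function_props(2)[OF \<phi>])
    from this l have "((\<lambda>x. (\<phi> x * \<phi> x) * (x \<bullet> b)) has_derivative
        (\<lambda>h. (\<phi> x * \<phi> x) * (h \<bullet> b) + (\<phi> x * partial_deriv h \<phi> x + partial_deriv h \<phi> x * \<phi> x) * (x \<bullet> b))) (at x)"
      by (rule has_derivative_mult)
    from partial_derivI[OF this, of b] show ?thesis using b by (simp add: inner_Basis algebra_simps)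
  qed
  have "(\<integral>x. partial_deriv b (\<lambda>x. (\<phi> x * \<phi> x) * (x \<bullet> b)) x \<partial>lebesgue) = 0"
  proof (rule integral_partial_deriv_zero[OF _ _ K(1)])
    show "(\<lambda>x. (\<phi> x * \<phi> x) * (x \<bullet> b)) differentiable (at x)" for x
      by (intro differentiable_mult test_function_props(2)[OF \<phi>] bounded_linear_imp_differentiable bounded_linear_inner_left)
    show "continuous_on UNIV (partial_deriv b (\<lambda>x. (\<phi> x * \<phi> x) * (x \<bullet> b)))"
      unfolding eq by (intro continuous_on_add continuous_on_mult continuous_on_inner continuous_on_id continuous_on_const c)
  qed (simp add: K(2))
  then have byparts: "(\<integral>x. \<phi> x * \<phi> x \<partial>lebesgue) + 2 * (\<integral>x. (x \<bullet> b) * (\<phi> x * ?d x) \<partial>lebesgue) = 0"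
    unfolding eq using i1 i2 by simp
  have pt: "- (\<phi> x * \<phi> x) - 4 * ((x \<bullet> b) * (\<phi> x * ?d x)) \<le> 4 * B\<^sup>2 * (?d x * ?d x)" for x
  proof (cases "x \<in> S")
    case True
    have "\<bar>x \<bullet> b\<bar> \<le> B" using Basis_le_norm[OF b, of x] B[OF True] by simp
    then have xb: "(x \<bullet> b)\<^sup>2 \<le> B\<^sup>2" by (simp add: abs_le_square_iff[symmetric])
    have "0 \<le> (\<phi> x + 2 * (x \<bullet> b) * ?d x)\<^sup>2" by simp
    also have "\<dots> = \<phi> x * \<phi> x + 4 * ((x \<bullet> b) * (\<phi> x * ?d x)) + 4 * (x \<bullet> b)\<^sup>2 * (?d x * ?d x)"
      by (simp add: power2_eq_square algebra_simps)
    also have "\<dots> \<le> \<phi> x * \<phi> x + 4 * ((x \<bullet> b) * (\<phi> x * ?d x)) + 4 * B\<^sup>2 * (?d x * ?d x)"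
      using mult_right_mono[OF xb, of "?d x * ?d x"] by simp
    finally show ?thesis by simp
  next
    case False
    then show ?thesis by (simp add: dS)
  qed
  have "(\<integral>x. - (\<phi> x * \<phi> x) - 4 * ((x \<bullet> b) * (\<phi> x * ?d x)) \<partial>lebesgue) \<le> (\<integral>x. 4 * B\<^sup>2 * (?d x * ?d x) \<partial>lebesgue)"
    using i1 i2 i3 by (intro integral_mono pt) auto
  then have "(\<integral>x. \<phi> x * \<phi> x \<partial>lebesgue) \<le> 4 * B\<^sup>2 * (\<integral>x. ?d x * ?d x \<partial>lebesgue)"
    using i1 i2 byparts by simp
  moreover have "(norm (lsq_class S \<phi>))\<^sup>2 = (\<integral>x. \<phi> x * \<phi> x \<partial>lebesgue)"
    using norm_abs_lsq[OF test_function_square_integrable(1)[OF \<phi>]]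
    by (simp add: lsq_class_test[OF \<phi>] power2_eq_square)
  moreover have "(norm (lsq_class S ?d))\<^sup>2 = (\<integral>x. ?d x * ?d x \<partial>lebesgue)"
    using norm_abs_lsq[OF test_function_square_integrable(1)[OF d]]
    by (simp add: lsq_class_test[OF d] power2_eq_square)
  ultimately show ?thesis by simp
qed

section \<open>Functions supported in a set\<close>

lemma square_integrable_restrict:
  assumes S: "S \<in> sets lebesgue" and f: "square_integrable f"
  shows "square_integrable (\<lambda>x. if x \<in> S then f x else 0)"
proof (rule square_integrable_bound[OF f])
  have "simple_function lebesgue (\<lambda>x. indicator S x :: real)" using S by (rule simple_function_indicator)
  then have "strongly_measurable (\<lambda>x. (indicator S x :: real) *\<^sub>R f x)"
    using f unfolding square_integrable_def
    by (intro strongly_measurable_combine[where h = "\<lambda>c u. c *\<^sub>R u", OF strongly_measurable_simple] tendsto_scaleR) auto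
  moreover have "(\<lambda>x. (indicator S x :: real) *\<^sub>R f x) = (\<lambda>x. if x \<in> S then f x else 0)"
    by (auto simp: indicator_def)
  ultimately show "strongly_measurable (\<lambda>x. if x \<in> S then f x else 0)" by simp
  show "AE x in lebesgue. norm (if x \<in> S then f x else 0) \<le> 1 * norm (f x)" by simp
qed

lemma lsq_class_on:
  assumes "square_integrable (\<lambda>x. if x \<in> S then f x else 0)"
  shows "lsq_class S f \<in> lsq_on S" "AE x in lebesgue. rep_lsq (lsq_class S f) x = (if x \<in> S then f x else 0)"
proof -
  show "AE x in lebesgue. rep_lsq (lsq_class S f) x = (if x \<in> S then f x else 0)"
    unfolding lsq_class_def by (rule rep_abs_lsq[OF assms])
  then show "lsq_class S f \<in> lsq_on S"
    unfolding lsq_on_def by (simp, elim eventually_mono) auto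
qed

lemma lsq_on_orthogonal:
  fixes f g :: "('a::euclidean_space, 'b::real_inner) lsq"
  assumes "f \<in> lsq_on S" "g \<in> lsq_on (- S)"
  shows "inner f g = 0"
proof -
  have "AE x in lebesgue. inner (rep_lsq f x) (rep_lsq g x) = 0"
    using assms unfolding lsq_on_def mem_Collect_eq
  proof eventually_elim
    case (elim x)
    then show ?case by (cases "x \<in> S") auto
  qed
  then show ?thesis unfolding inner_rep_lsq by (rule integral_eq_zero_AE)
qed

text \<open>As an orthogonal complement \<open>lsq_on S\<close> is a closed subspace.\<close>

lemma lsq_on_iff:
  fixes f :: "('a::euclidean_space, 'b::real_inner) lsq"
  assumes S: "S \<in> sets lebesgue"
  shows "f \<in> lsq_on S \<longleftrightarrow> (\<forall>g\<in>lsq_on (- S). inner f g = 0)"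
proof
  assume "\<forall>g\<in>lsq_on (- S). inner f g = 0"
  moreover have sq: "square_integrable (\<lambda>x. if x \<in> - S then rep_lsq f x else 0)"
    using S by (intro square_integrable_restrict square_integrable_rep) (metis Compl_in_sets_lebesgue)
  ultimately have "inner f (lsq_class (- S) (rep_lsq f)) = 0" using lsq_class_on(1)[OF sq] by blast
  then have "(\<integral>x. inner (rep_lsq f x) (if x \<in> - S then rep_lsq f x else 0) \<partial>lebesgue) = 0"
    unfolding lsq_class_def inner_rep_abs_lsq[OF sq] .
  moreover have "inner (rep_lsq f x) (if x \<in> - S then rep_lsq f x else 0) = (norm (if x \<in> - S then rep_lsq f x else 0))\<^sup>2" for x
    by (simp add: power2_norm_eq_inner)
  ultimately have "(norm (abs_lsq (\<lambda>x. if x \<in> - S then rep_lsq f x else 0)))\<^sup>2 = 0"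
    unfolding norm_abs_lsq[OF sq] by (simp only:)
  then have "abs_lsq (\<lambda>x. if x \<in> - S then rep_lsq f x else 0) = abs_lsq (\<lambda>x. 0)"
    by (simp add: zero_lsq_def)
  then have "AE x in lebesgue. (if x \<in> - S then rep_lsq f x else 0) = 0"
    unfolding abs_lsq_eq_iff[OF sq square_integrable_zero] .
  then show "f \<in> lsq_on S" unfolding lsq_on_def mem_Collect_eq by eventually_elim (auto split: if_splits)
qed (use lsq_on_orthogonal in blast)

lemma closed_lsq_on:
  assumes "S \<in> sets lebesgue"
  shows "closed (lsq_on S :: ('a::euclidean_space, 'b::real_inner) lsq set)"
proof -
  have "lsq_on S = (\<Inter>g\<in>lsq_on (- S). {f :: ('a, 'b) lsq. inner f g = 0})"
    by (auto simp: lsq_on_iff[OF assms])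
  moreover have "closed {f :: ('a, 'b) lsq. inner f g = 0}" for g
    by (intro closed_Collect_eq continuous_intros)
  ultimately show ?thesis by (simp only:) (intro closed_INT ballI)
qed

lemma subspace_lsq_on:
  assumes "S \<in> sets lebesgue"
  shows "subspace (lsq_on S :: ('a::euclidean_space, 'b::real_inner) lsq set)"
  by (auto simp: subspace_def lsq_on_iff[OF assms] inner_add_left)

section \<open>The Dirichlet form on the energy space\<close>

locale bounded_domain =
  fixes \<Omega> :: "'a::euclidean_space set"
  assumes open_\<Omega>: "open \<Omega>" and bounded_\<Omega>: "bounded \<Omega>"
begin

lemma meas_\<Omega>: "\<Omega> \<in> sets lebesgue"
  using open_\<Omega> by simp

lemmas closed_\<Omega> = closed_lsq_on[OF meas_\<Omega>] and subspace_\<Omega> = subspace_lsq_on[OF meas_\<Omega>]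

lemma lsq_class_test_on: "\<phi> \<in> test_functions \<Omega> \<Longrightarrow> lsq_class \<Omega> \<phi> \<in> lsq_on \<Omega>"
  by (rule lsq_class_on(1)) (simp add: test_function_square_integrable)

lemma test_total:
  assumes "f \<in> lsq_on \<Omega>" "\<And>\<phi>. \<phi> \<in> test_functions \<Omega> \<Longrightarrow> inner f (lsq_class \<Omega> \<phi>) = 0"
  shows "f = 0"
proof -
  have "AE x in lebesgue. x \<in> \<Omega> \<longrightarrow> rep_lsq f x = 0"
    by (rule test_functions_orthogonal[OF open_\<Omega>]) (rule assms(2))
  moreover have "AE x in lebesgue. x \<notin> \<Omega> \<longrightarrow> rep_lsq f x = 0"
    using assms(1) by (simp add: lsq_on_def)
  ultimately have "AE x in lebesgue. rep_lsq f x = 0"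
    by eventually_elim blast
  then have "abs_lsq (rep_lsq f) = abs_lsq (\<lambda>x. 0)"
    by (simp add: abs_lsq_eq_iff square_integrable_rep square_integrable_zero)
  then show ?thesis by (simp add: abs_rep_lsq zero_lsq_def)
qed

lemma weak_partial_unique:
  assumes "weak_partial \<Omega> b u g" "weak_partial \<Omega> b u h"
  shows "g = h"
proof -
  have "g - h = 0"
    using assms subspace_diff[OF subspace_\<Omega>]
    by (intro test_total) (auto simp: weak_partial_def inner_diff_left)
  then show ?thesis by simp
qed

definition grad :: "('a, real) lsq \<Rightarrow> 'a \<Rightarrow> ('a, real) lsq" where
  "grad u b = (THE g. weak_partial \<Omega> b u g)"

lemma grad_eq: "weak_partial \<Omega> b u g \<Longrightarrow> grad u b = g"
  unfolding grad_def by (rule the_equality) (auto intro: weak_partial_unique)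

definition dirichlet_form :: "('a, real) lsq \<Rightarrow> ('a, real) lsq \<Rightarrow> real" where
  "dirichlet_form u v = (\<Sum>b\<in>Basis. inner (grad u b) (grad v b))"

lemma H10_weak_partial: "u \<in> H10 \<Omega> \<Longrightarrow> b \<in> Basis \<Longrightarrow> weak_partial \<Omega> b u (grad u b)"
  using grad_eq unfolding H10_def H1_def by blast

lemma H10_sub: "H10 \<Omega> \<subseteq> lsq_on \<Omega>"
  by (auto simp: H10_def H1_def)

lemma weak_partial_test:
  assumes "\<phi> \<in> test_functions \<Omega>" "b \<in> Basis"
  shows "weak_partial \<Omega> b (lsq_class \<Omega> \<phi>) (lsq_class \<Omega> (partial_deriv b \<phi>))"
  unfolding weak_partial_def
proof (intro conjI ballI)
  note d = test_function_partial_deriv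
  show "lsq_class \<Omega> (partial_deriv b \<phi>) \<in> lsq_on \<Omega>"
    by (rule lsq_class_test_on[OF d[OF assms]])
  fix \<psi> assume \<psi>: "\<psi> \<in> test_functions \<Omega>"
  note sq = test_function_square_integrable(1)
  show "inner (lsq_class \<Omega> \<phi>) (lsq_class \<Omega> (partial_deriv b \<psi>)) = - inner (lsq_class \<Omega> (partial_deriv b \<phi>)) (lsq_class \<Omega> \<psi>)"
    unfolding lsq_class_test[OF assms(1)] lsq_class_test[OF \<psi>] lsq_class_test[OF d[OF assms]] lsq_class_test[OF d[OF \<psi> assms(2)]]
      inner_abs_lsq[OF sq[OF assms(1)] sq[OF d[OF \<psi> assms(2)]]] inner_abs_lsq[OF sq[OF d[OF assms]] sq[OF \<psi>]] inner_real_def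
    by (rule test_integration_by_parts[OF assms(1) \<psi> assms(2)])
qed

lemma weak_partial_limit:
  assumes "\<And>k::nat. weak_partial \<Omega> b (X k) (G k)" "X \<longlonglongrightarrow> u" "G \<longlonglongrightarrow> g"
  shows "weak_partial \<Omega> b u g"
  unfolding weak_partial_def
proof (intro conjI ballI)
  show "g \<in> lsq_on \<Omega>"
    using assms(1) by (intro closed_sequentially[OF closed_\<Omega> _ assms(3)]) (auto simp: weak_partial_def)
  fix \<phi> assume \<phi>: "\<phi> \<in> test_functions \<Omega>"
  show "inner u (lsq_class \<Omega> (partial_deriv b \<phi>)) = - inner g (lsq_class \<Omega> \<phi>)"
  proof (rule LIMSEQ_unique)
    show "(\<lambda>k. inner (X k) (lsq_class \<Omega> (partial_deriv b \<phi>))) \<longlonglongrightarrow> inner u (lsq_class \<Omega> (partial_deriv b \<phi>))"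
      by (intro tendsto_intros assms)
    have "(\<lambda>k. - inner (G k) (lsq_class \<Omega> \<phi>)) \<longlonglongrightarrow> - inner g (lsq_class \<Omega> \<phi>)"
      by (intro tendsto_intros assms)
    moreover have "inner (X k) (lsq_class \<Omega> (partial_deriv b \<phi>)) = - inner (G k) (lsq_class \<Omega> \<phi>)" for k
      using assms(1)[of k] \<phi> by (auto simp: weak_partial_def)
    ultimately show "(\<lambda>k. inner (X k) (lsq_class \<Omega> (partial_deriv b \<phi>))) \<longlonglongrightarrow> - inner g (lsq_class \<Omega> \<phi>)"
      by simp
  qed
qed

text \<open>Weak derivatives are closed under limits, so it suffices that the gradients of the test functions
converge to something.\<close>

lemma H10_limit:
  assumes \<phi>: "\<And>k::nat. \<phi> k \<in> test_functions \<Omega>" "(\<lambda>k. lsq_class \<Omega> (\<phi> k)) \<longlonglongrightarrow> u"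
    and G: "\<And>b. b \<in> Basis \<Longrightarrow> (\<lambda>k. lsq_class \<Omega> (partial_deriv b (\<phi> k))) \<longlonglongrightarrow> G b"
  shows "u \<in> H10 \<Omega>" "b \<in> Basis \<Longrightarrow> grad u b = G b"
proof -
  have w: "weak_partial \<Omega> b u (G b)" if "b \<in> Basis" for b
    by (rule weak_partial_limit[OF weak_partial_test[OF \<phi>(1) that] \<phi>(2) G[OF that]])
  then show "b \<in> Basis \<Longrightarrow> grad u b = G b" by (rule grad_eq)
  have "u \<in> lsq_on \<Omega>"
    by (rule closed_sequentially[OF closed_\<Omega> lsq_class_test_on[OF \<phi>(1)] \<phi>(2)])
  then show "u \<in> H10 \<Omega>" using \<phi> G w unfolding H10_def H1_def by blast
qed

lemma H10_approx_grad:
  assumes "u \<in> H10 \<Omega>"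
  obtains \<phi> where "\<And>k::nat. \<phi> k \<in> test_functions \<Omega>" "(\<lambda>k. lsq_class \<Omega> (\<phi> k)) \<longlonglongrightarrow> u"
    "\<And>b. b \<in> Basis \<Longrightarrow> (\<lambda>k. lsq_class \<Omega> (partial_deriv b (\<phi> k))) \<longlonglongrightarrow> grad u b"
proof -
  obtain \<phi> g where *: "\<And>k::nat. \<phi> k \<in> test_functions \<Omega>" "(\<lambda>k. lsq_class \<Omega> (\<phi> k)) \<longlonglongrightarrow> u"
    "\<And>b. b \<in> Basis \<Longrightarrow> weak_partial \<Omega> b u (g b)"
    "\<And>b. b \<in> Basis \<Longrightarrow> (\<lambda>k. lsq_class \<Omega> (partial_deriv b (\<phi> k))) \<longlonglongrightarrow> g b"
    by (rule H10_approx[OF assms], rule that)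
  show thesis
    by (rule that[OF *(1,2)]) (use grad_eq[OF *(3)] *(4) in simp)
qed

lemma test_in_H10:
  assumes "\<phi> \<in> test_functions \<Omega>"
  shows "lsq_class \<Omega> \<phi> \<in> H10 \<Omega>" "b \<in> Basis \<Longrightarrow> grad (lsq_class \<Omega> \<phi>) b = lsq_class \<Omega> (partial_deriv b \<phi>)"
  using H10_limit[of "\<lambda>_. \<phi>" "lsq_class \<Omega> \<phi>" "\<lambda>b. lsq_class \<Omega> (partial_deriv b \<phi>)"] assms by auto

lemma lsq_class_combination:
  assumes "\<phi> \<in> test_functions \<Omega>" "\<psi> \<in> test_functions \<Omega>"
  shows "lsq_class \<Omega> (\<lambda>x. \<phi> x + c * \<psi> x) = lsq_class \<Omega> \<phi> + c *\<^sub>R lsq_class \<Omega> \<psi>"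
  using abs_lsq_add[OF test_function_square_integrable(1)[OF assms(1)]
      square_integrable_scaleR[OF test_function_square_integrable(1)[OF assms(2)], of c]]
    abs_lsq_scaleR[OF test_function_square_integrable(1)[OF assms(2)], of c]
  by (simp add: lsq_class_test[OF test_function_combination[OF assms]] lsq_class_test[OF assms(1)] lsq_class_test[OF assms(2)])

lemma H10_combination:
  assumes u: "u \<in> H10 \<Omega>" and v: "v \<in> H10 \<Omega>"
  shows "u + c *\<^sub>R v \<in> H10 \<Omega>" "b \<in> Basis \<Longrightarrow> grad (u + c *\<^sub>R v) b = grad u b + c *\<^sub>R grad v b"
proof -
  obtain \<phi> where \<phi>: "\<And>k::nat. \<phi> k \<in> test_functions \<Omega>" "(\<lambda>k. lsq_class \<Omega> (\<phi> k)) \<longlonglongrightarrow> u"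
    "\<And>b. b \<in> Basis \<Longrightarrow> (\<lambda>k. lsq_class \<Omega> (partial_deriv b (\<phi> k))) \<longlonglongrightarrow> grad u b"
    by (rule H10_approx_grad[OF u], rule that)
  obtain \<psi> where \<psi>: "\<And>k::nat. \<psi> k \<in> test_functions \<Omega>" "(\<lambda>k. lsq_class \<Omega> (\<psi> k)) \<longlonglongrightarrow> v"
    "\<And>b. b \<in> Basis \<Longrightarrow> (\<lambda>k. lsq_class \<Omega> (partial_deriv b (\<psi> k))) \<longlonglongrightarrow> grad v b"
    by (rule H10_approx_grad[OF v], rule that)
  have d: "partial_deriv b (\<lambda>x. \<phi> k x + c * \<psi> k x) = (\<lambda>x. partial_deriv b (\<phi> k) x + c * partial_deriv b (\<psi> k) x)" for b k
    by (rule ext, rule partial_derivI, intro has_derivative_add has_derivative_mult_right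
        partial_deriv_has_derivative test_function_props(2)[OF \<phi>(1)] test_function_props(2)[OF \<psi>(1)])
  have l0: "(\<lambda>k. lsq_class \<Omega> (\<lambda>x. \<phi> k x + c * \<psi> k x)) \<longlonglongrightarrow> u + c *\<^sub>R v"
    unfolding lsq_class_combination[OF \<phi>(1) \<psi>(1)] by (intro tendsto_intros \<phi> \<psi>)
  have l1: "(\<lambda>k. lsq_class \<Omega> (partial_deriv b (\<lambda>x. \<phi> k x + c * \<psi> k x))) \<longlonglongrightarrow> grad u b + c *\<^sub>R grad v b" if b: "b \<in> Basis" for b
    unfolding d lsq_class_combination[OF test_function_partial_deriv[OF \<phi>(1) b] test_function_partial_deriv[OF \<psi>(1) b]]
    by (intro tendsto_intros \<phi>(3)[OF b] \<psi>(3)[OF b])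
  note t = test_function_combination[OF \<phi>(1) \<psi>(1)]
  show "u + c *\<^sub>R v \<in> H10 \<Omega>" by (rule H10_limit(1)[OF t l0 l1])
  show "b \<in> Basis \<Longrightarrow> grad (u + c *\<^sub>R v) b = grad u b + c *\<^sub>R grad v b" by (rule H10_limit(2)[OF t l0 l1])
qed

lemma zero_H10: "0 \<in> H10 \<Omega>"
proof -
  have "(\<lambda>x. 0) \<in> test_functions \<Omega>" by (rule test_functionI[where K = "{}"]) (auto intro: C_k_const)
  from test_in_H10(1)[OF this] show ?thesis by (simp add: lsq_class_def zero_lsq_def)
qed

lemma subspace_H10: "subspace (H10 \<Omega>)"
  unfolding subspace_def
  using zero_H10 H10_combination(1)[of _ _ 1] H10_combination(1)[OF zero_H10] by auto

lemma grad_zero: "b \<in> Basis \<Longrightarrow> grad 0 b = 0"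
  using H10_combination(2)[OF zero_H10 zero_H10, of b 1] by simp

lemma grad_add: "u \<in> H10 \<Omega> \<Longrightarrow> v \<in> H10 \<Omega> \<Longrightarrow> b \<in> Basis \<Longrightarrow> grad (u + v) b = grad u b + grad v b"
  using H10_combination(2)[of u v b 1] by simp

lemma grad_scaleR: "u \<in> H10 \<Omega> \<Longrightarrow> b \<in> Basis \<Longrightarrow> grad (c *\<^sub>R u) b = c *\<^sub>R grad u b"
  using H10_combination(2)[OF zero_H10, of u b c] grad_zero[of b] by simp

lemma grad_diff: "u \<in> H10 \<Omega> \<Longrightarrow> v \<in> H10 \<Omega> \<Longrightarrow> b \<in> Basis \<Longrightarrow> grad (u - v) b = grad u b - grad v b"
  using H10_combination(2)[of u v b "-1"] by simp

lemma dirichlet_form_component: "b \<in> Basis \<Longrightarrow> (norm (grad u b))\<^sup>2 \<le> dirichlet_form u u"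
  unfolding dirichlet_form_def power2_norm_eq_inner by (rule member_le_sum) auto

lemma poincare_H10: "\<exists>C>0. \<forall>u\<in>H10 \<Omega>. (norm u)\<^sup>2 \<le> C * dirichlet_form u u"
proof -
  obtain B where B: "B > 0" "\<And>x. x \<in> \<Omega> \<Longrightarrow> norm x \<le> B"
    using bounded_\<Omega> unfolding bounded_pos by blast
  obtain b :: 'a where b: "b \<in> Basis" using nonempty_Basis by blast
  have "(norm u)\<^sup>2 \<le> (4 * B\<^sup>2) * dirichlet_form u u" if u: "u \<in> H10 \<Omega>" for u
  proof -
    obtain \<phi> where \<phi>: "\<And>k::nat. \<phi> k \<in> test_functions \<Omega>" "(\<lambda>k. lsq_class \<Omega> (\<phi> k)) \<longlonglongrightarrow> u"
      "\<And>b. b \<in> Basis \<Longrightarrow> (\<lambda>k. lsq_class \<Omega> (partial_deriv b (\<phi> k))) \<longlonglongrightarrow> grad u b"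
      by (rule H10_approx_grad[OF u], rule that)
    have "(norm u)\<^sup>2 \<le> 4 * B\<^sup>2 * (norm (grad u b))\<^sup>2"
    proof (rule LIMSEQ_le)
      show "(\<lambda>k. (norm (lsq_class \<Omega> (\<phi> k)))\<^sup>2) \<longlonglongrightarrow> (norm u)\<^sup>2" by (intro tendsto_intros \<phi>)
      show "(\<lambda>k. 4 * B\<^sup>2 * (norm (lsq_class \<Omega> (partial_deriv b (\<phi> k))))\<^sup>2) \<longlonglongrightarrow> 4 * B\<^sup>2 * (norm (grad u b))\<^sup>2"
        by (intro tendsto_intros \<phi>(3)[OF b])
      show "\<exists>N. \<forall>n\<ge>N. (norm (lsq_class \<Omega> (\<phi> n)))\<^sup>2 \<le> 4 * B\<^sup>2 * (norm (lsq_class \<Omega> (partial_deriv b (\<phi> n))))\<^sup>2"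
        using test_poincare[OF \<phi>(1) b B(2)] by simp
    qed
    also have "\<dots> \<le> 4 * B\<^sup>2 * dirichlet_form u u"
      by (intro mult_left_mono dirichlet_form_component b) simp
    finally show ?thesis .
  qed
  then show ?thesis using B(1) by (intro exI[of _ "4 * B\<^sup>2"]) auto
qed

text \<open>The gradients of a Cauchy sequence converge in $L^2$ and by Poincare so do the functions. Each \<open>X n\<close>
is within $1/(n+1)$ of a test function together with its gradient, and these test functions show that
the limit lies in \<open>H10 \<Omega>\<close>.\<close>

lemma H10_complete:
  assumes X: "\<And>n. X n \<in> H10 \<Omega>"
    and C: "\<And>e. e > 0 \<Longrightarrow> \<exists>N. \<forall>m\<ge>N. \<forall>n\<ge>N. dirichlet_form (X m - X n) (X m - X n) < e"
  shows "\<exists>u\<in>H10 \<Omega>. (\<lambda>n. dirichlet_form (X n - u) (X n - u)) \<longlonglongrightarrow> 0"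
proof -
  obtain K where K: "K > 0" "\<And>u. u \<in> H10 \<Omega> \<Longrightarrow> (norm u)\<^sup>2 \<le> K * dirichlet_form u u"
    using poincare_H10 by blast
  have d: "X m - X n \<in> H10 \<Omega>" for m n by (rule subspace_diff[OF subspace_H10 X X])
  have Cauchy_from: "Cauchy Y" if M0: "M > 0" and YX: "\<And>m n. (norm (Y m - Y n))\<^sup>2 \<le> M * dirichlet_form (X m - X n) (X m - X n)" for Y :: "nat \<Rightarrow> ('a, real) lsq" and M
  proof (rule CauchyI)
    fix e :: real assume e: "e > 0"
    obtain N where N: "\<forall>m\<ge>N. \<forall>n\<ge>N. dirichlet_form (X m - X n) (X m - X n) < e\<^sup>2 / M"
      using C[of "e\<^sup>2 / M"] e M0 by auto
    have "norm (Y m - Y n) < e" if mn: "N \<le> m" "N \<le> n" for m n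
    proof -
      have "M * dirichlet_form (X m - X n) (X m - X n) < e\<^sup>2"
        using N mn M0 by (simp add: pos_less_divide_eq mult.commute)
      then have "(norm (Y m - Y n))\<^sup>2 < e\<^sup>2"
        using YX[of m n] by simp
      then show ?thesis using e by (simp add: power2_less_imp_less)
    qed
    then show "\<exists>N. \<forall>m\<ge>N. \<forall>n\<ge>N. norm (Y m - Y n) < e" by blast
  qed
  have "Cauchy X" by (rule Cauchy_from[OF K(1)]) (rule K(2)[OF d])
  then obtain u where u: "X \<longlonglongrightarrow> u" using Cauchy_convergent convergent_def by blast
  have "Cauchy (\<lambda>n. grad (X n) b)" if b: "b \<in> Basis" for b
    by (rule Cauchy_from[of 1]) (use dirichlet_form_component[OF b] grad_diff[OF X X b] in \<open>simp_all flip: grad_diff[OF X X b]\<close>)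
  then have "\<forall>b\<in>Basis. \<exists>g. (\<lambda>n. grad (X n) b) \<longlonglongrightarrow> g"
    by (auto simp: Cauchy_convergent_iff convergent_def)
  then obtain G where G: "\<And>b. b \<in> Basis \<Longrightarrow> (\<lambda>n. grad (X n) b) \<longlonglongrightarrow> G b" by metis
  have "\<exists>\<phi>. \<phi> \<in> test_functions \<Omega> \<and> norm (lsq_class \<Omega> \<phi> - X n) < inverse (real (Suc n)) \<and>
      (\<forall>b\<in>Basis. norm (lsq_class \<Omega> (partial_deriv b \<phi>) - grad (X n) b) < inverse (real (Suc n)))" for n
  proof -
    obtain \<phi> where \<phi>: "\<And>k::nat. \<phi> k \<in> test_functions \<Omega>" "(\<lambda>k. lsq_class \<Omega> (\<phi> k)) \<longlonglongrightarrow> X n"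
      "\<And>b. b \<in> Basis \<Longrightarrow> (\<lambda>k. lsq_class \<Omega> (partial_deriv b (\<phi> k))) \<longlonglongrightarrow> grad (X n) b"
      by (rule H10_approx_grad[OF X[of n]], rule that)
    have e: "inverse (real (Suc n)) > 0" by simp
    have "\<forall>\<^sub>F k in sequentially. dist (lsq_class \<Omega> (\<phi> k)) (X n) < inverse (real (Suc n))"
      by (rule tendstoD[OF \<phi>(2) e])
    moreover have "\<forall>\<^sub>F k in sequentially. \<forall>b\<in>Basis. dist (lsq_class \<Omega> (partial_deriv b (\<phi> k))) (grad (X n) b) < inverse (real (Suc n))"
      by (rule eventually_ball_finite[OF finite_Basis]) (intro ballI tendstoD[OF \<phi>(3) e])
    ultimately have "\<forall>\<^sub>F k in sequentially. dist (lsq_class \<Omega> (\<phi> k)) (X n) < inverse (real (Suc n)) \<and>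
      (\<forall>b\<in>Basis. dist (lsq_class \<Omega> (partial_deriv b (\<phi> k))) (grad (X n) b) < inverse (real (Suc n)))"
      by (rule eventually_conj)
    then obtain k where "dist (lsq_class \<Omega> (\<phi> k)) (X n) < inverse (real (Suc n)) \<and>
      (\<forall>b\<in>Basis. dist (lsq_class \<Omega> (partial_deriv b (\<phi> k))) (grad (X n) b) < inverse (real (Suc n)))"
      by (auto dest: eventually_happens)
    then show ?thesis using \<phi>(1)[of k] unfolding dist_norm by blast
  qed
  then obtain \<phi> where \<phi>: "\<And>n. \<phi> n \<in> test_functions \<Omega>" "\<And>n. norm (lsq_class \<Omega> (\<phi> n) - X n) < inverse (real (Suc n))"
    "\<And>n b. b \<in> Basis \<Longrightarrow> norm (lsq_class \<Omega> (partial_deriv b (\<phi> n)) - grad (X n) b) < inverse (real (Suc n))"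
    by metis
  have lim: "Z \<longlonglongrightarrow> l" if "Y \<longlonglongrightarrow> l" "\<And>n. norm (Z n - Y n) < inverse (real (Suc n))" for Y Z :: "nat \<Rightarrow> ('a, real) lsq" and l
  proof -
    have "(\<lambda>n. Z n - Y n) \<longlonglongrightarrow> 0"
      by (rule Lim_null_comparison[OF _ LIMSEQ_inverse_real_of_nat])
        (intro always_eventually allI less_imp_le that(2))
    from tendsto_add[OF this that(1)] show ?thesis by simp
  qed
  have l0: "(\<lambda>n. lsq_class \<Omega> (\<phi> n)) \<longlonglongrightarrow> u" by (rule lim[OF u \<phi>(2)])
  have l1: "(\<lambda>n. lsq_class \<Omega> (partial_deriv b (\<phi> n))) \<longlonglongrightarrow> G b" if "b \<in> Basis" for b
    by (rule lim[OF G[OF that] \<phi>(3)[OF that]])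
  have uH: "u \<in> H10 \<Omega>" by (rule H10_limit(1)[OF \<phi>(1) l0 l1])
  have gu: "grad u b = G b" if "b \<in> Basis" for b by (rule H10_limit(2)[OF \<phi>(1) l0 l1 that])
  have "(\<lambda>n. \<Sum>b\<in>Basis. inner (grad (X n) b - grad u b) (grad (X n) b - grad u b)) \<longlonglongrightarrow>
      (\<Sum>b\<in>(Basis::'a set). inner (grad u b - grad u b) (grad u b - grad u b))"
    by (intro tendsto_sum tendsto_inner tendsto_diff tendsto_const) (use G gu in auto)
  moreover have "dirichlet_form (X n - u) (X n - u) = (\<Sum>b\<in>Basis. inner (grad (X n) b - grad u b) (grad (X n) b - grad u b))" for n
    unfolding dirichlet_form_def by (intro sum.cong refl) (simp add: grad_diff[OF X uH])
  ultimately show ?thesis using uH by (intro bexI[of _ u]) auto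
qed

definition poincare_const :: real where
  "poincare_const = (SOME C. C > 0 \<and> (\<forall>u\<in>H10 \<Omega>. (norm u)\<^sup>2 \<le> C * dirichlet_form u u))"

lemma poincare_const: "poincare_const > 0" "u \<in> H10 \<Omega> \<Longrightarrow> (norm u)\<^sup>2 \<le> poincare_const * dirichlet_form u u"
proof -
  have "\<exists>C. C > 0 \<and> (\<forall>u\<in>H10 \<Omega>. (norm u)\<^sup>2 \<le> C * dirichlet_form u u)" using poincare_H10 by blast
  from someI_ex[OF this] show "poincare_const > 0" "u \<in> H10 \<Omega> \<Longrightarrow> (norm u)\<^sup>2 \<le> poincare_const * dirichlet_form u u"
    unfolding poincare_const_def by blast+
qed

sublocale form_triple "H10 \<Omega>" dirichlet_form "lsq_on \<Omega>" poincare_const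
proof unfold_locales
  show "subspace (H10 \<Omega>)" by (rule subspace_H10)
  show "dirichlet_form (u + v) w = dirichlet_form u w + dirichlet_form v w"
    if "u \<in> H10 \<Omega>" "v \<in> H10 \<Omega>" for u v w
    unfolding dirichlet_form_def by (simp add: grad_add[OF that] inner_add_left sum.distrib)
  show "dirichlet_form (c *\<^sub>R u) v = c * dirichlet_form u v" if "u \<in> H10 \<Omega>" for c u v
    unfolding dirichlet_form_def by (simp add: grad_scaleR[OF that] sum_distrib_left)
  show "dirichlet_form u v = dirichlet_form v u" for u v
    unfolding dirichlet_form_def by (simp add: inner_commute)
  show "0 \<le> dirichlet_form u u" for u unfolding dirichlet_form_def by (intro sum_nonneg) simp
  show "u = 0" if "u \<in> H10 \<Omega>" "dirichlet_form u u = 0" for u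
    using poincare_const(2)[OF that(1)] that(2) by simp
  show "\<exists>u\<in>H10 \<Omega>. (\<lambda>n. dirichlet_form (X n - u) (X n - u)) \<longlonglongrightarrow> 0"
    if "\<And>n. X n \<in> H10 \<Omega>" "\<And>e. e > 0 \<Longrightarrow> \<exists>N. \<forall>m\<ge>N. \<forall>n\<ge>N. dirichlet_form (X m - X n) (X m - X n) < e" for X
    using that by (rule H10_complete)
  show "closed (lsq_on \<Omega> :: ('a, real) lsq set)" by (rule closed_\<Omega>)
  show "subspace (lsq_on \<Omega> :: ('a, real) lsq set)" by (rule subspace_\<Omega>)
  show "H10 \<Omega> \<subseteq> lsq_on \<Omega>" by (rule H10_sub)
  show "poincare_const > 0" by (rule poincare_const(1))
  show "(norm u)\<^sup>2 \<le> poincare_const * dirichlet_form u u" if "u \<in> H10 \<Omega>" for u using that by (rule poincare_const(2))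
  show "f = 0" if "f \<in> lsq_on \<Omega>" "\<And>v. v \<in> H10 \<Omega> \<Longrightarrow> inner f v = 0" for f
    by (rule test_total[OF that(1)]) (rule that(2)[OF test_in_H10(1)])
qed

text \<open>The defining identity of the Laplacian is tested with test functions only; Green's identity extends
it to \<open>H10 \<Omega>\<close>, where it is the weak equation characterising \<open>R\<close>.\<close>

lemma dirichlet_laplacian_graph: "dirichlet_laplacian \<Omega> = op_graph"
proof (intro equalityI subsetI)
  fix p assume p: "p \<in> dirichlet_laplacian \<Omega>"
  then obtain u f where uf: "p = (u, f)" "(u, f) \<in> dirichlet_laplacian \<Omega>" by (cases p) auto
  then have u: "u \<in> H10 \<Omega>" "f \<in> lsq_on \<Omega>" by (auto simp: dirichlet_laplacian_def)
  have "u = R f"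
  proof (rule R_unique[OF u(1)])
    fix v assume v: "v \<in> H10 \<Omega>"
    obtain \<phi> where \<phi>: "\<And>k::nat. \<phi> k \<in> test_functions \<Omega>" "(\<lambda>k. lsq_class \<Omega> (\<phi> k)) \<longlonglongrightarrow> v"
      "\<And>b. b \<in> Basis \<Longrightarrow> (\<lambda>k. lsq_class \<Omega> (partial_deriv b (\<phi> k))) \<longlonglongrightarrow> grad v b"
      by (rule H10_approx_grad[OF v], rule that)
    show "dirichlet_form u v = inner f v"
      unfolding dirichlet_form_def
      by (rule dirichlet_laplacian_green[OF uf(2) H10_weak_partial[OF u(1)] \<phi>, symmetric])
  qed
  then show "p \<in> op_graph" using uf u by (auto simp: op_graph_def)
next
  fix p assume "p \<in> op_graph"
  then obtain f where f: "p = (R f, f)" "f \<in> lsq_on \<Omega>" by (auto simp: op_graph_def)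
  have "- inner (R f) (lsq_class \<Omega> (laplacian \<phi>)) = inner f (lsq_class \<Omega> \<phi>)" if \<phi>: "\<phi> \<in> test_functions \<Omega>" for \<phi>
  proof -
    have "- inner (R f) (lsq_class \<Omega> (laplacian \<phi>)) =
        (\<Sum>b\<in>Basis. - inner (R f) (lsq_class \<Omega> (partial_deriv b (partial_deriv b \<phi>))))"
      by (simp add: lsq_class_laplacian[OF \<phi>] inner_sum_right sum_negf)
    also have "\<dots> = (\<Sum>b\<in>Basis. inner (grad (R f) b) (grad (lsq_class \<Omega> \<phi>) b))"
    proof (rule sum.cong[OF refl])
      fix b :: 'a assume b: "b \<in> Basis"
      show "- inner (R f) (lsq_class \<Omega> (partial_deriv b (partial_deriv b \<phi>))) = inner (grad (R f) b) (grad (lsq_class \<Omega> \<phi>) b)"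
        using H10_weak_partial[OF R_in b, of f] test_function_partial_deriv[OF \<phi> b]
        by (simp add: weak_partial_def test_in_H10(2)[OF \<phi> b])
    qed
    also have "\<dots> = inner f (lsq_class \<Omega> \<phi>)"
      using R_eq[OF test_in_H10(1)[OF \<phi>], of f] by (simp add: dirichlet_form_def)
    finally show ?thesis .
  qed
  then show "p \<in> dirichlet_laplacian \<Omega>" using f R_in by (auto simp: dirichlet_laplacian_def)
qed

theorem H10_inner_eq:
  assumes "u \<in> H10 \<Omega>" "v \<in> H10 \<Omega>"
  shows "H10_inner \<Omega> u v = dirichlet_form u v"
  unfolding H10_inner_def A_half_def dirichlet_laplacian_graph by (rule op_sqrt_energy[OF assms])

lemma H10_norm_eq: "u \<in> H10 \<Omega> \<Longrightarrow> H10_norm \<Omega> u = sqrt (dirichlet_form u u)"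
  by (simp add: H10_norm_def H10_inner_eq)

end

section \<open>Continuous functions of time as square-integrable functions\<close>

text \<open>Sampling \<open>y\<close> at the points of a grid of width $1/(n+1)$ gives the simple functions.\<close>

lemma square_integrable_continuous:
  fixes y :: "real \<Rightarrow> 'b::real_inner"
  assumes y: "continuous_on {a..b} y"
  shows "square_integrable (\<lambda>t. if t \<in> {a..b} then y t else 0)"
proof -
  \<comment> \<open>The grid cell of \<open>t\<close>; the value \<open>-1\<close> marks points outside the interval.\<close>
  define k where "k n t = (if t \<in> {a..b} then \<lfloor>(t - a) * real (Suc n)\<rfloor> else -1)" for n t
  define g where "g n j = (if j < 0 then 0 else y (a + real_of_int j / real (Suc n)))" for n j
  have k0: "0 \<le> k n t" if "t \<in> {a..b}" for n t
    using that by (auto simp: k_def)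
  have simple: "simple_function lebesgue (\<lambda>t. g n (k n t))" for n
  proof (rule simple_function_compose1[where f = "k n" and g = "g n"])
    have "k n t \<in> {-1..\<lfloor>(b - a) * real (Suc n)\<rfloor>} \<union> {-1}" for t
    proof (cases "t \<in> {a..b}")
      case True
      then have "(t - a) * real (Suc n) \<le> (b - a) * real (Suc n)" by (intro mult_right_mono) auto
      then have "\<lfloor>(t - a) * real (Suc n)\<rfloor> \<le> \<lfloor>(b - a) * real (Suc n)\<rfloor>" by (rule floor_mono)
      then have "k n t \<le> \<lfloor>(b - a) * real (Suc n)\<rfloor>" using True by (simp only: k_def if_True)
      moreover have "-1 \<le> k n t" using k0[OF True, of n] by linarith
      ultimately show ?thesis by (intro UnI1) (simp only: atLeastAtMost_iff)
    next
      case False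
      then have "k n t = -1" unfolding k_def by (rule if_not_P)
      then show ?thesis by simp
    qed
    then have "range (k n) \<subseteq> {-1..\<lfloor>(b - a) * real (Suc n)\<rfloor>} \<union> {-1}" by blast
    then have "finite (range (k n))" by (rule finite_subset) simp
    moreover have "k n \<in> measurable lborel (count_space UNIV)"
      unfolding k_def by measurable
    then have "k n \<in> measurable lebesgue (count_space UNIV)" by (rule measurable_completion)
    ultimately show "simple_function lebesgue (k n)"
      by (simp add: simple_function_eq_measurable)
  qed
  have lim: "(\<lambda>n. g n (k n t)) \<longlonglongrightarrow> (if t \<in> {a..b} then y t else 0)" for t
  proof (cases "t \<in> {a..b}")
    case False
    then have "k n t = -1" for n unfolding k_def by (rule if_not_P)
    then have "g n (k n t) = (if t \<in> {a..b} then y t else 0)" for n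
      using False by (simp only: g_def if_False) simp
    then show ?thesis by simp
  next
    case True
    define r where "r n = a + real_of_int (k n t) / real (Suc n)" for n
    have r: "t - inverse (real (Suc n)) \<le> r n" "r n \<le> t" "a \<le> r n" for n
    proof -
      have kt: "k n t = \<lfloor>(t - a) * real (Suc n)\<rfloor>" using True by (simp add: k_def)
      have 1: "real_of_int (k n t) \<le> (t - a) * real (Suc n)" unfolding kt by (rule of_int_floor_le)
      have 2: "(t - a) * real (Suc n) - 1 \<le> real_of_int (k n t)" unfolding kt by linarith
      from 1 show "r n \<le> t" by (simp add: r_def field_simps)
      from 2 have "((t - a) * real (Suc n) - 1) / real (Suc n) \<le> real_of_int (k n t) / real (Suc n)"
        by (rule divide_right_mono) simp
      moreover have "((t - a) * real (Suc n) - 1) / real (Suc n) = (t - a) - inverse (real (Suc n))"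
        by (simp add: diff_divide_distrib inverse_eq_divide del: of_nat_Suc)
      ultimately show "t - inverse (real (Suc n)) \<le> r n" unfolding r_def by linarith
      show "a \<le> r n" using k0[OF True, of n] by (simp add: r_def)
    qed
    have "(\<lambda>n. t - inverse (real (Suc n))) \<longlonglongrightarrow> t - 0"
      by (intro tendsto_intros LIMSEQ_inverse_real_of_nat)
    then have "r \<longlonglongrightarrow> t"
      using r by (intro tendsto_sandwich[of "\<lambda>n. t - inverse (real (Suc n))" r _ "\<lambda>_. t"]) auto
    moreover have "r n \<in> {a..b}" for n using r[of n] True by auto
    ultimately have "(\<lambda>n. y (r n)) \<longlonglongrightarrow> y t"
      using y True unfolding continuous_on_sequentially by (auto simp: o_def)
    moreover have "g n (k n t) = y (r n)" for n
      using k0[OF True, of n] by (simp add: g_def r_def)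
    ultimately show ?thesis using True by simp
  qed
  have "strongly_measurable (\<lambda>t. if t \<in> {a..b} then y t else 0)"
    unfolding strongly_measurable_def by (intro exI[of _ "\<lambda>n t. g n (k n t)"] conjI allI simple always_eventually lim)
  moreover have "integrable lebesgue (\<lambda>t. (norm (if t \<in> {a..b} then y t else 0))\<^sup>2)"
  proof -
    have i: "integrable lborel (\<lambda>t. indicator {a..b} t *\<^sub>R (norm (y t))\<^sup>2)"
      by (intro borel_integrable_compact continuous_intros y) auto
    then have "integrable lebesgue (\<lambda>t. indicator {a..b} t *\<^sub>R (norm (y t))\<^sup>2)"
      by (subst integrable_completion) (auto dest: borel_measurable_integrable)
    moreover have "(\<lambda>t. indicator {a..b} t *\<^sub>R (norm (y t))\<^sup>2) = (\<lambda>t. (norm (if t \<in> {a..b} then y t else 0))\<^sup>2)"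
      by (auto simp: indicator_def)
    ultimately show ?thesis by simp
  qed
  ultimately show ?thesis by (simp add: square_integrable_def)
qed

lemma set_integral_continuous:
  fixes g :: "real \<Rightarrow> real"
  assumes "continuous_on {a..b} g"
  shows "(LINT t:{a..b}|lebesgue. g t) = integral {a..b} g"
  by (rule set_lebesgue_integral_eq_integral(2)) (rule absolutely_integrable_continuous_real[OF assms])

lemma lebesgue_AE_neq: "AE s in lebesgue. s \<noteq> (c::real)"
proof -
  have "AE s in lebesgue. s \<notin> {c}" by (rule AE_not_in) (simp add: negligible_iff_null_sets[symmetric])
  then show ?thesis by simp
qed

context
  fixes T :: real
begin

lemma class_combine:
  assumes "continuous_on {0..T} x" "continuous_on {0..T} y"
  shows "lsq_class {0..T} (\<lambda>t. x t + y t) = lsq_class {0..T} x + lsq_class {0..T} y"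
    "lsq_class {0..T} (\<lambda>t. x t - y t) = lsq_class {0..T} x - lsq_class {0..T} y"
    "lsq_class {0..T} (\<lambda>t. c *\<^sub>R x t) = c *\<^sub>R lsq_class {0..T} x"
proof -
  note sq = square_integrable_continuous[OF assms(1)] square_integrable_continuous[OF assms(2)]
  have eq: "(\<lambda>t. if t \<in> {0..T} then x t + y t else 0) = (\<lambda>t. (if t \<in> {0..T} then x t else 0) + (if t \<in> {0..T} then y t else 0))"
    "(\<lambda>t. if t \<in> {0..T} then x t - y t else 0) = (\<lambda>t. (if t \<in> {0..T} then x t else 0) - (if t \<in> {0..T} then y t else 0))"
    "(\<lambda>t. if t \<in> {0..T} then c *\<^sub>R x t else 0) = (\<lambda>t. c *\<^sub>R (if t \<in> {0..T} then x t else 0))"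
    by auto
  show "lsq_class {0..T} (\<lambda>t. x t + y t) = lsq_class {0..T} x + lsq_class {0..T} y"
    unfolding lsq_class_def eq by (rule abs_lsq_add[OF sq])
  show "lsq_class {0..T} (\<lambda>t. x t - y t) = lsq_class {0..T} x - lsq_class {0..T} y"
    unfolding lsq_class_def eq by (rule abs_lsq_diff[OF sq])
  show "lsq_class {0..T} (\<lambda>t. c *\<^sub>R x t) = c *\<^sub>R lsq_class {0..T} x"
    unfolding lsq_class_def eq by (rule abs_lsq_scaleR[OF sq(1)])
qed

lemma class_cong: "(\<And>t. t \<in> {0..T} \<Longrightarrow> x t = y t) \<Longrightarrow> lsq_class {0..T} x = lsq_class {0..T} y"
  unfolding lsq_class_def by (rule arg_cong[where f = abs_lsq]) auto

lemma class_rep: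
  assumes "continuous_on {0..T} y"
  shows "lsq_class {0..T} y \<in> lsq_on {0..T}"
    "AE t in lebesgue. rep_lsq (lsq_class {0..T} y) t = (if t \<in> {0..T} then y t else 0)"
  using lsq_class_on[OF square_integrable_continuous[OF assms]] by auto

lemma inner_class_rep:
  assumes "continuous_on {0..T} y"
  shows "inner f (lsq_class {0..T} y) = (LINT t:{0..T}|lebesgue. inner (rep_lsq f t) (y t))"
  unfolding lsq_class_def inner_rep_abs_lsq[OF square_integrable_continuous[OF assms]] set_lebesgue_integral_def
  by (rule Bochner_Integration.integral_cong) (auto simp: indicator_def)

lemma inner_class:
  assumes x: "continuous_on {0..T} x" and y: "continuous_on {0..T} y"
  shows "inner (lsq_class {0..T} x) (lsq_class {0..T} y) = integral {0..T} (\<lambda>t. inner (x t) (y t))"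
proof -
  have "inner (lsq_class {0..T} x) (lsq_class {0..T} y) = (LINT t:{0..T}|lebesgue. inner (x t) (y t))"
    unfolding lsq_class_def inner_abs_lsq[OF square_integrable_continuous[OF x] square_integrable_continuous[OF y]] set_lebesgue_integral_def
    by (rule Bochner_Integration.integral_cong) (auto simp: indicator_def)
  also have "\<dots> = integral {0..T} (\<lambda>t. inner (x t) (y t))"
    by (intro set_integral_continuous continuous_intros x y)
  finally show ?thesis .
qed

lemma norm_class:
  assumes "continuous_on {0..T} x"
  shows "(norm (lsq_class {0..T} x))\<^sup>2 = integral {0..T} (\<lambda>t. (norm (x t))\<^sup>2)"
  using inner_class[OF assms assms] by (simp add: power2_norm_eq_inner)

lemma norm_class_le:
  assumes x: "continuous_on {0..T} x" and M: "\<And>t. t \<in> {0..T} \<Longrightarrow> norm (x t) \<le> M" and T: "T \<ge> 0"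
  shows "norm (lsq_class {0..T} x) \<le> sqrt T * M"
proof -
  have M0: "M \<ge> 0" using M[of 0] T norm_ge_zero[of "x 0"] by (simp del: norm_ge_zero)
  have "(norm (lsq_class {0..T} x))\<^sup>2 \<le> integral {0..T} (\<lambda>t. M\<^sup>2)"
    unfolding norm_class[OF x]
    by (intro integral_le integrable_continuous_real continuous_intros x power_mono M) auto
  also have "\<dots> = (sqrt T * M)\<^sup>2" using T by (simp add: power_mult_distrib)
  finally show ?thesis by (rule power2_le_imp_le) (use M0 T in simp)
qed

lemma class_tendsto:
  assumes X: "\<And>n. continuous_on {0..T} (X n)" and x: "continuous_on {0..T} x" and T: "T \<ge> 0"
    and lim: "uniform_limit {0..T} X x sequentially"
  shows "(\<lambda>n::nat. lsq_class {0..T} (X n)) \<longlonglongrightarrow> lsq_class {0..T} x"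
proof (rule tendstoI)
  fix e :: real assume e: "e > 0"
  define c where "c = sqrt T + 1"
  define d where "d = e / (2 * c)"
  have c: "c > 0" using T by (simp add: c_def add_nonneg_pos)
  then have d: "d > 0" using e by (simp add: d_def)
  have "\<forall>\<^sub>F n in sequentially. \<forall>t\<in>{0..T}. dist (X n t) (x t) < d"
    using lim d by (simp add: uniform_limit_iff)
  then show "\<forall>\<^sub>F n in sequentially. dist (lsq_class {0..T} (X n)) (lsq_class {0..T} x) < e"
  proof eventually_elim
    case (elim n)
    have "norm (lsq_class {0..T} (\<lambda>t. X n t - x t)) \<le> sqrt T * d"
      using elim by (intro norm_class_le continuous_on_diff X x T) (auto simp: dist_norm less_imp_le)
    also have "\<dots> < e"
    proof -
      have "sqrt T * d \<le> c * d" using d by (intro mult_right_mono) (auto simp: c_def)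
      also have "\<dots> = e / 2" using c by (simp add: d_def)
      finally show ?thesis using e by simp
    qed
    finally show ?case by (simp add: dist_norm class_combine(2)[OF X x])
  qed
qed

end

lemma real_nonincreasing_within:
  fixes f :: "real \<Rightarrow> real"
  assumes "a \<le> b" "\<And>t. t \<in> {a..b} \<Longrightarrow> (f has_real_derivative f' t) (at t within {a..b})"
    and "\<And>t. t \<in> {a..b} \<Longrightarrow> f' t \<le> 0"
  shows "f b \<le> f a"
proof (cases "a = b")
  case False
  then have ab: "a < b" using assms(1) by simp
  have "\<exists>t\<in>{a<..<b}. f b - f a = (b - a) * f' t"
    using mvt_simple[OF ab, of f "\<lambda>t h. h * f' t"] assms(2)
    by (auto simp: has_field_derivative_def mult.commute[of "f' _"] mult_commute_abs)
  then obtain t where t: "t \<in> {a<..<b}" "f b - f a = (b - a) * f' t" by blast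
  have "(b - a) * f' t \<le> 0" using assms(3)[of t] t(1) ab by (intro mult_nonneg_nonpos) auto
  then show ?thesis using t(2) by simp
qed simp

lemma has_real_derivative_inner:
  fixes f g :: "real \<Rightarrow> 'v::real_inner"
  assumes "(f has_vector_derivative f') (at t within S)" "(g has_vector_derivative g') (at t within S)"
  shows "((\<lambda>t. inner (f t) (g t)) has_real_derivative (inner (f t) g' + inner f' (g t))) (at t within S)"
  using has_derivative_inner[OF assms[unfolded has_vector_derivative_def]]
  unfolding has_field_derivative_def
  by (rule has_derivative_eq_rhs) (auto simp: fun_eq_iff algebra_simps)

lemma has_vector_derivative_quadratic:
  fixes F :: "real \<Rightarrow> 'v::real_normed_vector"
  assumes "\<And>\<delta>. \<bar>\<delta>\<bar> \<le> 1 \<Longrightarrow> norm (F (t + \<delta>) - F t - \<delta> *\<^sub>R F') \<le> C * \<delta>\<^sup>2"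
  shows "(F has_vector_derivative F') (at t)"
  unfolding has_vector_derivative_def has_derivative_at
proof (intro conjI bounded_linear_scaleR_left)
  have C: "C \<ge> 0" using order_trans[OF norm_ge_zero assms[of 1]] by simp
  have "((\<lambda>h::real. C * norm h) \<longlongrightarrow> C * norm (0::real)) (at 0)" by (intro tendsto_intros)
  then have lim: "((\<lambda>h::real. C * norm h) \<longlongrightarrow> 0) (at 0)" by simp
  show "(\<lambda>h. norm (F (t + h) - F t - h *\<^sub>R F') / norm h) \<midarrow>0\<rightarrow> 0"
  proof (rule Lim_null_comparison[OF _ lim])
    have "\<forall>\<^sub>F h in at (0::real). \<bar>h\<bar> \<le> 1 \<and> h \<noteq> 0"
      unfolding eventually_at by (intro exI[of _ 1]) auto
    then show "\<forall>\<^sub>F h in at 0. norm (norm (F (t + h) - F t - h *\<^sub>R F') / norm h) \<le> C * norm h"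
    proof eventually_elim
      case (elim h)
      then have "norm (F (t + h) - F t - h *\<^sub>R F') \<le> (C * norm h) * norm h"
        using assms[of h] by (simp add: power2_eq_square abs_mult_self_eq mult.assoc)
      then show ?case using elim by (simp add: pos_divide_le_eq)
    qed
  qed
qed

section \<open>Truncated powers\<close>

text \<open>The iterated primitives of the Heaviside function; they are kernels for repeated integration.\<close>

definition trunc_pow :: "nat \<Rightarrow> real \<Rightarrow> real" where
  "trunc_pow n z = (max 0 z) ^ n / fact n"

lemma trunc_pow_bound2:
  "\<bar>trunc_pow 2 (z + d) - trunc_pow 2 z - d * trunc_pow 1 z\<bar> \<le> d\<^sup>2"
proof -
  have eq: "trunc_pow 2 w = (max 0 w)\<^sup>2 / 2" "trunc_pow 1 w = max 0 w" for w
    by (simp_all add: trunc_pow_def)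
  consider "z \<ge> 0" "z + d \<ge> 0" | "z < 0" "z + d \<ge> 0" | "z \<ge> 0" "z + d < 0" | "z < 0" "z + d < 0"
    by linarith
  then show ?thesis
  proof cases
    case 1
    then show ?thesis unfolding eq by (simp add: max_def power2_eq_square field_simps)
  next
    case 2
    then have "(z + d)\<^sup>2 \<le> d\<^sup>2" by (intro power_mono) auto
    moreover have "trunc_pow 2 (z + d) - trunc_pow 2 z - d * trunc_pow 1 z = (z + d)\<^sup>2 / 2"
      using 2 unfolding eq by (simp add: max_def)
    moreover have "0 \<le> (z + d)\<^sup>2" by simp
    ultimately show ?thesis by linarith
  next
    case 3
    have "z * z \<le> z * (- d)" by (rule mult_left_mono) (use 3 in auto)
    moreover have "z * (- d) \<le> (- d) * (- d)" by (rule mult_right_mono) (use 3 in auto)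
    moreover have "0 \<le> z * z" by simp
    moreover have "trunc_pow 2 (z + d) - trunc_pow 2 z - d * trunc_pow 1 z = z * (- d) - z * z / 2"
      using 3 unfolding eq by (simp add: max_def power2_eq_square)
    moreover have "(- d) * (- d) = d\<^sup>2" by (simp add: power2_eq_square)
    ultimately show ?thesis by linarith
  next
    case 4
    then show ?thesis unfolding eq by (simp add: max_def)
  qed
qed

lemma trunc_pow_bound3:
  "\<bar>trunc_pow 3 (z + d) - trunc_pow 3 z - d * trunc_pow 2 z\<bar> \<le> (\<bar>z\<bar> + \<bar>d\<bar>) * d\<^sup>2"
proof -
  have eq: "trunc_pow 3 w = (max 0 w) ^ 3 / 6" "trunc_pow 2 w = (max 0 w)\<^sup>2 / 2" for w
    by (simp_all add: trunc_pow_def fact_numeral)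
  consider "z \<ge> 0" "z + d \<ge> 0" | "z < 0" "z + d \<ge> 0" | "z \<ge> 0" "z + d < 0" | "z < 0" "z + d < 0"
    by linarith
  then show ?thesis
  proof cases
    case 1
    then have "trunc_pow 3 (z + d) - trunc_pow 3 z - d * trunc_pow 2 z = (z / 2 + d / 6) * d\<^sup>2"
      unfolding eq by (simp add: max_def power2_eq_square power3_eq_cube field_simps)
    also have "\<bar>\<dots>\<bar> = \<bar>z / 2 + d / 6\<bar> * d\<^sup>2" by (simp add: abs_mult)
    also have "\<dots> \<le> (\<bar>z\<bar> + \<bar>d\<bar>) * d\<^sup>2" by (intro mult_right_mono) auto
    finally show ?thesis .
  next
    case 2
    then have "(z + d) ^ 3 \<le> \<bar>d\<bar> ^ 3" by (intro power_mono) auto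
    also have "\<dots> = \<bar>d\<bar> * d\<^sup>2" by (simp add: power3_eq_cube power2_eq_square)
    also have "\<dots> \<le> (\<bar>z\<bar> + \<bar>d\<bar>) * d\<^sup>2" by (intro mult_right_mono) auto
    finally have "(z + d) ^ 3 \<le> (\<bar>z\<bar> + \<bar>d\<bar>) * d\<^sup>2" .
    moreover have "0 \<le> (z + d) ^ 3" using 2 by simp
    moreover have "trunc_pow 3 (z + d) - trunc_pow 3 z - d * trunc_pow 2 z = (z + d) ^ 3 / 6"
      using 2 unfolding eq by (simp add: max_def)
    ultimately show ?thesis by linarith
  next
    case 3
    have z2: "z\<^sup>2 \<le> d\<^sup>2" using 3 by (intro abs_le_square_iff[THEN iffD1]) auto
    have "trunc_pow 3 (z + d) - trunc_pow 3 z - d * trunc_pow 2 z = (- z / 6 - d / 2) * z\<^sup>2"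
      using 3 unfolding eq by (simp add: max_def power2_eq_square power3_eq_cube field_simps)
    also have "\<bar>\<dots>\<bar> = \<bar>- z / 6 - d / 2\<bar> * z\<^sup>2" by (simp add: abs_mult)
    also have "\<dots> \<le> (\<bar>z\<bar> + \<bar>d\<bar>) * d\<^sup>2" using z2 by (intro mult_mono) auto
    finally show ?thesis .
  next
    case 4
    then show ?thesis unfolding eq by (simp add: max_def)
  qed
qed

lemma trunc_pow_deriv:
  "(trunc_pow 2 has_vector_derivative trunc_pow 1 z) (at z)"
  "(trunc_pow 3 has_vector_derivative trunc_pow 2 z) (at z)"
proof -
  show "(trunc_pow 2 has_vector_derivative trunc_pow 1 z) (at z)"
    by (rule has_vector_derivative_quadratic[where C = 1]) (use trunc_pow_bound2[of z] in simp)
  show "(trunc_pow 3 has_vector_derivative trunc_pow 2 z) (at z)"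
  proof (rule has_vector_derivative_quadratic)
    show "norm (trunc_pow 3 (z + d) - trunc_pow 3 z - d *\<^sub>R trunc_pow 2 z) \<le> (\<bar>z\<bar> + 1) * d\<^sup>2"
      if "\<bar>d\<bar> \<le> 1" for d
    proof -
      have "(\<bar>z\<bar> + \<bar>d\<bar>) * d\<^sup>2 \<le> (\<bar>z\<bar> + 1) * d\<^sup>2" using that by (intro mult_right_mono) auto
      then show ?thesis using trunc_pow_bound3[of z d] by simp
    qed
  qed
qed

lemma trunc_pow_nonpos: "z \<le> 0 \<Longrightarrow> n > 0 \<Longrightarrow> trunc_pow n z = 0"
  by (simp add: trunc_pow_def max_def power_0_left)

lemma continuous_trunc_pow: "continuous_on S (\<lambda>s. trunc_pow n (s - c))"
  unfolding trunc_pow_def by (intro continuous_intros) auto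

section \<open>Strong solutions of the damped wave equation\<close>

text \<open>Solutions are written as $x = R y$, where \<open>y\<close> stands for $A x$. In terms of \<open>y\<close> the wave equation
contains bounded operators only.\<close>

locale positive_operator =
  fixes R :: "'h::{real_inner,banach} \<Rightarrow> 'h"
  assumes R_lin: "bounded_linear R" and R_symmetric: "\<And>f g. inner (R f) g = inner f (R g)"
    and R_nonnegative: "\<And>f. 0 \<le> inner (R f) f"
begin

lemma R_vector_derivative:
  "(f has_vector_derivative f') F \<Longrightarrow> ((\<lambda>t. R (f t)) has_vector_derivative R f') F"
  by (rule bounded_linear.has_vector_derivative[OF R_lin])

lemma R_continuous_on: "continuous_on S f \<Longrightarrow> continuous_on S (\<lambda>t. R (f t))"
  by (rule bounded_linear.continuous_on[OF R_lin])

lemmas R_simps = bounded_linear.linear[OF R_lin, THEN linear_add] bounded_linear.linear[OF R_lin, THEN linear_scale]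
  bounded_linear.linear[OF R_lin, THEN linear_0] bounded_linear.linear[OF R_lin, THEN linear_diff]

definition C2 :: "(real \<Rightarrow> 'h) \<Rightarrow> (real \<Rightarrow> 'h) \<Rightarrow> (real \<Rightarrow> 'h) \<Rightarrow> bool" where
  "C2 y y1 y2 \<longleftrightarrow> (\<forall>t. (y has_vector_derivative y1 t) (at t)) \<and>
     (\<forall>t. (y1 has_vector_derivative y2 t) (at t)) \<and> continuous_on UNIV y2"

text \<open>$\ddot x + \dot x + x + A x$ for $x = R y$.\<close>

definition source :: "(real \<Rightarrow> 'h) \<Rightarrow> (real \<Rightarrow> 'h) \<Rightarrow> (real \<Rightarrow> 'h) \<Rightarrow> real \<Rightarrow> 'h" where
  "source y y1 y2 t = R (y2 t) + R (y1 t) + R (y t) + y t"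

lemma C2_continuous:
  assumes "C2 y y1 y2"
  shows "continuous_on S y" "continuous_on S y1" "continuous_on S y2" "continuous_on S (source y y1 y2)"
proof -
  show y: "continuous_on S y" "continuous_on S y1" for S
    using assms unfolding C2_def
    by (auto intro!: continuous_at_imp_continuous_on has_vector_derivative_continuous)
  show y2: "continuous_on S y2" for S
    using assms unfolding C2_def by (auto intro: continuous_on_subset)
  show "continuous_on S (source y y1 y2)"
    unfolding source_def by (intro continuous_on_add R_continuous_on y y2)
qed

lemma C2_combination:
  assumes "C2 y y1 y2" "C2 z z1 z2"
  shows "C2 (\<lambda>t. y t + c *\<^sub>R z t) (\<lambda>t. y1 t + c *\<^sub>R z1 t) (\<lambda>t. y2 t + c *\<^sub>R z2 t)"
    "source (\<lambda>t. y t + c *\<^sub>R z t) (\<lambda>t. y1 t + c *\<^sub>R z1 t) (\<lambda>t. y2 t + c *\<^sub>R z2 t)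
      = (\<lambda>t. source y y1 y2 t + c *\<^sub>R source z z1 z2 t)"
proof -
  have s: "((\<lambda>t. c *\<^sub>R f t) has_vector_derivative c *\<^sub>R f') (at t)" if "(f has_vector_derivative f') (at t)" for f :: "real \<Rightarrow> 'h" and f' t
    by (rule bounded_linear.has_vector_derivative[OF bounded_linear_scaleR_right that])
  show "C2 (\<lambda>t. y t + c *\<^sub>R z t) (\<lambda>t. y1 t + c *\<^sub>R z1 t) (\<lambda>t. y2 t + c *\<^sub>R z2 t)"
    using assms unfolding C2_def by (auto intro!: has_vector_derivative_add s continuous_intros)
  show "source (\<lambda>t. y t + c *\<^sub>R z t) (\<lambda>t. y1 t + c *\<^sub>R z1 t) (\<lambda>t. y2 t + c *\<^sub>R z2 t)
      = (\<lambda>t. source y y1 y2 t + c *\<^sub>R source z z1 z2 t)"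
    by (auto simp: source_def R_simps algebra_simps)
qed

text \<open>Multiplying the equation by $2 \dot x + x$ produces the functional \<open>\<Phi>\<close>. The term
$\langle \dot x, x\rangle$ turns the dissipation of $\dot x$ into dissipation of the whole energy, and
$\frac32 |x|^2$ makes \<open>\<Phi>\<close> dominate \<open>D(x) + |x'|\<^sup>2 / 2\<close>. The bound on the integral does not grow with \<open>T\<close>.\<close>

lemma energy_estimate:
  assumes y: "C2 y y1 y2" and T: "T > 0"
  defines "K \<equiv> 3/2 * (norm (R (y1 0)))\<^sup>2 + inner (R (y 0)) (y 0) + 2 * (norm (R (y 0)))\<^sup>2
      + 3 * (norm (lsq_class {0..T} (source y y1 y2)))\<^sup>2"
  shows "t \<in> {0..T} \<Longrightarrow> inner (R (y t)) (y t) + 1/2 * (norm (R (y1 t)))\<^sup>2 \<le> K"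
    "integral {0..T} (\<lambda>t. inner (R (y t)) (y t) + 1/2 * (norm (R (y1 t)))\<^sup>2) \<le> K"
proof -
  let ?f = "source y y1 y2"
  define \<Phi> where "\<Phi> t = inner (R (y1 t)) (R (y1 t)) + inner (R (y t)) (y t) + 3/2 * inner (R (y t)) (R (y t))
      + inner (R (y1 t)) (R (y t))" for t
  define e where "e t = inner (R (y t)) (y t) + 1/2 * (norm (R (y1 t)))\<^sup>2" for t
  define h where "h t = 3 * (norm (?f t))\<^sup>2 - e t" for t
  have d: "(y has_vector_derivative y1 t) (at t)" "(y1 has_vector_derivative y2 t) (at t)" for t
    using y by (auto simp: C2_def)
  note c = C2_continuous[OF y]
  have ce: "continuous_on S e" for S unfolding e_def by (intro continuous_intros R_continuous_on c)
  have ch: "continuous_on S h" for S unfolding h_def by (intro continuous_intros c ce)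
  have e0: "0 \<le> e t" for t unfolding e_def by (simp add: R_nonnegative)
  have \<Phi>': "(\<Phi> has_real_derivative
      (2 * inner (R (y1 t)) (R (y2 t)) + 2 * inner (R (y1 t)) (y t) + 3 * inner (R (y1 t)) (R (y t))
        + inner (R (y1 t)) (R (y1 t)) + inner (R (y2 t)) (R (y t)))) (at t)" for t
  proof -
    note r = R_vector_derivative[OF d(1)[of t]] R_vector_derivative[OF d(2)[of t]]
    have "(\<Phi> has_real_derivative
      (inner (R (y1 t)) (R (y2 t)) + inner (R (y2 t)) (R (y1 t))) + (inner (R (y t)) (y1 t) + inner (R (y1 t)) (y t))
      + 3/2 * (inner (R (y t)) (R (y1 t)) + inner (R (y1 t)) (R (y t)))
      + (inner (R (y1 t)) (R (y1 t)) + inner (R (y2 t)) (R (y t)))) (at t)"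
      unfolding \<Phi>_def
      by (intro DERIV_add DERIV_cmult has_real_derivative_inner r d)
    moreover have "inner (R (y t)) (y1 t) = inner (R (y1 t)) (y t)"
      using R_symmetric[of "y t" "y1 t"] by (simp add: inner_commute)
    ultimately show ?thesis
      by (simp add: inner_commute[of "R (y2 t)" "R (y1 t)"] inner_commute[of "R (y t)" "R (y1 t)"] add.assoc)
  qed
  have \<Phi>'_le: "2 * inner (R (y1 t)) (R (y2 t)) + 2 * inner (R (y1 t)) (y t) + 3 * inner (R (y1 t)) (R (y t))
        + inner (R (y1 t)) (R (y1 t)) + inner (R (y2 t)) (R (y t)) \<le> h t" for t
  proof -
    define x1 where "x1 = R (y1 t)"
    define x where "x = R (y t)"
    define f where "f = ?f t"
    have x2: "R (y2 t) = f - x1 - x - y t" by (simp add: f_def source_def x_def x1_def)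
    have "2 * inner x1 (R (y2 t)) + 2 * inner x1 (y t) + 3 * inner x1 x + inner x1 x1 + inner (R (y2 t)) x
      = 2 * inner x1 f + inner f x - inner x1 x1 - inner x x - inner x (y t)"
      unfolding x2 by (simp add: inner_diff_left inner_diff_right inner_commute)
    \<comment> \<open>Young's inequality for the two terms containing \<open>f\<close>.\<close>
    moreover have "0 \<le> inner (x1 - 2 *\<^sub>R f) (x1 - 2 *\<^sub>R f)" "0 \<le> inner (f - x) (f - x)" by simp_all
    then have "4 * inner x1 f \<le> inner x1 x1 + 4 * inner f f" "2 * inner f x \<le> inner f f + inner x x"
      by (simp_all add: inner_diff_left inner_diff_right inner_commute)
    moreover have "0 \<le> inner f f" "0 \<le> inner x x" by simp_all
    moreover have "h t = 3 * inner f f - inner x (y t) - 1/2 * inner x1 x1"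
      by (simp add: h_def e_def f_def x_def x1_def power2_norm_eq_inner)
    ultimately show ?thesis unfolding x1_def[symmetric] x_def[symmetric] by linarith
  qed
  have main: "\<Phi> t + integral {0..t} e \<le> \<Phi> 0 + 3 * integral {0..t} (\<lambda>s. (norm (?f s))\<^sup>2)" if t: "t \<ge> 0" for t
  proof -
    have "(\<lambda>s. \<Phi> s - integral {0..s} h) t \<le> (\<lambda>s. \<Phi> s - integral {0..s} h) 0"
    proof (rule real_nonincreasing_within[OF t])
      fix s assume s: "s \<in> {0..t}"
      have "((\<lambda>u. integral {0..u} h) has_real_derivative h s) (at s within {0..t})"
        using integral_has_vector_derivative[OF ch s]
        by (simp add: has_real_derivative_iff_has_vector_derivative)
      then show "((\<lambda>s. \<Phi> s - integral {0..s} h) has_real_derivative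
          ((2 * inner (R (y1 s)) (R (y2 s)) + 2 * inner (R (y1 s)) (y s) + 3 * inner (R (y1 s)) (R (y s))
        + inner (R (y1 s)) (R (y1 s)) + inner (R (y2 s)) (R (y s))) - h s)) (at s within {0..t})"
        by (intro DERIV_diff has_field_derivative_at_within[OF \<Phi>'])
      show "(2 * inner (R (y1 s)) (R (y2 s)) + 2 * inner (R (y1 s)) (y s) + 3 * inner (R (y1 s)) (R (y s))
        + inner (R (y1 s)) (R (y1 s)) + inner (R (y2 s)) (R (y s))) - h s \<le> 0"
        using \<Phi>'_le[of s] by simp
    qed
    moreover have "integral {0..t} h = 3 * integral {0..t} (\<lambda>s. (norm (?f s))\<^sup>2) - integral {0..t} e"
      unfolding h_def
      by (subst integral_diff) (auto intro!: integrable_continuous_real continuous_intros c ce)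
    ultimately show ?thesis by simp
  qed
  have \<Phi>0: "\<Phi> 0 \<le> 3/2 * (norm (R (y1 0)))\<^sup>2 + inner (R (y 0)) (y 0) + 2 * (norm (R (y 0)))\<^sup>2"
  proof -
    have "0 \<le> inner (R (y1 0) - R (y 0)) (R (y1 0) - R (y 0))" by simp
    then have "2 * inner (R (y1 0)) (R (y 0)) \<le> inner (R (y1 0)) (R (y1 0)) + inner (R (y 0)) (R (y 0))"
      by (simp add: inner_diff_left inner_diff_right inner_commute)
    then show ?thesis unfolding \<Phi>_def power2_norm_eq_inner by linarith
  qed
  have e_le: "e t \<le> \<Phi> t" for t
  proof -
    have "0 \<le> inner (R (y1 t) + R (y t)) (R (y1 t) + R (y t))" by simp
    then have "0 \<le> inner (R (y1 t)) (R (y1 t)) + 2 * inner (R (y1 t)) (R (y t)) + inner (R (y t)) (R (y t))"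
      by (simp add: inner_add_left inner_add_right inner_commute)
    moreover have "0 \<le> inner (R (y t)) (R (y t))" by simp
    ultimately show ?thesis unfolding \<Phi>_def e_def power2_norm_eq_inner by linarith
  qed
  have f_le: "integral {0..t} (\<lambda>s. (norm (?f s))\<^sup>2) \<le> (norm (lsq_class {0..T} ?f))\<^sup>2" if "t \<in> {0..T}" for t
    unfolding norm_class[OF c(4)] using that
    by (intro integral_subset_le integrable_continuous_real continuous_intros c) auto
  show "inner (R (y t)) (y t) + 1/2 * (norm (R (y1 t)))\<^sup>2 \<le> K" if t: "t \<in> {0..T}"
  proof -
    have "0 \<le> integral {0..t} e" by (intro integral_nonneg integrable_continuous_real ce e0)
    then show ?thesis
      using main[of t] t \<Phi>0 e_le[of t] f_le[OF t] unfolding K_def e_def[symmetric] by auto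
  qed
  have "0 \<le> \<Phi> T" using order_trans[OF e0 e_le] .
  then have "integral {0..T} e \<le> K"
    using main[of T] T \<Phi>0 f_le[of T] unfolding K_def by auto
  then show "integral {0..T} (\<lambda>t. inner (R (y t)) (y t) + 1/2 * (norm (R (y1 t)))\<^sup>2) \<le> K"
    by (simp only: e_def[abs_def])
qed

text \<open>Pairing the equation with \<open>2 q1\<close> shows that \<open>e\<close> below does not increase. The term \<open>inner (q s) (q s)\<close>
in it controls \<open>q\<close> also on the kernel of \<open>R\<close>.\<close>

lemma homogeneous_ode_zero:
  assumes q: "\<And>t. t \<in> {0..T} \<Longrightarrow> (q has_vector_derivative q1 t) (at t within {0..T})"
      "\<And>t. t \<in> {0..T} \<Longrightarrow> (q1 has_vector_derivative q2 t) (at t within {0..T})"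
    and eq: "\<And>t. t \<in> {0..T} \<Longrightarrow> R (q2 t) + R (q1 t) + R (q t) + q t = 0"
    and init: "q 0 = 0" "q1 0 = 0" and t: "t \<in> {0..T}"
  shows "q t = 0"
proof -
  define e where "e s = inner (R (q1 s)) (q1 s) + inner (R (q s)) (q s) + inner (q s) (q s)" for s
  have "e t \<le> e 0"
  proof (rule real_nonincreasing_within[where f = e and a = 0 and b = t and f' = "\<lambda>s. - 2 * inner (R (q1 s)) (q1 s)"])
    show "0 \<le> t" using t by simp
    fix s assume s: "s \<in> {0..t}"
    then have sT: "s \<in> {0..T}" and sub: "{0..t} \<subseteq> {0..T}" using t by auto
    note d = has_vector_derivative_within_subset[OF q(1)[OF sT] sub] has_vector_derivative_within_subset[OF q(2)[OF sT] sub]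
    have "(e has_real_derivative (inner (R (q1 s)) (q2 s) + inner (R (q2 s)) (q1 s))
        + (inner (R (q s)) (q1 s) + inner (R (q1 s)) (q s)) + (inner (q s) (q1 s) + inner (q1 s) (q s))) (at s within {0..t})"
      unfolding e_def by (intro DERIV_add has_real_derivative_inner R_vector_derivative d)
    moreover have "(inner (R (q1 s)) (q2 s) + inner (R (q2 s)) (q1 s))
        + (inner (R (q s)) (q1 s) + inner (R (q1 s)) (q s)) + (inner (q s) (q1 s) + inner (q1 s) (q s))
        = 2 * inner (R (q2 s) + R (q s) + q s) (q1 s)"
    proof -
      have "inner (R (q1 s)) (q2 s) = inner (R (q2 s)) (q1 s)" "inner (R (q1 s)) (q s) = inner (R (q s)) (q1 s)"
        by (metis R_symmetric inner_commute)+
      then show ?thesis by (simp add: inner_add_left inner_commute[of "q1 s" "q s"])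
    qed
    moreover have "R (q2 s) + R (q s) + q s = - R (q1 s)"
      unfolding eq_neg_iff_add_eq_0 using eq[OF sT] by (simp add: algebra_simps)
    ultimately show "(e has_real_derivative - 2 * inner (R (q1 s)) (q1 s)) (at s within {0..t})"
      by (simp only:) simp
    show "- 2 * inner (R (q1 s)) (q1 s) \<le> 0" by (simp add: R_nonnegative)
  qed
  moreover have "e 0 = 0" by (simp add: e_def init)
  moreover have "inner (q t) (q t) \<le> e t" by (simp add: e_def R_nonnegative)
  ultimately have "inner (q t) (q t) \<le> 0" by simp
  then have "inner (q t) (q t) = 0" by (intro order_antisym inner_ge_zero)
  then show ?thesis by (simp only: inner_eq_zero_iff)
qed

end

section \<open>Density of the sources of strong solutions\<close>

text \<open>The integral $\int_0^T k(s)\, g(s)\, ds$ with values in \<open>'h\<close>, obtained as a Riesz representative.\<close>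

definition weighted_integral :: "real \<Rightarrow> (real, 'h::{real_inner,banach}) lsq \<Rightarrow> (real \<Rightarrow> real) \<Rightarrow> 'h" where
  "weighted_integral T g k = (SOME z. \<forall>h. inner z h = inner g (lsq_class {0..T} (\<lambda>s. k s *\<^sub>R h)))"

context
  fixes T :: real and g :: "(real, 'h::{real_inner,banach}) lsq"
  assumes T: "T > 0"
begin

lemma weighted_integral_inner:
  assumes k: "continuous_on {0..T} k"
  shows "inner (weighted_integral T g k) h = inner g (lsq_class {0..T} (\<lambda>s. k s *\<^sub>R h))"
proof -
  have c: "continuous_on {0..T} (\<lambda>s. k s *\<^sub>R h)" for h :: 'h by (intro continuous_intros k)
  obtain M where "\<And>x. x \<in> k ` {0..T} \<Longrightarrow> norm x \<le> M"
    using compact_imp_bounded[OF compact_continuous_image[OF k compact_Icc]] unfolding bounded_iff by blast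
  then have M: "\<bar>k s\<bar> \<le> M" if "s \<in> {0..T}" for s
    using that by fastforce
  have bl: "bounded_linear (\<lambda>h. inner g (lsq_class {0..T} (\<lambda>s. k s *\<^sub>R h)))"
  proof (rule bounded_linear_intro)
    show "inner g (lsq_class {0..T} (\<lambda>s. k s *\<^sub>R (h + h'))) =
        inner g (lsq_class {0..T} (\<lambda>s. k s *\<^sub>R h)) + inner g (lsq_class {0..T} (\<lambda>s. k s *\<^sub>R h'))" for h h'
      by (simp only: scaleR_add_right class_combine(1)[OF c c] inner_add_right)
    show "inner g (lsq_class {0..T} (\<lambda>s. k s *\<^sub>R (r *\<^sub>R h))) = r *\<^sub>R inner g (lsq_class {0..T} (\<lambda>s. k s *\<^sub>R h))" for r h
    proof -
      have "(\<lambda>s. k s *\<^sub>R (r *\<^sub>R h)) = (\<lambda>s. r *\<^sub>R (k s *\<^sub>R h))" by (rule ext) (rule scaleR_left_commute)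
      then show ?thesis by (simp only: class_combine(3)[OF c c] inner_scaleR_right real_scaleR_def)
    qed
    show "norm (inner g (lsq_class {0..T} (\<lambda>s. k s *\<^sub>R h))) \<le> norm h * (norm g * (sqrt T * M))" for h
    proof -
      have "norm (lsq_class {0..T} (\<lambda>s. k s *\<^sub>R h)) \<le> sqrt T * (M * norm h)"
        by (intro norm_class_le c) (use T M in \<open>auto intro: mult_right_mono\<close>)
      then have "norm g * norm (lsq_class {0..T} (\<lambda>s. k s *\<^sub>R h)) \<le> norm g * (sqrt T * (M * norm h))"
        by (intro mult_left_mono) auto
      then show ?thesis
        using order_trans[OF Cauchy_Schwarz_ineq2] by (simp add: mult.commute mult.left_commute)
    qed
  qed
  obtain z where "\<And>h. inner z h = inner g (lsq_class {0..T} (\<lambda>s. k s *\<^sub>R h))"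
    by (rule riesz_inner[OF bl], rule that)
  then have "\<exists>z. \<forall>h. inner z h = inner g (lsq_class {0..T} (\<lambda>s. k s *\<^sub>R h))" by blast
  from someI_ex[OF this] show ?thesis unfolding weighted_integral_def by blast
qed

lemma weighted_integral_expand:
  assumes "continuous_on {0..T} k" "continuous_on {0..T} k'" "continuous_on {0..T} k''"
  shows "weighted_integral T g (\<lambda>s. k s - k' s - c * k'' s)
    = weighted_integral T g k - weighted_integral T g k' - c *\<^sub>R weighted_integral T g k''"
proof -
  have cc: "continuous_on {0..T} (\<lambda>s. k s - k' s - c * k'' s)" by (intro continuous_intros assms)
  have c: "continuous_on {0..T} (\<lambda>s. k s *\<^sub>R h)" "continuous_on {0..T} (\<lambda>s. k' s *\<^sub>R h)" "continuous_on {0..T} (\<lambda>s. k'' s *\<^sub>R h)"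
     "continuous_on {0..T} (\<lambda>s. k s *\<^sub>R h - k' s *\<^sub>R h)" "continuous_on {0..T} (\<lambda>s. c *\<^sub>R (k'' s *\<^sub>R h))" for h :: 'h
    by (intro continuous_intros assms)+
  have "inner (weighted_integral T g (\<lambda>s. k s - k' s - c * k'' s)) h =
     inner (weighted_integral T g k - weighted_integral T g k' - c *\<^sub>R weighted_integral T g k'') h" for h
  proof -
    have "(\<lambda>s. (k s - k' s - c * k'' s) *\<^sub>R h) = (\<lambda>s. (k s *\<^sub>R h - k' s *\<^sub>R h) - c *\<^sub>R (k'' s *\<^sub>R h))"
      by (simp add: scaleR_diff_left)
    then show ?thesis
      by (simp only: weighted_integral_inner[OF cc] inner_diff_left inner_scaleR_left
          weighted_integral_inner[OF assms(1)] weighted_integral_inner[OF assms(2)] weighted_integral_inner[OF assms(3)]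
          class_combine(2)[OF c(4) c(5)] class_combine(2)[OF c(1) c(2)] class_combine(3)[OF c(3) c(3)]
          inner_diff_right inner_scaleR_right)
  qed
  then have "\<forall>h. inner (weighted_integral T g (\<lambda>s. k s - k' s - c * k'' s)) h =
     inner (weighted_integral T g k - weighted_integral T g k' - c *\<^sub>R weighted_integral T g k'') h" ..
  then show ?thesis by (rule vector_eq_rdot[THEN iffD1])
qed

lemma weighted_integral_norm:
  assumes k: "continuous_on {0..T} k" and M: "\<And>s. s \<in> {0..T} \<Longrightarrow> \<bar>k s\<bar> \<le> M"
  shows "norm (weighted_integral T g k) \<le> norm g * sqrt T * M"
proof (cases "weighted_integral T g k = 0")
  case True
  have "M \<ge> 0" using order_trans[OF abs_ge_zero M[of 0]] T by simp
  then show ?thesis using True T by simp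
next
  case False
  let ?z = "weighted_integral T g k"
  have "norm ?z * norm ?z = inner g (lsq_class {0..T} (\<lambda>s. k s *\<^sub>R ?z))"
    using weighted_integral_inner[OF k, of ?z] by (simp add: power2_norm_eq_inner[symmetric] power2_eq_square)
  also have "\<dots> \<le> norm g * norm (lsq_class {0..T} (\<lambda>s. k s *\<^sub>R ?z))" by (rule norm_cauchy_schwarz)
  also have "\<dots> \<le> norm g * (sqrt T * (M * norm ?z))"
    by (intro mult_left_mono norm_class_le continuous_intros k) (use T M in \<open>auto intro: mult_right_mono\<close>)
  finally have "norm ?z * norm ?z \<le> (norm g * sqrt T * M) * norm ?z" by (simp add: mult.assoc)
  then show ?thesis using False by simp
qed

text \<open>The \<open>(n + 1)\<close>-fold primitive of \<open>g\<close> with time running backwards from \<open>T\<close>.\<close>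

definition moment :: "nat \<Rightarrow> real \<Rightarrow> 'h" where
  "moment n t = weighted_integral T g (\<lambda>s. trunc_pow n (s - (T - t)))"

lemma moment_inner: "inner (moment n t) h = inner g (lsq_class {0..T} (\<lambda>s. trunc_pow n (s - (T - t)) *\<^sub>R h))"
  unfolding moment_def by (rule weighted_integral_inner[OF continuous_trunc_pow])

text \<open>A uniform quadratic Taylor bound for the kernels carries over to the integrals by the
Cauchy-Schwarz inequality.\<close>

lemma moment_derivative:
  assumes bound: "\<And>z d. \<bar>d\<bar> \<le> 1 \<Longrightarrow> \<bar>trunc_pow m (z + d) - trunc_pow m z - d * trunc_pow n z\<bar> \<le> (\<bar>z\<bar> + 1) * d\<^sup>2"
  shows "(moment m has_vector_derivative moment n t) (at t)"
proof (rule has_vector_derivative_quadratic)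
  fix d :: real assume d: "\<bar>d\<bar> \<le> 1"
  let ?k = "\<lambda>s. trunc_pow m (s - (T - (t + d))) - trunc_pow m (s - (T - t)) - d * trunc_pow n (s - (T - t))"
  have eq: "moment m (t + d) - moment m t - d *\<^sub>R moment n t = weighted_integral T g ?k"
    unfolding moment_def by (rule weighted_integral_expand[symmetric]) (rule continuous_trunc_pow)+
  have "norm (weighted_integral T g ?k) \<le> norm g * sqrt T * ((2 * T + \<bar>t\<bar> + 1) * d\<^sup>2)"
  proof (rule weighted_integral_norm)
    show "continuous_on {0..T} ?k" by (intro continuous_intros continuous_trunc_pow)
    fix s assume s: "s \<in> {0..T}"
    have z: "s - (T - (t + d)) = (s - (T - t)) + d" by simp
    have "\<bar>?k s\<bar> \<le> (\<bar>s - (T - t)\<bar> + 1) * d\<^sup>2"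
      unfolding z by (rule bound[OF d])
    also have "\<dots> \<le> (2 * T + \<bar>t\<bar> + 1) * d\<^sup>2" using s by (intro mult_right_mono) auto
    finally show "\<bar>?k s\<bar> \<le> (2 * T + \<bar>t\<bar> + 1) * d\<^sup>2" .
  qed
  then show "norm (moment m (t + d) - moment m t - d *\<^sub>R moment n t) \<le> (norm g * sqrt T * (2 * T + \<bar>t\<bar> + 1)) * d\<^sup>2"
    unfolding eq by (simp add: mult.assoc)
qed

lemma moment_derivatives:
  "(moment 2 has_vector_derivative moment 1 t) (at t)" "(moment 3 has_vector_derivative moment 2 t) (at t)"
proof -
  show "(moment 2 has_vector_derivative moment 1 t) (at t)"
  proof (rule moment_derivative)
    fix z d :: real
    have "1 * d\<^sup>2 \<le> (\<bar>z\<bar> + 1) * d\<^sup>2" by (intro mult_right_mono) auto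
    then show "\<bar>trunc_pow 2 (z + d) - trunc_pow 2 z - d * trunc_pow 1 z\<bar> \<le> (\<bar>z\<bar> + 1) * d\<^sup>2"
      using trunc_pow_bound2[of z d] by simp
  qed
  show "(moment 3 has_vector_derivative moment 2 t) (at t)"
  proof (rule moment_derivative)
    fix z d :: real assume "\<bar>d\<bar> \<le> 1"
    then have "(\<bar>z\<bar> + \<bar>d\<bar>) * d\<^sup>2 \<le> (\<bar>z\<bar> + 1) * d\<^sup>2" by (intro mult_right_mono) auto
    then show "\<bar>trunc_pow 3 (z + d) - trunc_pow 3 z - d * trunc_pow 2 z\<bar> \<le> (\<bar>z\<bar> + 1) * d\<^sup>2"
      using trunc_pow_bound3[of z d] by simp
  qed
qed

lemma moment_initial: "n > 0 \<Longrightarrow> moment n 0 = 0"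
proof -
  assume n: "n > 0"
  have "inner (moment n 0) h = 0" for h
  proof -
    have "lsq_class {0..T} (\<lambda>s. trunc_pow n (s - (T - 0)) *\<^sub>R h) = lsq_class {0..T} (\<lambda>s. 0 *\<^sub>R h)"
      by (rule class_cong) (simp add: trunc_pow_nonpos[OF _ n])
    also have "\<dots> = 0" by (simp add: lsq_class_def zero_lsq_def)
    finally show ?thesis by (simp add: moment_inner)
  qed
  then show ?thesis by (rule inner_eq_zero_iff[THEN iffD1])
qed

text \<open>Difference quotients of $a \mapsto (s - a)_+$ converge boundedly to the indicator of $s > a$. So \<open>g\<close> has
integral zero over half-lines, hence over intervals.\<close>

lemma first_moment_determines:
  assumes supp: "g \<in> lsq_on {0..T}" and zero: "\<And>t. t \<in> {0..T} \<Longrightarrow> moment 1 t = 0"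
  shows "g = 0"
proof (rule lsq_zero_weak)
  fix h :: 'h
  define G where "G s = inner (rep_lsq g s) (indicator {0..T} s *\<^sub>R h)" for s
  have lm: "{0..T} \<in> lmeasurable" using lmeasurable_cbox[of 0 T] by simp
  have G: "integrable lebesgue G"
    unfolding G_def by (rule square_integrable_inner[OF square_integrable_rep square_integrable_indicator[OF lm]])
  have Gm: "G \<in> borel_measurable lebesgue" using G by (rule borel_measurable_integrable)
  note null = lebesgue_AE_neq
  have k0: "(\<integral>s. trunc_pow 1 (s - a) * G s \<partial>lebesgue) = 0" if a: "a \<in> {0..T}" for a
  proof -
    have "inner (moment 1 (T - a)) h = 0" using zero[of "T - a"] a by simp
    then have "(LINT s:{0..T}|lebesgue. inner (rep_lsq g s) (trunc_pow 1 (s - a) *\<^sub>R h)) = 0"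
      by (subst (asm) moment_inner, subst (asm) inner_class_rep) (auto intro!: continuous_intros continuous_trunc_pow)
    moreover have "(LINT s:{0..T}|lebesgue. inner (rep_lsq g s) (trunc_pow 1 (s - a) *\<^sub>R h)) = (\<integral>s. trunc_pow 1 (s - a) * G s \<partial>lebesgue)"
      unfolding set_lebesgue_integral_def by (rule Bochner_Integration.integral_cong) (auto simp: G_def indicator_def)
    ultimately show ?thesis by simp
  qed
  have ki: "integrable lebesgue (\<lambda>s. trunc_pow 1 (s - a) * G s)" for a
  proof -
    have c: "continuous_on {0..T} (\<lambda>s. trunc_pow 1 (s - a) *\<^sub>R h)" by (intro continuous_intros continuous_trunc_pow)
    have "integrable lebesgue (\<lambda>s. inner (rep_lsq g s) (if s \<in> {0..T} then trunc_pow 1 (s - a) *\<^sub>R h else 0))"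
      by (rule square_integrable_inner[OF square_integrable_rep square_integrable_continuous[OF c]])
    moreover have "(\<lambda>s. inner (rep_lsq g s) (if s \<in> {0..T} then trunc_pow 1 (s - a) *\<^sub>R h else 0)) = (\<lambda>s. trunc_pow 1 (s - a) * G s)"
      by (auto simp: G_def indicator_def)
    ultimately show ?thesis by simp
  qed
  have tail0: "(\<integral>s. indicator {a<..} s * G s \<partial>lebesgue) = 0" if a: "0 \<le> a" "a < T" for a
  proof -
    define \<epsilon> where "\<epsilon> n = (T - a) * inverse (real (Suc n))" for n
    have \<epsilon>: "\<epsilon> n > 0" "a + \<epsilon> n \<le> T" for n
    proof -
      show "\<epsilon> n > 0" using a by (simp add: \<epsilon>_def)
      have "(T - a) * inverse (real (Suc n)) \<le> (T - a) * 1"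
        using a by (intro mult_left_mono) (auto simp: inverse_le_1_iff)
      then show "a + \<epsilon> n \<le> T" by (simp add: \<epsilon>_def)
    qed
    define w where "w n s = (trunc_pow 1 (s - a) - trunc_pow 1 (s - (a + \<epsilon> n))) / \<epsilon> n" for n s
    have w_bound: "0 \<le> w n s" "w n s \<le> 1" for n s
      using \<epsilon>(1)[of n] by (auto simp: w_def trunc_pow_def max_def field_simps)
    have "(\<lambda>n. \<integral>s. w n s * G s \<partial>lebesgue) \<longlonglongrightarrow> (\<integral>s. indicator {a<..} s * G s \<partial>lebesgue)"
    proof (rule integral_dominated_convergence[where w = "\<lambda>s. norm (G s)"])
      show "(\<lambda>s. indicator {a<..} s * G s) \<in> borel_measurable lebesgue"
        by (intro borel_measurable_times borel_measurable_indicator Gm) auto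
      show "(\<lambda>s. w n s * G s) \<in> borel_measurable lebesgue" for n
      proof (intro borel_measurable_times Gm)
        have "w n \<in> borel_measurable borel"
          unfolding w_def by (intro borel_measurable_continuous_onI continuous_intros continuous_trunc_pow) (use \<epsilon>(1)[of n] in auto)
        then show "w n \<in> borel_measurable lebesgue" by (intro measurable_completion) simp
      qed
      show "integrable lebesgue (\<lambda>s. norm (G s))" using G by (rule integrable_norm)
      show "AE s in lebesgue. norm (w n s * G s) \<le> norm (G s)" for n
        using w_bound[of n] by (intro always_eventually allI) (auto simp: abs_mult intro!: mult_left_le_one_le)
      show "AE s in lebesgue. (\<lambda>n. w n s * G s) \<longlonglongrightarrow> indicator {a<..} s * G s"
      proof (intro always_eventually allI)
        fix s
        have "(\<lambda>n. w n s) \<longlonglongrightarrow> indicator {a<..} s"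
        proof (cases "a < s")
          case True
          have "(\<lambda>n. (T - a) * inverse (real (Suc n))) \<longlonglongrightarrow> (T - a) * 0"
            by (intro tendsto_intros LIMSEQ_inverse_real_of_nat)
          then have "\<forall>\<^sub>F n in sequentially. \<epsilon> n < s - a"
            unfolding \<epsilon>_def by (intro order_tendstoD) (use True in auto)
          then have "\<forall>\<^sub>F n in sequentially. 1 = w n s"
          proof eventually_elim
            case (elim n)
            then have "max 0 (s - a) = s - a" "max 0 (s - (a + \<epsilon> n)) = s - (a + \<epsilon> n)" using True by auto
            then show ?case using \<epsilon>(1)[of n] by (simp add: w_def trunc_pow_def)
          qed
          from Lim_transform_eventually[OF tendsto_const this] show ?thesis using True by simp
        next
          case False
          then have "w n s = 0" for n
            using \<epsilon>(1)[of n] by (simp add: w_def trunc_pow_def max_def)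
          then show ?thesis using False by simp
        qed
        then show "(\<lambda>n. w n s * G s) \<longlonglongrightarrow> indicator {a<..} s * G s" by (intro tendsto_mult tendsto_const)
      qed
    qed
    moreover have "(\<integral>s. w n s * G s \<partial>lebesgue) = 0" for n
    proof -
      have "(\<lambda>s. w n s * G s) = (\<lambda>s. (trunc_pow 1 (s - a) * G s - trunc_pow 1 (s - (a + \<epsilon> n)) * G s) / \<epsilon> n)"
        by (simp add: w_def left_diff_distrib)
      then show ?thesis using k0[of a] k0[of "a + \<epsilon> n"] ki a \<epsilon>[of n] by (simp add: less_imp_le)
    qed
    ultimately show ?thesis by (simp add: LIMSEQ_const_iff)
  qed
  have tail: "(\<integral>s. indicator {a<..} s * G s \<partial>lebesgue) = 0" for a
  proof -
    consider "a < 0" | "0 \<le> a" "a < T" | "T \<le> a" by linarith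
    then show ?thesis
    proof cases
      case 1
      have "(\<integral>s. indicator {a<..} s * G s \<partial>lebesgue) = (\<integral>s. indicator {0<..} s * G s \<partial>lebesgue)"
      proof (rule integral_cong_AE)
        show "AE s in lebesgue. indicator {a<..} s * G s = indicator {0<..} s * G s"
          using null[of 0] by eventually_elim (use 1 in \<open>auto simp: G_def indicator_def\<close>)
      qed (intro borel_measurable_times borel_measurable_indicator Gm; simp)+
      then show ?thesis using tail0[of 0] T by simp
    next
      case 2
      then show ?thesis by (rule tail0)
    next
      case 3
      then have "(\<lambda>s. indicator {a<..} s * G s) = (\<lambda>s. 0)" by (auto simp: G_def indicator_def)
      then show ?thesis by simp
    qed
  qed
  have ti: "integrable lebesgue (\<lambda>s. indicator {a<..} s * G s)" for a
    using integrable_mult_indicator[OF _ G, of "{a<..}"] by simp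
  have "AE s in lebesgue. G s = 0"
  proof (rule set_integral_zero_on_boxes[OF G])
    fix a b :: real
    show "(LINT s:box a b|lebesgue. G s) = 0"
    proof (cases "a < b")
      case True
      have "(LINT s:box a b|lebesgue. G s) = (\<integral>s. indicator {a<..} s * G s - indicator {b<..} s * G s \<partial>lebesgue)"
        unfolding set_lebesgue_integral_def
      proof (rule integral_cong_AE)
        show "AE s in lebesgue. indicator (box a b) s *\<^sub>R G s = indicator {a<..} s * G s - indicator {b<..} s * G s"
          using null[of b] by eventually_elim (use True in \<open>auto simp: indicator_def box_real\<close>)
        show "(\<lambda>s. indicat_real (box a b) s *\<^sub>R G s) \<in> borel_measurable lebesgue"
          by (intro borel_measurable_scaleR borel_measurable_indicator Gm fmeasurableD lmeasurable_box)
        show "(\<lambda>s. indicat_real {a<..} s * G s - indicat_real {b<..} s * G s) \<in> borel_measurable lebesgue"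
          by (intro borel_measurable_diff borel_measurable_integrable ti)
      qed
      then show ?thesis using ti by (simp add: tail)
    next
      case False
      then show ?thesis by (simp add: set_lebesgue_integral_def box_real)
    qed
  qed
  moreover have "AE s in lebesgue. s \<notin> {0..T} \<longrightarrow> rep_lsq g s = 0"
    using supp by (simp only: lsq_on_def mem_Collect_eq)
  ultimately show "AE s in lebesgue. inner (rep_lsq g s) h = 0"
  proof eventually_elim
    case (elim s)
    then show ?case by (cases "s \<in> {0..T}") (auto simp: G_def)
  qed
qed

end

context positive_operator
begin

lemma trunc_pow_C2:
  "C2 (\<lambda>s. trunc_pow 3 (s - c) *\<^sub>R h) (\<lambda>s. trunc_pow 2 (s - c) *\<^sub>R h) (\<lambda>s. trunc_pow 1 (s - c) *\<^sub>R h)"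
proof -
  have s: "((\<lambda>s. f (s - c) *\<^sub>R h) has_vector_derivative f' *\<^sub>R h) (at t)"
    if "(f has_vector_derivative f') (at (t - c))" for f :: "real \<Rightarrow> real" and f' t
  proof -
    have "((\<lambda>s. s - c) has_real_derivative 1) (at t)" by (auto intro!: derivative_eq_intros)
    moreover have "(f has_real_derivative f') (at (t - c))"
      using that by (simp add: has_real_derivative_iff_has_vector_derivative)
    ultimately have "((\<lambda>s. f (s - c)) has_real_derivative f' * 1) (at t)" by (intro DERIV_chain2)
    from has_vector_derivative_scaleR[OF this has_vector_derivative_const[of h]] show ?thesis by simp
  qed
  show ?thesis unfolding C2_def
    by (intro conjI allI s trunc_pow_deriv continuous_intros continuous_trunc_pow)
qed

text \<open>A function \<open>g\<close> orthogonal to all sources is tested with $y(s) = (s - (T - t))_+^3 / 6 \cdot h$, which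
has zero initial data. By symmetry of \<open>R\<close> this says that the third moment of \<open>g\<close> solves
$R \ddot q + R \dot q + R q + q = 0$. It has zero initial values, so it vanishes, and with it the
first moment.\<close>

theorem sources_dense:
  assumes T: "T > 0"
  shows "lsq_on {0..T} \<subseteq> closure {lsq_class {0..T} (source y y1 y2) |y y1 y2. C2 y y1 y2 \<and> y 0 = 0 \<and> y1 0 = 0}"
    (is "_ \<subseteq> closure ?M")
proof (rule dense_if_orthogonal_trivial_inner)
  have m: "{0..T} \<in> sets lebesgue" by simp
  show "closed (lsq_on {0..T} :: (real, 'h) lsq set)" by (rule closed_lsq_on[OF m])
  show "subspace (lsq_on {0..T} :: (real, 'h) lsq set)" by (rule subspace_lsq_on[OF m])
  show "?M \<subseteq> lsq_on {0..T}" using class_rep(1) C2_continuous(4) by blast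
  have comb: "lsq_class {0..T} (source y y1 y2) + c *\<^sub>R lsq_class {0..T} (source z z1 z2) \<in> ?M"
    if y: "C2 y y1 y2" "y 0 = 0" "y1 0 = 0" and z: "C2 z z1 z2" "z 0 = 0" "z1 0 = 0" for y y1 y2 z z1 z2 c
  proof -
    note cy = C2_continuous(4)[OF y(1), of "{0..T}"] and cz = C2_continuous(4)[OF z(1), of "{0..T}"]
    have cz': "continuous_on {0..T} (\<lambda>t. c *\<^sub>R source z z1 z2 t)" by (intro continuous_intros cz)
    have "lsq_class {0..T} (source y y1 y2) + c *\<^sub>R lsq_class {0..T} (source z z1 z2) =
      lsq_class {0..T} (source (\<lambda>t. y t + c *\<^sub>R z t) (\<lambda>t. y1 t + c *\<^sub>R z1 t) (\<lambda>t. y2 t + c *\<^sub>R z2 t))"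
      unfolding C2_combination(2)[OF y(1) z(1)] class_combine(1)[OF cy cz'] class_combine(3)[OF cz cz] ..
    then show ?thesis using C2_combination(1)[OF y(1) z(1), of c] y z by (simp, metis (mono_tags, lifting) add_0 scaleR_zero_right)
  qed
  have C20: "C2 (\<lambda>_. 0) (\<lambda>_. 0) (\<lambda>_. 0)" by (simp add: C2_def)
  have z0: "lsq_class {0..T} (source (\<lambda>_. 0) (\<lambda>_. 0) (\<lambda>_. 0)) = 0"
  proof -
    have "source (\<lambda>_. 0) (\<lambda>_. 0) (\<lambda>_. 0) = (\<lambda>_. 0)" by (rule ext) (simp add: source_def R_simps)
    then show ?thesis by (simp add: lsq_class_def zero_lsq_def)
  qed
  show "subspace ?M"
    unfolding subspace_def
  proof (intro conjI ballI allI)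
    show "0 \<in> ?M" using C20 z0 by (metis (mono_tags, lifting) mem_Collect_eq)
    fix a b assume a: "a \<in> ?M" and b: "b \<in> ?M"
    then show "a + b \<in> ?M" using comb[where c = 1] by fastforce
  next
    fix c a assume a: "a \<in> ?M"
    then show "c *\<^sub>R a \<in> ?M" using comb[OF C20 refl refl, where c = c] z0 by fastforce
  qed
  fix g :: "(real, 'h) lsq" assume supp: "g \<in> lsq_on {0..T}" and ortho: "\<And>m. m \<in> ?M \<Longrightarrow> inner g m = 0"
  have memb: "lsq_class {0..T} (source y y1 y2) \<in> ?M" if "C2 y y1 y2" "y 0 = 0" "y1 0 = 0" for y y1 y2
    using that by blast
  let ?Q = "moment T g"
  have eq: "R (?Q 1 t) + R (?Q 2 t) + R (?Q 3 t) + ?Q 3 t = 0" if t: "t \<in> {0..T}" for t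
  proof -
    have "inner (R (?Q 1 t) + R (?Q 2 t) + R (?Q 3 t) + ?Q 3 t) h = 0" for h
    proof -
      define k where "k n s = trunc_pow n (s - (T - t))" for n s
      have k: "continuous_on {0..T} (\<lambda>s. k n s *\<^sub>R v)" for n and v :: 'h
        unfolding k_def by (intro continuous_intros continuous_trunc_pow)
      have s1: "continuous_on {0..T} (\<lambda>s. k 1 s *\<^sub>R R h + k 2 s *\<^sub>R R h)"
        by (intro continuous_on_add k)
      have s2: "continuous_on {0..T} (\<lambda>s. k 1 s *\<^sub>R R h + k 2 s *\<^sub>R R h + k 3 s *\<^sub>R R h)"
        by (intro continuous_on_add k)
      have "C2 (\<lambda>s. k 3 s *\<^sub>R h) (\<lambda>s. k 2 s *\<^sub>R h) (\<lambda>s. k 1 s *\<^sub>R h)"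
        unfolding k_def by (rule trunc_pow_C2)
      moreover have "k 3 0 *\<^sub>R h = 0" "k 2 0 *\<^sub>R h = 0" using t by (simp_all add: k_def trunc_pow_nonpos)
      ultimately have "lsq_class {0..T} (source (\<lambda>s. k 3 s *\<^sub>R h) (\<lambda>s. k 2 s *\<^sub>R h) (\<lambda>s. k 1 s *\<^sub>R h)) \<in> ?M"
        by (rule memb)
      moreover have "source (\<lambda>s. k 3 s *\<^sub>R h) (\<lambda>s. k 2 s *\<^sub>R h) (\<lambda>s. k 1 s *\<^sub>R h) =
          (\<lambda>s. k 1 s *\<^sub>R R h + k 2 s *\<^sub>R R h + k 3 s *\<^sub>R R h + k 3 s *\<^sub>R h)"
        by (rule ext) (simp only: source_def R_simps)
      ultimately have "inner g (lsq_class {0..T} (\<lambda>s. k 1 s *\<^sub>R R h + k 2 s *\<^sub>R R h + k 3 s *\<^sub>R R h + k 3 s *\<^sub>R h)) = 0"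
        using ortho by (simp only:)
      then have "inner g (lsq_class {0..T} (\<lambda>s. k 1 s *\<^sub>R R h)) + inner g (lsq_class {0..T} (\<lambda>s. k 2 s *\<^sub>R R h))
          + inner g (lsq_class {0..T} (\<lambda>s. k 3 s *\<^sub>R R h)) + inner g (lsq_class {0..T} (\<lambda>s. k 3 s *\<^sub>R h)) = 0"
        by (simp only: class_combine(1)[OF s2 k] class_combine(1)[OF s1 k] class_combine(1)[OF k k] inner_add_right)
      then show ?thesis
        by (simp add: inner_add_left R_symmetric moment_inner[OF T] k_def)
    qed
    then show ?thesis by (rule inner_eq_zero_iff[THEN iffD1])
  qed
  note d = moment_derivatives[OF T, of g, THEN has_vector_derivative_at_within]
  have zeroder: "q1 t = 0" if "\<And>t. t \<in> {0..T} \<Longrightarrow> q t = 0" "\<And>t. (q has_vector_derivative q1 t) (at t within {0..T})" "t \<in> {0..T}"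
    for q q1 :: "real \<Rightarrow> 'h" and t
  proof -
    have "((\<lambda>_. 0) has_vector_derivative q1 t) (at t within {0..T})"
      by (rule has_vector_derivative_transform[OF that(3) _ that(2)]) (use that(1) in simp)
    moreover have "((\<lambda>_. 0 :: 'h) has_vector_derivative 0) (at t within {0..T})" by simp
    ultimately show ?thesis
      using vector_derivative_unique_within_closed_interval[of 0 T t "\<lambda>_. 0" "q1 t" 0] T that(3) by simp
  qed
  have "?Q 3 t = 0" if "t \<in> {0..T}" for t
    by (rule homogeneous_ode_zero[OF d(2) d(1) eq moment_initial[OF T] moment_initial[OF T] that]) auto
  then have "?Q 2 t = 0" if "t \<in> {0..T}" for t by (rule zeroder[OF _ d(2) that])
  then have "?Q 1 t = 0" if "t \<in> {0..T}" for t by (rule zeroder[OF _ d(1) that])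
  then show "g = 0" by (rule first_moment_determines[OF T supp])
qed

end

section \<open>Test functions of time\<close>

lemma test_deriv:
  fixes \<phi> :: "real \<Rightarrow> real"
  assumes "\<phi> \<in> test_functions S"
  shows "deriv \<phi> \<in> test_functions S" "(\<phi> has_real_derivative deriv \<phi> t) (at t)"
proof -
  show d: "(\<phi> has_real_derivative deriv \<phi> t) (at t)" for t
    by (simp add: DERIV_deriv_iff_real_differentiable test_function_props(2)[OF assms])
  have "partial_deriv 1 \<phi> = deriv \<phi>"
    by (rule ext) (simp add: partial_deriv_real[OF d])
  then show "deriv \<phi> \<in> test_functions S"
    using test_function_partial_deriv[OF assms, of 1] by simp
qed

lemma test_continuous: "\<phi> \<in> test_functions S \<Longrightarrow> continuous_on A \<phi>"
  using test_function_props(1) continuous_on_subset by blast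

lemma test_endpoints:
  fixes \<phi> :: "real \<Rightarrow> real"
  assumes "\<phi> \<in> test_functions {0<..<T}" "t \<notin> {0<..<T}"
  shows "\<phi> t = 0"
proof -
  obtain K where K: "compact K" "K \<subseteq> {0<..<T}" "\<And>x. x \<notin> K \<Longrightarrow> \<phi> x = 0"
    by (rule test_function_support[OF assms(1)], rule that)
  have "t \<notin> K" using K(2) assms(2) by blast
  then show ?thesis by (rule K(3))
qed

lemma test_by_parts:
  fixes \<phi> u u1 :: "real \<Rightarrow> real"
  assumes T: "T > 0" and \<phi>: "\<phi> \<in> test_functions {0<..<T}"
    and u: "\<And>t. t \<in> {0..T} \<Longrightarrow> (u has_real_derivative u1 t) (at t within {0..T})"
    and u1: "continuous_on {0..T} u1"
  shows "integral {0..T} (\<lambda>t. deriv \<phi> t * u t) = - integral {0..T} (\<lambda>t. \<phi> t * u1 t)"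
proof -
  have cu: "continuous_on {0..T} u"
    unfolding continuous_on_eq_continuous_within by (intro ballI) (rule DERIV_continuous[OF u])
  note c = test_continuous[OF \<phi>] test_continuous[OF test_deriv(1)[OF \<phi>]]
  have "((\<lambda>t. deriv \<phi> t * u t + \<phi> t * u1 t) has_integral (\<phi> T * u T - \<phi> 0 * u 0)) {0..T}"
  proof (rule fundamental_theorem_of_calculus)
    fix t assume t: "t \<in> {0..T}"
    have "((\<lambda>t. \<phi> t * u t) has_real_derivative (deriv \<phi> t * u t + u1 t * \<phi> t)) (at t within {0..T})"
      by (rule DERIV_mult[OF has_field_derivative_at_within[OF test_deriv(2)[OF \<phi>]] u[OF t]])
    then show "((\<lambda>t. \<phi> t * u t) has_vector_derivative (deriv \<phi> t * u t + \<phi> t * u1 t)) (at t within {0..T})"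
      by (simp add: has_real_derivative_iff_has_vector_derivative mult.commute)
  qed (use T in simp)
  then have "((\<lambda>t. deriv \<phi> t * u t + \<phi> t * u1 t) has_integral 0) {0..T}"
    using test_endpoints[OF \<phi>, of 0] test_endpoints[OF \<phi>, of T] by simp
  then have "integral {0..T} (\<lambda>t. deriv \<phi> t * u t + \<phi> t * u1 t) = 0" by (rule integral_unique)
  moreover have "integral {0..T} (\<lambda>t. deriv \<phi> t * u t + \<phi> t * u1 t)
      = integral {0..T} (\<lambda>t. deriv \<phi> t * u t) + integral {0..T} (\<lambda>t. \<phi> t * u1 t)"
    by (rule Henstock_Kurzweil_Integration.integral_add) (intro integrable_continuous_real continuous_intros c cu u1)+
  ultimately show ?thesis by simp
qed

lemma time_zero_by_tests:
  fixes f :: "(real, real) lsq"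
  assumes f: "f \<in> lsq_on {0..T}"
    and zero: "\<And>\<phi>. \<phi> \<in> test_functions {0<..<T} \<Longrightarrow> inner f (lsq_class {0..T} \<phi>) = 0"
  shows "AE t in lebesgue. rep_lsq f t = 0"
proof -
  have "AE t in lebesgue. t \<in> {0<..<T} \<longrightarrow> rep_lsq f t = 0"
  proof (rule test_functions_orthogonal)
    fix \<phi> :: "real \<Rightarrow> real" assume \<phi>: "\<phi> \<in> test_functions {0<..<T}"
    have "(\<lambda>t. if t \<in> {0<..<T} then \<phi> t else 0) = (\<lambda>t. if t \<in> {0..T} then \<phi> t else 0)"
      using test_endpoints[OF \<phi>] by (intro ext) auto
    then show "inner f (lsq_class {0<..<T} \<phi>) = 0" using zero[OF \<phi>] by (simp add: lsq_class_def)
  qed simp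
  moreover have "AE t in lebesgue. t \<notin> {0..T} \<longrightarrow> rep_lsq f t = 0"
    using f by (simp only: lsq_on_def mem_Collect_eq)
  ultimately show ?thesis using lebesgue_AE_neq[of 0] lebesgue_AE_neq[of T]
  proof eventually_elim
    case (elim t)
    then show ?case by (cases "t \<in> {0..T}") auto
  qed
qed

lemma continuous_zero_by_tests:
  fixes c :: "real \<Rightarrow> real"
  assumes T: "T > 0" and c: "continuous_on {0..T} c"
    and zero: "\<And>\<phi>. \<phi> \<in> test_functions {0<..<T} \<Longrightarrow> integral {0..T} (\<lambda>t. \<phi> t * c t) = 0"
    and t: "t \<in> {0..T}"
  shows "c t = 0"
proof -
  let ?f = "lsq_class {0..T} c"
  have "AE t in lebesgue. rep_lsq ?f t = 0"
  proof (rule time_zero_by_tests[OF class_rep(1)[OF c]])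
    fix \<phi> :: "real \<Rightarrow> real" assume \<phi>: "\<phi> \<in> test_functions {0<..<T}"
    show "inner ?f (lsq_class {0..T} \<phi>) = 0"
      using inner_class[OF c test_continuous[OF \<phi>]] zero[OF \<phi>] by (simp add: mult.commute)
  qed
  then have "abs_lsq (rep_lsq ?f) = abs_lsq (\<lambda>x. 0)"
    by (simp add: abs_lsq_eq_iff square_integrable_rep square_integrable_zero)
  then have "?f = 0" by (simp add: abs_rep_lsq zero_lsq_def)
  then have "integral {0..T} (\<lambda>t. (norm (c t))\<^sup>2) = 0" using norm_class[OF c] by simp
  then have "\<forall>t\<in>{0..T}. (norm (c t))\<^sup>2 = 0"
    by (subst (asm) integral_eq_0_iff) (auto intro!: continuous_intros c T)
  then show ?thesis using t by simp
qed

text \<open>The primitive vanishing on the left of the support is constant on the right of it, and that constant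
is the mean.\<close>

lemma test_primitive:
  fixes \<psi> :: "real \<Rightarrow> real"
  assumes T: "T > 0" and \<psi>: "\<psi> \<in> test_functions {0<..<T}" and mean: "integral {0..T} \<psi> = 0"
  obtains \<phi> where "\<phi> \<in> test_functions {0<..<T}" "deriv \<phi> = \<psi>"
proof -
  obtain K where K: "compact K" "K \<subseteq> {0<..<T}" "\<And>x. x \<notin> K \<Longrightarrow> \<psi> x = 0"
    by (rule test_function_support[OF \<psi>], rule that)
  obtain a b where ab: "0 < a" "a \<le> b" "b < T" "K \<subseteq> {a..b}"
  proof (cases "K = {}")
    case True
    then show ?thesis using that[of "T/2" "T/2"] T by simp
  next
    case False
    obtain a b where "a \<in> K" "\<forall>x\<in>K. a \<le> x" "b \<in> K" "\<forall>x\<in>K. x \<le> b"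
      using compact_attains_inf[OF K(1) False] compact_attains_sup[OF K(1) False] by metis
    then show ?thesis using K(2) by (intro that[of a b]) auto
  qed
  have z: "\<psi> x = 0" if "x \<notin> {a..b}" for x using K(3) ab(4) that by blast
  have c: "continuous_on A \<psi>" for A by (rule test_continuous[OF \<psi>])
  \<comment> \<open>The base point \<open>-1\<close> lies to the left of the support, so that 0 is an interior point.\<close>
  define \<phi> where "\<phi> t = integral {-1..t} \<psi>" for t
  have left: "\<phi> t = 0" if "t < a" for t
  proof -
    have "integral {-1..t} \<psi> = integral {-1..t} (\<lambda>_. 0)"
      by (rule Henstock_Kurzweil_Integration.integral_cong) (use that in \<open>auto intro!: z\<close>)
    then show ?thesis by (simp add: \<phi>_def)
  qed
  have "\<phi> T = 0"
  proof -
    have "\<phi> T = integral {-1..0} \<psi> + integral {0..T} \<psi>"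
      unfolding \<phi>_def using T by (intro Henstock_Kurzweil_Integration.integral_combine[symmetric] integrable_continuous_real c) auto
    then show ?thesis using left[of 0] ab mean by (simp add: \<phi>_def)
  qed
  have right: "\<phi> t = 0" if "t > b" for t
  proof -
    have zr: "integral {s..r} \<psi> = 0" if "b < s" for s r
    proof -
      have "integral {s..r} \<psi> = integral {s..r} (\<lambda>_. 0)"
        by (rule Henstock_Kurzweil_Integration.integral_cong) (use that in \<open>auto intro!: z\<close>)
      then show ?thesis by simp
    qed
    have t1: "- 1 < t" "-1 < T" using that ab by linarith+
      show ?thesis
      proof (cases "t \<le> T")
        case True
        have "\<phi> T = \<phi> t + integral {t..T} \<psi>"
          unfolding \<phi>_def by (rule Henstock_Kurzweil_Integration.integral_combine[symmetric]) (use True t1 in \<open>simp_all add: integrable_continuous_real c\<close>)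
        then show ?thesis using zr[OF that] \<open>\<phi> T = 0\<close> by simp
      next
        case False
        have "\<phi> t = \<phi> T + integral {T..t} \<psi>"
          unfolding \<phi>_def by (rule Henstock_Kurzweil_Integration.integral_combine[symmetric]) (use False t1 in \<open>simp_all add: integrable_continuous_real c\<close>)
        then show ?thesis using zr[OF ab(3)] \<open>\<phi> T = 0\<close> by simp
      qed
  qed
  have d: "(\<phi> has_real_derivative \<psi> t) (at t)" for t
  proof (cases "t > -1")
    case True
    have "((\<lambda>u. integral {-1..u} \<psi>) has_vector_derivative \<psi> t) (at t within {-1..t + 1})"
      using True by (intro integral_has_vector_derivative c) auto
    moreover have "t \<in> interior {-1..t + 1}" using True by simp
    then have "at t within {-1..t + 1} = at t" by (rule at_within_interior)
    ultimately show ?thesis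
      unfolding \<phi>_def[abs_def] has_real_derivative_iff_has_vector_derivative by (simp only:)
  next
    case False
    have "((\<lambda>_. 0) has_real_derivative 0) (at t)" by (rule DERIV_const)
    then have "(\<phi> has_real_derivative 0) (at t)"
    proof (rule has_field_derivative_transform_within_open[where S = "{..<0}"])
      show "t \<in> {..<0}" using False by simp
      show "0 = \<phi> s" if "s \<in> {..<0}" for s using left[of s] that ab(1) by simp
    qed simp
    moreover have "\<psi> t = 0" using False ab(1) by (intro z) auto
    ultimately show ?thesis by simp
  qed
  have deriv: "deriv \<phi> = \<psi>" by (rule ext) (rule DERIV_imp_deriv[OF d])
  have pd: "partial_deriv 1 \<phi> = \<psi>" by (rule ext) (simp add: partial_deriv_real[OF d])
  have "C_k (Suc k) \<phi>" for k
    using test_function_props(3)[OF \<psi>, of k] pd d by (auto simp: real_differentiable_def)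
  then have "C_k k \<phi>" for k by (rule C_k_Suc)
  then have "\<phi> \<in> test_functions {0<..<T}"
    by (rule test_functionI[where K = "{a..b}"]) (use ab left right in \<open>auto simp: not_le\<close>)
  then show thesis using deriv by (rule that)
qed

text \<open>Every test function differs from a derivative of a test function by a multiple of the fixed bump
\<open>\<rho>\<close>, so \<open>c\<close> minus its \<open>\<rho>\<close>-average \<open>k\<close> is orthogonal to all test functions.\<close>

lemma du_Bois_Reymond:
  fixes c :: "real \<Rightarrow> real"
  assumes T: "T > 0" and c: "continuous_on {0..T} c"
    and zero: "\<And>\<phi>. \<phi> \<in> test_functions {0<..<T} \<Longrightarrow> integral {0..T} (\<lambda>t. deriv \<phi> t * c t) = 0"
    and t: "t \<in> {0..T}"
  shows "c t = c 0"
proof -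
  define \<rho> where "\<rho> = box_bump (T/4) (T/2) 0"
  have \<rho>: "\<rho> \<in> test_functions {0<..<T}"
    unfolding \<rho>_def using T by (intro box_bump_test) auto
  have c\<rho>: "continuous_on {0..T} \<rho>" by (rule test_continuous[OF \<rho>])
  define I where "I = integral {0..T} \<rho>"
  have I: "I \<noteq> 0"
  proof
    assume "I = 0"
    have "0 \<le> \<rho> s" for s unfolding \<rho>_def by (simp add: box_bump_bounds)
    with \<open>I = 0\<close> have "\<forall>t\<in>{0..T}. \<rho> t = 0"
      unfolding I_def by (subst (asm) integral_eq_0_iff) (auto intro!: c\<rho> T)
    moreover have "\<rho> (3/8 * T) \<noteq> 0" unfolding \<rho>_def box_bump_support using T by (simp add: box_real)
    ultimately show False using T by auto
  qed
  define k where "k = integral {0..T} (\<lambda>t. \<rho> t * c t) / I"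
  have ck: "c s - k = 0" if s: "s \<in> {0..T}" for s
  proof (rule continuous_zero_by_tests[OF T _ _ s])
    show "continuous_on {0..T} (\<lambda>s. c s - k)" by (intro continuous_intros c)
    fix \<psi> :: "real \<Rightarrow> real" assume \<psi>: "\<psi> \<in> test_functions {0<..<T}"
    note c\<psi> = test_continuous[OF \<psi>, of "{0..T}"]
    define m where "m = - integral {0..T} \<psi> / I"
    have \<chi>: "(\<lambda>x. \<psi> x + m * \<rho> x) \<in> test_functions {0<..<T}" by (rule test_function_combination[OF \<psi> \<rho>])
    have "integral {0..T} (\<lambda>x. \<psi> x + m * \<rho> x) = integral {0..T} \<psi> + m * I"
      unfolding I_def by (subst Henstock_Kurzweil_Integration.integral_add)
        (auto intro!: integrable_continuous_real continuous_intros c\<psi> c\<rho>)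
    then have m0: "integral {0..T} (\<lambda>x. \<psi> x + m * \<rho> x) = 0" using I by (simp add: m_def)
    obtain \<phi> where \<phi>: "\<phi> \<in> test_functions {0<..<T}" "deriv \<phi> = (\<lambda>x. \<psi> x + m * \<rho> x)"
      by (rule test_primitive[OF T \<chi> m0], rule that)
    have "0 = integral {0..T} (\<lambda>t. \<psi> t * c t + m * (\<rho> t * c t))"
      using zero[OF \<phi>(1)] unfolding \<phi>(2) by (simp add: algebra_simps)
    also have "\<dots> = integral {0..T} (\<lambda>t. \<psi> t * c t) + m * integral {0..T} (\<lambda>t. \<rho> t * c t)"
      by (subst Henstock_Kurzweil_Integration.integral_add)
        (auto intro!: integrable_continuous_real continuous_intros c\<psi> c\<rho> c)
    also have "m * integral {0..T} (\<lambda>t. \<rho> t * c t) = - k * integral {0..T} \<psi>"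
      by (simp add: m_def k_def)
    finally have "integral {0..T} (\<lambda>t. \<psi> t * c t) - k * integral {0..T} \<psi> = 0" by simp
    moreover have "integral {0..T} (\<lambda>t. \<psi> t * (c t - k)) = integral {0..T} (\<lambda>t. \<psi> t * c t) - k * integral {0..T} \<psi>"
      unfolding right_diff_distrib by (subst Henstock_Kurzweil_Integration.integral_diff)
        (auto intro!: integrable_continuous_real continuous_intros c\<psi> c)
    ultimately show "integral {0..T} (\<lambda>t. \<psi> t * (c t - k)) = 0" by simp
  qed
  show ?thesis using ck[OF t] ck[of 0] T by simp
qed

section \<open>The weak formulation\<close>

context bounded_domain
begin

sublocale positive_operator R
  by (rule positive_operator.intro[OF R_linear R_sym R_nonneg])

abbreviation "C \<equiv> poincare_const"

text \<open>The regularity in \<open>E_space\<close> with the energy norm written through the form and the time derivative made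
explicit.\<close>

definition energy_class :: "real \<Rightarrow> (real \<Rightarrow> ('a, real) lsq) \<Rightarrow> (real \<Rightarrow> ('a, real) lsq) \<Rightarrow> bool" where
  "energy_class T x x1 \<longleftrightarrow> (\<forall>t\<in>{0..T}. x t \<in> H10 \<Omega>) \<and>
     (\<forall>t\<in>{0..T}. ((\<lambda>s. dirichlet_form (x s - x t) (x s - x t)) \<longlongrightarrow> 0) (at t within {0..T})) \<and>
     (\<forall>t\<in>{0..T}. (x has_vector_derivative x1 t) (at t within {0..T})) \<and> continuous_on {0..T} x1"

lemma energy_classD:
  assumes "energy_class T x x1"
  shows "t \<in> {0..T} \<Longrightarrow> x t \<in> H10 \<Omega>"
    "t \<in> {0..T} \<Longrightarrow> (x has_vector_derivative x1 t) (at t within {0..T})"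
    "continuous_on {0..T} x1" "continuous_on {0..T} x"
    "t \<in> {0..T} \<Longrightarrow> ((\<lambda>s. dirichlet_form (x s - x t) (x s - x t)) \<longlongrightarrow> 0) (at t within {0..T})"
proof -
  show d: "t \<in> {0..T} \<Longrightarrow> (x has_vector_derivative x1 t) (at t within {0..T})" for t
    using assms by (simp add: energy_class_def)
  then show "continuous_on {0..T} x"
    unfolding continuous_on_eq_continuous_within by (intro ballI has_vector_derivative_continuous)
qed (use assms in \<open>simp_all add: energy_class_def\<close>)

lemma energy_class_form_continuous:
  assumes x: "energy_class T x x1" and v: "v \<in> H10 \<Omega>"
  shows "continuous_on {0..T} (\<lambda>t. dirichlet_form (x t) v)"
  unfolding continuous_on_def
proof
  fix t assume t: "t \<in> {0..T}"
  have "((\<lambda>s. sqrt (dirichlet_form (x s - x t) (x s - x t) * dirichlet_form v v)) \<longlongrightarrow> sqrt (0 * dirichlet_form v v)) (at t within {0..T})"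
    by (intro tendsto_intros energy_classD(5)[OF x t])
  then have lim: "((\<lambda>s. sqrt (dirichlet_form (x s - x t) (x s - x t) * dirichlet_form v v)) \<longlongrightarrow> 0) (at t within {0..T})" by simp
  have "((\<lambda>s. dirichlet_form (x s) v - dirichlet_form (x t) v) \<longlongrightarrow> 0) (at t within {0..T})"
  proof (rule Lim_null_comparison[OF _ lim])
    show "\<forall>\<^sub>F s in at t within {0..T}. norm (dirichlet_form (x s) v - dirichlet_form (x t) v) \<le> sqrt (dirichlet_form (x s - x t) (x s - x t) * dirichlet_form v v)"
      unfolding eventually_at_filter
    proof (intro always_eventually allI impI)
      fix s assume "s \<noteq> t" and s: "s \<in> {0..T}"
      note H = energy_classD(1)[OF x s] energy_classD(1)[OF x t]
      show "norm (dirichlet_form (x s) v - dirichlet_form (x t) v) \<le> sqrt (dirichlet_form (x s - x t) (x s - x t) * dirichlet_form v v)"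
        using D_Cauchy_Schwarz[OF V_ops(3)[OF H] v] by (simp add: D_diff_left[OF H v] real_le_rsqrt)
    qed
  qed
  then show "((\<lambda>t. dirichlet_form (x t) v) \<longlongrightarrow> dirichlet_form (x t) v) (at t within {0..T})"
    by (simp add: LIM_zero_iff)
qed

lemma energy_class_energy_continuous:
  assumes x: "energy_class T x x1"
  shows "continuous_on {0..T} (\<lambda>t. dirichlet_form (x t) (x t))"
  unfolding continuous_on_def
proof
  fix t assume t: "t \<in> {0..T}"
  note Ht = energy_classD(1)[OF x t]
  have "((\<lambda>s. dirichlet_form (x s) (x t)) \<longlongrightarrow> dirichlet_form (x t) (x t)) (at t within {0..T})"
    using energy_class_form_continuous[OF x Ht] t by (simp add: continuous_on_def)
  then have "((\<lambda>s. dirichlet_form (x s - x t) (x s - x t) + 2 * dirichlet_form (x s) (x t) - dirichlet_form (x t) (x t))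
      \<longlongrightarrow> 0 + 2 * dirichlet_form (x t) (x t) - dirichlet_form (x t) (x t)) (at t within {0..T})"
    by (intro tendsto_intros energy_classD(5)[OF x t])
  then have "((\<lambda>s. dirichlet_form (x s - x t) (x s - x t) + 2 * dirichlet_form (x s) (x t) - dirichlet_form (x t) (x t))
      \<longlongrightarrow> dirichlet_form (x t) (x t)) (at t within {0..T})" by simp
  moreover have "\<forall>\<^sub>F s in at t within {0..T}. dirichlet_form (x s - x t) (x s - x t) + 2 * dirichlet_form (x s) (x t) - dirichlet_form (x t) (x t)
      = dirichlet_form (x s) (x s)"
    unfolding eventually_at_filter
  proof (intro always_eventually allI impI)
    fix s assume "s \<noteq> t" and s: "s \<in> {0..T}"
    note Hs = energy_classD(1)[OF x s]
    show "dirichlet_form (x s - x t) (x s - x t) + 2 * dirichlet_form (x s) (x t) - dirichlet_form (x t) (x t) = dirichlet_form (x s) (x s)"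
      using Hs Ht by (simp add: D_diff_left D_diff_right V_ops D_sym[of "x t" "x s"])
  qed
  ultimately show "((\<lambda>t. dirichlet_form (x t) (x t)) \<longlongrightarrow> dirichlet_form (x t) (x t)) (at t within {0..T})"
    by (rule Lim_transform_eventually)
qed

lemma is_wave_image_iff:
  assumes x: "energy_class T x x1"
  shows "is_wave_image \<Omega> T x f \<longleftrightarrow> f \<in> L2_time \<Omega> T \<and>
     (\<forall>\<phi>\<in>test_functions {0<..<T}. \<forall>v\<in>H10 \<Omega>.
        integral {0..T} (\<lambda>t. deriv (deriv \<phi>) t * inner (x t) v) + integral {0..T} (\<lambda>t. \<phi> t * dirichlet_form (x t) v)
        = inner f (lsq_class {0..T} (\<lambda>t. \<phi> t *\<^sub>R v)))"
proof -
  have "distr_deriv (distr_deriv (regular_distr T (\<lambda>t. pivot (x t)))) \<phi> v + regular_distr T (\<lambda>t. A_ext \<Omega> (x t)) \<phi> v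
        = regular_distr T (\<lambda>t. pivot (rep_lsq f t)) \<phi> v
     \<longleftrightarrow> integral {0..T} (\<lambda>t. deriv (deriv \<phi>) t * inner (x t) v) + integral {0..T} (\<lambda>t. \<phi> t * dirichlet_form (x t) v)
        = inner f (lsq_class {0..T} (\<lambda>t. \<phi> t *\<^sub>R v))"
    if \<phi>: "\<phi> \<in> test_functions {0<..<T}" and v: "v \<in> H10 \<Omega>" for \<phi> v
  proof -
    note c = test_continuous[OF \<phi>, of "{0..T}"] test_continuous[OF test_deriv(1)[OF test_deriv(1)[OF \<phi>]], of "{0..T}"]
    have "(LINT t:{0..T}|lebesgue. deriv (deriv \<phi>) t * inner (x t) v) = integral {0..T} (\<lambda>t. deriv (deriv \<phi>) t * inner (x t) v)"
      by (intro set_integral_continuous continuous_intros c energy_classD(4)[OF x])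
    moreover have "(LINT t:{0..T}|lebesgue. \<phi> t * H10_inner \<Omega> (x t) v) = integral {0..T} (\<lambda>t. \<phi> t * dirichlet_form (x t) v)"
    proof -
      have "(LINT t:{0..T}|lebesgue. \<phi> t * H10_inner \<Omega> (x t) v) = (LINT t:{0..T}|lebesgue. \<phi> t * dirichlet_form (x t) v)"
        unfolding set_lebesgue_integral_def
        by (rule Bochner_Integration.integral_cong) (auto simp: indicator_def H10_inner_eq energy_classD(1)[OF x] v)
      also have "\<dots> = integral {0..T} (\<lambda>t. \<phi> t * dirichlet_form (x t) v)"
        by (intro set_integral_continuous continuous_on_mult c energy_class_form_continuous[OF x v])
      finally show ?thesis .
    qed
    moreover have "(LINT t:{0..T}|lebesgue. \<phi> t * inner (rep_lsq f t) v) = inner f (lsq_class {0..T} (\<lambda>t. \<phi> t *\<^sub>R v))"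
      by (subst inner_class_rep) (auto intro!: continuous_intros c)
    ultimately show ?thesis
      by (simp add: distr_deriv_def regular_distr_def pivot_def A_ext_def)
  qed
  then show ?thesis unfolding is_wave_image_def by blast
qed

lemma closure_H10: "lsq_on \<Omega> \<subseteq> closure (H10 \<Omega>)"
proof -
  have "R ` lsq_on \<Omega> \<subseteq> H10 \<Omega>" using R_in by blast
  from subset_trans[OF R_dense closure_mono[OF this]] show ?thesis .
qed

text \<open>For fixed \<open>v\<close> the scalar function \<open>inner (d t) v\<close> vanishes almost everywhere by testing in time. For
a general direction \<open>h\<close> only its projection to \<open>lsq_on \<Omega>\<close> matters, which is a limit of a sequence in
\<open>H10 \<Omega>\<close>, so that countably many null sets suffice.\<close>

lemma L2_time_zero:
  assumes d: "d \<in> L2_time \<Omega> T"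
    and zero: "\<And>\<phi> v. \<phi> \<in> test_functions {0<..<T} \<Longrightarrow> v \<in> H10 \<Omega> \<Longrightarrow> inner d (lsq_class {0..T} (\<lambda>t. \<phi> t *\<^sub>R v)) = 0"
  shows "d = 0"
proof (rule lsq_zero_weak)
  have supp: "AE t in lebesgue. t \<notin> {0..T} \<longrightarrow> rep_lsq d t = 0" and on\<Omega>: "AE t in lebesgue. rep_lsq d t \<in> lsq_on \<Omega>"
    using d by (auto simp only: L2_time_def lsq_on_def mem_Collect_eq)
  have H: "AE t in lebesgue. inner (rep_lsq d t) v = 0" if v: "v \<in> H10 \<Omega>" for v
  proof -
    define F where "F t = inner (rep_lsq d t) v" for t
    have F: "square_integrable F"
    proof (rule square_integrable_bound[OF square_integrable_rep])
      show "strongly_measurable F" unfolding F_def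
        by (rule strongly_measurable_combine[where h = "\<lambda>u _. inner u v" and g = "rep_lsq d"])
          (use square_integrable_rep[of d] in \<open>auto simp: square_integrable_def intro: tendsto_inner\<close>)
      show "AE t in lebesgue. norm (F t) \<le> norm v * norm (rep_lsq d t)"
      proof (intro always_eventually allI)
        fix t
        show "norm (F t) \<le> norm v * norm (rep_lsq d t)"
          using Cauchy_Schwarz_ineq2[of "rep_lsq d t" v] by (simp add: F_def mult.commute)
      qed
    qed
    have FA: "AE t in lebesgue. rep_lsq (abs_lsq F) t = F t" by (rule rep_abs_lsq[OF F])
    have "AE t in lebesgue. rep_lsq (abs_lsq F) t = 0"
    proof (rule time_zero_by_tests)
      show "abs_lsq F \<in> lsq_on {0..T}"
        unfolding lsq_on_def mem_Collect_eq using FA supp by eventually_elim (auto simp: F_def)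
      fix \<phi> :: "real \<Rightarrow> real" assume \<phi>: "\<phi> \<in> test_functions {0<..<T}"
      note c = test_continuous[OF \<phi>, of "{0..T}"]
      have cv: "continuous_on {0..T} (\<lambda>t. \<phi> t *\<^sub>R v)" by (intro continuous_intros c)
      have "inner (abs_lsq F) (lsq_class {0..T} \<phi>) = (\<integral>t. F t * (if t \<in> {0..T} then \<phi> t else 0) \<partial>lebesgue)"
        unfolding lsq_class_def inner_abs_lsq[OF F square_integrable_continuous[OF c]] by simp
      also have "\<dots> = (\<integral>t. inner (rep_lsq d t) (if t \<in> {0..T} then \<phi> t *\<^sub>R v else 0) \<partial>lebesgue)"
        by (rule Bochner_Integration.integral_cong) (auto simp: F_def)
      also have "\<dots> = inner d (lsq_class {0..T} (\<lambda>t. \<phi> t *\<^sub>R v))"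
        unfolding lsq_class_def inner_rep_abs_lsq[OF square_integrable_continuous[OF cv]] ..
      finally show "inner (abs_lsq F) (lsq_class {0..T} \<phi>) = 0" using zero[OF \<phi> v] by simp
    qed
    with FA show ?thesis by eventually_elim (simp add: F_def)
  qed
  fix h :: "('a, real) lsq"
  obtain p where p: "p \<in> lsq_on \<Omega>" "\<And>m. m \<in> lsq_on \<Omega> \<Longrightarrow> inner (h - p) m = 0"
    by (rule closed_subspace_projection[OF closed_\<Omega> subspace_\<Omega>], rule that)
  obtain v where v: "\<And>n::nat. v n \<in> H10 \<Omega>" "v \<longlonglongrightarrow> p"
  proof -
    have "p \<in> closure (H10 \<Omega>)" using closure_H10 p(1) by (rule subsetD)
    then have "\<exists>v. (\<forall>n::nat. v n \<in> H10 \<Omega>) \<and> v \<longlonglongrightarrow> p" by (simp only: closure_sequential)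
    then obtain v where "\<forall>n::nat. v n \<in> H10 \<Omega>" "v \<longlonglongrightarrow> p" by (elim exE conjE)
    then show thesis by (intro that[of v]) simp_all
  qed
  have "AE t in lebesgue. \<forall>n. inner (rep_lsq d t) (v n) = 0"
    unfolding AE_all_countable using H[OF v(1)] by simp
  then show "AE t in lebesgue. inner (rep_lsq d t) h = 0"
    using on\<Omega>
  proof eventually_elim
    case (elim t)
    have "(\<lambda>n. inner (rep_lsq d t) (v n)) \<longlonglongrightarrow> inner (rep_lsq d t) p" by (intro tendsto_intros v)
    then have "inner (rep_lsq d t) p = 0" using elim(1) by (simp add: LIMSEQ_const_iff)
    moreover have "inner (rep_lsq d t) (h - p) = 0" using p(2)[OF elim(2)] by (simp add: inner_commute)
    ultimately show ?case by (simp add: inner_diff_right)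
  qed
qed

lemma L2_time_diff:
  assumes "f \<in> L2_time \<Omega> T" "g \<in> L2_time \<Omega> T"
  shows "f - g \<in> L2_time \<Omega> T" "f + g \<in> L2_time \<Omega> T"
proof -
  have T: "{0..T} \<in> sets lebesgue" by simp
  have fg: "AE t in lebesgue. rep_lsq f t \<in> lsq_on \<Omega>" "AE t in lebesgue. rep_lsq g t \<in> lsq_on \<Omega>"
    "f \<in> lsq_on {0..T}" "g \<in> lsq_on {0..T}"
    using assms by (auto simp only: L2_time_def mem_Collect_eq)
  have "abs_lsq (\<lambda>t. rep_lsq f t - rep_lsq g t) = f - g"
    by (simp add: abs_lsq_diff square_integrable_rep abs_rep_lsq)
  with rep_abs_lsq[OF square_integrable_diff[OF square_integrable_rep[of f] square_integrable_rep[of g]]]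
  have "AE t in lebesgue. rep_lsq (f - g) t = rep_lsq f t - rep_lsq g t" by simp
  with fg(1,2) have "AE t in lebesgue. rep_lsq (f - g) t \<in> lsq_on \<Omega>"
    by eventually_elim (simp add: subspace_diff[OF subspace_\<Omega>])
  then show "f - g \<in> L2_time \<Omega> T"
    using subspace_diff[OF subspace_lsq_on[OF T] fg(3,4)] by (simp add: L2_time_def)
  have "abs_lsq (\<lambda>t. rep_lsq f t + rep_lsq g t) = f + g"
    by (simp add: abs_lsq_add square_integrable_rep abs_rep_lsq)
  with rep_abs_lsq[OF square_integrable_add[OF square_integrable_rep[of f] square_integrable_rep[of g]]]
  have "AE t in lebesgue. rep_lsq (f + g) t = rep_lsq f t + rep_lsq g t" by simp
  with fg(1,2) have "AE t in lebesgue. rep_lsq (f + g) t \<in> lsq_on \<Omega>"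
    by eventually_elim (simp add: subspace_add[OF subspace_\<Omega>])
  then show "f + g \<in> L2_time \<Omega> T"
    using subspace_add[OF subspace_lsq_on[OF T] fg(3,4)] by (simp add: L2_time_def)
qed

lemma L2_time_class:
  assumes y: "continuous_on {0..T} y" "\<And>t. t \<in> {0..T} \<Longrightarrow> y t \<in> lsq_on \<Omega>"
  shows "lsq_class {0..T} y \<in> L2_time \<Omega> T"
proof -
  have "AE t in lebesgue. rep_lsq (lsq_class {0..T} y) t \<in> lsq_on \<Omega>"
    using class_rep(2)[OF y(1)] by eventually_elim (auto simp: y(2) subspace_0[OF subspace_\<Omega>])
  then show ?thesis using class_rep(1)[OF y(1)] by (simp add: L2_time_def)
qed

lemma wave_op_eq:
  assumes x: "energy_class T x x1" and f: "is_wave_image \<Omega> T x f"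
  shows "wave_op \<Omega> T x = f"
  unfolding wave_op_def
proof (rule the_equality)
  show "is_wave_image \<Omega> T x f" by (rule f)
  fix g assume g: "is_wave_image \<Omega> T x g"
  have "g - f = 0"
  proof (rule L2_time_zero)
    show "g - f \<in> L2_time \<Omega> T" using f g unfolding is_wave_image_iff[OF x] by (intro L2_time_diff) auto
    show "inner (g - f) (lsq_class {0..T} (\<lambda>t. \<phi> t *\<^sub>R v)) = 0" if "\<phi> \<in> test_functions {0<..<T}" "v \<in> H10 \<Omega>" for \<phi> v
      using f g that unfolding is_wave_image_iff[OF x] by (simp add: inner_diff_left)
  qed
  then show "g = f" by simp
qed

lemma at_within_Icc: "T > 0 \<Longrightarrow> t \<in> {0..T} \<Longrightarrow> at t within {0..T} \<noteq> bot" for t T :: real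
  by (simp add: trivial_limit_within islimpt_Icc)

lemma time_deriv_eq:
  assumes "T > 0" "energy_class T x x1" "t \<in> {0..T}"
  shows "time_deriv T x t = x1 t"
  unfolding time_deriv_def
  by (rule vector_derivative_within[OF at_within_Icc[OF assms(1,3)] energy_classD(2)[OF assms(2,3)]])

lemma H10_norm_tendsto_iff:
  assumes "\<And>s. s \<in> S \<Longrightarrow> x s \<in> H10 \<Omega>" "a \<in> H10 \<Omega>"
  shows "((\<lambda>s. H10_norm \<Omega> (x s - a)) \<longlongrightarrow> 0) (at t within S) \<longleftrightarrow>
    ((\<lambda>s. dirichlet_form (x s - a) (x s - a)) \<longlongrightarrow> 0) (at t within S)"
proof
  have eq: "\<forall>\<^sub>F s in at t within S. sqrt (dirichlet_form (x s - a) (x s - a)) = H10_norm \<Omega> (x s - a)"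
    unfolding eventually_at_filter
    by (intro always_eventually) (auto simp: H10_norm_eq V_ops(3)[OF assms(1) assms(2)])
  have eq2: "\<forall>\<^sub>F s in at t within S. (H10_norm \<Omega> (x s - a))\<^sup>2 = dirichlet_form (x s - a) (x s - a)"
    unfolding eventually_at_filter
    by (intro always_eventually) (auto simp: H10_norm_eq V_ops(3)[OF assms(1) assms(2)] D_nonneg)
  { assume "((\<lambda>s. H10_norm \<Omega> (x s - a)) \<longlongrightarrow> 0) (at t within S)"
    from tendsto_power[OF this, of 2] have "((\<lambda>s. (H10_norm \<Omega> (x s - a))\<^sup>2) \<longlongrightarrow> 0) (at t within S)" by simp
    then show "((\<lambda>s. dirichlet_form (x s - a) (x s - a)) \<longlongrightarrow> 0) (at t within S)"
      by (rule Lim_transform_eventually[OF _ eq2]) }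
  { assume "((\<lambda>s. dirichlet_form (x s - a) (x s - a)) \<longlongrightarrow> 0) (at t within S)"
    from tendsto_real_sqrt[OF this] have "((\<lambda>s. sqrt (dirichlet_form (x s - a) (x s - a))) \<longlongrightarrow> 0) (at t within S)" by simp
    then show "((\<lambda>s. H10_norm \<Omega> (x s - a)) \<longlongrightarrow> 0) (at t within S)"
      by (rule Lim_transform_eventually[OF _ eq]) }
qed

lemma E_spaceD:
  assumes x: "x \<in> E_space \<Omega> T"
  shows "t \<notin> {0..T} \<Longrightarrow> x t = 0" "energy_class T x (time_deriv T x)" "\<exists>f. is_wave_image \<Omega> T x f"
proof -
  have H: "x t \<in> H10 \<Omega>" if "t \<in> {0..T}" for t using x that unfolding E_space_def by blast
  show "energy_class T x (time_deriv T x)"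
    unfolding energy_class_def
  proof (intro conjI ballI)
    fix t assume t: "t \<in> {0..T}"
    show "x t \<in> H10 \<Omega>" by (rule H[OF t])
    have "((\<lambda>s. H10_norm \<Omega> (x s - x t)) \<longlongrightarrow> 0) (at t within {0..T})" using x t unfolding E_space_def by blast
    then show "((\<lambda>s. dirichlet_form (x s - x t) (x s - x t)) \<longlongrightarrow> 0) (at t within {0..T})"
      using H10_norm_tendsto_iff[of "{0..T}" x "x t" t] H H[OF t] by simp
    have "x differentiable (at t within {0..T})" using x t unfolding E_space_def by blast
    then show "(x has_vector_derivative time_deriv T x t) (at t within {0..T})"
      by (simp add: time_deriv_def vector_derivative_works)
  qed (use x in \<open>simp add: E_space_def\<close>)
qed (use x in \<open>auto simp: E_space_def\<close>)

lemma E_spaceI: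
  assumes T: "T > 0" and z: "\<And>t. t \<notin> {0..T} \<Longrightarrow> x t = 0" and x: "energy_class T x x1" and f: "is_wave_image \<Omega> T x f"
  shows "x \<in> E_space \<Omega> T"
  unfolding E_space_def
proof (intro CollectI conjI ballI allI impI)
  show "continuous_on {0..T} (time_deriv T x)"
    using energy_classD(3)[OF x] by (rule continuous_on_eq) (simp add: time_deriv_eq[OF T x])
  fix t assume t: "t \<in> {0..T}"
  show "((\<lambda>s. H10_norm \<Omega> (x s - x t)) \<longlongrightarrow> 0) (at t within {0..T})"
    using H10_norm_tendsto_iff[of "{0..T}" x "x t" t] energy_classD(1)[OF x] energy_classD(1)[OF x t] energy_classD(5)[OF x t] by simp
  show "x differentiable at t within {0..T}" by (rule differentiableI_vector[OF energy_classD(2)[OF x t]])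
qed (use z f energy_classD(1)[OF x] in auto)

text \<open>The component of \<open>x1 t\<close> orthogonal to \<open>lsq_on \<Omega>\<close> is the derivative of a constant.\<close>

lemma energy_class_derivative_in:
  assumes T: "T > 0" and x: "energy_class T x x1" and t: "t \<in> {0..T}"
  shows "x1 t \<in> lsq_on \<Omega>"
proof -
  obtain p where p: "p \<in> lsq_on \<Omega>" "\<And>m. m \<in> lsq_on \<Omega> \<Longrightarrow> inner (x1 t - p) m = 0"
    by (rule closed_subspace_projection[OF closed_\<Omega> subspace_\<Omega>], rule that)
  let ?q = "x1 t - p"
  have "((\<lambda>s. inner (x s) ?q) has_real_derivative inner (x1 t) ?q) (at t within {0..T})"
    using has_real_derivative_inner[OF energy_classD(2)[OF x t] has_vector_derivative_const[of ?q]] by simp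
  moreover have orth: "inner (x s) ?q = 0" if s: "s \<in> {0..T}" for s
  proof -
    have "x s \<in> lsq_on \<Omega>" using energy_classD(1)[OF x s] H10_sub by blast
    from p(2)[OF this] show ?thesis by (simp only: inner_commute[of "x s"])
  qed
  ultimately have d: "((\<lambda>s. inner (x s) ?q) has_vector_derivative inner (x1 t) ?q) (at t within {0..T})"
    by (simp only: has_real_derivative_iff_has_vector_derivative)
  have "((\<lambda>s. 0) has_vector_derivative inner (x1 t) ?q) (at t within {0..T})"
    by (rule has_vector_derivative_transform[OF t _ d]) (simp only: orth)
  then have "inner (x1 t) ?q = 0"
    by (rule vector_derivative_unique_within[OF at_within_Icc[OF T t]]) simp
  moreover have "inner p ?q = 0" using p(2)[OF p(1)] by (simp only: inner_commute[of p])
  ultimately have "inner ?q ?q = 0" by (simp only: inner_diff_left)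
  then have "x1 t = p" by simp
  then show ?thesis using p(1) by simp
qed

lemma op_A_tilde_in:
  assumes T: "T > 0" and x: "x \<in> E_space \<Omega> T"
  shows "op_A_tilde \<Omega> T x \<in> P_space \<Omega> T"
proof -
  note e = E_spaceD(2)[OF x]
  obtain f where f: "is_wave_image \<Omega> T x f" using E_spaceD(3)[OF x] by blast
  have 0: "0 \<in> {0..T}" using T by simp
  have "lsq_class {0..T} (\<lambda>t. x t + time_deriv T x t) \<in> L2_time \<Omega> T"
  proof (rule L2_time_class)
    show "continuous_on {0..T} (\<lambda>t. x t + time_deriv T x t)" by (intro continuous_on_add energy_classD(3,4)[OF e])
    fix t assume t: "t \<in> {0..T}"
    have "x t \<in> lsq_on \<Omega>" using energy_classD(1)[OF e t] H10_sub by blast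
    then show "x t + time_deriv T x t \<in> lsq_on \<Omega>"
      by (intro subspace_add[OF subspace_\<Omega>] energy_class_derivative_in[OF T e t])
  qed
  moreover have "f \<in> L2_time \<Omega> T" using f by (simp add: is_wave_image_def)
  ultimately have "f + lsq_class {0..T} (\<lambda>t. x t + time_deriv T x t) \<in> L2_time \<Omega> T" by (intro L2_time_diff)
  then show ?thesis
    unfolding op_A_tilde_eq P_space_def wave_op_eq[OF e f]
    using energy_classD(1)[OF e 0] energy_class_derivative_in[OF T e 0] by simp
qed

text \<open>Testing with \<open>R h\<close> removes the form from the weak equation, since \<open>D (d t) (R h) = inner (d t) h\<close>.
After integration by parts every term is paired with $\dot\varphi$ and has a continuous factor, so
that the lemma of du Bois-Reymond yields the equation pointwise for the primitive \<open>p\<close> of \<open>d\<close>.\<close>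

theorem op_A_tilde_inj:
  assumes T: "T > 0" and x: "x \<in> E_space \<Omega> T" and z: "z \<in> E_space \<Omega> T"
    and eq: "op_A_tilde \<Omega> T x = op_A_tilde \<Omega> T z"
  shows "x = z"
proof -
  let ?x1 = "time_deriv T x" and ?z1 = "time_deriv T z"
  note ex = E_spaceD(2)[OF x] and ez = E_spaceD(2)[OF z]
  obtain f where f: "is_wave_image \<Omega> T x f" using E_spaceD(3)[OF x] by blast
  obtain g where g: "is_wave_image \<Omega> T z g" using E_spaceD(3)[OF z] by blast
  define d where "d t = x t - z t" for t
  define d1 where "d1 t = ?x1 t - ?z1 t" for t
  note c = energy_classD(3,4)[OF ex] energy_classD(3,4)[OF ez]
  have cd: "continuous_on {0..T} d" "continuous_on {0..T} d1"
    unfolding d_def d1_def by (intro continuous_intros c)+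
  have dd: "(d has_vector_derivative d1 t) (at t within {0..T})" if "t \<in> {0..T}" for t
    unfolding d_def d1_def by (intro has_vector_derivative_diff energy_classD(2)[OF ex that] energy_classD(2)[OF ez that])
  have eqs: "f + lsq_class {0..T} (\<lambda>t. x t + ?x1 t) = g + lsq_class {0..T} (\<lambda>t. z t + ?z1 t)" "x 0 = z 0" "?x1 0 = ?z1 0"
    using eq unfolding op_A_tilde_eq wave_op_eq[OF ex f] wave_op_eq[OF ez g] by simp_all
  have init: "d 0 = 0" "d1 0 = 0" using eqs by (simp_all add: d_def d1_def)
  have fg: "f - g = - lsq_class {0..T} (\<lambda>t. d t + d1 t)"
  proof -
    have "(\<lambda>t. d t + d1 t) = (\<lambda>t. (x t + ?x1 t) - (z t + ?z1 t))" by (auto simp: d_def d1_def)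
    then have "lsq_class {0..T} (\<lambda>t. d t + d1 t) = lsq_class {0..T} (\<lambda>t. x t + ?x1 t) - lsq_class {0..T} (\<lambda>t. z t + ?z1 t)"
      using class_combine(2)[of T "\<lambda>t. x t + ?x1 t" "\<lambda>t. z t + ?z1 t"] c by (simp add: continuous_on_add)
    moreover have "f - g = lsq_class {0..T} (\<lambda>t. z t + ?z1 t) - lsq_class {0..T} (\<lambda>t. x t + ?x1 t)"
    proof -
      have "f = g + lsq_class {0..T} (\<lambda>t. z t + ?z1 t) - lsq_class {0..T} (\<lambda>t. x t + ?x1 t)"
        unfolding eqs(1)[symmetric] by (rule add_diff_cancel_right'[symmetric])
      then show ?thesis by (simp add: algebra_simps)
    qed
    ultimately show ?thesis by (simp only: minus_diff_eq)
  qed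
  define p where "p t = integral {0..t} d" for t
  have pd: "(p has_vector_derivative d t) (at t within {0..T})" if "t \<in> {0..T}" for t
    unfolding p_def by (rule integral_has_vector_derivative[OF cd(1) that])
  have p0: "p 0 = 0" by (simp add: p_def)
  have cp: "continuous_on {0..T} p"
    unfolding continuous_on_eq_continuous_within by (intro ballI has_vector_derivative_continuous[OF pd])
  have ode: "R (d1 t) + R (d t) + R (p t) + p t = 0" if t: "t \<in> {0..T}" for t
  proof -
    have "inner (R (d1 t) + R (d t) + R (p t) + p t) h = 0" for h
    proof -
      define u where "u t = inner (R (d t)) h" for t
      define u1 where "u1 t = inner (R (d1 t)) h" for t
      define W where "W t = inner (R (d t)) h + inner (R (p t)) h + inner (p t) h" for t
      define w where "w t = inner (R (d1 t)) h + inner (R (d t)) h + inner (d t) h" for t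
      have cuw: "continuous_on {0..T} u" "continuous_on {0..T} u1" "continuous_on {0..T} W" "continuous_on {0..T} w"
        unfolding u_def u1_def W_def w_def by (intro continuous_intros R_continuous_on cd cp)+
      have du: "(u has_real_derivative u1 t) (at t within {0..T})" "(W has_real_derivative w t) (at t within {0..T})" if "t \<in> {0..T}" for t
      proof -
        have i: "((\<lambda>t. inner (q t) h) has_real_derivative inner q' h) (at t within {0..T})" if "(q has_vector_derivative q') (at t within {0..T})" for q q'
          using has_real_derivative_inner[OF that has_vector_derivative_const[of h]] by simp
        show "(u has_real_derivative u1 t) (at t within {0..T})"
          unfolding u_def u1_def by (rule i[OF R_vector_derivative[OF dd[OF that]]])
        show "(W has_real_derivative w t) (at t within {0..T})"
          unfolding W_def w_def by (intro DERIV_add i R_vector_derivative dd pd that)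
      qed
      have key: "integral {0..T} (\<lambda>t. deriv \<phi> t * (u1 t + W t)) = 0" if \<phi>: "\<phi> \<in> test_functions {0<..<T}" for \<phi>
      proof -
        note t1 = test_deriv(1)[OF \<phi>] and t2 = test_deriv(1)[OF test_deriv(1)[OF \<phi>]]
        note ct = test_continuous[OF \<phi>, of "{0..T}"] test_continuous[OF t1, of "{0..T}"] test_continuous[OF t2, of "{0..T}"]
        have wx: "integral {0..T} (\<lambda>t. deriv (deriv \<phi>) t * inner (x t) (R h)) + integral {0..T} (\<lambda>t. \<phi> t * dirichlet_form (x t) (R h))
            = inner f (lsq_class {0..T} (\<lambda>t. \<phi> t *\<^sub>R R h))"
          using f \<phi> R_in unfolding is_wave_image_iff[OF ex] by blast
        have wz: "integral {0..T} (\<lambda>t. deriv (deriv \<phi>) t * inner (z t) (R h)) + integral {0..T} (\<lambda>t. \<phi> t * dirichlet_form (z t) (R h))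
            = inner g (lsq_class {0..T} (\<lambda>t. \<phi> t *\<^sub>R R h))"
          using g \<phi> R_in unfolding is_wave_image_iff[OF ez] by blast
        have 1: "integral {0..T} (\<lambda>t. deriv (deriv \<phi>) t * u t)
          = integral {0..T} (\<lambda>t. deriv (deriv \<phi>) t * inner (x t) (R h)) - integral {0..T} (\<lambda>t. deriv (deriv \<phi>) t * inner (z t) (R h))"
        proof -
          have "(\<lambda>t. deriv (deriv \<phi>) t * u t) = (\<lambda>t. deriv (deriv \<phi>) t * inner (x t) (R h) - deriv (deriv \<phi>) t * inner (z t) (R h))"
            by (simp add: u_def d_def R_symmetric inner_diff_left right_diff_distrib)
          then show ?thesis
            by (simp only:) (rule Henstock_Kurzweil_Integration.integral_diff; intro integrable_continuous_real continuous_intros ct c)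
        qed
        have 2: "integral {0..T} (\<lambda>t. \<phi> t * inner (d t) h)
          = integral {0..T} (\<lambda>t. \<phi> t * dirichlet_form (x t) (R h)) - integral {0..T} (\<lambda>t. \<phi> t * dirichlet_form (z t) (R h))"
        proof -
          have DR: "dirichlet_form v (R h) = inner v h" if "v \<in> H10 \<Omega>" for v
            using R_eq[OF that, of h] D_sym[OF that R_in, of h] by (simp add: inner_commute)
          have "integral {0..T} (\<lambda>t. \<phi> t * inner (d t) h) = integral {0..T} (\<lambda>t. \<phi> t * dirichlet_form (x t) (R h) - \<phi> t * dirichlet_form (z t) (R h))"
            by (rule Henstock_Kurzweil_Integration.integral_cong)
              (simp add: d_def inner_diff_left right_diff_distrib DR energy_classD(1)[OF ex] energy_classD(1)[OF ez])
          also have "\<dots> = integral {0..T} (\<lambda>t. \<phi> t * dirichlet_form (x t) (R h)) - integral {0..T} (\<lambda>t. \<phi> t * dirichlet_form (z t) (R h))"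
            by (rule Henstock_Kurzweil_Integration.integral_diff; intro integrable_continuous_real continuous_on_mult ct
                energy_class_form_continuous[OF ex R_in] energy_class_form_continuous[OF ez R_in])
          finally show ?thesis .
        qed
        have 3: "inner (f - g) (lsq_class {0..T} (\<lambda>t. \<phi> t *\<^sub>R R h)) = - integral {0..T} (\<lambda>t. \<phi> t * (u t + u1 t))"
        proof -
          have "inner (lsq_class {0..T} (\<lambda>t. d t + d1 t)) (lsq_class {0..T} (\<lambda>t. \<phi> t *\<^sub>R R h)) = integral {0..T} (\<lambda>t. inner (d t + d1 t) (\<phi> t *\<^sub>R R h))"
            by (rule inner_class; intro continuous_intros cd ct)
          also have "(\<lambda>t. inner (d t + d1 t) (\<phi> t *\<^sub>R R h)) = (\<lambda>t. \<phi> t * (u t + u1 t))"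
            by (simp add: u_def u1_def inner_add_left R_symmetric)
          finally show ?thesis by (simp add: fg)
        qed
        have sum: "integral {0..T} (\<lambda>t. deriv (deriv \<phi>) t * u t) + integral {0..T} (\<lambda>t. \<phi> t * inner (d t) h) = - integral {0..T} (\<lambda>t. \<phi> t * (u t + u1 t))"
          using wx wz 1 2 3 by (simp add: inner_diff_left)
        have "integral {0..T} (\<lambda>t. \<phi> t * w t) = integral {0..T} (\<lambda>t. \<phi> t * inner (d t) h) + integral {0..T} (\<lambda>t. \<phi> t * (u t + u1 t))"
        proof -
          have "(\<lambda>t. \<phi> t * w t) = (\<lambda>t. \<phi> t * inner (d t) h + \<phi> t * (u t + u1 t))"
            by (simp add: w_def u_def u1_def algebra_simps)
          then show ?thesis
            by (simp only:) (rule Henstock_Kurzweil_Integration.integral_add; intro integrable_continuous_real continuous_intros ct cd cuw)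
        qed
        then have "integral {0..T} (\<lambda>t. deriv (deriv \<phi>) t * u t) = - integral {0..T} (\<lambda>t. \<phi> t * w t)" using sum by simp
        moreover have "integral {0..T} (\<lambda>t. deriv (deriv \<phi>) t * u t) = - integral {0..T} (\<lambda>t. deriv \<phi> t * u1 t)"
          by (rule test_by_parts[OF T t1 du(1) cuw(2)])
        moreover have "integral {0..T} (\<lambda>t. deriv \<phi> t * W t) = - integral {0..T} (\<lambda>t. \<phi> t * w t)"
          by (rule test_by_parts[OF T \<phi> du(2) cuw(4)])
        moreover have "integral {0..T} (\<lambda>t. deriv \<phi> t * (u1 t + W t)) = integral {0..T} (\<lambda>t. deriv \<phi> t * u1 t) + integral {0..T} (\<lambda>t. deriv \<phi> t * W t)"
          unfolding distrib_left
          by (rule Henstock_Kurzweil_Integration.integral_add; intro integrable_continuous_real continuous_intros ct cuw)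
        ultimately show ?thesis by simp
      qed
      have "u1 t + W t = u1 0 + W 0"
        by (rule du_Bois_Reymond[OF T _ key t]) (intro continuous_on_add cuw)
      then have "u1 t + W t = 0" by (simp add: u1_def W_def init p0 R_simps)
      then show ?thesis by (simp add: u1_def W_def inner_add_left add.assoc)
    qed
    then show ?thesis by (rule inner_eq_zero_iff[THEN iffD1])
  qed
  have pz: "p t = 0" if "t \<in> {0..T}" for t
    by (rule homogeneous_ode_zero[OF pd dd ode p0 init(1) that])
  have "d t = 0" if t: "t \<in> {0..T}" for t
  proof (rule vector_derivative_unique_within[OF at_within_Icc[OF T t]])
    show "((\<lambda>_. 0) has_vector_derivative d t) (at t within {0..T})"
      by (rule has_vector_derivative_transform[OF t _ pd[OF t]]) (simp add: pz)
  qed simp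
  then show "x = z"
  proof (intro ext)
    fix t
    show "x t = z t"
    proof (cases "t \<in> {0..T}")
      case True
      then show ?thesis using \<open>\<And>t. t \<in> {0..T} \<Longrightarrow> d t = 0\<close>[OF True] by (simp add: d_def)
    next
      case False
      then show ?thesis using E_spaceD(1)[OF x False] E_spaceD(1)[OF z False] by simp
    qed
  qed
qed

end

section \<open>Existence by approximation\<close>

lemma uniform_limit_square:
  fixes X :: "nat \<Rightarrow> 's \<Rightarrow> 'b::real_normed_vector"
  assumes \<delta>: "\<delta> \<longlonglongrightarrow> 0" and X: "\<And>n t. t \<in> S \<Longrightarrow> (norm (x t - X n t))\<^sup>2 \<le> \<delta> n"
  shows "uniform_limit S X x sequentially"
proof (rule uniform_limitI)
  fix e :: real assume e: "e > 0"
  then have "e\<^sup>2 > 0" by simp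
  from order_tendstoD(2)[OF \<delta> this] show "\<forall>\<^sub>F n in sequentially. \<forall>t\<in>S. dist (X n t) (x t) < e"
  proof eventually_elim
    case (elim n)
    show ?case
    proof
      fix t assume "t \<in> S"
      from X[OF this, of n] elim have "(norm (x t - X n t))\<^sup>2 < e\<^sup>2" by linarith
      then show "dist (X n t) (x t) < e"
        using e by (simp add: dist_norm norm_minus_commute power2_less_imp_less)
    qed
  qed
qed

lemma norm_diff_triangle_square:
  fixes p q r :: "'b::real_normed_vector"
  shows "(norm (p - q))\<^sup>2 \<le> 2 * (norm (p - r))\<^sup>2 + 2 * (norm (q - r))\<^sup>2"
proof -
  have "norm (p - q) \<le> norm (p - r) + norm (q - r)"
    using norm_triangle_ineq4[of "p - r" "q - r"] by simp
  then have "(norm (p - q))\<^sup>2 \<le> (norm (p - r) + norm (q - r))\<^sup>2" by (rule power_mono) simp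
  also have "\<dots> \<le> 2 * (norm (p - r))\<^sup>2 + 2 * (norm (q - r))\<^sup>2"
    using sum_squares_bound[of "norm (p - r)" "norm (q - r)"] by (simp add: power2_sum)
  finally show ?thesis .
qed

context bounded_domain
begin

text \<open>The affine function \<open>z n\<close> produces the initial data; density of the sources with zero initial data
corrects the right-hand side without disturbing them.\<close>

lemma data_approximation:
  assumes T: "T > 0" and u: "u \<in> lsq_on {0..T}" and a: "a \<in> H10 \<Omega>" and b: "b \<in> lsq_on \<Omega>"
  obtains y y1 y2 where "\<And>n::nat. C2 (y n) (y1 n) (y2 n)"
    "(\<lambda>n. dirichlet_form (R (y n 0) - a) (R (y n 0) - a)) \<longlonglongrightarrow> 0"
    "(\<lambda>n. R (y1 n 0)) \<longlonglongrightarrow> b"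
    "(\<lambda>n. lsq_class {0..T} (source (y n) (y1 n) (y2 n))) \<longlonglongrightarrow> u"
proof -
  obtain h0 where h0: "(\<lambda>n::nat. dirichlet_form (R (h0 n) - a) (R (h0 n) - a)) \<longlonglongrightarrow> 0"
    by (rule R_dense_form[OF a], rule that)
  have "b \<in> closure (R ` lsq_on \<Omega>)" using R_dense b by (rule subsetD)
  then have "\<exists>s. (\<forall>n::nat. s n \<in> R ` lsq_on \<Omega>) \<and> s \<longlonglongrightarrow> b" by (simp only: closure_sequential)
  then obtain s where s: "\<forall>n::nat. s n \<in> R ` lsq_on \<Omega>" "s \<longlonglongrightarrow> b" by (elim exE conjE)
  have "\<forall>n. \<exists>h. s n = R h" using s(1) by blast
  then obtain h1 where h1: "\<forall>n. s n = R (h1 n)" by (rule choice[THEN exE])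
  have h1b: "(\<lambda>n. R (h1 n)) \<longlonglongrightarrow> b" using s(2) by (simp only: fun_eq_iff[THEN iffD2, OF h1])
  define z where "z n t = h0 n + t *\<^sub>R h1 n" for n t
  have z: "C2 (z n) (\<lambda>_. h1 n) (\<lambda>_. 0)" for n
    unfolding C2_def z_def by (auto intro!: derivative_eq_intros)
  let ?Z = "\<lambda>n. lsq_class {0..T} (source (z n) (\<lambda>_. h1 n) (\<lambda>_. 0))"
  let ?W = "\<lambda>p. lsq_class {0..T} (source (fst p) (fst (snd p)) (snd (snd p)))"
  have "\<forall>n::nat. \<exists>p. C2 (fst p) (fst (snd p)) (snd (snd p)) \<and> fst p 0 = 0 \<and> fst (snd p) 0 = 0
      \<and> dist (?W p) (u - ?Z n) < inverse (real (Suc n))"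
  proof
    fix n :: nat
    have "u - ?Z n \<in> lsq_on {0..T}"
      by (intro subspace_diff[OF subspace_lsq_on] u class_rep(1) C2_continuous(4)[OF z]) simp
    then have "u - ?Z n \<in> closure {lsq_class {0..T} (source w w1 w2) |w w1 w2. C2 w w1 w2 \<and> w 0 = 0 \<and> w1 0 = 0}"
      using sources_dense[OF T] by (rule subsetD[rotated])
    moreover have "0 < inverse (real (Suc n))" by simp
    ultimately obtain f where f: "f \<in> {lsq_class {0..T} (source w w1 w2) |w w1 w2. C2 w w1 w2 \<and> w 0 = 0 \<and> w1 0 = 0}"
      "dist f (u - ?Z n) < inverse (real (Suc n))"
      unfolding closure_approachable by (elim allE impE) (assumption, elim bexE, rule that)
    then obtain w w1 w2 where w: "f = lsq_class {0..T} (source w w1 w2)" "C2 w w1 w2" "w 0 = 0" "w1 0 = 0"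
      by (elim CollectE exE conjE) (rule that)
    show "\<exists>p. C2 (fst p) (fst (snd p)) (snd (snd p)) \<and> fst p 0 = 0 \<and> fst (snd p) 0 = 0
      \<and> dist (?W p) (u - ?Z n) < inverse (real (Suc n))"
      by (rule exI[of _ "(w, w1, w2)"]) (use w f(2) in simp)
  qed
  then obtain p where p: "\<forall>n. C2 (fst (p n)) (fst (snd (p n))) (snd (snd (p n))) \<and> fst (p n) 0 = 0 \<and> fst (snd (p n)) 0 = 0
      \<and> dist (?W (p n)) (u - ?Z n) < inverse (real (Suc n))"
    by (rule choice[THEN exE])
  define w where "w n = fst (p n)" for n
  define w1 where "w1 n = fst (snd (p n))" for n
  define w2 where "w2 n = snd (snd (p n))" for n
  have w: "C2 (w n) (w1 n) (w2 n)" "w n 0 = 0" "w1 n 0 = 0"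
    "dist (lsq_class {0..T} (source (w n) (w1 n) (w2 n))) (u - ?Z n) < inverse (real (Suc n))" for n
    using p[rule_format, of n] by (simp_all only: w_def w1_def w2_def)
  let ?y = "\<lambda>n t. z n t + 1 *\<^sub>R w n t" and ?y1 = "\<lambda>n t. h1 n + 1 *\<^sub>R w1 n t" and ?y2 = "\<lambda>n t. 0 + 1 *\<^sub>R w2 n t"
  let ?F = "\<lambda>n. lsq_class {0..T} (source (?y n) (?y1 n) (?y2 n))"
  have F: "?F n = ?Z n + lsq_class {0..T} (source (w n) (w1 n) (w2 n))" for n
    unfolding C2_combination(2)[OF z w(1)] unfolding scaleR_one
    by (rule class_combine(1)[OF C2_continuous(4)[OF z] C2_continuous(4)[OF w(1)]])
  have Fu: "?F \<longlonglongrightarrow> u"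
  proof (rule metric_tendsto_imp_tendsto[OF LIMSEQ_inverse_real_of_nat])
    have "dist (?F n) u \<le> dist (inverse (real (Suc n))) 0" for n
    proof -
      have "?F n - u = lsq_class {0..T} (source (w n) (w1 n) (w2 n)) - (u - ?Z n)" unfolding F by simp
      then have "dist (?F n) u = dist (lsq_class {0..T} (source (w n) (w1 n) (w2 n))) (u - ?Z n)" by (simp only: dist_norm)
      also have "\<dots> \<le> inverse (real (Suc n))" using w(4)[of n] by (rule less_imp_le)
      also have "\<dots> = dist (inverse (real (Suc n))) 0" by simp
      finally show ?thesis .
    qed
    then show "\<forall>\<^sub>F n in sequentially. dist (?F n) u \<le> dist (inverse (real (Suc n))) 0" by simp
  qed
  have y0: "?y n 0 = h0 n" "?y1 n 0 = h1 n" for n by (simp_all add: z_def w(2,3))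
  show thesis
  proof (rule that[of ?y ?y1 ?y2])
    show "C2 (?y n) (?y1 n) (?y2 n)" for n by (rule C2_combination(1)[OF z w(1)])
    show "(\<lambda>n. dirichlet_form (R (?y n 0) - a) (R (?y n 0) - a)) \<longlonglongrightarrow> 0" unfolding y0 by (rule h0)
    show "(\<lambda>n. R (?y1 n 0)) \<longlonglongrightarrow> b" unfolding y0 by (rule h1b)
  qed (rule Fu)
qed

lemma strong_solution_weak:
  assumes T: "T > 0" and y: "C2 y y1 y2" and \<phi>: "\<phi> \<in> test_functions {0<..<T}"
  shows "inner (lsq_class {0..T} (\<lambda>t. R (y t))) (lsq_class {0..T} (\<lambda>t. deriv (deriv \<phi>) t *\<^sub>R v))
      + inner (lsq_class {0..T} (\<lambda>t. inner (y t) v)) (lsq_class {0..T} \<phi>)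
    = inner (lsq_class {0..T} (source y y1 y2) - lsq_class {0..T} (\<lambda>t. R (y t) + R (y1 t))) (lsq_class {0..T} (\<lambda>t. \<phi> t *\<^sub>R v))"
proof -
  note t1 = test_deriv(1)[OF \<phi>] and t2 = test_deriv(1)[OF test_deriv(1)[OF \<phi>]]
  note ct = test_continuous[OF \<phi>, of "{0..T}"] test_continuous[OF t1, of "{0..T}"] test_continuous[OF t2, of "{0..T}"]
  note c = C2_continuous[OF y, of "{0..T}"] C2_continuous(1-3)[OF y, of "{0..T}", THEN R_continuous_on]
  have d: "((\<lambda>t. inner (R (q t)) v) has_real_derivative inner (R (q' t)) v) (at t within {0..T})"
    if q: "\<And>t. (q has_vector_derivative q' t) (at t)" for q q' t
    using has_real_derivative_inner[OF has_vector_derivative_at_within[OF R_vector_derivative[OF q[of t]], of "{0..T}"] has_vector_derivative_const[of v]] by simp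
  have dy: "\<And>t. (y has_vector_derivative y1 t) (at t)" "\<And>t. (y1 has_vector_derivative y2 t) (at t)"
    using y by (auto simp: C2_def)
  have 1: "inner (lsq_class {0..T} (\<lambda>t. R (y t))) (lsq_class {0..T} (\<lambda>t. deriv (deriv \<phi>) t *\<^sub>R v))
      = integral {0..T} (\<lambda>t. deriv (deriv \<phi>) t * inner (R (y t)) v)"
    by (subst inner_class) (auto intro!: continuous_intros ct c)
  have 2: "integral {0..T} (\<lambda>t. deriv (deriv \<phi>) t * inner (R (y t)) v) = - integral {0..T} (\<lambda>t. deriv \<phi> t * inner (R (y1 t)) v)"
    by (rule test_by_parts[OF T t1 d[OF dy(1)]]) (intro continuous_intros c)
  have 3: "integral {0..T} (\<lambda>t. deriv \<phi> t * inner (R (y1 t)) v) = - integral {0..T} (\<lambda>t. \<phi> t * inner (R (y2 t)) v)"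
    by (rule test_by_parts[OF T \<phi> d[OF dy(2)]]) (intro continuous_intros c)
  have 4: "inner (lsq_class {0..T} (\<lambda>t. inner (y t) v)) (lsq_class {0..T} \<phi>) = integral {0..T} (\<lambda>t. \<phi> t * inner (y t) v)"
    by (subst inner_class) (auto intro!: continuous_intros ct c simp: mult.commute)
  have 5: "lsq_class {0..T} (source y y1 y2) - lsq_class {0..T} (\<lambda>t. R (y t) + R (y1 t)) = lsq_class {0..T} (\<lambda>t. R (y2 t) + y t)"
  proof -
    have "(\<lambda>t. R (y2 t) + y t) = (\<lambda>t. source y y1 y2 t - (R (y t) + R (y1 t)))" by (rule ext) (simp add: source_def)
    then show ?thesis
      by (simp only:) (rule class_combine(2)[symmetric]; intro continuous_on_add c)
  qed
  have 6: "inner (lsq_class {0..T} (\<lambda>t. R (y2 t) + y t)) (lsq_class {0..T} (\<lambda>t. \<phi> t *\<^sub>R v))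
      = integral {0..T} (\<lambda>t. \<phi> t * inner (R (y2 t)) v + \<phi> t * inner (y t) v)"
  proof -
    have "inner (lsq_class {0..T} (\<lambda>t. R (y2 t) + y t)) (lsq_class {0..T} (\<lambda>t. \<phi> t *\<^sub>R v))
        = integral {0..T} (\<lambda>t. inner (R (y2 t) + y t) (\<phi> t *\<^sub>R v))"
      by (rule inner_class) (intro continuous_intros ct c)+
    then show ?thesis by (simp add: inner_add_left distrib_left)
  qed
  have 7: "integral {0..T} (\<lambda>t. \<phi> t * inner (R (y2 t)) v + \<phi> t * inner (y t) v)
      = integral {0..T} (\<lambda>t. \<phi> t * inner (R (y2 t)) v) + integral {0..T} (\<lambda>t. \<phi> t * inner (y t) v)"
    by (rule Henstock_Kurzweil_Integration.integral_add; intro integrable_continuous_real continuous_intros ct c)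
  show ?thesis unfolding 1 2 3 4 5 6 7 by simp
qed

context
  fixes T :: real and y y1 y2 :: "nat \<Rightarrow> real \<Rightarrow> ('a, real) lsq" and a b u
  assumes T: "T > 0" and C2: "\<And>n. C2 (y n) (y1 n) (y2 n)" and a: "a \<in> H10 \<Omega>"
    and lim0: "(\<lambda>n. dirichlet_form (R (y n 0) - a) (R (y n 0) - a)) \<longlonglongrightarrow> 0"
    and lim1: "(\<lambda>n. R (y1 n 0)) \<longlonglongrightarrow> b"
    and limF: "(\<lambda>n. lsq_class {0..T} (source (y n) (y1 n) (y2 n))) \<longlonglongrightarrow> u"
begin

text \<open>The energy estimate for the difference of two approximations. The bound is split into a part for
\<open>m\<close> and a part for \<open>n\<close> by passing through the limits \<open>a\<close>, \<open>b\<close>, \<open>u\<close> of the data.\<close>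

lemma approximations_Cauchy:
  obtains \<delta> where "\<delta> \<longlonglongrightarrow> 0"
    "\<And>m n t. t \<in> {0..T} \<Longrightarrow> dirichlet_form (R (y m t) - R (y n t)) (R (y m t) - R (y n t))
        + 1/2 * (norm (R (y1 m t) - R (y1 n t)))\<^sup>2 \<le> \<delta> m + \<delta> n"
proof -
  let ?F = "\<lambda>n. lsq_class {0..T} (source (y n) (y1 n) (y2 n))"
  define B where "B n = dirichlet_form (R (y n 0) - a) (R (y n 0) - a)" for n
  define \<delta> where "\<delta> n = 3 * (norm (R (y1 n 0) - b))\<^sup>2 + (2 + 4 * C) * B n + 6 * (norm (?F n - u))\<^sup>2" for n
  have B0: "B \<longlonglongrightarrow> 0" unfolding B_def by (rule lim0)
  have "\<delta> \<longlonglongrightarrow> 3 * (norm (b - b))\<^sup>2 + (2 + 4 * C) * 0 + 6 * (norm (u - u))\<^sup>2"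
    unfolding \<delta>_def by (intro tendsto_intros lim1 limF B0)
  then have lim: "\<delta> \<longlonglongrightarrow> 0" by simp
  show thesis
  proof (rule that[OF lim])
    fix m n t assume t: "t \<in> {0..T}"
    let ?d = "\<lambda>t. y m t + (-1) *\<^sub>R y n t" and ?d1 = "\<lambda>t. y1 m t + (-1) *\<^sub>R y1 n t" and ?d2 = "\<lambda>t. y2 m t + (-1) *\<^sub>R y2 n t"
    note cc = C2_combination[OF C2[of m] C2[of n], of "-1"]
    have R_diff: "R (p + (-1) *\<^sub>R q) = R p - R q" for p q by (simp add: R_simps)
    have src: "lsq_class {0..T} (source ?d ?d1 ?d2) = ?F m - ?F n"
      unfolding cc(2) by (simp add: class_combine(2)[OF C2_continuous(4)[OF C2] C2_continuous(4)[OF C2]])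
    have "dirichlet_form (R (y m t) - R (y n t)) (R (y m t) - R (y n t)) + 1/2 * (norm (R (y1 m t) - R (y1 n t)))\<^sup>2
        \<le> 3/2 * (norm (R (y1 m 0) - R (y1 n 0)))\<^sup>2 + dirichlet_form (R (y m 0) - R (y n 0)) (R (y m 0) - R (y n 0))
          + 2 * (norm (R (y m 0) - R (y n 0)))\<^sup>2 + 3 * (norm (?F m - ?F n))\<^sup>2"
      using energy_estimate(1)[OF cc(1) T t] unfolding R_form unfolding src R_diff .
    moreover have D0: "dirichlet_form (R (y m 0) - R (y n 0)) (R (y m 0) - R (y n 0)) \<le> 2 * B m + 2 * B n"
      unfolding B_def by (rule D_diff_triangle[OF R_in R_in a])
    moreover have "(norm (R (y m 0) - R (y n 0)))\<^sup>2 \<le> C * (2 * B m + 2 * B n)"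
      using poincare_const(2)[OF V_ops(3)[OF R_in R_in]] mult_left_mono[OF D0 less_imp_le[OF poincare_const(1)]] by (rule order_trans)
    moreover note norm_diff_triangle_square[of "R (y1 m 0)" "R (y1 n 0)" b] norm_diff_triangle_square[of "?F m" "?F n" u]
    moreover have "\<delta> m + \<delta> n = 3/2 * (2 * (norm (R (y1 m 0) - b))\<^sup>2 + 2 * (norm (R (y1 n 0) - b))\<^sup>2) + (2 * B m + 2 * B n)
       + 2 * (C * (2 * B m + 2 * B n)) + 3 * (2 * (norm (?F m - u))\<^sup>2 + 2 * (norm (?F n - u))\<^sup>2)"
      by (simp add: \<delta>_def algebra_simps)
    moreover have "E \<le> d" if "E \<le> 3/2 * p + q + 2 * r + 3 * s" "q \<le> q'" "r \<le> r'" "p \<le> p'" "s \<le> s'"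
      "d = 3/2 * p' + q' + 2 * r' + 3 * s'" for E d p q r s p' q' r' s' :: real
      using that by linarith
    ultimately show "dirichlet_form (R (y m t) - R (y n t)) (R (y m t) - R (y n t))
        + 1/2 * (norm (R (y1 m t) - R (y1 n t)))\<^sup>2 \<le> \<delta> m + \<delta> n" by blast
  qed
qed

lemma approximations_converge:
  obtains x x1 \<delta> where "\<delta> \<longlonglongrightarrow> 0" "\<And>t. t \<notin> {0..T} \<Longrightarrow> x t = 0"
    "\<And>t. t \<in> {0..T} \<Longrightarrow> x t \<in> H10 \<Omega>"
    "\<And>n t. t \<in> {0..T} \<Longrightarrow> dirichlet_form (x t - R (y n t)) (x t - R (y n t)) \<le> \<delta> n"
    "\<And>n t. t \<in> {0..T} \<Longrightarrow> (norm (x1 t - R (y1 n t)))\<^sup>2 \<le> \<delta> n"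
proof -
  obtain \<delta> where \<delta>: "\<delta> \<longlonglongrightarrow> 0" and
    bound: "\<And>m n t. t \<in> {0..T} \<Longrightarrow> dirichlet_form (R (y m t) - R (y n t)) (R (y m t) - R (y n t))
        + 1/2 * (norm (R (y1 m t) - R (y1 n t)))\<^sup>2 \<le> \<delta> m + \<delta> n"
    by (rule approximations_Cauchy, rule that)
  have bD: "dirichlet_form (R (y m t) - R (y n t)) (R (y m t) - R (y n t)) \<le> \<delta> m + \<delta> n" if "t \<in> {0..T}" for m n t
    using bound[OF that, of m n] zero_le_power2[of "norm (R (y1 m t) - R (y1 n t))"] by linarith
  have bN: "(norm (R (y1 m t) - R (y1 n t)))\<^sup>2 \<le> 2 * (\<delta> m + \<delta> n)" if "t \<in> {0..T}" for m n t
    using bound[OF that, of m n] D_nonneg[OF V_ops(3)[OF R_in[of "y m t"] R_in[of "y n t"]]] by argo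
  have small: "\<exists>N. \<forall>m\<ge>N. \<forall>n\<ge>N. \<delta> m + \<delta> n < e" if e: "e > 0" for e :: real
  proof -
    have "\<forall>\<^sub>F n in sequentially. \<delta> n < e / 2" using e by (intro order_tendstoD(2)[OF \<delta>]) simp
    then obtain N where N: "\<forall>n\<ge>N. \<delta> n < e / 2" unfolding eventually_sequentially by (elim exE)
    have "\<forall>m\<ge>N. \<forall>n\<ge>N. \<delta> m + \<delta> n < e"
    proof (intro allI impI)
      fix m n assume "m \<ge> N" "n \<ge> N"
      then have "\<delta> m < e / 2" "\<delta> n < e / 2" using N by simp_all
      then show "\<delta> m + \<delta> n < e" by argo
    qed
    then show ?thesis by (rule exI)
  qed
  have "\<forall>t\<in>{0..T}. \<exists>x. x \<in> H10 \<Omega> \<and> (\<lambda>n. dirichlet_form (R (y n t) - x) (R (y n t) - x)) \<longlonglongrightarrow> 0"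
  proof
    fix t assume t: "t \<in> {0..T}"
    have "\<exists>x\<in>H10 \<Omega>. (\<lambda>n. dirichlet_form (R (y n t) - x) (R (y n t) - x)) \<longlonglongrightarrow> 0"
    proof (rule D_complete)
      show "R (y n t) \<in> H10 \<Omega>" for n by (rule R_in)
      fix e :: real assume "e > 0"
      from small[OF this] obtain N where N: "\<forall>m\<ge>N. \<forall>n\<ge>N. \<delta> m + \<delta> n < e" by (elim exE)
      show "\<exists>N. \<forall>m\<ge>N. \<forall>n\<ge>N. dirichlet_form (R (y m t) - R (y n t)) (R (y m t) - R (y n t)) < e"
        by (rule exI[of _ N]) (use N in \<open>auto intro: le_less_trans[OF bD[OF t]]\<close>)
    qed
    then show "\<exists>x. x \<in> H10 \<Omega> \<and> (\<lambda>n. dirichlet_form (R (y n t) - x) (R (y n t) - x)) \<longlonglongrightarrow> 0" by (simp only: Bex_def)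
  qed
  then obtain x where "\<forall>t\<in>{0..T}. x t \<in> H10 \<Omega> \<and> (\<lambda>n. dirichlet_form (R (y n t) - x t) (R (y n t) - x t)) \<longlonglongrightarrow> 0"
    by (rule bchoice[THEN exE])
  then have x: "x t \<in> H10 \<Omega>" "(\<lambda>n. dirichlet_form (R (y n t) - x t) (R (y n t) - x t)) \<longlonglongrightarrow> 0" if "t \<in> {0..T}" for t
    using that by simp_all
  have "\<forall>t\<in>{0..T}. \<exists>p. (\<lambda>n. R (y1 n t)) \<longlonglongrightarrow> p"
  proof
    fix t assume t: "t \<in> {0..T}"
    have "Cauchy (\<lambda>n. R (y1 n t))"
    proof (rule CauchyI)
      fix e :: real assume e: "e > 0"
      then have "e\<^sup>2 / 2 > 0" by simp
      from small[OF this] obtain N where N: "\<forall>m\<ge>N. \<forall>n\<ge>N. \<delta> m + \<delta> n < e\<^sup>2 / 2" by (elim exE)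
      have "norm (R (y1 m t) - R (y1 n t)) < e" if "m \<ge> N" "n \<ge> N" for m n
      proof (rule power2_less_imp_less)
        have "\<delta> m + \<delta> n < e\<^sup>2 / 2" using N that by simp
        then show "(norm (R (y1 m t) - R (y1 n t)))\<^sup>2 < e\<^sup>2" using bN[OF t, of m n] by argo
      qed (use e in simp)
      then show "\<exists>M. \<forall>m\<ge>M. \<forall>n\<ge>M. norm (R (y1 m t) - R (y1 n t)) < e" by blast
    qed
    then show "\<exists>p. (\<lambda>n. R (y1 n t)) \<longlonglongrightarrow> p" by (simp only: Cauchy_convergent_iff convergent_def)
  qed
  then obtain x1 where "\<forall>t\<in>{0..T}. (\<lambda>n. R (y1 n t)) \<longlonglongrightarrow> x1 t" by (rule bchoice[THEN exE])
  then have x1: "(\<lambda>n. R (y1 n t)) \<longlonglongrightarrow> x1 t" if "t \<in> {0..T}" for t using that by simp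
  have fin_D: "dirichlet_form (x t - R (y n t)) (x t - R (y n t)) \<le> 2 * \<delta> n" if t: "t \<in> {0..T}" for n t
  proof -
    have lim: "(\<lambda>m. 2 * dirichlet_form (R (y m t) - x t) (R (y m t) - x t) + 2 * (\<delta> n + \<delta> m)) \<longlonglongrightarrow> 2 * 0 + 2 * (\<delta> n + 0)"
      by (intro tendsto_intros x(2)[OF t] \<delta>)
    have le: "dirichlet_form (x t - R (y n t)) (x t - R (y n t))
        \<le> 2 * dirichlet_form (R (y m t) - x t) (R (y m t) - x t) + 2 * (\<delta> n + \<delta> m)" for m
      using D_diff_triangle[OF x(1)[OF t] R_in[of "y n t"] R_in[of "y m t"]] bD[OF t, of n m]
        D_diff_commute[OF x(1)[OF t] R_in[of "y m t"]] by argo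
    have "dirichlet_form (x t - R (y n t)) (x t - R (y n t)) \<le> 2 * 0 + 2 * (\<delta> n + 0)"
      by (rule LIMSEQ_le_const[OF lim]) (rule exI[of _ 0], intro allI impI le)
    then show ?thesis by simp
  qed
  have fin_N: "(norm (x1 t - R (y1 n t)))\<^sup>2 \<le> 2 * \<delta> n" if t: "t \<in> {0..T}" for n t
  proof -
    have "(\<lambda>m. (norm (R (y1 m t) - R (y1 n t)))\<^sup>2) \<longlonglongrightarrow> (norm (x1 t - R (y1 n t)))\<^sup>2"
      by (intro tendsto_intros x1[OF t])
    moreover have "(\<lambda>m. 2 * (\<delta> m + \<delta> n)) \<longlonglongrightarrow> 2 * (0 + \<delta> n)" by (intro tendsto_intros \<delta>)
    ultimately have "(norm (x1 t - R (y1 n t)))\<^sup>2 \<le> 2 * (0 + \<delta> n)"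
      by (rule LIMSEQ_le) (use bN[OF t] in blast)
    then show ?thesis by simp
  qed
  have "(\<lambda>n. 2 * \<delta> n) \<longlonglongrightarrow> 2 * 0" by (intro tendsto_intros \<delta>)
  then have \<delta>2: "(\<lambda>n. 2 * \<delta> n) \<longlonglongrightarrow> 0" by simp
  show thesis
    by (rule that[of "\<lambda>n. 2 * \<delta> n" "\<lambda>t. if t \<in> {0..T} then x t else 0" x1])
      (use \<delta>2 x(1) fin_D fin_N in \<open>simp_all only: if_True if_False\<close>)
qed

context
  fixes x x1 :: "real \<Rightarrow> ('a, real) lsq" and \<delta> :: "nat \<Rightarrow> real"
  assumes \<delta>: "\<delta> \<longlonglongrightarrow> 0" and xH: "\<And>t. t \<in> {0..T} \<Longrightarrow> x t \<in> H10 \<Omega>"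
    and xD: "\<And>n t. t \<in> {0..T} \<Longrightarrow> dirichlet_form (x t - R (y n t)) (x t - R (y n t)) \<le> \<delta> n"
    and x1N: "\<And>n t. t \<in> {0..T} \<Longrightarrow> (norm (x1 t - R (y1 n t)))\<^sup>2 \<le> \<delta> n"
begin

lemma approximations_uniform_limit:
  "uniform_limit {0..T} (\<lambda>n t. R (y n t)) x sequentially"
  "uniform_limit {0..T} (\<lambda>n t. R (y1 n t)) x1 sequentially"
  "v \<in> H10 \<Omega> \<Longrightarrow> uniform_limit {0..T} (\<lambda>n t. inner (y n t) v) (\<lambda>t. dirichlet_form (x t) v) sequentially"
proof -
  have "(\<lambda>n. C * \<delta> n) \<longlonglongrightarrow> C * 0" by (intro tendsto_intros \<delta>)
  then have C\<delta>: "(\<lambda>n. C * \<delta> n) \<longlonglongrightarrow> 0" by simp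
  show "uniform_limit {0..T} (\<lambda>n t. R (y n t)) x sequentially"
  proof (rule uniform_limit_square[OF C\<delta>])
    fix n t assume t: "t \<in> {0..T}"
    show "(norm (x t - R (y n t)))\<^sup>2 \<le> C * \<delta> n"
      using poincare_const(2)[OF V_ops(3)[OF xH[OF t] R_in]] mult_left_mono[OF xD[OF t] less_imp_le[OF poincare_const(1)]]
      by (rule order_trans)
  qed
  show "uniform_limit {0..T} (\<lambda>n t. R (y1 n t)) x1 sequentially" by (rule uniform_limit_square[OF \<delta> x1N])
  assume v: "v \<in> H10 \<Omega>"
  have "(\<lambda>n. \<delta> n * dirichlet_form v v) \<longlonglongrightarrow> 0 * dirichlet_form v v" by (intro tendsto_intros \<delta>)
  then have D\<delta>: "(\<lambda>n. \<delta> n * dirichlet_form v v) \<longlonglongrightarrow> 0" by simp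
  show "uniform_limit {0..T} (\<lambda>n t. inner (y n t) v) (\<lambda>t. dirichlet_form (x t) v) sequentially"
  proof (rule uniform_limit_square[OF D\<delta>])
    fix n t assume t: "t \<in> {0..T}"
    have "(norm (dirichlet_form (x t) v - inner (y n t) v))\<^sup>2 = (dirichlet_form (x t - R (y n t)) v)\<^sup>2"
      by (simp add: D_diff_left[OF xH[OF t] R_in v] R_eq[OF v])
    also have "\<dots> \<le> dirichlet_form (x t - R (y n t)) (x t - R (y n t)) * dirichlet_form v v"
      by (rule D_Cauchy_Schwarz[OF V_ops(3)[OF xH[OF t] R_in] v])
    also have "\<dots> \<le> \<delta> n * dirichlet_form v v" by (rule mult_right_mono[OF xD[OF t] D_nonneg[OF v]])
    finally show "(norm (dirichlet_form (x t) v - inner (y n t) v))\<^sup>2 \<le> \<delta> n * dirichlet_form v v" .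
  qed
qed

text \<open>All parts are uniform limits: the derivative by the theorem on differentiating sequences, continuity
in the energy norm because the form norm of \<open>x s - R (y n s)\<close> is small uniformly in \<open>s\<close>.\<close>

lemma limit_energy_class: "energy_class T x x1"
  unfolding energy_class_def
proof (intro conjI ballI)
  show "x t \<in> H10 \<Omega>" if "t \<in> {0..T}" for t by (rule xH[OF that])
  show "continuous_on {0..T} x1"
    by (rule uniform_limit_theorem[OF _ approximations_uniform_limit(2)])
      (simp_all add: C2_continuous(2)[OF C2] R_continuous_on)
  fix t assume t: "t \<in> {0..T}"
  show "((\<lambda>s. dirichlet_form (x s - x t) (x s - x t)) \<longlongrightarrow> 0) (at t within {0..T})"
  proof (rule tendstoI)
    fix e :: real assume e: "e > 0"
    have "\<forall>\<^sub>F n in sequentially. \<delta> n < e / 12" using e by (intro order_tendstoD(2)[OF \<delta>]) simp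
    then obtain n where n: "\<delta> n < e / 12" unfolding eventually_sequentially by auto
    let ?g = "\<lambda>s. inner (R (y n s - y n t)) (y n s - y n t)"
    have "continuous_on {0..T} ?g" by (intro continuous_intros R_continuous_on C2_continuous(1)[OF C2])
    then have "(?g \<longlongrightarrow> ?g t) (at t within {0..T})" using t by (simp only: continuous_on_def)
    moreover have "?g t < e / 8" using e by simp
    ultimately have "\<forall>\<^sub>F s in at t within {0..T}. ?g s < e / 8" by (rule order_tendstoD(2))
    moreover have "\<forall>\<^sub>F s in at t within {0..T}. s \<in> {0..T}" by (simp add: eventually_at_filter)
    ultimately show "\<forall>\<^sub>F s in at t within {0..T}. dist (dirichlet_form (x s - x t) (x s - x t)) 0 < e"
    proof eventually_elim
      case (elim s)
      note s = elim(2)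
      have "?g s = dirichlet_form (R (y n t) - R (y n s)) (R (y n t) - R (y n s))"
        unfolding R_form unfolding R_simps by (rule D_diff_commute[OF R_in R_in])
      moreover note D_diff_triangle[OF xH[OF s] xH[OF t] R_in[of "y n t"]]
        D_diff_triangle[OF xH[OF s] R_in[of "y n t"] R_in[of "y n s"]] xD[OF t, of n] xD[OF s, of n]
      ultimately have "dirichlet_form (x s - x t) (x s - x t) \<le> 6 * \<delta> n + 4 * ?g s" by linarith
      also have "\<dots> < e" using n elim(1) by linarith
      finally show ?case using D_nonneg[OF V_ops(3)[OF xH[OF s] xH[OF t]]] by simp
    qed
  qed
  have "\<exists>g. \<forall>t\<in>{0..T}. (\<lambda>n. R (y n t)) \<longlonglongrightarrow> g t \<and> (g has_derivative (\<lambda>h. h *\<^sub>R x1 t)) (at t within {0..T})"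
  proof (rule has_derivative_sequence[where ?x0.0 = 0 and l = "x 0"])
    fix n t assume "t \<in> {0..T}"
    have "(y n has_vector_derivative y1 n t) (at t)" using C2[of n] by (simp add: C2_def)
    from has_vector_derivative_at_within[OF R_vector_derivative[OF this]]
    show "((\<lambda>t. R (y n t)) has_derivative (\<lambda>h. h *\<^sub>R R (y1 n t))) (at t within {0..T})"
      by (simp only: has_vector_derivative_def)
  next
    fix e :: real assume "e > 0"
    from uniform_limitD[OF approximations_uniform_limit(2) this]
    show "\<forall>\<^sub>F n in sequentially. \<forall>t\<in>{0..T}. \<forall>h. norm (h *\<^sub>R R (y1 n t) - h *\<^sub>R x1 t) \<le> e * norm h"
    proof eventually_elim
      case (elim n)
      show ?case
      proof (intro ballI allI)
        fix t h assume "t \<in> {0..T}"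
        then have "norm (R (y1 n t) - x1 t) \<le> e" using elim by (simp add: dist_norm less_imp_le)
        then have "\<bar>h\<bar> * norm (R (y1 n t) - x1 t) \<le> \<bar>h\<bar> * e" by (rule mult_left_mono) simp
        then show "norm (h *\<^sub>R R (y1 n t) - h *\<^sub>R x1 t) \<le> e * norm h"
          by (simp add: scaleR_diff_right[symmetric] mult.commute)
      qed
    qed
  next
    show "(\<lambda>n. R (y n 0)) \<longlonglongrightarrow> x 0"
      by (rule tendsto_uniform_limitI[OF approximations_uniform_limit(1)]) (use T in simp)
  qed (use T in simp_all)
  then obtain g where g: "\<forall>t\<in>{0..T}. (\<lambda>n. R (y n t)) \<longlonglongrightarrow> g t \<and> (g has_derivative (\<lambda>h. h *\<^sub>R x1 t)) (at t within {0..T})" by (elim exE)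
  have gx: "g s = x s" if s: "s \<in> {0..T}" for s
    by (rule LIMSEQ_unique[OF bspec[OF g s, THEN conjunct1] tendsto_uniform_limitI[OF approximations_uniform_limit(1) s]])
  have "(g has_vector_derivative x1 t) (at t within {0..T})"
    unfolding has_vector_derivative_def by (rule bspec[OF g t, THEN conjunct2])
  then show "(x has_vector_derivative x1 t) (at t within {0..T})"
    by (rule has_vector_derivative_transform[OF t gx[symmetric], rotated])
qed

lemma limit_initial_values: "x 0 = a" "x1 0 = b"
proof -
  have 0: "0 \<in> {0..T}" using T by simp
  show "x1 0 = b" by (rule LIMSEQ_unique[OF tendsto_uniform_limitI[OF approximations_uniform_limit(2) 0] lim1])
  have lim: "(\<lambda>n. 2 * \<delta> n + 2 * dirichlet_form (R (y n 0) - a) (R (y n 0) - a)) \<longlonglongrightarrow> 2 * 0 + 2 * 0"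
    by (intro tendsto_intros \<delta> lim0)
  have "dirichlet_form (x 0 - a) (x 0 - a) \<le> 2 * \<delta> n + 2 * dirichlet_form (R (y n 0) - a) (R (y n 0) - a)" for n
    using D_diff_triangle[OF xH[OF 0] a R_in[of "y n 0"]] xD[OF 0, of n] D_diff_commute[OF a R_in[of "y n 0"]] by linarith
  then have "dirichlet_form (x 0 - a) (x 0 - a) \<le> 2 * 0 + 2 * 0" by (intro LIMSEQ_le_const[OF lim]) auto
  then have "dirichlet_form (x 0 - a) (x 0 - a) = 0" using D_nonneg[OF V_ops(3)[OF xH[OF 0] a]] by simp
  then have "x 0 - a = 0" by (rule D_definite[OF V_ops(3)[OF xH[OF 0] a]])
  then show "x 0 = a" by simp
qed

text \<open>The weak identity for the approximations is linear in them and involves them only through inner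
products in $L^2$, so it passes to the limit.\<close>

lemma limit_wave_image:
  assumes u: "u \<in> L2_time \<Omega> T"
  shows "is_wave_image \<Omega> T x (u - lsq_class {0..T} (\<lambda>t. x t + x1 t))"
  unfolding is_wave_image_iff[OF limit_energy_class]
proof (intro conjI ballI)
  note e = limit_energy_class
  note cx = energy_classD(3,4)[OF e]
  have T0: "T \<ge> 0" using T by simp
  have "lsq_class {0..T} (\<lambda>t. x t + x1 t) \<in> L2_time \<Omega> T"
  proof (rule L2_time_class)
    show "continuous_on {0..T} (\<lambda>t. x t + x1 t)" by (intro continuous_on_add cx)
    fix t assume t: "t \<in> {0..T}"
    have "x t \<in> lsq_on \<Omega>" using xH[OF t] H10_sub by blast
    then show "x t + x1 t \<in> lsq_on \<Omega>" by (intro subspace_add[OF subspace_\<Omega>] energy_class_derivative_in[OF T e t])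
  qed
  then show "u - lsq_class {0..T} (\<lambda>t. x t + x1 t) \<in> L2_time \<Omega> T" by (rule L2_time_diff(1)[OF u])
  fix \<phi> v assume \<phi>: "\<phi> \<in> test_functions {0<..<T}" and v: "v \<in> H10 \<Omega>"
  note ct = test_continuous[OF \<phi>, of "{0..T}"] test_continuous[OF test_deriv(1)[OF test_deriv(1)[OF \<phi>]], of "{0..T}"]
  note cy = C2_continuous(1,2)[OF C2, of "{0..T}"]
  note ul = approximations_uniform_limit
  have L1: "(\<lambda>n. lsq_class {0..T} (\<lambda>t. R (y n t))) \<longlonglongrightarrow> lsq_class {0..T} x"
    by (rule class_tendsto[OF R_continuous_on[OF cy(1)] cx(2) T0 ul(1)])
  have L2: "(\<lambda>n. lsq_class {0..T} (\<lambda>t. inner (y n t) v)) \<longlonglongrightarrow> lsq_class {0..T} (\<lambda>t. dirichlet_form (x t) v)"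
    by (rule class_tendsto[OF _ energy_class_form_continuous[OF e v] T0 ul(3)[OF v]]) (intro continuous_intros cy)
  have L3: "(\<lambda>n. lsq_class {0..T} (\<lambda>t. R (y n t) + R (y1 n t))) \<longlonglongrightarrow> lsq_class {0..T} (\<lambda>t. x t + x1 t)"
    by (rule class_tendsto[OF _ _ T0 uniform_limit_add[OF ul(1,2)]]) (intro continuous_on_add R_continuous_on cy cx)+
  let ?l = "\<lambda>n. inner (lsq_class {0..T} (\<lambda>t. R (y n t))) (lsq_class {0..T} (\<lambda>t. deriv (deriv \<phi>) t *\<^sub>R v))
      + inner (lsq_class {0..T} (\<lambda>t. inner (y n t) v)) (lsq_class {0..T} \<phi>)"
  have "?l \<longlonglongrightarrow> inner (lsq_class {0..T} x) (lsq_class {0..T} (\<lambda>t. deriv (deriv \<phi>) t *\<^sub>R v))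
      + inner (lsq_class {0..T} (\<lambda>t. dirichlet_form (x t) v)) (lsq_class {0..T} \<phi>)"
    by (intro tendsto_intros L1 L2)
  moreover have "?l \<longlonglongrightarrow> inner (u - lsq_class {0..T} (\<lambda>t. x t + x1 t)) (lsq_class {0..T} (\<lambda>t. \<phi> t *\<^sub>R v))"
    unfolding strong_solution_weak[OF T C2 \<phi>] by (intro tendsto_intros L3 limF)
  ultimately have "inner (lsq_class {0..T} x) (lsq_class {0..T} (\<lambda>t. deriv (deriv \<phi>) t *\<^sub>R v))
      + inner (lsq_class {0..T} (\<lambda>t. dirichlet_form (x t) v)) (lsq_class {0..T} \<phi>)
      = inner (u - lsq_class {0..T} (\<lambda>t. x t + x1 t)) (lsq_class {0..T} (\<lambda>t. \<phi> t *\<^sub>R v))"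
    by (rule LIMSEQ_unique)
  moreover have "inner (lsq_class {0..T} x) (lsq_class {0..T} (\<lambda>t. deriv (deriv \<phi>) t *\<^sub>R v))
      = integral {0..T} (\<lambda>t. deriv (deriv \<phi>) t * inner (x t) v)"
    by (subst inner_class) (auto intro!: continuous_intros ct cx)
  moreover have "inner (lsq_class {0..T} (\<lambda>t. dirichlet_form (x t) v)) (lsq_class {0..T} \<phi>)
      = integral {0..T} (\<lambda>t. \<phi> t * dirichlet_form (x t) v)"
    by (subst inner_class[OF energy_class_form_continuous[OF e v] ct(1)]) (simp add: mult.commute)
  ultimately show "integral {0..T} (\<lambda>t. deriv (deriv \<phi>) t * inner (x t) v) + integral {0..T} (\<lambda>t. \<phi> t * dirichlet_form (x t) v)
      = inner (u - lsq_class {0..T} (\<lambda>t. x t + x1 t)) (lsq_class {0..T} (\<lambda>t. \<phi> t *\<^sub>R v))" by simp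
qed

text \<open>One factor 2 comes from comparing \<open>x\<close> with the approximations, another from the coefficient $\frac12$
of $|\dot x|^2$ in the energy estimate.\<close>

lemma limit_energy_bound:
  "integral {0..T} (\<lambda>t. dirichlet_form (x t) (x t) + (norm (x1 t))\<^sup>2)
    \<le> 4 * (3/2 * (norm b)\<^sup>2 + dirichlet_form a a + 2 * (norm a)\<^sup>2 + 3 * (norm u)\<^sup>2)"
proof -
  let ?F = "\<lambda>n. lsq_class {0..T} (source (y n) (y1 n) (y2 n))"
  define K where "K n = 3/2 * (norm (R (y1 n 0)))\<^sup>2 + inner (R (y n 0)) (y n 0) + 2 * (norm (R (y n 0)))\<^sup>2 + 3 * (norm (?F n))\<^sup>2" for n
  have 0: "0 \<in> {0..T}" using T by simp
  note e = limit_energy_class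
  have lim_a: "(\<lambda>n. R (y n 0)) \<longlonglongrightarrow> a"
    using tendsto_uniform_limitI[OF approximations_uniform_limit(1) 0] by (simp only: limit_initial_values)
  have lim_D: "(\<lambda>n. inner (R (y n 0)) (y n 0)) \<longlonglongrightarrow> dirichlet_form a a"
  proof -
    have "(\<lambda>n. dirichlet_form (R (y n 0) - a) (R (y n 0) - a) + 2 * dirichlet_form (R (y n 0)) a - dirichlet_form a a)
        \<longlonglongrightarrow> 0 + 2 * dirichlet_form a a - dirichlet_form a a"
      by (intro tendsto_intros lim0 D_continuous[OF R_in a lim0 a])
    moreover have "dirichlet_form (R (y n 0) - a) (R (y n 0) - a) + 2 * dirichlet_form (R (y n 0)) a - dirichlet_form a a
        = inner (R (y n 0)) (y n 0)" for n
      unfolding R_form using a R_in[of "y n 0"] D_sym[OF a R_in[of "y n 0"]] V_ops(3)[OF R_in[of "y n 0"] a]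
      by (simp only: D_diff_left D_diff_right)
    ultimately show ?thesis by simp
  qed
  have K: "K \<longlonglongrightarrow> 3/2 * (norm b)\<^sup>2 + dirichlet_form a a + 2 * (norm a)\<^sup>2 + 3 * (norm u)\<^sup>2"
    unfolding K_def by (intro tendsto_intros lim1 lim_a lim_D limF)
  then have lim: "(\<lambda>n. 4 * K n + 8 * \<delta> n * T) \<longlonglongrightarrow> 4 * (3/2 * (norm b)\<^sup>2 + dirichlet_form a a + 2 * (norm a)\<^sup>2 + 3 * (norm u)\<^sup>2) + 8 * 0 * T"
    by (intro tendsto_intros \<delta>)
  have "integral {0..T} (\<lambda>t. dirichlet_form (x t) (x t) + (norm (x1 t))\<^sup>2) \<le> 4 * K n + 8 * \<delta> n * T" for n
  proof -
    let ?e = "\<lambda>t. inner (R (y n t)) (y n t) + 1/2 * (norm (R (y1 n t)))\<^sup>2"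
    have ce: "continuous_on {0..T} ?e" by (intro continuous_intros R_continuous_on C2_continuous(1,2)[OF C2])
    have "integral {0..T} (\<lambda>t. dirichlet_form (x t) (x t) + (norm (x1 t))\<^sup>2) \<le> integral {0..T} (\<lambda>t. 4 * ?e t + 8 * \<delta> n)"
    proof (rule integral_le)
      show "(\<lambda>t. dirichlet_form (x t) (x t) + (norm (x1 t))\<^sup>2) integrable_on {0..T}"
        by (intro integrable_continuous_real continuous_on_add continuous_on_power continuous_on_norm
            energy_class_energy_continuous[OF e] energy_classD(3)[OF e])
      show "(\<lambda>t. 4 * ?e t + 8 * \<delta> n) integrable_on {0..T}"
        by (intro integrable_continuous_real continuous_on_add continuous_on_mult continuous_on_const ce)
      fix t assume t: "t \<in> {0..T}"
      have "dirichlet_form (x t) (x t) \<le> 2 * dirichlet_form (x t - R (y n t)) (x t - R (y n t)) + 2 * dirichlet_form (R (y n t)) (R (y n t))"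
        using D_triangle_square[OF V_ops(3)[OF xH[OF t] R_in[of "y n t"]] R_in[of "y n t"]] by simp
      moreover have "(norm (x1 t))\<^sup>2 \<le> 2 * (norm (x1 t - R (y1 n t)))\<^sup>2 + 2 * (norm (R (y1 n t)))\<^sup>2"
        using norm_diff_triangle_square[of "x1 t" 0 "R (y1 n t)"] by simp
      moreover have "\<delta> n \<ge> 0" using x1N[OF t, of n] zero_le_power2[of "norm (x1 t - R (y1 n t))"] by linarith
      moreover have "p + q \<le> 4 * (e' + 1/2 * f') + 8 * d" if "p \<le> 2 * p' + 2 * e'" "q \<le> 2 * q' + 2 * f'" "0 \<le> d"
        "p' \<le> d" "q' \<le> d" "0 \<le> e'" for p q p' q' d e' f' :: real
        using that by argo
      ultimately show "dirichlet_form (x t) (x t) + (norm (x1 t))\<^sup>2 \<le> 4 * ?e t + 8 * \<delta> n"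
        using xD[OF t, of n] x1N[OF t, of n] R_nonnegative[of "y n t"] unfolding R_form by blast
    qed
    also have "\<dots> = 4 * integral {0..T} ?e + 8 * \<delta> n * T"
    proof -
      have "integral {0..T} (\<lambda>t. 4 * ?e t + 8 * \<delta> n) = integral {0..T} (\<lambda>t. 4 * ?e t) + integral {0..T} (\<lambda>t. 8 * \<delta> n)"
        by (rule Henstock_Kurzweil_Integration.integral_add; intro integrable_continuous_real continuous_on_mult continuous_on_const ce)
      also have "integral {0..T} (\<lambda>t. 4 * ?e t) = 4 * integral {0..T} ?e" by (rule integral_mult_right)
      also have "integral {0..T} (\<lambda>t. 8 * \<delta> n) = 8 * \<delta> n * T" using T by simp
      finally show ?thesis .
    qed
    also have "\<dots> \<le> 4 * K n + 8 * \<delta> n * T"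
      unfolding K_def by (intro add_right_mono mult_left_mono energy_estimate(2)[OF C2[of n] T]) simp
    finally show ?thesis .
  qed
  then have "integral {0..T} (\<lambda>t. dirichlet_form (x t) (x t) + (norm (x1 t))\<^sup>2)
    \<le> 4 * (3/2 * (norm b)\<^sup>2 + dirichlet_form a a + 2 * (norm a)\<^sup>2 + 3 * (norm u)\<^sup>2) + 8 * 0 * T"
    by (intro LIMSEQ_le_const[OF lim]) auto
  then show ?thesis by simp
qed

end

end

lemma energy_norm_op_C:
  assumes T: "T > 0" and x: "energy_class T x x1"
  shows "energy_norm \<Omega> T (op_C T x) = sqrt (integral {0..T} (\<lambda>t. dirichlet_form (x t) (x t) + (norm (x1 t))\<^sup>2))"
proof -
  let ?z = "lsq_class {0..T} (\<lambda>t. (x t, x1 t))"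
  let ?e = "\<lambda>t. dirichlet_form (x t) (x t) + (norm (x1 t))\<^sup>2"
  let ?h = "\<lambda>t. (H10_norm \<Omega> (fst (rep_lsq ?z t)))\<^sup>2 + (norm (snd (rep_lsq ?z t)))\<^sup>2"
  have z: "op_C T x = ?z"
    unfolding op_C_def by (rule class_cong) (simp add: time_deriv_eq[OF T x])
  have ce: "continuous_on {0..T} ?e"
    by (intro continuous_on_add continuous_on_power continuous_on_norm
        energy_class_energy_continuous[OF x] energy_classD(3)[OF x])
  have "continuous_on {0..T} (\<lambda>t. (x t, x1 t))" by (intro continuous_intros energy_classD(3,4)[OF x])
  then have "AE t in lebesgue. rep_lsq ?z t = (if t \<in> {0..T} then (x t, x1 t) else 0)" by (rule class_rep(2))
  then have ae: "AE t in lebesgue. indicator {0..T} t *\<^sub>R ?e t = indicator {0..T} t *\<^sub>R ?h t"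
  proof eventually_elim
    case (elim t)
    show ?case
    proof (cases "t \<in> {0..T}")
      case True
      then have "rep_lsq ?z t = (x t, x1 t)" using elim by simp
      then show ?thesis using True energy_classD(1)[OF x True] by (simp add: H10_norm_eq D_nonneg)
    qed simp
  qed
  have m: "(\<lambda>t. indicator {0..T} t *\<^sub>R ?e t) \<in> borel_measurable lebesgue"
  proof -
    have "(\<lambda>t. if t \<in> {0..T} then ?e t else 0) \<in> borel_measurable borel"
      by (intro borel_measurable_continuous_on_if ce continuous_on_const) auto
    moreover have "(\<lambda>t. if t \<in> {0..T} then ?e t else 0) = (\<lambda>t. indicator {0..T} t *\<^sub>R ?e t)" by (auto simp: indicator_def)
    ultimately show ?thesis by (simp add: measurable_completion)
  qed
  have "(LINT t:{0..T}|lebesgue. ?h t) = (LINT t:{0..T}|lebesgue. ?e t)"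
    unfolding set_lebesgue_integral_def
    by (rule integral_cong_AE[OF borel_measurable_AE[OF m ae] m]) (use ae in \<open>auto elim: eventually_mono\<close>)
  also have "\<dots> = integral {0..T} ?e" by (rule set_integral_continuous[OF ce])
  finally show ?thesis unfolding z energy_norm_def by simp
qed

text \<open>The Poincare inequality absorbs the term \<open>2 * (norm a)\<^sup>2\<close> of the energy bound into \<open>2 * C\<close> times the
form, which explains \<open>12 + 8 * C = 4 * (3 + 2 * C)\<close>.\<close>

theorem closed_loop_solvable:
  assumes T: "T > 0" and p: "p \<in> P_space \<Omega> T"
  obtains x where "x \<in> E_space \<Omega> T" "op_A_tilde \<Omega> T x = p"
    "energy_norm \<Omega> T (op_C T x) \<le> sqrt (12 + 8 * C) * P_norm \<Omega> p"
proof -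
  obtain u a b where pq: "p = (u, a, b)" by (cases p)
  have u: "u \<in> L2_time \<Omega> T" and a: "a \<in> H10 \<Omega>" and b: "b \<in> lsq_on \<Omega>" using p by (simp_all add: P_space_def pq)
  have u0: "u \<in> lsq_on {0..T}" using u by (simp add: L2_time_def)
  obtain y y1 y2 where y: "\<And>n::nat. C2 (y n) (y1 n) (y2 n)"
    "(\<lambda>n. dirichlet_form (R (y n 0) - a) (R (y n 0) - a)) \<longlonglongrightarrow> 0"
    "(\<lambda>n. R (y1 n 0)) \<longlonglongrightarrow> b" "(\<lambda>n. lsq_class {0..T} (source (y n) (y1 n) (y2 n))) \<longlonglongrightarrow> u"
    by (rule data_approximation[OF T u0 a b], rule that)
  obtain x x1 \<delta> where \<delta>: "\<delta> \<longlonglongrightarrow> 0" and x0: "\<And>t. t \<notin> {0..T} \<Longrightarrow> x t = 0" and x: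
    "\<And>t. t \<in> {0..T} \<Longrightarrow> x t \<in> H10 \<Omega>"
    "\<And>n t. t \<in> {0..T} \<Longrightarrow> dirichlet_form (x t - R (y n t)) (x t - R (y n t)) \<le> \<delta> n"
    "\<And>n t. t \<in> {0..T} \<Longrightarrow> (norm (x1 t - R (y1 n t)))\<^sup>2 \<le> \<delta> n"
    by (rule approximations_converge[OF T y(1) a y(2,3,4)], rule that)
  note hyps = T y(1) a y(2,3,4) \<delta> x
  have e: "energy_class T x x1" by (rule limit_energy_class[OF hyps])
  have w: "is_wave_image \<Omega> T x (u - lsq_class {0..T} (\<lambda>t. x t + x1 t))" by (rule limit_wave_image[OF hyps u])
  have x_init: "x 0 = a" by (rule limit_initial_values(1)[OF hyps])
  have x1_init: "x1 0 = b" by (rule limit_initial_values(2)[OF hyps])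
  have 0: "0 \<in> {0..T}" using T by simp
  have td: "time_deriv T x t = x1 t" if "t \<in> {0..T}" for t by (rule time_deriv_eq[OF T e that])
  have "lsq_class {0..T} (\<lambda>t. x t + time_deriv T x t) = lsq_class {0..T} (\<lambda>t. x t + x1 t)"
    by (rule class_cong) (simp add: td)
  then have A: "op_A_tilde \<Omega> T x = p"
    unfolding op_A_tilde_eq wave_op_eq[OF e w] td[OF 0] x_init x1_init pq by simp
  have "integral {0..T} (\<lambda>t. dirichlet_form (x t) (x t) + (norm (x1 t))\<^sup>2)
      \<le> (12 + 8 * C) * ((norm u)\<^sup>2 + dirichlet_form a a + (norm b)\<^sup>2)"
  proof -
    have C: "C * dirichlet_form a a \<ge> (norm a)\<^sup>2" by (rule poincare_const(2)[OF a])
    have nn: "0 \<le> C * (norm u)\<^sup>2" "0 \<le> C * (norm b)\<^sup>2" "0 \<le> dirichlet_form a a" "0 \<le> (norm u)\<^sup>2" "0 \<le> (norm b)\<^sup>2"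
      using poincare_const(1) D_nonneg[OF a] by simp_all
    have "(12 + 8 * C) * ((norm u)\<^sup>2 + dirichlet_form a a + (norm b)\<^sup>2)
      = 12 * (norm u)\<^sup>2 + 12 * dirichlet_form a a + 12 * (norm b)\<^sup>2 + 8 * (C * (norm u)\<^sup>2) + 8 * (C * dirichlet_form a a) + 8 * (C * (norm b)\<^sup>2)"
      by (simp add: algebra_simps)
    moreover have "integral {0..T} (\<lambda>t. dirichlet_form (x t) (x t) + (norm (x1 t))\<^sup>2)
        \<le> 4 * (3/2 * (norm b)\<^sup>2 + dirichlet_form a a + 2 * (norm a)\<^sup>2 + 3 * (norm u)\<^sup>2)"
      by (rule limit_energy_bound[OF hyps])
    ultimately show ?thesis using C nn by argo
  qed
  then have "energy_norm \<Omega> T (op_C T x) \<le> sqrt ((12 + 8 * C) * ((norm u)\<^sup>2 + dirichlet_form a a + (norm b)\<^sup>2))"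
    unfolding energy_norm_op_C[OF T e] by (rule real_sqrt_le_mono)
  also have "\<dots> = sqrt (12 + 8 * C) * P_norm \<Omega> p"
    using D_nonneg[OF a] by (simp add: real_sqrt_mult P_norm_def pq H10_norm_eq[OF a])
  finally have E: "energy_norm \<Omega> T (op_C T x) \<le> sqrt (12 + 8 * C) * P_norm \<Omega> p" .
  show thesis by (rule that[OF E_spaceI[OF T x0 e w] A E])
qed

end

theorem theorem4p9:
  fixes \<Omega> :: "'a::euclidean_space set"
  assumes "open \<Omega>" and "bounded \<Omega>"
  shows "\<exists>c>0. \<forall>T>0.
    bij_betw (op_A_tilde \<Omega> T) (E_space \<Omega> T) (P_space \<Omega> T) \<and>
    operator_norm (P_space \<Omega> T) (P_norm \<Omega>) (energy_norm \<Omega> T)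
      (op_C T \<circ> inv_into (E_space \<Omega> T) (op_A_tilde \<Omega> T)) \<le> ereal c"
proof -
  interpret bounded_domain \<Omega> by (rule bounded_domain.intro[OF assms])
  show ?thesis
  proof (intro exI[of _ "sqrt (12 + 8 * C)"] conjI allI impI)
    show pos: "0 < sqrt (12 + 8 * C)" using poincare_const(1) by simp
    fix T :: real assume T: "T > 0"
    have inj: "inj_on (op_A_tilde \<Omega> T) (E_space \<Omega> T)" by (intro inj_onI op_A_tilde_inj[OF T])
    have surj: "P_space \<Omega> T \<subseteq> op_A_tilde \<Omega> T ` E_space \<Omega> T"
    proof
      fix p assume p: "p \<in> P_space \<Omega> T"
      obtain x where "x \<in> E_space \<Omega> T" "op_A_tilde \<Omega> T x = p" by (rule closed_loop_solvable[OF T p], rule that)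
      then show "p \<in> op_A_tilde \<Omega> T ` E_space \<Omega> T" by (intro image_eqI[of _ _ x]) simp_all
    qed
    show "bij_betw (op_A_tilde \<Omega> T) (E_space \<Omega> T) (P_space \<Omega> T)"
      unfolding bij_betw_def using inj surj op_A_tilde_in[OF T] by blast
    show "operator_norm (P_space \<Omega> T) (P_norm \<Omega>) (energy_norm \<Omega> T)
      (op_C T \<circ> inv_into (E_space \<Omega> T) (op_A_tilde \<Omega> T)) \<le> ereal (sqrt (12 + 8 * C))"
      unfolding operator_norm_def
    proof (rule SUP_least)
      fix p assume p: "p \<in> P_space \<Omega> T"
      obtain x where x: "x \<in> E_space \<Omega> T" "op_A_tilde \<Omega> T x = p" "energy_norm \<Omega> T (op_C T x) \<le> sqrt (12 + 8 * C) * P_norm \<Omega> p"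
        by (rule closed_loop_solvable[OF T p], rule that)
      have "inv_into (E_space \<Omega> T) (op_A_tilde \<Omega> T) p = x" by (rule inv_into_f_eq[OF inj x(1)], rule x(2))
      moreover have "energy_norm \<Omega> T (op_C T x) / P_norm \<Omega> p \<le> sqrt (12 + 8 * C)"
      proof (cases "P_norm \<Omega> p = 0")
        case False
        have "P_norm \<Omega> p \<ge> 0" unfolding P_norm_def by (cases p) simp
        with False have "P_norm \<Omega> p > 0" by simp
        then show ?thesis using x(3) by (simp add: divide_le_eq)
      qed (use pos in simp)
      ultimately show "ereal (energy_norm \<Omega> T ((op_C T \<circ> inv_into (E_space \<Omega> T) (op_A_tilde \<Omega> T)) p) / P_norm \<Omega> p)
          \<le> ereal (sqrt (12 + 8 * C))" by simp
    qed
  qed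
qed

end
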